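(* Let $G$ be a second countable locally compact abelian group, $\Gamma\subseteq G$ a closed subgroup, $V\subseteq L^2(G)$ a closed subspace, and $Z:L^2(G)\to L^2(\Omega,L^2(C))$ the (non-discrete) generalized Zak transform. The following conditions are equivalent: (1) $V$ is a $\Gamma$-invariant space; (2) there exists a measurable range function $J:\Omega\to\{\text{closed subspaces of }L^2(C)\}$ such that $$V=\{f\in L^2(G): Z[f](\omega)\in J(\omega)\ \text{for }\nu\text{-a.e. }\omega\in\Omega\}.$$ Identifying range functions which are equal almost everywhere, the correspondence between $\Gamma$-invariant spaces and measurable range functions given by (2) is one-to-one and onto. Moreover, if $V=S^\Gamma(\mathcal{A})$ for some (finite or) countable subset $\mathcal{A}$ of $L^2(G)$, the measurable range function $J$ associated to $V$ is given by $$J(\omega)=\overline{\mathrm{span}}\{Z[\phi](\omega):\phi\in\mathcal{A}\}\quad\text{for }\nu\text{-a.e. }\omega\in\Omega.$$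
   Context: Setting. $G$ is a second countable LCA group (written additively) with dual $\widehat{G}$; $\Gamma$ is a closed subgroup of $G$ (not necessarily discrete or co-compact), $\Gamma^*=\{\delta\in\widehat{G}:(\gamma,\delta)=1\ \forall\gamma\in\Gamma\}$ its annihilator; $(x,\xi)$ denotes the value of $\xi\in\widehat{G}$ at $x\in G$. $C\subseteq G$ is a measurable section of $G/\Gamma$ (a measurable set meeting each coset in exactly one point), with cross-section map $\tau:G/\Gamma\to C$, $\tau([x])=[x]\cap C$. $C$ carries the topology transported from $G/\Gamma$ by the bijection $\tau$, and the measure $\mu(E)=m_{G/\Gamma}(\tau^{-1}(E))$, where $m_{G/\Gamma}$ is Haar measure. Likewise $\Omega\subseteq\widehat{G}$ is a measurable section of $\widehat{G}/\Gamma^*$ with cross-section map $\tilde\tau$, carrying the transported topology and the measure $\nu(E)=m_{\widehat{G}/\Gamma^*}(\tilde\tau^{-1}(E))$. $\Omega$ is identified with $\widehat{\Gamma}$ via $\omega\mapsto(\cdot,\omega)|_\Gamma$, which carries $\nu$ to a Haar measure $m_{\widehat\Gamma}$. Haar measures are normalized so that $m_\Gamma$ and $m_{\widehat\Gamma}$ are dual (inversion formula and Plancherel hold), and $m_G$ is such that $\int_G f\,dm_G=\int_C\int_\Gamma f(x+\gamma)\,dm_\Gamma(\gamma)\,d\mu(x)$ for $f\in L^1(G)$. $L^2(C)=L^2(C,\mu)$ and $L^2(\Omega,L^2(C))$ is with respect to $\nu$. For $\psi\in C_c(G)$ (continuous with compact support), $Z[\psi](\omega)(x)=\int_\Gamma\psi(x-\gamma)(-\gamma,\omega)\,dm_\Gamma(\gamma)$,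 $\omega\in\Omega$, $x\in C$. This is an isometry from $(C_c(G),\|\cdot\|_{L^2(G)})$ into $L^2(\Omega,L^2(C))$, and $Z:L^2(G)\to L^2(\Omega,L^2(C))$ denotes its continuous extension (an isometric isomorphism). $T_\gamma f(x)=f(x-\gamma)$. A closed subspace $V\subseteq L^2(G)$ is $\Gamma$-invariant if $T_\gamma V\subseteq V$ for all $\gamma\in\Gamma$. $S^\Gamma(\mathcal{A})=\overline{\mathrm{span}}\{T_\gamma\phi:\gamma\in\Gamma,\phi\in\mathcal{A}\}$. A range function is a mapping $J:\Omega\to\{\text{closed subspaces of }L^2(C)\}$ together with the orthogonal projections $P_J(\omega)$ of $L^2(C)$ onto $J(\omega)$; it is measurable if for every $a\in L^2(C)$ the map $\omega\mapsto P_J(\omega)a$ is measurable as a vector-valued function. *)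

theory Defs
  imports
    "HOL-Analysis.Analysis"
    "HOL-Algebra.Coset"
    "HOL-Library.Function_Algebras"
begin

section \<open>Topological groups, quotients and duals\<close>

text \<open>
  A topological group is a pair of a group and a topology on its carrier. Groups are written
  multiplicatively, as in HOL-Algebra: \<open>x \<otimes> y\<close> is x + y and \<open>inv x\<close> is -x.
\<close>

locale second_countable_lca_group = comm_group G for G :: "'a monoid" (structure) +
  fixes X :: "'a topology"
  assumes topspace_eq: "topspace X = carrier G"
    and continuous_mult: "continuous_map (prod_topology X X) X (\<lambda>(x, y). x \<otimes> y)"
    and continuous_inv: "continuous_map X X (\<lambda>x. inv x)"
    and Hausdorff: "Hausdorff_space X"
    and locally_compact: "locally_compact_space X"
    and second_countable: "second_countable X"

definition quotient_topology :: "'a topology \<Rightarrow> ('a \<Rightarrow> 'b) \<Rightarrow> 'b topology" where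
  "quotient_topology X q =
     topology (\<lambda>U. U \<subseteq> q ` topspace X \<and> openin X {x \<in> topspace X. q x \<in> U})"

lemma openin_quotient_topology:
  "openin (quotient_topology X q) U \<longleftrightarrow>
     U \<subseteq> q ` topspace X \<and> openin X {x \<in> topspace X. q x \<in> U}"
proof -
  have "istopology (\<lambda>U. U \<subseteq> q ` topspace X \<and> openin X {x \<in> topspace X. q x \<in> U})"
    unfolding istopology_def
  proof (intro conjI allI impI)
    fix S T
    assume "S \<subseteq> q ` topspace X \<and> openin X {x \<in> topspace X. q x \<in> S}"
      and "T \<subseteq> q ` topspace X \<and> openin X {x \<in> topspace X. q x \<in> T}"
    moreover have "{x \<in> topspace X. q x \<in> S \<inter> T} =
        {x \<in> topspace X. q x \<in> S} \<inter> {x \<in> topspace X. q x \<in> T}" by auto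
    ultimately show "S \<inter> T \<subseteq> q ` topspace X" "openin X {x \<in> topspace X. q x \<in> S \<inter> T}"
      by auto
  next
    fix \<K>
    assume "\<forall>K\<in>\<K>. K \<subseteq> q ` topspace X \<and> openin X {x \<in> topspace X. q x \<in> K}"
    moreover have "{x \<in> topspace X. q x \<in> \<Union>\<K>} = (\<Union>K\<in>\<K>. {x \<in> topspace X. q x \<in> K})"
      by auto
    ultimately show "\<Union>\<K> \<subseteq> q ` topspace X" "openin X {x \<in> topspace X. q x \<in> \<Union>\<K>}"
      by auto
  qed
  then show ?thesis
    by (simp add: quotient_topology_def topology_inverse')
qed

lemma quotient_map_quotient_topology: "quotient_map X (quotient_topology X q) q"
proof -
  have "{x \<in> topspace X. q x \<in> q ` topspace X} = topspace X"
    by auto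
  then have "openin (quotient_topology X q) (q ` topspace X)"
    by (simp add: openin_quotient_topology)
  then have "q ` topspace X \<subseteq> topspace (quotient_topology X q)"
    by (rule openin_subset)
  moreover have "topspace (quotient_topology X q) \<subseteq> q ` topspace X"
    using openin_topspace[of "quotient_topology X q"] unfolding openin_quotient_topology by blast
  ultimately show ?thesis
    by (auto simp: quotient_map_def openin_quotient_topology)
qed

text \<open>The topology of the quotient group \<open>G Mod N\<close>.\<close>

definition coset_topology :: "'a monoid \<Rightarrow> 'a topology \<Rightarrow> 'a set \<Rightarrow> 'a set topology" where
  "coset_topology G X N = quotient_topology X (\<lambda>x. N #>\<^bsub>G\<^esub> x)"

text \<open>
  Characters are normalized to be \<open>extensional\<close>, so that two characters are equal
  as soon as they agree on the carrier.
\<close>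

definition characters :: "'a monoid \<Rightarrow> 'a topology \<Rightarrow> ('a \<Rightarrow> complex) set" where
  "characters G X =
     {\<xi> \<in> extensional (carrier G). continuous_map X euclidean \<xi> \<and>
        (\<forall>x\<in>carrier G. cmod (\<xi> x) = 1) \<and>
        (\<forall>x\<in>carrier G. \<forall>y\<in>carrier G. \<xi> (x \<otimes>\<^bsub>G\<^esub> y) = \<xi> x * \<xi> y)}"

definition dual_group :: "'a monoid \<Rightarrow> 'a topology \<Rightarrow> ('a \<Rightarrow> complex) monoid" where
  "dual_group G X =
     \<lparr>carrier = characters G X,
      mult = (\<lambda>\<xi> \<psi>. \<lambda>x\<in>carrier G. \<xi> x * \<psi> x),
      one = (\<lambda>x\<in>carrier G. 1)\<rparr>"

text \<open>The compact-open topology.\<close>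

definition dual_topology :: "'a monoid \<Rightarrow> 'a topology \<Rightarrow> ('a \<Rightarrow> complex) topology" where
  "dual_topology G X =
     topology_generated_by
       {{\<xi> \<in> characters G X. \<xi> ` K \<subseteq> U} | K U. compactin X K \<and> open U}"

definition annihilator :: "'a monoid \<Rightarrow> 'a topology \<Rightarrow> 'a set \<Rightarrow> ('a \<Rightarrow> complex) set" where
  "annihilator G X \<Gamma> = {\<delta> \<in> characters G X. \<forall>\<gamma>\<in>\<Gamma>. \<delta> \<gamma> = 1}"


section \<open>Haar measures and sections\<close>

definition borel_of :: "'a topology \<Rightarrow> 'a measure" where
  "borel_of X = sigma (topspace X) {U. openin X U}"

definition haar_measure :: "'a monoid \<Rightarrow> 'a topology \<Rightarrow> 'a measure \<Rightarrow> bool" where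
  "haar_measure G X M \<longleftrightarrow>
     sets M = sets (borel_of X) \<and>
     emeasure M (space M) \<noteq> 0 \<and>
     (\<forall>K. compactin X K \<longrightarrow> emeasure M K < \<infinity>) \<and>
     (\<forall>E\<in>sets M. emeasure M E = (INF U\<in>{U. openin X U \<and> E \<subseteq> U}. emeasure M U)) \<and>
     (\<forall>U. openin X U \<longrightarrow> emeasure M U = (SUP K\<in>{K. compactin X K \<and> K \<subseteq> U}. emeasure M K)) \<and>
     (\<forall>x\<in>carrier G. \<forall>E\<in>sets M. emeasure M (x <#\<^bsub>G\<^esub> E) = emeasure M E)"

definition measurable_section :: "'a monoid \<Rightarrow> 'a topology \<Rightarrow> 'a set \<Rightarrow> 'a set \<Rightarrow> bool" where
  "measurable_section G X N C \<longleftrightarrow>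
     C \<in> sets (borel_of X) \<and> (\<forall>c \<in> rcosets\<^bsub>G\<^esub> N. \<exists>!x. x \<in> c \<inter> C)"

definition cross_section :: "'a set \<Rightarrow> 'a set \<Rightarrow> 'a" where
  "cross_section C c = (THE x. x \<in> c \<inter> C)"

text \<open>
  On C, the map \<open>x \<mapsto> N #> x\<close> is the inverse of the cross-section map, so the
  topology transported from the quotient is the pullback along it.
\<close>

definition section_topology :: "'a monoid \<Rightarrow> 'a topology \<Rightarrow> 'a set \<Rightarrow> 'a set \<Rightarrow> 'a topology" where
  "section_topology G X N C = pullback_topology C (\<lambda>x. N #>\<^bsub>G\<^esub> x) (coset_topology G X N)"

definition section_measure ::
  "'a monoid \<Rightarrow> 'a topology \<Rightarrow> 'a set \<Rightarrow> 'a set \<Rightarrow> 'a set measure \<Rightarrow> 'a measure" where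
  "section_measure G X N C m =
     distr m (borel_of (section_topology G X N C)) (cross_section C)"


section \<open>L2 spaces\<close>

text \<open>
  Elements of L2 are represented by functions, that is, the spaces below are seminormed. A closed
  set contains with a function every function almost everywhere equal to it, so closed
  subspaces correspond exactly to those of the quotient by almost everywhere equality.
\<close>

definition seminorm_topology :: "'f set \<Rightarrow> ('f \<Rightarrow> real) \<Rightarrow> ('f::minus) topology" where
  "seminorm_topology S N =
     topology (\<lambda>U. U \<subseteq> S \<and> (\<forall>f\<in>U. \<exists>e>0. \<forall>g\<in>S. N (g - f) < e \<longrightarrow> g \<in> U))"

lemma openin_seminorm_topology:
  "openin (seminorm_topology S N) U \<longleftrightarrow>
     U \<subseteq> S \<and> (\<forall>f\<in>U. \<exists>e>0. \<forall>g\<in>S. N (g - f) < e \<longrightarrow> g \<in> U)"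
proof -
  have "istopology (\<lambda>U. U \<subseteq> S \<and> (\<forall>f\<in>U. \<exists>e>0. \<forall>g\<in>S. N (g - f) < e \<longrightarrow> g \<in> U))"
    (is "istopology ?P")
    unfolding istopology_def
  proof (rule conjI; intro allI impI)
    fix A B
    assume A: "?P A" and B: "?P B"
    show "?P (A \<inter> B)"
    proof (intro conjI ballI)
      fix f
      assume "f \<in> A \<inter> B"
      then have "f \<in> A" "f \<in> B"
        by simp_all
      from bspec[OF conjunct2[OF A] this(1)] bspec[OF conjunct2[OF B] this(2)]
      obtain d e where "d > 0" "\<forall>g\<in>S. N (g - f) < d \<longrightarrow> g \<in> A"
        and "e > 0" "\<forall>g\<in>S. N (g - f) < e \<longrightarrow> g \<in> B"
        by (elim exE conjE)
      then show "\<exists>e>0. \<forall>g\<in>S. N (g - f) < e \<longrightarrow> g \<in> A \<inter> B"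
        by (intro exI[of _ "min d e"]) auto
    qed (use A in auto)
  next
    fix \<K>
    assume "\<forall>K\<in>\<K>. ?P K"
    then have K: "?P K" if "K \<in> \<K>" for K
      using that by (rule bspec)
    show "?P (\<Union>\<K>)"
    proof (intro conjI ballI)
      show "\<Union>\<K> \<subseteq> S"
        using K by (intro Union_least) simp
    next
      fix f
      assume "f \<in> \<Union>\<K>"
      then obtain K' where "K' \<in> \<K>" "f \<in> K'"
        by (rule UnionE)
      moreover from this obtain e where "e > 0" "\<forall>g\<in>S. N (g - f) < e \<longrightarrow> g \<in> K'"
        using K[of K'] by meson
      ultimately show "\<exists>e>0. \<forall>g\<in>S. N (g - f) < e \<longrightarrow> g \<in> \<Union>\<K>"
        by (intro exI[of _ e]) auto
    qed
  qed
  then show ?thesis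
    by (simp add: seminorm_topology_def topology_inverse')
qed

lemma topspace_seminorm_topology [simp]: "topspace (seminorm_topology S N) = S"
proof -
  have "openin (seminorm_topology S N) S"
    by (auto simp: openin_seminorm_topology intro: exI[of _ 1])
  then show ?thesis
    using openin_subset openin_seminorm_topology[THEN iffD1, THEN conjunct1, OF openin_topspace]
    by (intro subset_antisym)
qed

definition L2 :: "'a measure \<Rightarrow> ('a \<Rightarrow> complex) set" where
  "L2 M = {f \<in> borel_measurable M. integrable M (\<lambda>x. (cmod (f x))\<^sup>2)}"

definition L2_norm :: "'a measure \<Rightarrow> ('a \<Rightarrow> complex) \<Rightarrow> real" where
  "L2_norm M f = sqrt (LINT x|M. (cmod (f x))\<^sup>2)"

definition L2_inner :: "'a measure \<Rightarrow> ('a \<Rightarrow> complex) \<Rightarrow> ('a \<Rightarrow> complex) \<Rightarrow> complex" where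
  "L2_inner M f g = (LINT x|M. f x * cnj (g x))"

definition L2_topology :: "'a measure \<Rightarrow> ('a \<Rightarrow> complex) topology" where
  "L2_topology M = seminorm_topology (L2 M) (L2_norm M)"

text \<open>
  A map into \<open>L2 M\<close> is measurable if it is Borel measurable. All spaces \<open>L2 M\<close> to which
  this is applied are separable, so that this agrees with weak and with strong measurability.
\<close>

abbreviation L2_borel :: "'a measure \<Rightarrow> ('a \<Rightarrow> complex) measure" where
  "L2_borel M \<equiv> borel_of (L2_topology M)"

text \<open>The space of square integrable maps from \<open>N\<close> into \<open>L2 M\<close>.\<close>

definition L2_vec :: "'b measure \<Rightarrow> 'a measure \<Rightarrow> ('b \<Rightarrow> 'a \<Rightarrow> complex) set" where
  "L2_vec N M = {F \<in> measurable N (L2_borel M). integrable N (\<lambda>w. (L2_norm M (F w))\<^sup>2)}"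

definition L2_vec_norm :: "'b measure \<Rightarrow> 'a measure \<Rightarrow> ('b \<Rightarrow> 'a \<Rightarrow> complex) \<Rightarrow> real" where
  "L2_vec_norm N M F = sqrt (LINT w|N. (L2_norm M (F w))\<^sup>2)"

definition L2_vec_topology :: "'b measure \<Rightarrow> 'a measure \<Rightarrow> ('b \<Rightarrow> 'a \<Rightarrow> complex) topology" where
  "L2_vec_topology N M = seminorm_topology (L2_vec N M) (L2_vec_norm N M)"

definition cscale :: "complex \<Rightarrow> ('a \<Rightarrow> complex) \<Rightarrow> 'a \<Rightarrow> complex" where
  "cscale c f = (\<lambda>x. c * f x)"

global_interpretation cfun: vector_space "cscale :: complex \<Rightarrow> ('a \<Rightarrow> complex) \<Rightarrow> 'a \<Rightarrow> complex"
  by unfold_locales (auto simp: cscale_def algebra_simps)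

definition closed_subspace :: "'a measure \<Rightarrow> ('a \<Rightarrow> complex) set \<Rightarrow> bool" where
  "closed_subspace M W \<longleftrightarrow> cfun.subspace W \<and> closedin (L2_topology M) W"

definition closed_span :: "'a measure \<Rightarrow> ('a \<Rightarrow> complex) set \<Rightarrow> ('a \<Rightarrow> complex) set" where
  "closed_span M A = L2_topology M closure_of cfun.span A"

text \<open>
  The orthogonal projection is determined up to almost everywhere equality; the value below is an
  arbitrary representative.
\<close>

definition orth_proj ::
  "'a measure \<Rightarrow> ('a \<Rightarrow> complex) set \<Rightarrow> ('a \<Rightarrow> complex) \<Rightarrow> 'a \<Rightarrow> complex" where
  "orth_proj M W a = (SOME p. p \<in> W \<and> (\<forall>w\<in>W. L2_inner M (a - p) w = 0))"


section \<open>Normalization of the Haar measures\<close>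

definition fourier :: "'a measure \<Rightarrow> ('a \<Rightarrow> complex) \<Rightarrow> ('a \<Rightarrow> complex) \<Rightarrow> complex" where
  "fourier m f = (\<lambda>\<xi>. LINT x|m. f x * cnj (\<xi> x))"

text \<open>
  The last three conditions are the inversion formula and the Plancherel theorem: on the
  intersection of L1 and L2 the Fourier transform is isometric for the L2 norms, with
  dense range, that is, it extends to a unitary map onto the L2 space of the dual.
\<close>

definition dual_haar_measures ::
  "'a monoid \<Rightarrow> 'a topology \<Rightarrow> 'a measure \<Rightarrow> ('a \<Rightarrow> complex) measure \<Rightarrow> bool" where
  "dual_haar_measures G X m m' \<longleftrightarrow>
     haar_measure G X m \<and>
     haar_measure (dual_group G X) (dual_topology G X) m' \<and>
     (\<forall>f. integrable m f \<longrightarrow> integrable m' (fourier m f) \<longrightarrow>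
        (AE x in m. f x = (LINT \<xi>|m'. fourier m f \<xi> * \<xi> x))) \<and>
     (\<forall>f. integrable m f \<longrightarrow> f \<in> L2 m \<longrightarrow>
        fourier m f \<in> L2 m' \<and> L2_norm m' (fourier m f) = L2_norm m f) \<and>
     L2_topology m' closure_of (fourier m ` {f \<in> L2 m. integrable m f}) = L2 m'"

definition weil_formula ::
  "'a monoid \<Rightarrow> 'a measure \<Rightarrow> 'a measure \<Rightarrow> 'a measure \<Rightarrow> bool" where
  "weil_formula G mG m\<Gamma> \<mu> \<longleftrightarrow>
     (\<forall>f :: 'a \<Rightarrow> complex. integrable mG f \<longrightarrow>
        (AE x in \<mu>. integrable m\<Gamma> (\<lambda>\<gamma>. f (x \<otimes>\<^bsub>G\<^esub> \<gamma>))) \<and>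
        integrable \<mu> (\<lambda>x. LINT \<gamma>|m\<Gamma>. f (x \<otimes>\<^bsub>G\<^esub> \<gamma>)) \<and>
        (LINT x|mG. f x) = (LINT x|\<mu>. LINT \<gamma>|m\<Gamma>. f (x \<otimes>\<^bsub>G\<^esub> \<gamma>)))"


section \<open>Zak transform, invariant spaces and range functions\<close>

definition Cc :: "'a topology \<Rightarrow> ('a \<Rightarrow> complex) set" where
  "Cc X = {\<psi>. continuous_map X euclidean \<psi> \<and>
              compactin X (X closure_of {x \<in> topspace X. \<psi> x \<noteq> 0})}"

text \<open>
  \<open>Z\<close> is a version of the continuous extension to \<open>L2 mG\<close> of the transform given by the
  integral on \<open>Cc X\<close>. Since \<open>Z\<close> takes values in functions rather than equivalence classes,
  it is determined up to almost everywhere equality.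
\<close>

definition zak_transform ::
  "'a monoid \<Rightarrow> 'a topology \<Rightarrow> 'a measure \<Rightarrow> 'a measure \<Rightarrow> 'a measure \<Rightarrow> ('a \<Rightarrow> complex) measure \<Rightarrow>
   (('a \<Rightarrow> complex) \<Rightarrow> ('a \<Rightarrow> complex) \<Rightarrow> 'a \<Rightarrow> complex) \<Rightarrow> bool" where
  "zak_transform G X mG m\<Gamma> \<mu> \<nu> Z \<longleftrightarrow>
     continuous_map (L2_topology mG) (L2_vec_topology \<nu> \<mu>) Z \<and>
     (\<forall>\<psi>\<in>Cc X. AE \<omega> in \<nu>. AE x in \<mu>.
        Z \<psi> \<omega> x = (LINT \<gamma>|m\<Gamma>. \<psi> (x \<otimes>\<^bsub>G\<^esub> inv\<^bsub>G\<^esub> \<gamma>) * \<omega> (inv\<^bsub>G\<^esub> \<gamma>)))"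

definition translate :: "'a monoid \<Rightarrow> 'a \<Rightarrow> ('a \<Rightarrow> complex) \<Rightarrow> 'a \<Rightarrow> complex" where
  "translate G \<gamma> f = (\<lambda>x. f (x \<otimes>\<^bsub>G\<^esub> inv\<^bsub>G\<^esub> \<gamma>))"

definition invariant_space ::
  "'a monoid \<Rightarrow> 'a measure \<Rightarrow> 'a set \<Rightarrow> ('a \<Rightarrow> complex) set \<Rightarrow> bool" where
  "invariant_space G mG \<Gamma> V \<longleftrightarrow>
     closed_subspace mG V \<and> (\<forall>\<gamma>\<in>\<Gamma>. translate G \<gamma> ` V \<subseteq> V)"

definition generated_space ::
  "'a monoid \<Rightarrow> 'a measure \<Rightarrow> 'a set \<Rightarrow> ('a \<Rightarrow> complex) set \<Rightarrow> ('a \<Rightarrow> complex) set" where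
  "generated_space G mG \<Gamma> A = closed_span mG {translate G \<gamma> \<phi> | \<gamma> \<phi>. \<gamma> \<in> \<Gamma> \<and> \<phi> \<in> A}"

definition measurable_range_function ::
  "'b measure \<Rightarrow> 'a measure \<Rightarrow> ('b \<Rightarrow> ('a \<Rightarrow> complex) set) \<Rightarrow> bool" where
  "measurable_range_function \<nu> \<mu> J \<longleftrightarrow>
     (\<forall>\<omega>\<in>space \<nu>. closed_subspace \<mu> (J \<omega>)) \<and>
     (\<forall>a\<in>L2 \<mu>. (\<lambda>\<omega>. orth_proj \<mu> (J \<omega>) a) \<in> measurable \<nu> (L2_borel \<mu>))"

definition range_space ::
  "'a measure \<Rightarrow> 'b measure \<Rightarrow> (('a \<Rightarrow> complex) \<Rightarrow> 'b \<Rightarrow> 'c) \<Rightarrow> ('b \<Rightarrow> 'c set) \<Rightarrow>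
   ('a \<Rightarrow> complex) set" where
  "range_space mG \<nu> Z J = {f \<in> L2 mG. AE \<omega> in \<nu>. Z f \<omega> \<in> J \<omega>}"

end

theory Submission
  imports Defs
begin

text \<open>
  The transform \<open>Z\<close> is isometric and turns the translation by \<open>\<gamma>\<close> into the multiplication by
  \<open>\<omega> \<mapsto> \<omega> \<gamma>\<close>, so the range space of every range function is closed and invariant.

  If \<open>f\<close> is orthogonal to all translates of \<open>\<phi>\<close>, then the integrable function
  \<open>\<langle>Z f \<omega>, Z \<phi> \<omega>\<rangle>\<close> of \<open>\<omega>\<close> integrates to 0 against every \<open>\<omega> \<mapsto> \<omega> \<gamma>\<close>, hence against the
  Fourier transforms \<open>hat g\<close> of all \<open>g\<close> in L1. These form an algebra whose exponentials
  approximate indicator functions, by the Plancherel theorem on \<open>\<Gamma>\<close>, so the function vanishes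
  almost everywhere. It follows that the space generated by a countable \<open>A\<close> is the range space of
  the pointwise closed span of \<open>Z A\<close>; since L2 is separable, every invariant space is of this form.

  A similar argument shows that \<open>Z\<close> is onto: an \<open>E\<close> orthogonal to its range is, at almost every
  \<open>\<omega>\<close>, orthogonal to the transforms of bump functions on \<open>G\<close> multiplied by bump functions on the
  quotient, which forces \<open>E \<omega> = 0\<close>. Hence every projection \<open>\<omega> \<mapsto> P\<^sub>J(\<omega>) d\<close>, cut off to a set of
  finite measure, is some \<open>Z f\<close>, and letting \<open>d\<close> run through a countable dense set the range
  space determines \<open>J\<close> almost everywhere.
\<close>

section \<open>Seminormed topologies\<close>

text \<open>Three obstacles shape the details. The quotient of the dual by the annihilator is not
  shown to be locally compact or second countable: \<sigma>-finiteness of \<open>\<nu>\<close> is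
  drawn from Plancherel, joint measurability asks for a countable base of one factor only, and sets
  on the section are compared with sets in the dual of \<Gamma> along a continuous injection, which
  handles compact sets; regularity of Haar measure reaches the others. The \<sigma>-algebra of
  \<open>\<mu>\<close> is transported from the quotient, and a measurable function on G is not known
  to be measurable on C, so that integrals over C are rewritten over G before Fubini is applied.
  Finally, elements of L2 are functions: \<open>Z\<close> is a continuous map whose values are
  prescribed almost everywhere on \<open>Cc X\<close>, its linearity has to be recovered up to
  seminorm 0, and \<open>orth_proj\<close> is a choice of representative, whose measurability can
  only be read off from distances.\<close>

locale seminormed_set =
  fixes S :: "'f::ab_group_add set" and N :: "'f \<Rightarrow> real"
  assumes norm_self: "f \<in> S \<Longrightarrow> N (f - f) = 0"
    and norm_sym: "f \<in> S \<Longrightarrow> g \<in> S \<Longrightarrow> N (f - g) = N (g - f)"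
    and norm_tri: "f \<in> S \<Longrightarrow> g \<in> S \<Longrightarrow> h \<in> S \<Longrightarrow> N (f - h) \<le> N (f - g) + N (g - h)"
begin

abbreviation T where "T \<equiv> seminorm_topology S N"

lemma openin_ball: "f \<in> S \<Longrightarrow> openin T {g \<in> S. N (g - f) < e}"
  unfolding openin_seminorm_topology
proof (intro conjI ballI)
  fix g assume f: "f \<in> S" and g: "g \<in> {g \<in> S. N (g - f) < e}"
  show "\<exists>d>0. \<forall>h\<in>S. N (h - g) < d \<longrightarrow> h \<in> {g \<in> S. N (g - f) < e}"
  proof (intro exI[of _ "e - N (g - f)"] conjI ballI impI)
    show "0 < e - N (g - f)" using g by simp
    fix h assume "h \<in> S" "N (h - g) < e - N (g - f)"
    then show "h \<in> {g \<in> S. N (g - f) < e}" using norm_tri[of h g f] f g by auto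
  qed
qed auto

lemma in_closure_of_iff:
  "f \<in> T closure_of A \<longleftrightarrow> f \<in> S \<and> (\<forall>e>0. \<exists>a\<in>A \<inter> S. N (a - f) < e)"
proof
  assume f: "f \<in> T closure_of A"
  then have fS: "f \<in> S" by (simp add: in_closure_of)
  moreover have "\<exists>a\<in>A \<inter> S. N (a - f) < e" if "e > 0" for e
  proof -
    have "f \<in> {g \<in> S. N (g - f) < e}" using fS norm_self that by simp
    with f openin_ball[OF fS, of e] obtain y where "y \<in> A" "y \<in> {g \<in> S. N (g - f) < e}"
      unfolding in_closure_of by meson
    then show ?thesis by auto
  qed
  ultimately show "f \<in> S \<and> (\<forall>e>0. \<exists>a\<in>A \<inter> S. N (a - f) < e)" by blast
next
  assume f: "f \<in> S \<and> (\<forall>e>0. \<exists>a\<in>A \<inter> S. N (a - f) < e)"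
  show "f \<in> T closure_of A"
    unfolding in_closure_of
  proof (intro conjI allI impI)
    show "f \<in> topspace T" using f by simp
    fix U assume U: "f \<in> U \<and> openin T U"
    then obtain e where "e > 0" "\<forall>g\<in>S. N (g - f) < e \<longrightarrow> g \<in> U"
      unfolding openin_seminorm_topology by blast
    then show "\<exists>y. y \<in> A \<and> y \<in> U" using f by blast
  qed
qed

lemma closedin_iff:
  "closedin T A \<longleftrightarrow> A \<subseteq> S \<and> (\<forall>f\<in>S. (\<forall>e>0. \<exists>a\<in>A. N (a - f) < e) \<longrightarrow> f \<in> A)"
proof -
  have "closedin T A \<longleftrightarrow> A \<subseteq> S \<and> T closure_of A \<subseteq> A"
    by (metis closedin_subset closure_of_eq closure_of_subset subset_antisym
        topspace_seminorm_topology order_refl)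
  also have "\<dots> \<longleftrightarrow> A \<subseteq> S \<and> (\<forall>f\<in>S. (\<forall>e>0. \<exists>a\<in>A. N (a - f) < e) \<longrightarrow> f \<in> A)"
    unfolding subset_iff in_closure_of_iff by blast
  finally show ?thesis .
qed

text \<open>Balls with rational radii about a countable dense set form a base. This is what later
  reduces Borel measurability of a map into L2 to measurability of its distances to fixed
  points.\<close>

lemma open_countable_balls:
  assumes D: "countable D" "D \<subseteq> S" "\<And>f e. f \<in> S \<Longrightarrow> e > 0 \<Longrightarrow> \<exists>d\<in>D. N (d - f) < e"
    and U: "openin T U"
  shows "\<exists>I. countable I \<and> I \<subseteq> D \<times> UNIV \<and> U = (\<Union>(d, r)\<in>I. {g \<in> S. N (g - d) < r})"
proof (intro exI conjI)
  let ?I = "{(d, r). d \<in> D \<and> r \<in> \<rat> \<and> {g \<in> S. N (g - d) < r} \<subseteq> U}"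
  have "?I \<subseteq> D \<times> \<rat>" by auto
  then show "countable ?I" using D(1) countable_rat by (meson countable_SIGMA countable_subset)
  show "?I \<subseteq> D \<times> UNIV" by auto
  show "U = (\<Union>(d, r)\<in>?I. {g \<in> S. N (g - d) < r})"
  proof (intro subset_antisym subsetI)
    fix f assume f: "f \<in> U"
    then have fS: "f \<in> S" using U unfolding openin_seminorm_topology by blast
    from f U obtain e where e: "e > 0" "\<forall>g\<in>S. N (g - f) < e \<longrightarrow> g \<in> U"
      unfolding openin_seminorm_topology by blast
    obtain r where r: "r \<in> \<rat>" "0 < r" "r < e / 2"
      using e(1) Rats_dense_in_real[of 0 "e/2"] by auto
    \<comment> \<open>With radius below e/2, the triangle inequality keeps the ball about
      \<open>d\<close> inside the e-ball about \<open>f\<close>, and symmetry puts \<open>f\<close>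
      inside it.\<close>
    obtain d where d: "d \<in> D" "N (d - f) < r" using D(3)[OF fS r(2)] by blast
    have dS: "d \<in> S" using d D by auto
    have "{g \<in> S. N (g - d) < r} \<subseteq> U"
    proof
      fix g assume g: "g \<in> {g \<in> S. N (g - d) < r}"
      then have "N (g - f) < e" using norm_tri[of g d f] d r dS fS by auto
      then show "g \<in> U" using e g by auto
    qed
    moreover have "N (f - d) < r" using d norm_sym dS fS by simp
    ultimately show "f \<in> (\<Union>(d, r)\<in>?I. {g \<in> S. N (g - d) < r})" using d r fS by auto
  qed auto
qed

end

text \<open>Continuity of the Zak transform is given topologically; this is the epsilon-delta form
  in which it is used.\<close>

lemma continuous_map_seminorm_topology:
  assumes "seminormed_set S N" "seminormed_set S' N'"
    and "continuous_map (seminorm_topology S N) (seminorm_topology S' N') F"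
    and f: "f \<in> S" and e: "e > 0"
  shows "\<exists>d>0. \<forall>g\<in>S. N (g - f) < d \<longrightarrow> N' (F g - F f) < e"
proof -
  interpret B: seminormed_set S' N' by fact
  have "F f \<in> S'" using assms(3) f by (auto simp: continuous_map_def Pi_iff)
  with assms(3) have "openin (seminorm_topology S N) {g \<in> S. F g \<in> {h \<in> S'. N' (h - F f) < e}}"
    using B.openin_ball[of "F f" e] unfolding continuous_map_def topspace_seminorm_topology by blast
  moreover have "f \<in> {g \<in> S. F g \<in> {h \<in> S'. N' (h - F f) < e}}"
    using f e \<open>F f \<in> S'\<close> B.norm_self by simp
  ultimately show ?thesis unfolding openin_seminorm_topology by blast
qed


section \<open>The spaces L2\<close>

lemma borel_measurable_cnj [measurable]: "cnj \<in> borel_measurable borel"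
  by (intro borel_measurable_continuous_onI continuous_intros)

lemma L2_measurable [measurable_dest]: "f \<in> L2 M \<Longrightarrow> f \<in> borel_measurable M"
  by (simp add: L2_def)

lemma L2_integrable: "f \<in> L2 M \<Longrightarrow> integrable M (\<lambda>x. (cmod (f x))\<^sup>2)"
  by (simp add: L2_def)

lemma L2_zero [simp]: "0 \<in> L2 M"
  by (simp add: L2_def zero_fun_def)

lemma L2_cscale [intro]: "f \<in> L2 M \<Longrightarrow> cscale c f \<in> L2 M"
  by (auto simp: L2_def cscale_def norm_mult power_mult_distrib)

lemma L2_add [intro]: assumes "f \<in> L2 M" "g \<in> L2 M" shows "f + g \<in> L2 M"
proof -
  note [measurable] = assms
  have "integrable M (\<lambda>x. (cmod (f x + g x))\<^sup>2)"
  proof (rule Bochner_Integration.integrable_bound)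
    show "integrable M (\<lambda>x. 2 * (cmod (f x))\<^sup>2 + 2 * (cmod (g x))\<^sup>2)"
      using assms by (simp add: L2_integrable)
    show "AE x in M. norm ((cmod (f x + g x))\<^sup>2) \<le> norm (2 * (cmod (f x))\<^sup>2 + 2 * (cmod (g x))\<^sup>2)"
    proof (intro AE_I2)
      fix x
      have "(cmod (f x + g x))\<^sup>2 \<le> (cmod (f x) + cmod (g x))\<^sup>2"
        by (intro power_mono norm_triangle_ineq) auto
      also have "\<dots> \<le> 2 * (cmod (f x))\<^sup>2 + 2 * (cmod (g x))\<^sup>2"
        using sum_squares_bound[of "cmod (f x)" "cmod (g x)"] by (simp add: power2_sum)
      finally show "norm ((cmod (f x + g x))\<^sup>2) \<le> norm (2 * (cmod (f x))\<^sup>2 + 2 * (cmod (g x))\<^sup>2)"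
        by simp
    qed
  qed measurable
  moreover have "f + g \<in> borel_measurable M" unfolding plus_fun_def by measurable
  ultimately show ?thesis by (simp add: L2_def)
qed

lemma diff_eq_cscale: "f - g = f + cscale (-1) g"
  by (auto simp: cscale_def)

lemma L2_diff [intro]: "f \<in> L2 M \<Longrightarrow> g \<in> L2 M \<Longrightarrow> f - g \<in> L2 M"
  unfolding diff_eq_cscale by (intro L2_add L2_cscale)

lemma cfun_subspace_L2: "cfun.subspace (L2 M)"
  by (auto simp: cfun.subspace_def)

lemma L2_cong_AE:
  assumes "f \<in> L2 M" "g \<in> borel_measurable M" "AE x in M. f x = g x" shows "g \<in> L2 M"
proof -
  have "integrable M (\<lambda>x. (cmod (g x))\<^sup>2)"
    by (rule integrable_cong_AE_imp[OF L2_integrable[OF assms(1)]]) (use assms in auto)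
  then show ?thesis using assms by (simp add: L2_def)
qed

lemma L2_mult_bounded:
  assumes "f \<in> L2 M" and [measurable]: "k \<in> borel_measurable M" and "\<And>x. x \<in> space M \<Longrightarrow> cmod (k x) \<le> B"
  shows "(\<lambda>x. k x * f x) \<in> L2 M"
proof -
  note [measurable] = assms(1)
  have "integrable M (\<lambda>x. (cmod (k x * f x))\<^sup>2)"
  proof (rule Bochner_Integration.integrable_bound)
    show "integrable M (\<lambda>x. B\<^sup>2 * (cmod (f x))\<^sup>2)" using assms by (simp add: L2_integrable)
    show "AE x in M. norm ((cmod (k x * f x))\<^sup>2) \<le> norm (B\<^sup>2 * (cmod (f x))\<^sup>2)"
      using assms(3) by (auto simp: norm_mult power_mult_distrib intro!: mult_right_mono power_mono)
  qed measurable
  then show ?thesis by (simp add: L2_def)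
qed

lemma L2_inner_integrable [intro]:
  assumes "f \<in> L2 M" "g \<in> L2 M" shows "integrable M (\<lambda>x. f x * cnj (g x))"
proof (rule Bochner_Integration.integrable_bound)
  note [measurable] = assms
  show "integrable M (\<lambda>x. (cmod (f x))\<^sup>2 + (cmod (g x))\<^sup>2)"
    using assms by (simp add: L2_integrable)
  show "AE x in M. norm (f x * cnj (g x)) \<le> norm ((cmod (f x))\<^sup>2 + (cmod (g x))\<^sup>2)"
  proof (intro AE_I2)
    fix x
    have "cmod (f x) * cmod (g x) \<le> 2 * cmod (f x) * cmod (g x)" by simp
    also have "\<dots> \<le> (cmod (f x))\<^sup>2 + (cmod (g x))\<^sup>2" by (rule sum_squares_bound)
    finally show "norm (f x * cnj (g x)) \<le> norm ((cmod (f x))\<^sup>2 + (cmod (g x))\<^sup>2)"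
      by (simp add: norm_mult)
  qed
qed (use assms in measurable)

lemma L2_norm_nonneg [simp]: "0 \<le> L2_norm M f"
  by (simp add: L2_norm_def)

lemma L2_norm_sq: "(L2_norm M f)\<^sup>2 = (LINT x|M. (cmod (f x))\<^sup>2)"
  by (simp add: L2_norm_def)

lemma L2_norm_zero [simp]: "L2_norm M 0 = 0"
  by (simp add: L2_norm_def)

lemma L2_inner_self: "L2_inner M f f = (L2_norm M f)\<^sup>2"
  by (simp add: L2_inner_def L2_norm_sq complex_norm_square [symmetric] del: of_real_power)

lemma L2_norm_cscale: "L2_norm M (cscale c f) = cmod c * L2_norm M f"
  by (simp add: L2_norm_def cscale_def norm_mult power_mult_distrib real_sqrt_mult)

lemma L2_norm_minus_commute: "L2_norm M (f - g) = L2_norm M (g - f)"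
  by (simp add: L2_norm_def norm_minus_commute)

lemma L2_inner_add_left:
  "f \<in> L2 M \<Longrightarrow> g \<in> L2 M \<Longrightarrow> h \<in> L2 M \<Longrightarrow> L2_inner M (f + g) h = L2_inner M f h + L2_inner M g h"
  by (simp add: L2_inner_def distrib_right L2_inner_integrable)

lemma L2_inner_cscale_left: "L2_inner M (cscale c f) h = c * L2_inner M f h"
  by (simp add: L2_inner_def cscale_def mult.assoc)

lemma L2_inner_commute: "L2_inner M g f = cnj (L2_inner M f g)"
proof -
  have "L2_inner M g f = (LINT x|M. cnj (f x * cnj (g x)))"
    unfolding L2_inner_def by (rule Bochner_Integration.integral_cong) (simp_all add: mult.commute)
  then show ?thesis by (simp only: Bochner_Integration.integral_cnj L2_inner_def)
qed

lemma L2_inner_add_right: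
  "f \<in> L2 M \<Longrightarrow> g \<in> L2 M \<Longrightarrow> h \<in> L2 M \<Longrightarrow> L2_inner M h (f + g) = L2_inner M h f + L2_inner M h g"
  by (metis L2_inner_add_left L2_inner_commute complex_cnj_add)

lemma L2_inner_cscale_right: "L2_inner M h (cscale c f) = cnj c * L2_inner M h f"
  by (metis L2_inner_cscale_left L2_inner_commute complex_cnj_mult)

lemma L2_inner_diff_left:
  "f \<in> L2 M \<Longrightarrow> g \<in> L2 M \<Longrightarrow> h \<in> L2 M \<Longrightarrow> L2_inner M (f - g) h = L2_inner M f h - L2_inner M g h"
  by (simp only: diff_eq_cscale L2_inner_add_left L2_cscale L2_inner_cscale_left) simp

lemma L2_inner_diff_right:
  "f \<in> L2 M \<Longrightarrow> g \<in> L2 M \<Longrightarrow> h \<in> L2 M \<Longrightarrow> L2_inner M h (f - g) = L2_inner M h f - L2_inner M h g"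
  by (simp only: diff_eq_cscale L2_inner_add_right L2_cscale L2_inner_cscale_right) simp

lemma L2_norm_add_sq:
  assumes "f \<in> L2 M" "g \<in> L2 M"
  shows "(L2_norm M (f + g))\<^sup>2 = (L2_norm M f)\<^sup>2 + (L2_norm M g)\<^sup>2 + 2 * Re (L2_inner M f g)"
proof -
  have "L2_inner M (f + g) (f + g) =
      L2_inner M f f + L2_inner M g g + (L2_inner M f g + L2_inner M g f)"
    using assms by (simp add: L2_inner_add_left L2_inner_add_right L2_add)
  then have "Re (L2_inner M (f + g) (f + g)) =
      Re (L2_inner M f f) + Re (L2_inner M g g) + 2 * Re (L2_inner M f g)"
    using L2_inner_commute[of M g f] by simp
  then show ?thesis by (simp add: L2_inner_self del: of_real_power)
qed

lemma L2_norm_diff_sq: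
  assumes "f \<in> L2 M" "g \<in> L2 M"
  shows "(L2_norm M (f - g))\<^sup>2 = (L2_norm M f)\<^sup>2 + (L2_norm M g)\<^sup>2 - 2 * Re (L2_inner M f g)"
proof -
  have "L2_norm M (cscale (-1) g) = L2_norm M g"
      "L2_inner M f (cscale (-1) g) = - L2_inner M f g"
    by (simp_all only: L2_norm_cscale L2_inner_cscale_right) simp_all
  then show ?thesis
    unfolding diff_eq_cscale
    using L2_norm_add_sq[OF assms(1) L2_cscale[OF assms(2)], of "-1"] by simp
qed

text \<open>Integrate 2uv \<le> s u^2 + v^2/s, where s is nearly the ratio of the two norms. Having
  the moduli inside the integral is what the estimate for vector-valued maps needs.\<close>

lemma L2_Cauchy_Schwarz_abs:
  assumes "f \<in> L2 M" "g \<in> L2 M"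
  shows "(LINT x|M. cmod (f x) * cmod (g x)) \<le> L2_norm M f * L2_norm M g"
proof -
  let ?a = "L2_norm M f" and ?b = "L2_norm M g"
  have int: "integrable M (\<lambda>x. cmod (f x) * cmod (g x))"
    using integrable_norm[OF L2_inner_integrable[OF assms]] by (simp add: norm_mult)
  have *: "2 * (LINT x|M. cmod (f x) * cmod (g x)) \<le> ?a * (?b + e) + ?b * (?a + e)" if e: "e > 0" for e
  proof -
    \<comment> \<open>The optimal weight is the ratio of the norms; adding \<open>e\<close> to both
      keeps it defined and positive when a norm vanishes.\<close>
    let ?s = "(?b + e) / (?a + e)"
    have pos: "?a + e > 0" "?b + e > 0" using e by (simp_all add: add_nonneg_pos)
    then have s: "?s > 0" by simp
    have pt: "2 * (u * v) \<le> s * u\<^sup>2 + v\<^sup>2 / s" if "s > 0" for u v s :: real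
    proof -
      have "0 \<le> (s * u - v)\<^sup>2 / s" using that by (intro divide_nonneg_pos) auto
      also have "\<dots> = s * u\<^sup>2 + v\<^sup>2 / s - 2 * (u * v)"
        using that by (simp add: field_simps power2_eq_square)
      finally show ?thesis by simp
    qed
    have "(LINT x|M. 2 * (cmod (f x) * cmod (g x))) \<le> (LINT x|M. ?s * (cmod (f x))\<^sup>2 + (cmod (g x))\<^sup>2 / ?s)"
      by (intro integral_mono pt s) (use int assms in \<open>auto simp: L2_integrable\<close>)
    also have "\<dots> = ?s * ?a\<^sup>2 + ?b\<^sup>2 / ?s"
      using assms by (simp add: L2_integrable L2_norm_sq)
    also have "\<dots> = (?b + e) * ?a * (?a / (?a + e)) + (?a + e) * ?b * (?b / (?b + e))"
      by (simp add: power2_eq_square mult_ac)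
    also have "\<dots> \<le> (?b + e) * ?a * 1 + (?a + e) * ?b * 1"
      using pos e by (intro add_mono mult_left_mono) (auto intro!: mult_nonneg_nonneg)
    finally show ?thesis by (simp add: algebra_simps)
  qed
  have "2 * (LINT x|M. cmod (f x) * cmod (g x)) \<le> 2 * (?a * ?b)"
  proof (rule field_le_epsilon)
    fix d :: real assume "d > 0"
    \<comment> \<open>The error in the estimate is \<open>e\<close> times the sum of the norms, so
      this value of \<open>e\<close> keeps it below \<open>d\<close>; the 1 guards against two
      vanishing norms.\<close>
    then have "d / (?a + ?b + 1) > 0" by (auto intro!: divide_pos_pos add_nonneg_pos)
    from *[OF this] have "2 * (LINT x|M. cmod (f x) * cmod (g x))
        \<le> 2 * (?a * ?b) + d * ((?a + ?b) / (?a + ?b + 1))"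
      by (simp add: algebra_simps add_divide_distrib)
    also have "\<dots> \<le> 2 * (?a * ?b) + d * 1"
      using \<open>d > 0\<close> by (intro add_left_mono mult_left_mono)
        (auto simp: divide_le_eq_1 add_nonneg_pos)
    finally show "2 * (LINT x|M. cmod (f x) * cmod (g x)) \<le> 2 * (?a * ?b) + d" by simp
  qed
  then show ?thesis by simp
qed

lemma L2_Cauchy_Schwarz:
  assumes "f \<in> L2 M" "g \<in> L2 M"
  shows "cmod (L2_inner M f g) \<le> L2_norm M f * L2_norm M g"
proof -
  have "cmod (L2_inner M f g) \<le> (LINT x|M. cmod (f x * cnj (g x)))"
    unfolding L2_inner_def by (rule integral_norm_bound)
  also have "\<dots> = (LINT x|M. cmod (f x) * cmod (g x))" by (simp add: norm_mult)
  also have "\<dots> \<le> L2_norm M f * L2_norm M g" by (rule L2_Cauchy_Schwarz_abs[OF assms])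
  finally show ?thesis .
qed

lemma L2_norm_triangle:
  assumes "f \<in> L2 M" "g \<in> L2 M"
  shows "L2_norm M (f + g) \<le> L2_norm M f + L2_norm M g"
proof (rule power2_le_imp_le)
  have "Re (L2_inner M f g) \<le> L2_norm M f * L2_norm M g"
    using complex_Re_le_cmod L2_Cauchy_Schwarz[OF assms] by (rule order_trans)
  then show "(L2_norm M (f + g))\<^sup>2 \<le> (L2_norm M f + L2_norm M g)\<^sup>2"
    by (simp add: L2_norm_add_sq[OF assms] power2_sum)
qed simp

lemma L2_norm_triangle_diff:
  assumes "f \<in> L2 M" "g \<in> L2 M" "h \<in> L2 M"
  shows "L2_norm M (f - h) \<le> L2_norm M (f - g) + L2_norm M (g - h)"
  using L2_norm_triangle[of "f - g" M "g - h"] assms by (simp add: L2_diff)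

lemma L2_norm_mono:
  assumes "f \<in> borel_measurable M" "g \<in> L2 M" "AE x in M. cmod (f x) \<le> cmod (g x)"
  shows "f \<in> L2 M" "L2_norm M f \<le> L2_norm M g"
proof -
  have *: "integrable M (\<lambda>x. (cmod (f x))\<^sup>2)"
    by (rule Bochner_Integration.integrable_bound[OF L2_integrable[OF assms(2)]])
      (use assms in \<open>auto elim!: eventually_mono intro!: power_mono\<close>)
  then show "f \<in> L2 M" using assms by (simp add: L2_def)
  show "L2_norm M f \<le> L2_norm M g" unfolding L2_norm_def
    by (intro real_sqrt_le_mono integral_mono_AE * L2_integrable assms)
      (use assms(3) in \<open>auto elim!: eventually_mono intro!: power_mono\<close>)
qed

interpretation L2: seminormed_set "L2 M" "L2_norm M" for M :: "'a measure"
  by unfold_locales (auto simp: L2_norm_minus_commute intro: L2_norm_triangle_diff)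

lemma L2_norm_eq_0_iff:
  assumes "f \<in> L2 M" shows "L2_norm M f = 0 \<longleftrightarrow> (AE x in M. f x = 0)"
proof -
  have "L2_norm M f = 0 \<longleftrightarrow> (LINT x|M. (cmod (f x))\<^sup>2) = 0" by (simp add: L2_norm_def)
  also have "\<dots> \<longleftrightarrow> (AE x in M. (cmod (f x))\<^sup>2 = 0)"
    by (rule integral_nonneg_eq_0_iff_AE[OF L2_integrable[OF assms]]) simp
  finally show ?thesis by simp
qed

lemma L2_norm_diff_eq_0:
  assumes "f \<in> L2 M" "g \<in> L2 M"
  shows "L2_norm M (f - g) = 0 \<longleftrightarrow> (AE x in M. f x = g x)"
  using L2_norm_eq_0_iff[OF L2_diff[OF assms]] by simp

lemma nn_integral_L2: "f \<in> L2 M \<Longrightarrow> (\<integral>\<^sup>+x. ennreal ((cmod (f x))\<^sup>2) \<partial>M) = ennreal ((L2_norm M f)\<^sup>2)"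
  by (simp add: L2_norm_sq nn_integral_eq_integral L2_integrable)

lemma L2_I_nn_integral:
  assumes "f \<in> borel_measurable M" "(\<integral>\<^sup>+x. ennreal ((cmod (f x))\<^sup>2) \<partial>M) < \<infinity>"
  shows "f \<in> L2 M"
  using assms by (auto simp: L2_def intro!: integrableI_nonneg)

lemma indicator_L2:
  assumes "A \<in> sets M" "emeasure M A < \<infinity>" shows "indicator A \<in> L2 M"
proof (rule L2_I_nn_integral)
  have "(\<integral>\<^sup>+x. ennreal ((cmod (indicator A x))\<^sup>2) \<partial>M) = (\<integral>\<^sup>+x. indicator A x \<partial>M)"
    by (intro nn_integral_cong) (simp add: indicator_def)
  then show "(\<integral>\<^sup>+x. ennreal ((cmod (indicator A x))\<^sup>2) \<partial>M) < \<infinity>" using assms by simp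
qed (use assms in auto)

section \<open>Completeness of L2 (Riesz-Fischer)\<close>

lemma ennreal_le_suminf: "(f k :: ennreal) \<le> (\<Sum>k. f k)"
proof -
  have "sum f {k} \<le> suminf f" by (rule sum_le_suminf) (rule summableI, auto)
  then show ?thesis by simp
qed

text \<open>A rapidly Cauchy subsequence converges almost everywhere, and Fatou's lemma turns
  pointwise convergence back into convergence in norm.\<close>

lemma L2_complete:
  assumes f: "\<And>n. f n \<in> L2 M"
    and Cauchy: "\<And>e. e > 0 \<Longrightarrow> \<exists>K. \<forall>m\<ge>K. \<forall>n\<ge>K. L2_norm M (f m - f n) < e"
  shows "\<exists>g\<in>L2 M. (\<lambda>n. L2_norm M (f n - g)) \<longlonglongrightarrow> 0"
proof -
  note [measurable] = f
  \<comment> \<open>The rate 1/8 leaves room for the weight 4^k: the integrals of 4^k |d k|^2 are at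
    most 2^-k, so they can be summed, and finiteness of the sum at a point bounds |d k| there by a
    multiple of 2^-k.\<close>
  have "\<forall>k. \<exists>K. \<forall>m\<ge>K. \<forall>n\<ge>K. L2_norm M (f m - f n) < (1/8)^k" using Cauchy by simp
  then obtain K where K: "\<And>k m n. m \<ge> K k \<Longrightarrow> n \<ge> K k \<Longrightarrow> L2_norm M (f m - f n) < (1/8)^k"
    by metis
  \<comment> \<open>Partial sums make \<open>r\<close> monotone while \<open>r k\<close> still
    dominates \<open>K k\<close>.\<close>
  define r where "r k = (\<Sum>i\<le>k. K i) + k" for k :: nat
  have rK: "r k \<ge> K k" "r k \<ge> k" for k
    by (auto simp: r_def intro: trans_le_add1 member_le_sum)
  have rS: "r (Suc k) \<ge> r k" for k by (simp add: r_def)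
  then have rmono: "j \<ge> k \<Longrightarrow> r j \<ge> r k" for j k using lift_Suc_mono_le[of r] by auto
  have sqbound: "(L2_norm M (f m - f n))\<^sup>2 \<le> (1/8)^k" if "m \<ge> K k" "n \<ge> K k" for m n k
  proof -
    have "(L2_norm M (f m - f n))\<^sup>2 \<le> ((1/8)^k)\<^sup>2"
      using K[OF that] by (intro power_mono) auto
    also have "\<dots> = (1/8)^k * (1/8)^k" by (simp add: power2_eq_square)
    also have "\<dots> \<le> (1/8)^k * 1"
      by (intro mult_left_mono) (auto simp: power_le_one)
    finally show ?thesis by simp
  qed
  define d where "d k x = f (r (Suc k)) x - f (r k) x" for k x
  have [measurable]: "d k \<in> borel_measurable M" for k unfolding d_def by measurable
  have "(\<integral>\<^sup>+x. (\<Sum>k. ennreal (4^k * (cmod (d k x))\<^sup>2)) \<partial>M)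
      = (\<Sum>k. \<integral>\<^sup>+x. ennreal (4^k * (cmod (d k x))\<^sup>2) \<partial>M)"
    by (intro nn_integral_suminf) measurable
  also have "\<dots> \<le> (\<Sum>k. ennreal ((1/2)^k))"
  proof (intro suminf_le)
    fix k
    have "f (r (Suc k)) - f (r k) = d k" by (auto simp: d_def)
    then have dk: "d k \<in> L2 M" "(L2_norm M (d k))\<^sup>2 \<le> (1/8)^k"
      using sqbound[of k "r (Suc k)" "r k"] rK rS[of k] f L2_diff by (metis order_trans)+
    have "(\<integral>\<^sup>+x. ennreal (4^k * (cmod (d k x))\<^sup>2) \<partial>M) = ennreal (4^k) * ennreal ((L2_norm M (d k))\<^sup>2)"
      by (subst nn_integral_L2[OF dk(1), symmetric], subst nn_integral_cmult[symmetric])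
        (auto simp: ennreal_mult)
    also have "\<dots> = ennreal (4^k * (L2_norm M (d k))\<^sup>2)" by (simp add: ennreal_mult)
    also have "\<dots> \<le> ennreal (4^k * (1/8)^k)"
      using dk(2) by (intro ennreal_leI mult_left_mono) auto
    also have "\<dots> = ennreal ((1/2)^k)" by (simp add: power_mult_distrib[symmetric])
    finally show "(\<integral>\<^sup>+x. ennreal (4^k * (cmod (d k x))\<^sup>2) \<partial>M) \<le> ennreal ((1/2)^k)" .
  qed auto
  also have "\<dots> = ennreal (\<Sum>k. (1/2)^k)"
    by (intro suminf_ennreal2) (auto intro: summable_geometric)
  also have "\<dots> < \<infinity>" by simp
  finally have "AE x in M. (\<Sum>k. ennreal (4^k * (cmod (d k x))\<^sup>2)) \<noteq> \<infinity>"
    by (intro nn_integral_noteq_infinite) auto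
  then have conv: "AE x in M. convergent (\<lambda>n. f (r n) x)"
  proof (eventually_elim)
    fix x assume fin: "(\<Sum>k. ennreal (4^k * (cmod (d k x))\<^sup>2)) \<noteq> \<infinity>"
    define C where "C = enn2real (\<Sum>k. ennreal (4^k * (cmod (d k x))\<^sup>2))"
    have C: "ennreal C = (\<Sum>k. ennreal (4^k * (cmod (d k x))\<^sup>2))"
      unfolding C_def using fin by (intro ennreal_enn2real) (simp add: less_top)
    have "cmod (d k x) \<le> sqrt C * (1/2)^k" for k
    proof -
      have "ennreal (4^k * (cmod (d k x))\<^sup>2) \<le> ennreal C"
        unfolding C by (rule ennreal_le_suminf)
      then have "4^k * (cmod (d k x))\<^sup>2 \<le> C" by (subst (asm) ennreal_le_iff) (auto simp: C_def)
      then have "sqrt (4^k * (cmod (d k x))\<^sup>2) \<le> sqrt C" by simp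
      then have "2^k * cmod (d k x) \<le> sqrt C"
        by (simp add: real_sqrt_mult real_sqrt_power)
      then show ?thesis by (simp add: field_simps power_one_over)
    qed
    moreover have "summable (\<lambda>k. sqrt C * (1/2)^k)"
      by (rule summable_mult, rule summable_geometric) simp
    ultimately have "summable (\<lambda>k. d k x)"
      using summable_comparison_test'[of "\<lambda>k. sqrt C * (1/2)^k" 0 "\<lambda>k. d k x"] by blast
    then have "(\<lambda>n. f (r 0) x + (\<Sum>k<n. d k x)) \<longlonglongrightarrow> f (r 0) x + (\<Sum>k. d k x)"
      by (intro tendsto_intros summable_LIMSEQ)
    moreover have "f (r 0) x + (\<Sum>k<n. d k x) = f (r n) x" for n
      unfolding d_def by (subst sum_lessThan_telescope) simp
    ultimately show "convergent (\<lambda>n. f (r n) x)" by (auto simp: convergent_def)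
  qed
  define g where "g x = lim (\<lambda>n. f (r n) x)" for x
  have [measurable]: "g \<in> borel_measurable M" unfolding g_def by measurable
  have lim: "AE x in M. (\<lambda>n. f (r n) x) \<longlonglongrightarrow> g x"
    using conv by eventually_elim (simp add: g_def convergent_LIMSEQ_iff)
  \<comment> \<open>Fatou along the subsequence bounds the distance of every late \<open>f n\<close>
    to the limit, so the whole sequence converges and not just the subsequence.\<close>
  have Fatou: "(\<integral>\<^sup>+x. ennreal ((cmod (f n x - g x))\<^sup>2) \<partial>M) \<le> ennreal ((1/8)^k)" if n: "n \<ge> K k" for n k
  proof -
    have "(\<integral>\<^sup>+x. ennreal ((cmod (f n x - g x))\<^sup>2) \<partial>M)
        = (\<integral>\<^sup>+x. liminf (\<lambda>j. ennreal ((cmod (f n x - f (r j) x))\<^sup>2)) \<partial>M)"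
    proof (rule nn_integral_cong_AE, use lim in eventually_elim)
      fix x assume "(\<lambda>n. f (r n) x) \<longlonglongrightarrow> g x"
      then have "(\<lambda>j. ennreal ((cmod (f n x - f (r j) x))\<^sup>2)) \<longlonglongrightarrow> ennreal ((cmod (f n x - g x))\<^sup>2)"
        by (intro tendsto_intros tendsto_ennrealI)
      then show "ennreal ((cmod (f n x - g x))\<^sup>2) = liminf (\<lambda>j. ennreal ((cmod (f n x - f (r j) x))\<^sup>2))"
        by (intro lim_imp_Liminf[symmetric]) auto
    qed
    also have "\<dots> \<le> liminf (\<lambda>j. \<integral>\<^sup>+x. ennreal ((cmod (f n x - f (r j) x))\<^sup>2) \<partial>M)"
      by (intro nn_integral_liminf) measurable
    also have "\<dots> \<le> limsup (\<lambda>j. \<integral>\<^sup>+x. ennreal ((cmod (f n x - f (r j) x))\<^sup>2) \<partial>M)"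
      by (intro Liminf_le_Limsup) simp
    also have "\<dots> \<le> ennreal ((1/8)^k)"
    proof (intro Limsup_bounded, unfold eventually_sequentially, intro exI[of _ k] allI impI)
      fix j assume "k \<le> j"
      then have "r j \<ge> K k" using rK(1)[of k] rmono[of k j] by simp
      then show "(\<integral>\<^sup>+x. ennreal ((cmod (f n x - f (r j) x))\<^sup>2) \<partial>M) \<le> ennreal ((1/8)^k)"
        using sqbound[OF n, of "r j"] nn_integral_L2[OF L2_diff[OF f[of n] f[of "r j"]]]
        by (simp add: ennreal_leI)
    qed
    finally show ?thesis .
  qed
  have dL2: "f n - g \<in> L2 M" if "n \<ge> K 0" for n
    by (intro L2_I_nn_integral) (use Fatou[OF that] in \<open>auto simp: fun_diff_def le_less_trans\<close>)
  \<comment> \<open>Only differences with \<open>g\<close> are controlled so far; \<open>g\<close>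
    itself is recovered by subtracting one of them from \<open>f (K 0)\<close>.\<close>
  have gL2: "g \<in> L2 M"
  proof -
    have "f (K 0) - (f (K 0) - g) \<in> L2 M" by (intro L2_diff f dL2) simp
    then show ?thesis by simp
  qed
  moreover have "(\<lambda>n. L2_norm M (f n - g)) \<longlonglongrightarrow> 0"
  proof (rule LIMSEQ_I)
    fix e :: real assume "e > 0"
    then have "e\<^sup>2 > 0" by simp
    then obtain k where k: "(1/8)^k < e\<^sup>2" using real_arch_pow_inv[of "e\<^sup>2" "1/8"] by auto
    show "\<exists>N. \<forall>n\<ge>N. norm (L2_norm M (f n - g) - 0) < e"
    proof (intro exI[of _ "K k"] allI impI)
      fix n assume "n \<ge> K k"
      from Fatou[OF this] have "ennreal ((L2_norm M (f n - g))\<^sup>2) \<le> ennreal ((1/8)^k)"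
        using nn_integral_L2[OF L2_diff[OF f[of n] gL2]] by simp
      then have "(L2_norm M (f n - g))\<^sup>2 \<le> (1/8)^k" by (subst (asm) ennreal_le_iff) auto
      with k have "(L2_norm M (f n - g))\<^sup>2 < e\<^sup>2" by simp
      then show "norm (L2_norm M (f n - g) - 0) < e"
        using \<open>e > 0\<close> by (auto dest: power2_less_imp_less)
    qed
  qed
  ultimately show ?thesis by blast
qed

section \<open>Closed subspaces, Riesz representation and orthogonal projection\<close>

lemma closed_subspaceD:
  assumes "closed_subspace M W"
  shows "W \<subseteq> L2 M" "0 \<in> W" "\<And>f g. f \<in> W \<Longrightarrow> g \<in> W \<Longrightarrow> f + g \<in> W"
    "\<And>c f. f \<in> W \<Longrightarrow> cscale c f \<in> W" "\<And>f g. f \<in> W \<Longrightarrow> g \<in> W \<Longrightarrow> f - g \<in> W"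
  using assms cfun.subspace_diff
  by (auto simp: closed_subspace_def cfun.subspace_def L2_topology_def L2.closedin_iff)

lemma closed_subspace_closed:
  assumes "closed_subspace M W" "f \<in> L2 M" "\<And>e. e > 0 \<Longrightarrow> \<exists>a\<in>W. L2_norm M (a - f) < e"
  shows "f \<in> W"
  using assms by (simp add: closed_subspace_def L2_topology_def L2.closedin_iff)

lemma closed_subspaceI:
  assumes "W \<subseteq> L2 M" "cfun.subspace W"
    and "\<And>f. f \<in> L2 M \<Longrightarrow> (\<And>e. e > 0 \<Longrightarrow> \<exists>a\<in>W. L2_norm M (a - f) < e) \<Longrightarrow> f \<in> W"
  shows "closed_subspace M W"
  using assms by (simp add: closed_subspace_def L2_topology_def L2.closedin_iff)

text \<open>Functions equal almost everywhere have distance 0, and closed sets absorb distance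
  0.\<close>

lemma closed_subspace_cong_AE:
  assumes "closed_subspace M W" "f \<in> W" "g \<in> L2 M" "AE x in M. f x = g x"
  shows "g \<in> W"
proof (rule closed_subspace_closed[OF assms(1,3)])
  fix e :: real assume "e > 0"
  moreover have "L2_norm M (f - g) = 0"
    using assms closed_subspaceD(1)[OF assms(1)] by (subst L2_norm_diff_eq_0) auto
  ultimately show "\<exists>a\<in>W. L2_norm M (a - g) < e" using assms(2) by (intro bexI[of _ f]) simp_all
qed

lemma closed_subspace_LIMSEQ:
  assumes "closed_subspace M W" "f \<in> L2 M" "\<And>n. u n \<in> W" "(\<lambda>n. L2_norm M (u n - f)) \<longlonglongrightarrow> 0"
  shows "f \<in> W"
proof (rule closed_subspace_closed[OF assms(1,2)])
  fix e :: real assume "e > 0"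
  then obtain n where "L2_norm M (u n - f) < e" using LIMSEQ_D[OF assms(4)] by force
  then show "\<exists>a\<in>W. L2_norm M (a - f) < e" using assms(3) by blast
qed

lemma L2_inner_LIMSEQ:
  assumes "\<And>n. u n \<in> L2 M" "f \<in> L2 M" "h \<in> L2 M" "(\<lambda>n. L2_norm M (u n - f)) \<longlonglongrightarrow> 0"
  shows "(\<lambda>n. L2_inner M (u n) h) \<longlonglongrightarrow> L2_inner M f h"
proof (rule LIM_zero_cancel, rule Lim_null_comparison)
  show "\<forall>\<^sub>F n in sequentially. norm (L2_inner M (u n) h - L2_inner M f h) \<le> L2_norm M (u n - f) * L2_norm M h"
    using L2_Cauchy_Schwarz[OF L2_diff[OF assms(1) assms(2)] assms(3)] assms
    by (simp add: L2_inner_diff_left)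
  show "(\<lambda>n. L2_norm M (u n - f) * L2_norm M h) \<longlonglongrightarrow> 0"
    using tendsto_mult_right[OF assms(4), of "L2_norm M h"] by simp
qed

text \<open>A nonzero \<open>c\<close> would make the polynomial negative at a small t of the
  opposite sign; this is the first-order condition at a minimum.\<close>

lemma quadratic_nonneg_imp_linear_0:
  fixes a c :: real
  assumes "a \<ge> 0" and pos: "\<And>t. 0 \<le> t\<^sup>2 * a + 2 * t * c"
  shows "c = 0"
proof (rule ccontr)
  assume c: "c \<noteq> 0"
  \<comment> \<open>The vertex is at -c/a; \<open>a + 1\<close> replaces \<open>a\<close>, which may
    be 0.\<close>
  define n where "n = a + 1"
  have n: "n > 0" using assms(1) by (simp add: n_def)
  have "0 \<le> (- c / n)\<^sup>2 * a + 2 * (- c / n) * c" by (rule pos)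
  also have "\<dots> \<le> (- c / n)\<^sup>2 * n + 2 * (- c / n) * c"
    unfolding n_def by (intro add_right_mono mult_left_mono) auto
  also have "\<dots> = - (c\<^sup>2 / n)" using n by (simp add: field_simps power2_eq_square)
  also have "\<dots> < 0" using c n by simp
  finally show False by simp
qed

text \<open>The representing element minimises ||w||^2 - 2 Re l(w) over \<open>W\<close>: the
  parallelogram law makes a minimising sequence Cauchy, and the first variation at the limit is the
  claim for real parts. It is used on a closed subspace to obtain projections, and on all of L2 to
  solve for a preimage under \<open>Z\<close>.\<close>

theorem L2_Riesz:
  fixes l :: "('a \<Rightarrow> complex) \<Rightarrow> complex"
  assumes W: "closed_subspace M W"
    and add: "\<And>u v. u \<in> W \<Longrightarrow> v \<in> W \<Longrightarrow> l (u + v) = l u + l v"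
    and scale: "\<And>c u. u \<in> W \<Longrightarrow> l (cscale c u) = c * l u"
    and bound: "\<And>u. u \<in> W \<Longrightarrow> cmod (l u) \<le> B * L2_norm M u"
  shows "\<exists>p\<in>W. \<forall>w\<in>W. l w = L2_inner M w p"
proof -
  note WD = closed_subspaceD[OF W]
  have WL2: "w \<in> W \<Longrightarrow> w \<in> L2 M" for w using WD(1) by blast
  define \<Phi> where "\<Phi> w = (L2_norm M w)\<^sup>2 - 2 * Re (l w)" for w
  have lower: "\<Phi> w \<ge> - (B\<^sup>2)" if "w \<in> W" for w
  proof -
    have "Re (l w) \<le> B * L2_norm M w"
      using complex_Re_le_cmod bound[OF that] by (rule order_trans)
    \<comment> \<open>Completing the square bounds the functional below by -B^2.\<close>
    moreover have "0 \<le> (L2_norm M w - B)\<^sup>2" by simp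
    ultimately show ?thesis unfolding \<Phi>_def power2_diff by (simp add: algebra_simps)
  qed
  define m where "m = Inf (\<Phi> ` W)"
  have bdd: "bdd_below (\<Phi> ` W)" using lower by (intro bdd_belowI[of _ "- (B\<^sup>2)"]) auto
  have m_le: "m \<le> \<Phi> w" if "w \<in> W" for w
    unfolding m_def by (rule cInf_lower) (use that bdd in auto)
  have "\<exists>w\<in>W. \<Phi> w < m + 1 / (real n + 1)" for n
  proof -
    have "m < m + 1 / (real n + 1)" by simp
    then show ?thesis unfolding m_def using WD(2) bdd
      by (subst (asm) (1) cInf_less_iff) auto
  qed
  then obtain u where u: "\<And>n. u n \<in> W" "\<And>n. \<Phi> (u n) < m + 1 / (real n + 1)" by metis
  have cauchy: "(L2_norm M (u i - u j))\<^sup>2 \<le> 2 * (1 / (real i + 1) + 1 / (real j + 1))" for i j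
  proof -
    let ?a = "u i" and ?b = "u j"
    have h: "cscale (1/2) (?a + ?b) \<in> W" by (intro WD(3,4) u)
    have "\<Phi> (cscale (1/2) (?a + ?b)) = (L2_norm M (?a + ?b))\<^sup>2 / 4 - Re (l ?a) - Re (l ?b)"
      using u WD by (simp add: \<Phi>_def L2_norm_cscale scale add power_mult_distrib power2_eq_square
          add_divide_distrib)
    then have "4 * m \<le> (L2_norm M (?a + ?b))\<^sup>2 - 4 * Re (l ?a) - 4 * Re (l ?b)"
      using m_le[OF h] by simp
    moreover have "(L2_norm M (?a + ?b))\<^sup>2 + (L2_norm M (?a - ?b))\<^sup>2
        = 2 * (L2_norm M ?a)\<^sup>2 + 2 * (L2_norm M ?b)\<^sup>2"
      using WL2[OF u(1)] by (simp add: L2_norm_add_sq L2_norm_diff_sq)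
    ultimately have "(L2_norm M (?a - ?b))\<^sup>2 \<le> 2 * \<Phi> ?a + 2 * \<Phi> ?b - 4 * m" by (simp add: \<Phi>_def)
    then show ?thesis using u(2)[of i] u(2)[of j] by simp
  qed
  have "\<exists>K. \<forall>i\<ge>K. \<forall>j\<ge>K. L2_norm M (u i - u j) < e" if "e > 0" for e
  proof -
    have "e\<^sup>2 / 4 > 0" using that by simp
    then obtain K where K: "inverse (real (Suc K)) < e\<^sup>2 / 4" using reals_Archimedean by blast
    show ?thesis
    proof (intro exI[of _ K] allI impI)
      fix i j assume "K \<le> i" "K \<le> j"
      then have "1 / (real i + 1) \<le> inverse (real (Suc K))" "1 / (real j + 1) \<le> inverse (real (Suc K))"
        by (auto simp: field_simps)
      with cauchy[of i j] K have "(L2_norm M (u i - u j))\<^sup>2 < e\<^sup>2" by simp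
      then show "L2_norm M (u i - u j) < e" using that by (auto dest: power2_less_imp_less)
    qed
  qed
  from L2_complete[of u M, OF WL2[OF u(1)] this]
  obtain p where p: "p \<in> L2 M" "(\<lambda>n. L2_norm M (u n - p)) \<longlonglongrightarrow> 0" by blast
  have pW: "p \<in> W" using closed_subspace_LIMSEQ[OF W p(1) u(1) p(2)] .
  have Re: "Re (l w) = Re (L2_inner M w p)" if w: "w \<in> W" for w
  proof -
    let ?c = "Re (L2_inner M p w) - Re (l w)"
    \<comment> \<open>The functional is not evaluated at the limit \<open>p\<close>: the variation
      is written down at \<open>u n\<close>, which is minimal up to 1/(n + 1), and only the inner
      product passes to the limit.\<close>
    have pos: "0 \<le> t\<^sup>2 * (L2_norm M w)\<^sup>2 + 2 * t * ?c" for t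
    proof (rule LIMSEQ_le_const)
      show "(\<lambda>n. t\<^sup>2 * (L2_norm M w)\<^sup>2 + 2 * t * (Re (L2_inner M (u n) w) - Re (l w)) + inverse (real (Suc n)))
          \<longlonglongrightarrow> t\<^sup>2 * (L2_norm M w)\<^sup>2 + 2 * t * ?c"
        using tendsto_add[OF tendsto_add[OF tendsto_const tendsto_mult[OF tendsto_const
            tendsto_diff[OF tendsto_Re[OF L2_inner_LIMSEQ[OF WL2[OF u(1)] p(1) WL2[OF w] p(2)]] tendsto_const]]]
          LIMSEQ_inverse_real_of_nat] by simp
      show "\<exists>N. \<forall>n\<ge>N. 0 \<le> t\<^sup>2 * (L2_norm M w)\<^sup>2 + 2 * t * (Re (L2_inner M (u n) w) - Re (l w)) + inverse (real (Suc n))"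
      proof (intro exI[of _ 0] allI impI)
        fix n
        have tw: "cscale (of_real t) w \<in> W" using w by (intro WD(4))
        have "m \<le> \<Phi> (u n + cscale (of_real t) w)" by (intro m_le WD(3) u(1) tw)
        also have "\<dots> = \<Phi> (u n) + t\<^sup>2 * (L2_norm M w)\<^sup>2 + 2 * t * (Re (L2_inner M (u n) w) - Re (l w))"
          unfolding \<Phi>_def using u(1) w tw WL2
          by (simp add: L2_norm_add_sq L2_norm_cscale add scale L2_inner_cscale_right power_mult_distrib
              algebra_simps)
        finally show "0 \<le> t\<^sup>2 * (L2_norm M w)\<^sup>2 + 2 * t * (Re (L2_inner M (u n) w) - Re (l w)) + inverse (real (Suc n))"
          using u(2)[of n] by (simp add: inverse_eq_divide add.commute)
      qed
    qed
    have "?c = 0" by (rule quadratic_nonneg_imp_linear_0[OF _ pos]) simp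
    then show ?thesis using L2_inner_commute[of M w p] by simp
  qed
  have "l w = L2_inner M w p" if w: "w \<in> W" for w
  proof (rule complex_eqI)
    show "Re (l w) = Re (L2_inner M w p)" by (rule Re[OF w])
    \<comment> \<open>Complex linearity recovers imaginary parts: the real part at i w is minus the
      imaginary part at w, on both sides.\<close>
    have "Re (l (cscale \<i> w)) = Re (L2_inner M (cscale \<i> w) p)" by (intro Re WD(4) w)
    then show "Im (l w) = Im (L2_inner M w p)" using w by (simp add: scale L2_inner_cscale_left)
  qed
  then show ?thesis using pW by blast
qed

text \<open>The Riesz representative on \<open>W\<close> of w \<mapsto> <w, a> satisfies the
  defining condition, so the choice in \<open>orth_proj\<close> is not void.\<close>

lemma orth_proj:
  assumes "closed_subspace M W" "a \<in> L2 M"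
  shows "orth_proj M W a \<in> W" "\<And>w. w \<in> W \<Longrightarrow> L2_inner M (a - orth_proj M W a) w = 0"
proof -
  note WD = closed_subspaceD[OF assms(1)]
  have WL2: "w \<in> W \<Longrightarrow> w \<in> L2 M" for w using WD(1) by blast
  have "\<exists>p\<in>W. \<forall>w\<in>W. L2_inner M w a = L2_inner M w p"
  proof (rule L2_Riesz[OF assms(1)])
    fix u assume "u \<in> W"
    then show "cmod (L2_inner M u a) \<le> L2_norm M a * L2_norm M u"
      using L2_Cauchy_Schwarz[OF WL2[OF \<open>u \<in> W\<close>] assms(2)] by (simp add: mult.commute)
  qed (use WL2 assms in \<open>auto simp: L2_inner_add_left L2_inner_cscale_left\<close>)
  then obtain p where "p \<in> W" "\<forall>w\<in>W. L2_inner M w a = L2_inner M w p" by blast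
  then have "p \<in> W \<and> (\<forall>w\<in>W. L2_inner M (a - p) w = 0)"
    using WL2 assms by (metis L2_inner_commute L2_inner_diff_left eq_iff_diff_eq_0)
  then have "orth_proj M W a \<in> W \<and> (\<forall>w\<in>W. L2_inner M (a - orth_proj M W a) w = 0)"
    unfolding orth_proj_def by (rule someI[of "\<lambda>p. p \<in> W \<and> (\<forall>w\<in>W. L2_inner M (a - p) w = 0)"])
  then show "orth_proj M W a \<in> W" "\<And>w. w \<in> W \<Longrightarrow> L2_inner M (a - orth_proj M W a) w = 0"
    by auto
qed

text \<open>Pythagoras. Contraction of projections and their description by distances alone both
  come from here.\<close>

lemma norm_orth_proj:
  assumes W: "closed_subspace M W" and a: "a \<in> L2 M" and w: "w \<in> W"
  shows "(L2_norm M (a - w))\<^sup>2 = (L2_norm M (a - orth_proj M W a))\<^sup>2 + (L2_norm M (orth_proj M W a - w))\<^sup>2"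
proof -
  let ?p = "orth_proj M W a"
  have L: "?p \<in> L2 M" "w \<in> L2 M" "?p - w \<in> W"
    using closed_subspaceD[OF W] orth_proj(1)[OF W a] w by auto
  have "(L2_norm M ((a - ?p) + (?p - w)))\<^sup>2 = (L2_norm M (a - ?p))\<^sup>2 + (L2_norm M (?p - w))\<^sup>2"
    using L a orth_proj(2)[OF W a L(3)] by (subst L2_norm_add_sq) (auto intro: L2_diff)
  then show ?thesis by simp
qed

lemma closed_subspace_L2: "closed_subspace M (L2 M)"
  by (rule closed_subspaceI) (auto simp: cfun_subspace_L2)

text \<open>Lets orthogonality to a generating set pass to its closed span.\<close>

lemma closed_subspace_orthogonal:
  assumes r: "r \<in> L2 M" shows "closed_subspace M {f \<in> L2 M. L2_inner M f r = 0}"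
proof (rule closed_subspaceI)
  show "cfun.subspace {f \<in> L2 M. L2_inner M f r = 0}"
    using r by (auto simp: cfun.subspace_def L2_inner_add_left L2_inner_cscale_left L2_inner_def[of M 0])
  fix f assume f: "f \<in> L2 M"
    and lim: "\<And>e. e > 0 \<Longrightarrow> \<exists>a\<in>{f \<in> L2 M. L2_inner M f r = 0}. L2_norm M (a - f) < e"
  have "cmod (L2_inner M f r) \<le> 0 + e" if e: "e > 0" for e
  proof -
    have "e / (L2_norm M r + 1) > 0" using e by (auto intro!: divide_pos_pos add_nonneg_pos)
    from lim[OF this] obtain a where a: "a \<in> L2 M" "L2_inner M a r = 0" "L2_norm M (a - f) < e / (L2_norm M r + 1)"
      by blast
    have "cmod (L2_inner M f r) = cmod (L2_inner M (a - f) r)"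
      using a f r by (simp add: L2_inner_diff_left)
    also have "\<dots> \<le> L2_norm M (a - f) * L2_norm M r" by (rule L2_Cauchy_Schwarz) (use a f r in auto)
    also have "\<dots> \<le> e / (L2_norm M r + 1) * (L2_norm M r + 1)"
      using a e by (intro mult_mono) auto
    also have "\<dots> = e" using add_nonneg_pos[OF L2_norm_nonneg[of M r] zero_less_one] by simp
    finally show ?thesis by simp
  qed
  then have "cmod (L2_inner M f r) \<le> 0" by (rule field_le_epsilon)
  then show "f \<in> {f \<in> L2 M. L2_inner M f r = 0}" using f by simp
qed auto

section \<open>Closed spans and their countable dense subsets\<close>

lemma closed_span_iff:
  assumes "A \<subseteq> L2 M"
  shows "f \<in> closed_span M A \<longleftrightarrow> f \<in> L2 M \<and> (\<forall>e>0. \<exists>a\<in>cfun.span A. L2_norm M (a - f) < e)"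
proof -
  have "cfun.span A \<subseteq> L2 M" by (rule cfun.span_minimal[OF assms cfun_subspace_L2])
  then have "cfun.span A \<inter> L2 M = cfun.span A" by blast
  then show ?thesis by (simp add: closed_span_def L2_topology_def L2.in_closure_of_iff)
qed

lemma closed_subspace_closed_span:
  assumes A: "A \<subseteq> L2 M" shows "closed_subspace M (closed_span M A)"
proof (rule closed_subspaceI)
  have span: "a \<in> L2 M" if "a \<in> cfun.span A" for a
    using cfun.span_minimal[OF A cfun_subspace_L2] that by blast
  show "closed_span M A \<subseteq> L2 M" using closed_span_iff[OF A] by blast
  show "cfun.subspace (closed_span M A)"
    unfolding cfun.subspace_def
  proof (intro conjI ballI allI)
    show "0 \<in> closed_span M A"
      unfolding closed_span_iff[OF A] by (auto intro!: bexI[of _ 0] cfun.span_zero)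
  next
    fix x y assume x: "x \<in> closed_span M A" and y: "y \<in> closed_span M A"
    show "x + y \<in> closed_span M A"
      unfolding closed_span_iff[OF A]
    proof (intro conjI allI impI)
      show "x + y \<in> L2 M" using x y unfolding closed_span_iff[OF A] by blast
      fix e :: real assume "e > 0"
      then have "e / 2 > 0" by simp
      then obtain a b where ab: "a \<in> cfun.span A" "L2_norm M (a - x) < e / 2"
        "b \<in> cfun.span A" "L2_norm M (b - y) < e / 2"
        using x y unfolding closed_span_iff[OF A] by meson
      have "L2_norm M ((a - x) + (b - y)) \<le> L2_norm M (a - x) + L2_norm M (b - y)"
        using x y ab span unfolding closed_span_iff[OF A] by (intro L2_norm_triangle L2_diff) auto
      also have "\<dots> < e" using ab by simp
      finally show "\<exists>c\<in>cfun.span A. L2_norm M (c - (x + y)) < e"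
        using ab by (intro bexI[of _ "a + b"] cfun.span_add) (simp_all add: algebra_simps)
    qed
  next
    fix c x assume x: "x \<in> closed_span M A"
    show "cscale c x \<in> closed_span M A"
      unfolding closed_span_iff[OF A]
    proof (intro conjI allI impI)
      show "cscale c x \<in> L2 M" using x unfolding closed_span_iff[OF A] by blast
      fix e :: real assume e: "e > 0"
      then have "e / (cmod c + 1) > 0" by (auto intro!: divide_pos_pos add_nonneg_pos)
      then obtain a where a: "a \<in> cfun.span A" "L2_norm M (a - x) < e / (cmod c + 1)"
        using x unfolding closed_span_iff[OF A] by meson
      have "L2_norm M (cscale c (a - x)) \<le> (cmod c) * (e / (cmod c + 1))"
        using a unfolding L2_norm_cscale by (intro mult_left_mono) auto
      also have "\<dots> < e"
      proof -
        have "cmod c + 1 > 0" by (simp add: add_nonneg_pos)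
        then show ?thesis using e by (simp add: pos_divide_less_eq algebra_simps)
      qed
      finally show "\<exists>b\<in>cfun.span A. L2_norm M (b - cscale c x) < e"
        using a by (intro bexI[of _ "cscale c a"] cfun.span_scale) (simp_all add: cfun.scale_right_diff_distrib)
    qed
  qed
  fix f assume f: "f \<in> L2 M" and lim: "\<And>e. e > 0 \<Longrightarrow> \<exists>a\<in>closed_span M A. L2_norm M (a - f) < e"
  show "f \<in> closed_span M A"
    unfolding closed_span_iff[OF A]
  proof (intro conjI allI impI f)
    fix e :: real assume "e > 0"
    then have e: "e / 2 > 0" by simp
    from lim[OF this] obtain g where g: "g \<in> closed_span M A" "L2_norm M (g - f) < e / 2" by blast
    then obtain a where a: "a \<in> cfun.span A" "L2_norm M (a - g) < e / 2"
      using e unfolding closed_span_iff[OF A] by meson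
    have "g \<in> L2 M" using g unfolding closed_span_iff[OF A] by blast
    from L2_norm_triangle_diff[OF span[OF a(1)] this f] g a
    show "\<exists>a\<in>cfun.span A. L2_norm M (a - f) < e" by (intro bexI[of _ a]) auto
  qed
qed

lemma closed_span_superset: "A \<subseteq> L2 M \<Longrightarrow> A \<subseteq> closed_span M A"
proof
  fix a assume "A \<subseteq> L2 M" "a \<in> A"
  then show "a \<in> closed_span M A"
    unfolding closed_span_iff[OF \<open>A \<subseteq> L2 M\<close>] by (auto intro!: bexI[of _ a] cfun.span_base)
qed

lemma closed_span_minimal:
  assumes W: "closed_subspace M W" and "A \<subseteq> W" shows "closed_span M A \<subseteq> W"
proof
  fix f assume f: "f \<in> closed_span M A"
  have A: "A \<subseteq> L2 M" using closed_subspaceD(1)[OF W] assms by blast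
  have "cfun.span A \<subseteq> W"
    using W assms by (intro cfun.span_minimal) (auto simp: closed_subspace_def)
  then show "f \<in> W" using f unfolding closed_span_iff[OF A]
    by (intro closed_subspace_closed[OF W]) blast+
qed

text \<open>The Gaussian rationals, a countable dense set of coefficients.\<close>

definition crat :: "complex set" where
  "crat = (\<lambda>(a, b). Complex a b) ` (\<rat> \<times> \<rat>)"

lemma countable_crat: "countable crat"
  unfolding crat_def by (intro countable_image countable_SIGMA countable_rat)

lemma crat_dense: assumes "e > 0" shows "\<exists>q\<in>crat. cmod (q - c) < e"
proof -
  obtain a where a: "a \<in> \<rat>" "Re c - e / 2 < a" "a < Re c + e / 2"
    using Rats_dense_in_real[of "Re c - e / 2" "Re c + e / 2"] assms by auto
  obtain b where b: "b \<in> \<rat>" "Im c - e / 2 < b" "b < Im c + e / 2"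
    using Rats_dense_in_real[of "Im c - e / 2" "Im c + e / 2"] assms by auto
  have "cmod (Complex a b - c) \<le> \<bar>Re (Complex a b - c)\<bar> + \<bar>Im (Complex a b - c)\<bar>" by (rule cmod_le)
  also have "\<dots> < e" using a b by simp
  finally show ?thesis using a b by (intro bexI[of _ "Complex a b"]) (auto simp: crat_def)
qed

text \<open>Combinations are coded by lists of coefficient-index pairs. With coefficients in
  \<open>crat\<close> and countably many indices there are countably many codes, and one code can be
  evaluated at every point when \<open>F\<close> depends on a parameter.\<close>

definition lincomb :: "('i \<Rightarrow> 'a \<Rightarrow> complex) \<Rightarrow> (complex \<times> 'i) list \<Rightarrow> 'a \<Rightarrow> complex" where
  "lincomb F xs = sum_list (map (\<lambda>(c, i). cscale c (F i)) xs)"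

lemma lincomb_simps [simp]:
  "lincomb F [] = 0" "lincomb F ((c, i) # xs) = cscale c (F i) + lincomb F xs"
  "lincomb F (xs @ ys) = lincomb F xs + lincomb F ys"
  by (simp_all add: lincomb_def)

lemma lincomb_in_span: "xs \<in> lists (Q \<times> I) \<Longrightarrow> lincomb F xs \<in> cfun.span (F ` I)"
proof (induction xs)
  case Nil
  show ?case by (simp only: lincomb_simps cfun.span_zero)
next
  case (Cons x xs)
  then obtain c i where "x = (c, i)" "i \<in> I" "lincomb F xs \<in> cfun.span (F ` I)" by auto
  then show ?case
    by (simp only: lincomb_simps) (rule cfun.span_add; auto intro: cfun.span_scale cfun.span_base)
qed

lemma lincomb_in_L2: "F ` I \<subseteq> L2 M \<Longrightarrow> xs \<in> lists (Q \<times> I) \<Longrightarrow> lincomb F xs \<in> L2 M"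
  using lincomb_in_span[of xs Q I F] cfun.span_minimal[OF _ cfun_subspace_L2] by blast

lemma lincomb_dense_span:
  assumes F: "F ` I \<subseteq> L2 M" and f: "f \<in> cfun.span (F ` I)" and e: "e > 0"
  shows "\<exists>xs\<in>lists (crat \<times> I). L2_norm M (lincomb F xs - f) < e"
proof -
  have "f \<in> L2 M \<and> (\<forall>e>0. \<exists>xs\<in>lists (crat \<times> I). L2_norm M (lincomb F xs - f) < e)"
    using f
  proof (induction rule: cfun.span_induct_alt)
    case base
    have "L2_norm M (lincomb F [] - 0) = 0"
      by (simp only: lincomb_simps diff_self L2_norm_zero)
    moreover have "[] \<in> lists (crat \<times> I)" by (rule lists.Nil)
    ultimately show ?case using L2_zero[of M] by metis
  next
    case (step c x y)
    then obtain i where i: "i \<in> I" "x = F i" by blast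
    have L: "F i \<in> L2 M" "y \<in> L2 M" using i F step by auto
    show ?case
    proof (intro conjI allI impI)
      show "cscale c x + y \<in> L2 M" using L i by (intro L2_add L2_cscale) simp_all
      fix e :: real assume e: "e > 0"
      then have "e / 2 > 0" by simp
      then obtain xs where xs: "xs \<in> lists (crat \<times> I)" "L2_norm M (lincomb F xs - y) < e / 2"
        using step(2) by meson
      have LL: "lincomb F xs \<in> L2 M" by (rule lincomb_in_L2[OF F xs(1)])
      \<comment> \<open>Half of the error is for rounding the new coefficient, whose effect is
        scaled by the norm of \<open>F i\<close>; the other half is for the remaining terms.\<close>
      have "e / 2 / (L2_norm M (F i) + 1) > 0" using e by (auto intro!: divide_pos_pos add_nonneg_pos)
      from crat_dense[OF this] obtain q where q: "q \<in> crat" "cmod (q - c) < e / 2 / (L2_norm M (F i) + 1)"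
        by blast
      have "L2_norm M (cscale (q - c) (F i) + (lincomb F xs - y))
          \<le> L2_norm M (cscale (q - c) (F i)) + L2_norm M (lincomb F xs - y)"
        by (intro L2_norm_triangle L2_cscale L2_diff L LL)
      also have "L2_norm M (cscale (q - c) (F i)) \<le> e / 2 / (L2_norm M (F i) + 1) * (L2_norm M (F i) + 1)"
        unfolding L2_norm_cscale using q e by (intro mult_mono) auto
      also have "\<dots> = e / 2"
      proof -
        have "e / 2 / n * n = e / 2" if "n > 0" for n :: real using that by simp
        then show ?thesis using add_nonneg_pos[OF L2_norm_nonneg[of M "F i"] zero_less_one] by blast
      qed
      finally have "L2_norm M (cscale (q - c) (F i) + (lincomb F xs - y)) < e" using xs by linarith
      moreover have "cscale (q - c) (F i) + (lincomb F xs - y) = lincomb F ((q, i) # xs) - (cscale c x + y)"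
        using i by (simp add: cfun.scale_left_diff_distrib algebra_simps)
      ultimately show "\<exists>xs\<in>lists (crat \<times> I). L2_norm M (lincomb F xs - (cscale c x + y)) < e"
        using q i xs by (intro bexI[of _ "(q, i) # xs"]) auto
    qed
  qed
  then show ?thesis using e by blast
qed

lemma lincomb_dense:
  assumes F: "F ` I \<subseteq> L2 M" and f: "f \<in> closed_span M (F ` I)" and e: "e > 0"
  shows "\<exists>xs\<in>lists (crat \<times> I). L2_norm M (lincomb F xs - f) < e"
proof -
  have e2: "e / 2 > 0" using e by simp
  obtain a where a: "a \<in> cfun.span (F ` I)" "L2_norm M (a - f) < e / 2"
    using f e2 unfolding closed_span_iff[OF F] by meson
  from lincomb_dense_span[OF F a(1) e2]
  obtain xs where xs: "xs \<in> lists (crat \<times> I)" "L2_norm M (lincomb F xs - a) < e / 2" by blast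
  have "lincomb F xs \<in> L2 M" "a \<in> L2 M" "f \<in> L2 M"
    using lincomb_in_L2[OF F xs(1)] a(1) f cfun.span_minimal[OF F cfun_subspace_L2] closed_span_iff[OF F]
    by auto
  from L2_norm_triangle_diff[OF this] xs a show ?thesis by (intro bexI[of _ xs]) auto
qed

section \<open>Functions with vanishing integrals\<close>

lemma AE_le_0_if_set_integrals_0:
  fixes f :: "'a \<Rightarrow> real"
  assumes f: "integrable M f" and z: "\<And>E. E \<in> sets M \<Longrightarrow> (LINT x:E|M. f x) = 0"
  shows "AE x in M. f x \<le> 0"
proof -
  have [measurable]: "f \<in> borel_measurable M" using f by simp
  let ?E = "{x \<in> space M. f x > 0}"
  have "(LINT x|M. indicator ?E x * f x) = 0"
    using z[of ?E] by (simp add: set_lebesgue_integral_def)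
  moreover have "integrable M (\<lambda>x. indicator ?E x * f x)"
    using integrable_mult_indicator[OF _ f, of ?E] by simp
  moreover have "AE x in M. 0 \<le> indicator ?E x * f x" by (auto simp: indicator_def)
  ultimately have "AE x in M. indicator ?E x * f x = 0"
    by (subst (asm) integral_nonneg_eq_0_iff_AE) auto
  then show ?thesis using AE_space by eventually_elim (auto simp: indicator_def split: if_splits)
qed

lemma AE_eq_0_if_set_integrals_0:
  fixes f :: "'a \<Rightarrow> complex"
  assumes f: "integrable M f" and z: "\<And>E. E \<in> sets M \<Longrightarrow> (LINT x:E|M. f x) = 0"
  shows "AE x in M. f x = 0"
proof -
  have [measurable]: "f \<in> borel_measurable M" using f by simp
  have int: "integrable M (\<lambda>x. indicator E x *\<^sub>R f x)" if "E \<in> sets M" for E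
    using that f by (rule integrable_mult_indicator)
  have Re: "(LINT x:E|M. Re (f x)) = 0" "(LINT x:E|M. Im (f x)) = 0" if "E \<in> sets M" for E
    using integral_Re[OF int[OF that]] integral_Im[OF int[OF that]] z[OF that]
    by (simp_all add: set_lebesgue_integral_def)
  have "AE x in M. Re (f x) \<le> 0" "AE x in M. - Re (f x) \<le> 0"
    "AE x in M. Im (f x) \<le> 0" "AE x in M. - Im (f x) \<le> 0"
    by (intro AE_le_0_if_set_integrals_0;
      use f Re in \<open>auto simp: set_lebesgue_integral_def\<close>)+
  then show ?thesis by eventually_elim (auto simp: complex_eq_iff)
qed

text \<open>Dynkin's theorem, localised to the covering sets \<open>A i\<close>: there
  \<open>f\<close> is integrable, so complements can be treated by subtraction, and intersection
  stability brings B \<inter> A i back into the generator. Several density and uniqueness arguments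
  below end here.\<close>

lemma AE_eq_0_if_generator:
  fixes f :: "'a \<Rightarrow> complex"
  assumes G: "Int_stable G" "G \<subseteq> Pow (space M)" "sets M = sigma_sets (space M) G"
    and A: "range (A :: nat \<Rightarrow> 'a set) \<subseteq> G" "(\<Union>i. A i) = space M"
    and f: "f \<in> borel_measurable M" "\<And>i. set_integrable M (A i) f"
    and z: "\<And>B. B \<in> G \<Longrightarrow> (LINT x:B|M. f x) = 0"
  shows "AE x in M. f x = 0"
proof -
  have Gs: "B \<in> sets M" if "B \<in> G" for B using G(3) that by auto
  have Ai: "A i \<in> G" "A i \<in> sets M" for i using A(1) Gs by auto
  have "AE x in M. indicator (A i) x *\<^sub>R f x = 0" for i
  proof (rule AE_eq_0_if_set_integrals_0)
    let ?g = "\<lambda>x. indicator (A i) x *\<^sub>R f x"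
    show gint: "integrable M ?g" using f(2)[of i] by (simp add: set_integrable_def)
    fix E assume "E \<in> sets M"
    then have "E \<in> sigma_sets (space M) G" using G(3) by simp
    from G(1,2) this show "(LINT x:E|M. ?g x) = 0"
    proof (induction rule: sigma_sets_induct_disjoint)
      case (basic B)
      have "(LINT x:B|M. ?g x) = (LINT x:(B \<inter> A i)|M. f x)"
        by (simp add: set_lebesgue_integral_def indicator_inter_arith mult.commute)
      then show ?case using z[of "B \<inter> A i"] G(1) basic Ai by (auto simp: Int_stable_def)
    next
      case empty
      show ?case by (simp add: set_lebesgue_integral_def)
    next
      case (compl B)
      then have B: "B \<in> sets M" using G(3) by simp
      have "(LINT x:(space M - B)|M. ?g x) = (LINT x|M. ?g x - indicator B x *\<^sub>R ?g x)"
        unfolding set_lebesgue_integral_def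
        by (intro Bochner_Integration.integral_cong) (auto simp: indicator_def)
      also have "\<dots> = (LINT x|M. ?g x) - (LINT x:B|M. ?g x)"
        unfolding set_lebesgue_integral_def
        by (rule Bochner_Integration.integral_diff[OF gint integrable_mult_indicator[OF B gint]])
      finally have "(LINT x:(space M - B)|M. ?g x) = (LINT x|M. ?g x) - (LINT x:B|M. ?g x)" .
      \<comment> \<open>For the localised function the whole space amounts to \<open>A i\<close>,
        which belongs to the generator.\<close>
      moreover have "(LINT x|M. ?g x) = 0" using z[OF Ai(1)[of i]] by (simp add: set_lebesgue_integral_def)
      ultimately show ?case using compl by simp
    next
      case (union B)
      then have B: "B j \<in> sets M" for j using G(3) by auto
      have "(LINT x:(\<Union>j. B j)|M. ?g x) = (\<Sum>j. (LINT x:(B j)|M. ?g x))"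
      proof (rule lebesgue_integral_countable_add)
        show "set_integrable M (\<Union>j. B j) ?g"
          unfolding set_integrable_def by (rule integrable_mult_indicator[OF _ gint]) (use B in auto)
      qed (use B union(1) in \<open>auto simp: disjoint_family_on_def\<close>)
      then show ?case using union by simp
    qed
  qed
  then have "AE x in M. \<forall>i. indicator (A i) x *\<^sub>R f x = 0" unfolding AE_all_countable by blast
  then show ?thesis using AE_space
  proof eventually_elim
    fix x assume x: "\<forall>i. indicator (A i) x *\<^sub>R f x = 0" "x \<in> space M"
    then obtain i where "x \<in> A i" using A(2) by blast
    then show "f x = 0" using x(1)[rule_format, of i] by simp
  qed
qed

lemma L2_set_integrable:
  assumes "f \<in> L2 M" "A \<in> sets M" "emeasure M A < \<infinity>" shows "set_integrable M A f"
proof -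
  have "integrable M (\<lambda>x. f x * cnj (indicator A x))"
    by (intro L2_inner_integrable indicator_L2 assms)
  also have "(\<lambda>x. f x * cnj (indicator A x)) = (\<lambda>x. indicator A x *\<^sub>R f x)"
    by (auto simp: indicator_def)
  finally show ?thesis by (simp add: set_integrable_def)
qed

section \<open>Separability of L2\<close>

definition L2_separable :: "'a measure \<Rightarrow> bool" where
  "L2_separable M \<longleftrightarrow>
     (\<exists>D. countable D \<and> D \<subseteq> L2 M \<and> (\<forall>f\<in>L2 M. \<forall>e>0. \<exists>d\<in>D. L2_norm M (d - f) < e))"

text \<open>The residual of \<open>f\<close> after projection to the closed span is orthogonal to
  \<open>S\<close>, hence null, and closed spans absorb null differences.\<close>

lemma L2_total_imp_dense:
  assumes S: "S \<subseteq> L2 M"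
    and total: "\<And>f. f \<in> L2 M \<Longrightarrow> (\<And>s. s \<in> S \<Longrightarrow> L2_inner M f s = 0) \<Longrightarrow> AE x in M. f x = 0"
  shows "closed_span M S = L2 M"
proof
  note W = closed_subspace_closed_span[OF S]
  show "closed_span M S \<subseteq> L2 M" using closed_subspaceD(1)[OF W] .
  show "L2 M \<subseteq> closed_span M S"
  proof
    fix f assume f: "f \<in> L2 M"
    let ?p = "orth_proj M (closed_span M S) f"
    have p: "?p \<in> closed_span M S" "?p \<in> L2 M"
      using orth_proj(1)[OF W f] closed_subspaceD(1)[OF W] by auto
    have "AE x in M. (f - ?p) x = 0"
    proof (rule total)
      show "f - ?p \<in> L2 M" by (rule L2_diff[OF f p(2)])
      show "L2_inner M (f - ?p) s = 0" if "s \<in> S" for s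
        using closed_span_superset[OF S] orth_proj(2)[OF W f] that by blast
    qed
    then have "AE x in M. ?p x = f x" by eventually_elim simp
    then show "f \<in> closed_span M S" by (rule closed_subspace_cong_AE[OF W p(1) f])
  qed
qed

text \<open>Indicators of the generator are total by the Dynkin argument; their combinations with
  coefficients in \<open>crat\<close> form the countable dense set.\<close>

lemma L2_separable_if_generator:
  assumes G: "countable G" "Int_stable G" "G \<subseteq> Pow (space M)" "sets M = sigma_sets (space M) G"
    and A: "range (A :: nat \<Rightarrow> 'a set) \<subseteq> G" "(\<Union>i. A i) = space M"
    and fin: "\<And>B. B \<in> G \<Longrightarrow> emeasure M B < \<infinity>"
  shows "L2_separable M"
proof -
  have Gs: "B \<in> sets M" if "B \<in> G" for B using G(4) that by auto
  let ?F = "indicator :: 'a set \<Rightarrow> 'a \<Rightarrow> complex"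
  have F: "?F ` G \<subseteq> L2 M" using Gs fin by (auto intro: indicator_L2)
  have "closed_span M (?F ` G) = L2 M"
  proof (rule L2_total_imp_dense[OF F])
    fix f assume f: "f \<in> L2 M" and orth: "\<And>s. s \<in> ?F ` G \<Longrightarrow> L2_inner M f s = 0"
    show "AE x in M. f x = 0"
    proof (rule AE_eq_0_if_generator[OF G(2-4) A])
      show "f \<in> borel_measurable M" using f by measurable
      show "set_integrable M (A i) f" for i using A(1) by (intro L2_set_integrable f Gs fin) auto
      fix B assume B: "B \<in> G"
      have "(LINT x:B|M. f x) = L2_inner M f (?F B)"
        unfolding set_lebesgue_integral_def L2_inner_def
        by (intro Bochner_Integration.integral_cong) (auto simp: indicator_def)
      then show "(LINT x:B|M. f x) = 0" using orth B by simp
    qed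
  qed
  then have "\<exists>xs\<in>lists (crat \<times> G). L2_norm M (lincomb ?F xs - f) < e" if "f \<in> L2 M" "e > 0" for f e
    using lincomb_dense[OF F] that by simp
  moreover have "countable (lists (crat \<times> G))"
    by (intro countable_lists countable_SIGMA countable_crat G)
  moreover have "lincomb ?F xs \<in> L2 M" if "xs \<in> lists (crat \<times> G)" for xs
    by (rule lincomb_in_L2[OF F that])
  ultimately show ?thesis unfolding L2_separable_def
    by (intro exI[of _ "lincomb ?F ` lists (crat \<times> G)"]) auto
qed


section \<open>Borel measures of topologies\<close>

lemma space_borel_of [simp]: "space (borel_of X) = topspace X"
  by (simp add: borel_of_def space_measure_of_conv)

lemma open_subset_Pow: "{U. openin X U} \<subseteq> Pow (topspace X)"
  by (auto dest: openin_subset)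

lemma sets_borel_of: "sets (borel_of X) = sigma_sets (topspace X) {U. openin X U}"
  unfolding borel_of_def by (rule sets_measure_of[OF open_subset_Pow])

lemma borel_of_open: "openin X U \<Longrightarrow> U \<in> sets (borel_of X)"
  by (simp add: sets_borel_of)

lemma borel_of_closed: "closedin X U \<Longrightarrow> U \<in> sets (borel_of X)"
  using sets.compl_sets[OF borel_of_open, of X "topspace X - U"]
  by (simp add: closedin_def double_diff)

lemma measurable_borel_ofI:
  assumes "f \<in> space M \<rightarrow> topspace X" "\<And>U. openin X U \<Longrightarrow> f -` U \<inter> space M \<in> sets M"
  shows "f \<in> measurable M (borel_of X)"
  by (rule measurable_sigma_sets[OF sets_borel_of open_subset_Pow assms(1)]) (simp add: assms(2))

lemma continuous_map_measurable:
  assumes "continuous_map X Y f" shows "f \<in> measurable (borel_of X) (borel_of Y)"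
proof (rule measurable_borel_ofI)
  show "f \<in> space (borel_of X) \<rightarrow> topspace Y" using assms by (auto simp: continuous_map_def)
  fix U assume "openin Y U"
  then have "openin X {x \<in> topspace X. f x \<in> U}" using assms by (simp add: continuous_map_def)
  moreover have "{x \<in> topspace X. f x \<in> U} = f -` U \<inter> space (borel_of X)" by auto
  ultimately show "f -` U \<inter> space (borel_of X) \<in> sets (borel_of X)" by (simp add: borel_of_open)
qed

lemma borel_of_euclidean: "borel_of euclidean = borel"
  by (simp add: borel_of_def borel_def)

lemma continuous_map_borel_measurable:
  "continuous_map X euclidean f \<Longrightarrow> f \<in> borel_measurable (borel_of X)"
  using continuous_map_measurable[of X euclidean f] by (simp add: borel_of_euclidean)


section \<open>Measurable maps into L2\<close>

lemma L2_separableE: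
  assumes "L2_separable M"
  obtains D where "countable D" "D \<subseteq> L2 M"
    "\<And>f e. f \<in> L2 M \<Longrightarrow> e > 0 \<Longrightarrow> \<exists>d\<in>D. L2_norm M (d - f) < e"
  using assms unfolding L2_separable_def by metis

lemma topspace_L2 [simp]: "topspace (L2_topology M) = L2 M"
  by (simp add: L2_topology_def)

lemma L2_borel_space: "F \<in> measurable N (L2_borel M) \<Longrightarrow> w \<in> space N \<Longrightarrow> F w \<in> L2 M"
  by (auto dest: measurable_space)

lemma L2_borel_norm_diff:
  assumes F: "F \<in> measurable N (L2_borel M)" and a: "a \<in> L2 M"
  shows "(\<lambda>w. L2_norm M (F w - a)) \<in> borel_measurable N"
  unfolding borel_measurable_iff_less
proof
  fix r
  have "{g \<in> L2 M. L2_norm M (g - a) < r} \<in> sets (L2_borel M)"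
    unfolding L2_topology_def by (intro borel_of_open L2.openin_ball a)
  from measurable_sets[OF F this]
  have "F -` {g \<in> L2 M. L2_norm M (g - a) < r} \<inter> space N \<in> sets N" .
  also have "F -` {g \<in> L2 M. L2_norm M (g - a) < r} \<inter> space N = {w \<in> space N. L2_norm M (F w - a) < r}"
    using L2_borel_space[OF F] by auto
  finally show "{w \<in> space N. L2_norm M (F w - a) < r} \<in> sets N" .
qed

lemma L2_borel_norm:
  "F \<in> measurable N (L2_borel M) \<Longrightarrow> (\<lambda>w. L2_norm M (F w)) \<in> borel_measurable N"
  using L2_borel_norm_diff[of F N M 0] L2_zero[of M] by (simp only: diff_zero)

text \<open>Separability makes each open set a countable union of balls, so distances to fixed
  elements decide measurability.\<close>

lemma L2_borelI:
  assumes sep: "L2_separable M" and F: "\<And>w. w \<in> space N \<Longrightarrow> F w \<in> L2 M"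
    and meas: "\<And>a. a \<in> L2 M \<Longrightarrow> (\<lambda>w. L2_norm M (F w - a)) \<in> borel_measurable N"
  shows "F \<in> measurable N (L2_borel M)"
proof (rule measurable_borel_ofI)
  show "F \<in> space N \<rightarrow> topspace (L2_topology M)" using F by simp
  obtain D where D: "countable D" "D \<subseteq> L2 M" "\<And>f e. f \<in> L2 M \<Longrightarrow> e > 0 \<Longrightarrow> \<exists>d\<in>D. L2_norm M (d - f) < e"
    by (rule L2_separableE[OF sep]) (rule that)
  fix U assume "openin (L2_topology M) U"
  from L2.open_countable_balls[OF D this[unfolded L2_topology_def]] obtain I
    where I: "countable I" "I \<subseteq> D \<times> UNIV" "U = (\<Union>(d, r)\<in>I. {g \<in> L2 M. L2_norm M (g - d) < r})"
    by blast
  have "F -` U \<inter> space N = (\<Union>(d, r)\<in>I. {w \<in> space N. L2_norm M (F w - d) < r})"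
    unfolding I(3) using F by auto
  also have "\<dots> \<in> sets N"
  proof (intro sets.countable_UN''[OF I(1)])
    fix x assume "x \<in> I"
    then have "fst x \<in> L2 M" using I(2) D(2) by (cases x) auto
    from meas[OF this] show "(case x of (d, r) \<Rightarrow> {w \<in> space N. L2_norm M (F w - d) < r}) \<in> sets N"
      unfolding borel_measurable_iff_less by (simp add: split_beta)
  qed
  finally show "F -` U \<inter> space N \<in> sets N" .
qed

lemma L2_borel_const: "L2_separable M \<Longrightarrow> a \<in> L2 M \<Longrightarrow> (\<lambda>w. a) \<in> measurable N (L2_borel M)"
  by (intro L2_borelI) auto

lemma L2_borel_diff_const:
  assumes sep: "L2_separable M" and F: "F \<in> measurable N (L2_borel M)" and a: "a \<in> L2 M"
  shows "(\<lambda>w. F w - a) \<in> measurable N (L2_borel M)"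
proof (rule L2_borelI[OF sep])
  fix b assume b: "b \<in> L2 M"
  have "F w - a - b = F w - (a + b)" for w by (simp add: algebra_simps)
  then show "(\<lambda>w. L2_norm M (F w - a - b)) \<in> borel_measurable N"
    using L2_borel_norm_diff[OF F L2_add[OF a b]] by (simp only:)
qed (use L2_borel_space[OF F] a L2_diff in blast)

text \<open>The sum is split at a point \<open>d\<close> of a countable dense set: the norm of F + G
  is below r exactly when ||F - d|| + ||G + d|| is below r for some \<open>d\<close>. This avoids
  product \<sigma>-algebras on L2.\<close>

lemma L2_borel_norm_add:
  assumes sep: "L2_separable M"
    and F: "F \<in> measurable N (L2_borel M)" and G: "G \<in> measurable N (L2_borel M)"
  shows "(\<lambda>w. L2_norm M (F w + G w)) \<in> borel_measurable N"
  unfolding borel_measurable_iff_less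
proof
  fix r
  obtain D where D: "countable D" "D \<subseteq> L2 M" "\<And>f e. f \<in> L2 M \<Longrightarrow> e > 0 \<Longrightarrow> \<exists>d\<in>D. L2_norm M (d - f) < e"
    by (rule L2_separableE[OF sep]) (rule that)
  note FL = L2_borel_space[OF F] and GL = L2_borel_space[OF G]
  have "{w \<in> space N. L2_norm M (F w + G w) < r}
      = (\<Union>d\<in>D. {w \<in> space N. L2_norm M (F w - d) + L2_norm M (G w - cscale (-1) d) < r})"
    (is "?A = ?B")
  proof (intro subset_antisym subsetI)
    fix w assume "w \<in> ?A"
    then have w: "w \<in> space N" "L2_norm M (F w + G w) < r" by auto
    \<comment> \<open>Half of the slack, since the error of \<open>d\<close> enters both
      terms.\<close>
    let ?e = "(r - L2_norm M (F w + G w)) / 2"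
    have "?e > 0" using w by simp
    from D(3)[OF FL[OF w(1)] this] obtain d where d: "d \<in> D" "L2_norm M (d - F w) < ?e" by blast
    have dL: "d \<in> L2 M" using d D by blast
    have "L2_norm M ((F w + G w) + (d - F w)) \<le> L2_norm M (F w + G w) + L2_norm M (d - F w)"
      by (intro L2_norm_triangle L2_add L2_diff FL GL w dL)
    also have "(F w + G w) + (d - F w) = G w - cscale (-1) d" by simp
    finally have "L2_norm M (F w - d) + L2_norm M (G w - cscale (-1) d) < r"
      using d L2_norm_minus_commute[of M d "F w"] by argo
    then show "w \<in> ?B" using d w by blast
  next
    fix w assume "w \<in> ?B"
    then obtain d where d: "d \<in> D" "w \<in> space N"
      "L2_norm M (F w - d) + L2_norm M (G w - cscale (-1) d) < r" by auto
    have dL: "d \<in> L2 M" using d D by blast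
    have "L2_norm M ((F w - d) + (G w - cscale (-1) d)) \<le> L2_norm M (F w - d) + L2_norm M (G w - cscale (-1) d)"
      by (intro L2_norm_triangle L2_diff L2_cscale FL GL d dL)
    also have "(F w - d) + (G w - cscale (-1) d) = F w + G w" by simp
    finally have "L2_norm M (F w + G w) < r" using d by linarith
    then show "w \<in> ?A" using d by blast
  qed
  also have "\<dots> \<in> sets N"
  proof (intro sets.countable_UN''[OF D(1)])
    fix d assume "d \<in> D"
    then have "d \<in> L2 M" using D(2) by auto
    then have [measurable]: "(\<lambda>w. L2_norm M (F w - d)) \<in> borel_measurable N"
      "(\<lambda>w. L2_norm M (G w - cscale (-1) d)) \<in> borel_measurable N"
      by (intro L2_borel_norm_diff F G L2_cscale; assumption)+
    show "{w \<in> space N. L2_norm M (F w - d) + L2_norm M (G w - cscale (-1) d) < r} \<in> sets N"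
      by measurable
  qed
  finally show "{w \<in> space N. L2_norm M (F w + G w) < r} \<in> sets N" .
qed

lemma L2_borel_add:
  assumes sep: "L2_separable M"
    and F: "F \<in> measurable N (L2_borel M)" and G: "G \<in> measurable N (L2_borel M)"
  shows "(\<lambda>w. F w + G w) \<in> measurable N (L2_borel M)"
proof (rule L2_borelI[OF sep])
  fix a assume a: "a \<in> L2 M"
  have "F w + G w - a = F w + (G w - a)" for w by (simp add: algebra_simps)
  then show "(\<lambda>w. L2_norm M (F w + G w - a)) \<in> borel_measurable N"
    using L2_borel_norm_add[OF sep F L2_borel_diff_const[OF sep G a]] by (simp only:)
qed (use L2_borel_space[OF F] L2_borel_space[OF G] L2_add in blast)

lemma L2_borel_cscale_const:
  assumes sep: "L2_separable M" and F: "F \<in> measurable N (L2_borel M)"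
  shows "(\<lambda>w. cscale c (F w)) \<in> measurable N (L2_borel M)"
proof (rule L2_borelI[OF sep])
  fix a assume a: "a \<in> L2 M"
  show "(\<lambda>w. L2_norm M (cscale c (F w) - a)) \<in> borel_measurable N"
  proof (cases "c = 0")
    case True
    then show ?thesis by simp
  next
    case False
    then have "cscale c (F w) - a = cscale c (F w - cscale (1 / c) a)" for w
      by (simp add: cfun.scale_right_diff_distrib)
    then have "L2_norm M (cscale c (F w) - a) = cmod c * L2_norm M (F w - cscale (1 / c) a)" for w
      by (simp only: L2_norm_cscale)
    then show ?thesis using L2_borel_norm_diff[OF F L2_cscale[OF a, of "1 / c"]] by simp
  qed
qed (use L2_borel_space[OF F] L2_cscale in blast)

lemma L2_borel_diff:
  assumes "L2_separable M" "F \<in> measurable N (L2_borel M)" "G \<in> measurable N (L2_borel M)"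
  shows "(\<lambda>w. F w - G w) \<in> measurable N (L2_borel M)"
  unfolding diff_eq_cscale by (intro L2_borel_add L2_borel_cscale_const assms)

text \<open>Polarisation: the real part is a difference of squared norms of F + G and F - G, and
  multiplying \<open>G\<close> by i turns the imaginary part into a real one.\<close>

lemma L2_borel_inner:
  assumes sep: "L2_separable M"
    and F: "F \<in> measurable N (L2_borel M)" and G: "G \<in> measurable N (L2_borel M)"
  shows "(\<lambda>w. L2_inner M (F w) (G w)) \<in> borel_measurable N"
proof -
  have Re: "(\<lambda>w. Re (L2_inner M (F w) (G w))) \<in> borel_measurable N"
    if G: "G \<in> measurable N (L2_borel M)" for G
  proof -
    have [measurable]: "(\<lambda>w. L2_norm M (F w + G w)) \<in> borel_measurable N"
      "(\<lambda>w. L2_norm M (F w - G w)) \<in> borel_measurable N"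
      by (intro L2_borel_norm L2_borel_add L2_borel_diff sep F G)+
    have "Re (L2_inner M (F w) (G w)) = ((L2_norm M (F w + G w))\<^sup>2 - (L2_norm M (F w - G w))\<^sup>2) / 4"
      if "w \<in> space N" for w
      using L2_borel_space[OF F that] L2_borel_space[OF G that]
      by (simp add: L2_norm_add_sq L2_norm_diff_sq)
    from measurable_cong[OF this] show ?thesis by (rule iffD2) measurable
  qed
  have "Im (L2_inner M (F w) (G w)) = Re (L2_inner M (F w) (cscale \<i> (G w)))" for w
    by (simp add: L2_inner_cscale_right)
  then have "(\<lambda>w. Im (L2_inner M (F w) (G w))) \<in> borel_measurable N"
    using Re[OF L2_borel_cscale_const[OF sep G, of \<i>]] by simp
  with Re[OF G] show ?thesis by (simp add: borel_measurable_complex_iff)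
qed

text \<open>For a varying factor the distance is expanded into norms and an inner product, which are
  already measurable.\<close>

lemma L2_borel_cscale:
  assumes sep: "L2_separable M" and F: "F \<in> measurable N (L2_borel M)"
    and k [measurable]: "k \<in> borel_measurable N"
  shows "(\<lambda>w. cscale (k w) (F w)) \<in> measurable N (L2_borel M)"
proof (rule L2_borelI[OF sep])
  fix a assume a: "a \<in> L2 M"
  note [measurable] = L2_borel_norm[OF F] L2_borel_inner[OF sep F L2_borel_const[OF sep a]]
  have "L2_norm M (cscale (k w) (F w) - a) = sqrt ((cmod (k w))\<^sup>2 * (L2_norm M (F w))\<^sup>2 + (L2_norm M a)\<^sup>2
      - 2 * Re (k w * L2_inner M (F w) a))" if "w \<in> space N" for w
    using L2_norm_diff_sq[OF L2_cscale[OF L2_borel_space[OF F that]] a]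
    by (intro real_sqrt_unique[symmetric])
      (simp_all add: L2_norm_cscale L2_inner_cscale_left power_mult_distrib)
  from measurable_cong[OF this] show "(\<lambda>w. L2_norm M (cscale (k w) (F w) - a)) \<in> borel_measurable N"
    by (rule iffD2) measurable
qed (use L2_borel_space[OF F] L2_cscale in blast)

lemma L2_borel_lincomb:
  assumes sep: "L2_separable M" and F: "\<And>i. i \<in> I \<Longrightarrow> F i \<in> measurable N (L2_borel M)"
    and xs: "xs \<in> lists (Q \<times> I)"
  shows "(\<lambda>w. lincomb (\<lambda>i. F i w) xs) \<in> measurable N (L2_borel M)"
  using xs
proof (induction xs)
  case Nil
  show ?case unfolding lincomb_simps by (rule L2_borel_const[OF sep L2_zero])
next
  case (Cons x xs)
  then obtain c i where "x = (c, i)" "i \<in> I" by auto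
  then show ?case using Cons
    by (simp only: lincomb_simps) (intro L2_borel_add L2_borel_cscale_const sep F)
qed


section \<open>Square integrable maps into L2\<close>

lemma L2_vecD:
  assumes "F \<in> L2_vec N M"
  shows "F \<in> measurable N (L2_borel M)" "integrable N (\<lambda>w. (L2_norm M (F w))\<^sup>2)"
    "\<And>w. w \<in> space N \<Longrightarrow> F w \<in> L2 M"
  using assms L2_borel_space by (auto simp: L2_vec_def)

text \<open>Passing to the scalar function of norms lets the results on scalar L2 be reused for
  vector-valued maps.\<close>

lemma L2_vec_norm_eq: "L2_vec_norm N M F = L2_norm N (\<lambda>w. complex_of_real (L2_norm M (F w)))"
  by (simp add: L2_vec_norm_def L2_norm_def)

lemma L2_vec_norm_fun:
  assumes "F \<in> L2_vec N M" shows "(\<lambda>w. complex_of_real (L2_norm M (F w))) \<in> L2 N"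
proof -
  note [measurable] = L2_borel_norm[OF L2_vecD(1)[OF assms]]
  have "(\<lambda>w. complex_of_real (L2_norm M (F w))) \<in> borel_measurable N" by measurable
  then show ?thesis using L2_vecD(2)[OF assms] by (simp add: L2_def)
qed

lemma L2_vecI:
  assumes F: "F \<in> measurable N (L2_borel M)"
    and g: "g \<in> L2 N" "\<And>w. w \<in> space N \<Longrightarrow> L2_norm M (F w) \<le> cmod (g w)"
  shows "F \<in> L2_vec N M" "L2_vec_norm N M F \<le> L2_norm N g"
proof -
  note [measurable] = L2_borel_norm[OF F]
  have "(\<lambda>w. complex_of_real (L2_norm M (F w))) \<in> L2 N"
    and 2: "L2_norm N (\<lambda>w. complex_of_real (L2_norm M (F w))) \<le> L2_norm N g"
    by (intro L2_norm_mono[OF _ g(1)]; use g(2) in simp)+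
  then show "F \<in> L2_vec N M" using F by (simp add: L2_vec_def L2_def)
  show "L2_vec_norm N M F \<le> L2_norm N g" using 2 by (simp add: L2_vec_norm_eq)
qed

lemma L2_vec_add:
  assumes sep: "L2_separable M" and F: "F \<in> L2_vec N M" and G: "G \<in> L2_vec N M"
  shows "F + G \<in> L2_vec N M" "L2_vec_norm N M (F + G) \<le> L2_vec_norm N M F + L2_vec_norm N M G"
proof -
  let ?f = "\<lambda>w. complex_of_real (L2_norm M (F w))" and ?g = "\<lambda>w. complex_of_real (L2_norm M (G w))"
  have fg: "?f \<in> L2 N" "?g \<in> L2 N" by (intro L2_vec_norm_fun F G)+
  have meas: "F + G \<in> measurable N (L2_borel M)"
    using L2_borel_add[OF sep L2_vecD(1)[OF F] L2_vecD(1)[OF G]] by (simp add: plus_fun_def)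
  have le: "L2_norm M ((F + G) w) \<le> cmod ((?f + ?g) w)" if "w \<in> space N" for w
  proof -
    have "L2_norm M (F w + G w) \<le> L2_norm M (F w) + L2_norm M (G w)"
      by (intro L2_norm_triangle L2_vecD(3)[OF F] L2_vecD(3)[OF G] that)
    also have "\<dots> = cmod ((?f + ?g) w)" by (simp add: of_real_add[symmetric] del: of_real_add)
    finally show ?thesis by simp
  qed
  show "F + G \<in> L2_vec N M" using L2_vecI(1)[OF meas L2_add[OF fg] le] .
  have "L2_vec_norm N M (F + G) \<le> L2_norm N (?f + ?g)" using L2_vecI(2)[OF meas L2_add[OF fg] le] .
  also have "\<dots> \<le> L2_vec_norm N M F + L2_vec_norm N M G"
    unfolding L2_vec_norm_eq by (rule L2_norm_triangle[OF fg])
  finally show "L2_vec_norm N M (F + G) \<le> L2_vec_norm N M F + L2_vec_norm N M G" .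
qed

lemma L2_vec_mult_bounded:
  assumes sep: "L2_separable M" and F: "F \<in> L2_vec N M" and k: "k \<in> borel_measurable N"
    and B: "\<And>w. w \<in> space N \<Longrightarrow> cmod (k w) \<le> B"
  shows "(\<lambda>w. cscale (k w) (F w)) \<in> L2_vec N M"
proof (rule L2_vecI(1))
  show "(\<lambda>w. cscale (k w) (F w)) \<in> measurable N (L2_borel M)"
    by (rule L2_borel_cscale[OF sep L2_vecD(1)[OF F] k])
  show "(\<lambda>w. k w * complex_of_real (L2_norm M (F w))) \<in> L2 N"
    by (rule L2_mult_bounded[OF L2_vec_norm_fun[OF F] k B])
qed (simp add: L2_norm_cscale norm_mult)

lemma L2_vec_cscale:
  "L2_separable M \<Longrightarrow> F \<in> L2_vec N M \<Longrightarrow> (\<lambda>w. cscale c (F w)) \<in> L2_vec N M"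
  using L2_vec_mult_bounded[of M F N "\<lambda>_. c" "cmod c"] by simp

lemma L2_vec_norm_cscale:
  assumes "F \<in> L2_vec N M" "\<And>w. w \<in> space N \<Longrightarrow> cmod (k w) = c" "c \<ge> 0"
  shows "L2_vec_norm N M (\<lambda>w. cscale (k w) (F w)) = c * L2_vec_norm N M F"
proof -
  have "(LINT w|N. (L2_norm M (cscale (k w) (F w)))\<^sup>2) = (LINT w|N. c\<^sup>2 * (L2_norm M (F w))\<^sup>2)"
    by (intro Bochner_Integration.integral_cong)
      (simp_all add: L2_norm_cscale power_mult_distrib assms)
  then show ?thesis using assms by (simp add: L2_vec_norm_def real_sqrt_mult)
qed

lemma L2_vec_diff:
  assumes "L2_separable M" "F \<in> L2_vec N M" "G \<in> L2_vec N M"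
  shows "F - G \<in> L2_vec N M"
proof -
  have "F - G = F + (\<lambda>w. cscale (-1) (G w))" by (auto simp: fun_eq_iff cscale_def)
  then show ?thesis using L2_vec_add(1)[OF assms(1,2) L2_vec_cscale[OF assms(1,3)]] by (simp only:)
qed

lemma L2_vec_norm_minus_commute: "L2_vec_norm N M (F - G) = L2_vec_norm N M (G - F)"
  unfolding L2_vec_norm_def fun_diff_def[of F] fun_diff_def[of G] L2_norm_minus_commute[of M "F _"] by simp

lemma seminormed_set_L2_vec:
  assumes sep: "L2_separable M"
  shows "seminormed_set (L2_vec N M) (L2_vec_norm N M)"
proof
  fix F G H assume F: "F \<in> L2_vec N M" and G: "G \<in> L2_vec N M" and H: "H \<in> L2_vec N M"
  have "L2_vec_norm N M ((F - G) + (G - H)) \<le> L2_vec_norm N M (F - G) + L2_vec_norm N M (G - H)"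
    by (intro L2_vec_add(2) L2_vec_diff sep F G H)
  then show "L2_vec_norm N M (F - H) \<le> L2_vec_norm N M (F - G) + L2_vec_norm N M (G - H)" by simp
next
  fix F show "L2_vec_norm N M (F - F) = 0"
    by (simp only: diff_self L2_vec_norm_def zero_fun_apply L2_norm_zero) simp
qed (rule L2_vec_norm_minus_commute)

lemma L2_vec_norm_eq_0:
  assumes "F \<in> L2_vec N M"
  shows "L2_vec_norm N M F = 0 \<longleftrightarrow> (AE w in N. L2_norm M (F w) = 0)"
  unfolding L2_vec_norm_eq using L2_norm_eq_0_iff[OF L2_vec_norm_fun[OF assms]] by simp

lemma L2_vec_norm_sq: "(L2_vec_norm N M F)\<^sup>2 = (LINT w|N. (L2_norm M (F w))\<^sup>2)"
  by (simp add: L2_vec_norm_def)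

lemma L2_vec_norm_nonneg [simp]: "0 \<le> L2_vec_norm N M F"
  by (simp add: L2_vec_norm_def)

lemma L2_vec_inner_integrable:
  assumes sep: "L2_separable M" and F: "F \<in> L2_vec N M" and G: "G \<in> L2_vec N M"
  shows "integrable N (\<lambda>w. L2_inner M (F w) (G w))"
    "cmod (LINT w|N. L2_inner M (F w) (G w)) \<le> L2_vec_norm N M F * L2_vec_norm N M G"
proof -
  let ?f = "\<lambda>w. complex_of_real (L2_norm M (F w))" and ?g = "\<lambda>w. complex_of_real (L2_norm M (G w))"
  have fg: "?f \<in> L2 N" "?g \<in> L2 N" by (intro L2_vec_norm_fun F G)+
  have i: "integrable N (\<lambda>w. ?f w * cnj (?g w))" by (intro L2_inner_integrable fg)
  have le: "cmod (L2_inner M (F w) (G w)) \<le> cmod (?f w * cnj (?g w))" if "w \<in> space N" for w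
    using L2_Cauchy_Schwarz[OF L2_vecD(3)[OF F that] L2_vecD(3)[OF G that]] by (simp add: norm_mult)
  show *: "integrable N (\<lambda>w. L2_inner M (F w) (G w))"
    by (rule Bochner_Integration.integrable_bound[OF i])
      (use le L2_borel_inner[OF sep L2_vecD(1)[OF F] L2_vecD(1)[OF G]] in auto)
  have "cmod (LINT w|N. L2_inner M (F w) (G w)) \<le> (LINT w|N. cmod (L2_inner M (F w) (G w)))"
    by (rule integral_norm_bound)
  also have "\<dots> \<le> (LINT w|N. cmod (?f w) * cmod (?g w))"
    by (intro integral_mono integrable_norm * ) (use i[THEN integrable_norm] le in \<open>simp_all add: norm_mult\<close>)
  also have "\<dots> \<le> L2_vec_norm N M F * L2_vec_norm N M G"
    unfolding L2_vec_norm_eq by (rule L2_Cauchy_Schwarz_abs[OF fg])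
  finally show "cmod (LINT w|N. L2_inner M (F w) (G w)) \<le> L2_vec_norm N M F * L2_vec_norm N M G" .
qed

text \<open>Convergence in mean yields pointwise convergence of values, which is what membership in
  a closed J(\<omega>) needs.\<close>

lemma L2_vec_LIMSEQ_AE_subseq:
  assumes sep: "L2_separable M" and F: "\<And>n. F n \<in> L2_vec N M" "G \<in> L2_vec N M"
    and lim: "(\<lambda>n. L2_vec_norm N M (F n - G)) \<longlonglongrightarrow> 0"
  shows "\<exists>r. strict_mono (r :: nat \<Rightarrow> nat) \<and> (AE w in N. (\<lambda>n. L2_norm M (F (r n) w - G w)) \<longlonglongrightarrow> 0)"
proof -
  have int: "integrable N (\<lambda>w. (L2_norm M (F n w - G w))\<^sup>2)" for n
    using L2_vecD(2)[OF L2_vec_diff[OF sep F(1) F(2)], of n] by (simp only: fun_diff_def[of "F n"])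
  have "(LINT w|N. norm ((L2_norm M (F n w - G w))\<^sup>2)) = (L2_vec_norm N M (F n - G))\<^sup>2" for n
    unfolding L2_vec_norm_sq by (simp only: fun_diff_def[of "F n"] real_norm_def abs_power2)
  moreover have "(\<lambda>n. (L2_vec_norm N M (F n - G))\<^sup>2) \<longlonglongrightarrow> 0\<^sup>2" by (intro tendsto_power lim)
  ultimately have "(\<lambda>n. LINT w|N. norm ((L2_norm M (F n w - G w))\<^sup>2)) \<longlonglongrightarrow> 0" by (simp only: zero_power2)
  from tendsto_L1_AE_subseq[OF int this] obtain r :: "nat \<Rightarrow> nat" where
    r: "strict_mono r" "AE w in N. (\<lambda>n. (L2_norm M (F (r n) w - G w))\<^sup>2) \<longlonglongrightarrow> 0" by blast
  from r(2) have "AE w in N. (\<lambda>n. L2_norm M (F (r n) w - G w)) \<longlonglongrightarrow> 0"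
  proof eventually_elim
    fix w assume "(\<lambda>n. (L2_norm M (F (r n) w - G w))\<^sup>2) \<longlonglongrightarrow> 0"
    from tendsto_real_sqrt[OF this] show "(\<lambda>n. L2_norm M (F (r n) w - G w)) \<longlonglongrightarrow> 0"
      by (simp only: real_sqrt_abs real_sqrt_zero abs_of_nonneg[OF L2_norm_nonneg])
  qed
  with r(1) show ?thesis by blast
qed


section \<open>Second countable locally compact Hausdorff spaces\<close>

text \<open>An open subset of the product is the union, over a countable base of the first factor,
  of B times the largest open V with B \<times> V inside it. The second factor may thus be the dual
  of \<Gamma>, for which no countable base is at hand.\<close>

lemma continuous_map_prod_measurable:
  assumes X: "second_countable X" and f: "continuous_map (prod_topology X Y) Z f"
  shows "f \<in> measurable (borel_of X \<Otimes>\<^sub>M borel_of Y) (borel_of Z)"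
proof (rule measurable_borel_ofI)
  have sp: "space (borel_of X \<Otimes>\<^sub>M borel_of Y) = topspace X \<times> topspace Y"
    by (simp add: space_pair_measure)
  show "f \<in> space (borel_of X \<Otimes>\<^sub>M borel_of Y) \<rightarrow> topspace Z"
    using f unfolding sp continuous_map_def by auto
  obtain \<B> where \<B>: "countable \<B>" "\<And>B. B \<in> \<B> \<Longrightarrow> openin X B"
    "\<And>U x. openin X U \<Longrightarrow> x \<in> U \<Longrightarrow> \<exists>B\<in>\<B>. x \<in> B \<and> B \<subseteq> U"
    using X unfolding second_countable_def by metis
  fix U assume "openin Z U"
  define W where "W = {p \<in> topspace X \<times> topspace Y. f p \<in> U}"
  have W: "openin (prod_topology X Y) W"
    using f \<open>openin Z U\<close> unfolding W_def continuous_map_def by auto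
  define V where "V B = \<Union>{V. openin Y V \<and> B \<times> V \<subseteq> W}" for B
  have "W = (\<Union>B\<in>\<B>. B \<times> V B)"
  proof (intro subset_antisym subsetI)
    fix p assume p: "p \<in> W"
    then obtain x y where xy: "p = (x, y)" by (cases p)
    obtain A V' where AV: "openin X A" "openin Y V'" "x \<in> A" "y \<in> V'" "A \<times> V' \<subseteq> W"
      using W p unfolding xy openin_prod_topology_alt by meson
    obtain B where B: "B \<in> \<B>" "x \<in> B" "B \<subseteq> A" using \<B>(3)[OF AV(1,3)] by blast
    then have "y \<in> V B" unfolding V_def using AV by blast
    then show "p \<in> (\<Union>B\<in>\<B>. B \<times> V B)" using B xy by blast
  qed (auto simp: V_def)
  also have "\<dots> \<in> sets (borel_of X \<Otimes>\<^sub>M borel_of Y)"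
  proof (intro sets.countable_UN''[OF \<B>(1)] pair_measureI)
    fix B assume "B \<in> \<B>"
    then show "B \<in> sets (borel_of X)" by (intro borel_of_open \<B>)
    show "V B \<in> sets (borel_of Y)" unfolding V_def by (intro borel_of_open openin_Union) auto
  qed
  also have "W = f -` U \<inter> space (borel_of X \<Otimes>\<^sub>M borel_of Y)" unfolding W_def sp by auto
  finally show "f -` U \<inter> space (borel_of X \<Otimes>\<^sub>M borel_of Y) \<in> sets (borel_of X \<Otimes>\<^sub>M borel_of Y)" .
qed

locale lch_space =
  fixes X :: "'a topology"
  assumes loc_comp: "locally_compact_space X" and haus: "Hausdorff_space X"
    and sec_count: "second_countable X"
begin

text \<open>Finite intersections of relatively compact basic sets. The empty set is included so that
  the family is nonempty and can be enumerated even when the space is empty.\<close>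

lemma base:
  obtains \<G> where "countable \<G>" "Int_stable \<G>" "{} \<in> \<G>" "\<And>B. B \<in> \<G> \<Longrightarrow> openin X B"
    "\<And>B. B \<in> \<G> \<Longrightarrow> \<exists>K. compactin X K \<and> B \<subseteq> K"
    "\<And>U x. openin X U \<Longrightarrow> x \<in> U \<Longrightarrow> \<exists>B\<in>\<G>. x \<in> B \<and> B \<subseteq> U"
proof -
  obtain \<B> where \<B>: "countable \<B>" "\<And>B. B \<in> \<B> \<Longrightarrow> openin X B"
    "\<And>U x. openin X U \<Longrightarrow> x \<in> U \<Longrightarrow> \<exists>B\<in>\<B>. x \<in> B \<and> B \<subseteq> U"
    using sec_count unfolding second_countable_def by metis
  define \<C> where "\<C> = insert {} {B \<in> \<B>. \<exists>K. compactin X K \<and> B \<subseteq> K}"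
  define \<G> where "\<G> = Inter ` ({F. finite F \<and> F \<subseteq> \<C>} - {{}})"
  have \<C>: "countable \<C>" "B \<in> \<C> \<Longrightarrow> openin X B" "B \<in> \<C> \<Longrightarrow> \<exists>K. compactin X K \<and> B \<subseteq> K" for B
    using \<B>(1,2) by (auto simp: \<C>_def intro: exI[of _ "{}"])
  have single: "B \<in> \<G>" if "B \<in> \<C>" for B
    unfolding \<G>_def using that by (intro image_eqI[of _ _ "{B}"]) auto
  show ?thesis
  proof (rule that[of \<G>])
    show "countable \<G>"
      unfolding \<G>_def using countable_Collect_finite_subset[OF \<C>(1)] by auto
    show "Int_stable \<G>"
    proof (rule Int_stableI)
      fix a b assume "a \<in> \<G>" "b \<in> \<G>"
      then obtain F F' where F: "finite F" "F \<subseteq> \<C>" "F \<noteq> {}" "a = \<Inter>F"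
        "finite F'" "F' \<subseteq> \<C>" "F' \<noteq> {}" "b = \<Inter>F'" unfolding \<G>_def by auto
      then show "a \<inter> b \<in> \<G>" unfolding \<G>_def by (intro image_eqI[of _ _ "F \<union> F'"]) auto
    qed
    show "{} \<in> \<G>" by (rule single) (simp add: \<C>_def)
    show "openin X B" if B: "B \<in> \<G>" for B
    proof -
      obtain F where "finite F" "F \<subseteq> \<C>" "F \<noteq> {}" "B = \<Inter>F" using B unfolding \<G>_def by auto
      then show ?thesis using \<C>(2) by (auto intro!: openin_Inter)
    qed
    show "\<exists>K. compactin X K \<and> B \<subseteq> K" if B: "B \<in> \<G>" for B
    proof -
      obtain F where F: "F \<subseteq> \<C>" "F \<noteq> {}" "B = \<Inter>F" using B unfolding \<G>_def by auto
      then obtain D where D: "D \<in> F" by blast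
      then obtain K where "compactin X K" "D \<subseteq> K" using F \<C>(3)[of D] by blast
      then show ?thesis using D F by blast
    qed
    fix U x assume U: "openin X U" "x \<in> U"
    then have "x \<in> topspace X" using openin_subset by blast
    then obtain A K where A: "openin X A" "compactin X K" "x \<in> A" "A \<subseteq> K"
      using loc_comp unfolding locally_compact_space_def by meson
    have "openin X (U \<inter> A)" "x \<in> U \<inter> A" using U A by auto
    from \<B>(3)[OF this] obtain B where B: "B \<in> \<B>" "x \<in> B" "B \<subseteq> U \<inter> A" by blast
    then have "B \<in> \<C>" unfolding \<C>_def using A by blast
    then show "\<exists>B\<in>\<G>. x \<in> B \<and> B \<subseteq> U" using B single by blast
  qed
qed

lemma generator:
  obtains \<G> and A :: "nat \<Rightarrow> 'a set" where "countable \<G>" "Int_stable \<G>" "\<G> \<subseteq> Pow (topspace X)"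
    "sets (borel_of X) = sigma_sets (topspace X) \<G>" "range A \<subseteq> \<G>" "(\<Union>i. A i) = topspace X"
    "\<And>B. B \<in> \<G> \<Longrightarrow> openin X B" "\<And>B. B \<in> \<G> \<Longrightarrow> \<exists>K. compactin X K \<and> B \<subseteq> K"
proof -
  obtain \<G> where G: "countable \<G>" "Int_stable \<G>" "{} \<in> \<G>" "\<And>B. B \<in> \<G> \<Longrightarrow> openin X B"
    "\<And>B. B \<in> \<G> \<Longrightarrow> \<exists>K. compactin X K \<and> B \<subseteq> K"
    "\<And>U x. openin X U \<Longrightarrow> x \<in> U \<Longrightarrow> \<exists>B\<in>\<G>. x \<in> B \<and> B \<subseteq> U"
    using base by metis
  have Pow: "\<G> \<subseteq> Pow (topspace X)" using G(4) openin_subset by blast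
  have rng: "range (from_nat_into \<G>) = \<G>"
    using G(1,3) by (intro range_from_nat_into) auto
  show ?thesis
  proof (rule that[of \<G> "from_nat_into \<G>"])
    show "sets (borel_of X) = sigma_sets (topspace X) \<G>"
      unfolding sets_borel_of
    proof (rule sigma_sets_eqI)
      fix U assume "U \<in> {U. openin X U}"
      then have U: "openin X U" by simp
      have "U = \<Union>{B \<in> \<G>. B \<subseteq> U}" using G(6)[OF U] by auto
      moreover have "\<Union>{B \<in> \<G>. B \<subseteq> U} \<in> sigma_sets (topspace X) \<G>"
        using G(1) by (intro sigma_sets_UNION) (auto intro: countable_subset)
      ultimately show "U \<in> sigma_sets (topspace X) \<G>" by simp
    qed (auto intro: G(4))
    show "(\<Union>i. from_nat_into \<G> i) = topspace X"
      using G(6)[OF openin_topspace] Pow unfolding rng by blast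
  qed (use G Pow rng in auto)
qed

text \<open>Complete regularity gives at each point of \<open>U\<close> a function positive there
  and 0 off \<open>U\<close>; a countable base makes countably many of them suffice, and their sums
  are amplified and cut off at 1. Indicators of open sets thereby become bounded pointwise limits of
  continuous functions.\<close>

lemma bumps:
  assumes O: "openin X U"
  obtains u :: "nat \<Rightarrow> 'a \<Rightarrow> real" where "\<And>j. continuous_map X euclideanreal (u j)"
    "\<And>j x. 0 \<le> u j x \<and> u j x \<le> 1" "\<And>j x. x \<in> topspace X - U \<Longrightarrow> u j x = 0"
    "\<And>x. x \<in> U \<Longrightarrow> (\<lambda>j. u j x) \<longlonglongrightarrow> 1"
proof -
  have creg: "completely_regular_space X"
    by (intro locally_compact_regular_imp_completely_regular_space loc_comp
        disjI1 haus)
  obtain \<G> where G: "countable \<G>" "{} \<in> \<G>" "\<And>U x. openin X U \<Longrightarrow> x \<in> U \<Longrightarrow> \<exists>B\<in>\<G>. x \<in> B \<and> B \<subseteq> U"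
    using base by metis
  define ok where "ok B f \<longleftrightarrow> continuous_map X euclideanreal f \<and> (\<forall>x. 0 \<le> f x) \<and>
      (\<forall>x\<in>topspace X - U. f x = 0) \<and> (\<forall>x\<in>B. f x > 0)" for B and f :: "'a \<Rightarrow> real"
  define \<C> where "\<C> = {B \<in> \<G>. \<exists>f. ok B f}"
  have "\<exists>f. ok {} f" by (intro exI[of _ "\<lambda>_. 0"]) (auto simp: ok_def)
  then have "{} \<in> \<C>" using G(2) by (auto simp: \<C>_def)
  moreover have "countable \<C>" using G(1) by (auto simp: \<C>_def intro: countable_subset)
  ultimately have rng: "range (from_nat_into \<C>) = \<C>" by (intro range_from_nat_into) auto
  have "\<forall>i. \<exists>f. ok (from_nat_into \<C> i) f" using rng by (auto simp: \<C>_def)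
  then obtain f where f: "\<And>i. ok (from_nat_into \<C> i) (f i)" by metis
  have cover: "\<exists>i. f i x > 0" if x: "x \<in> U" for x
  proof -
    from creg O x obtain g where g: "continuous_map X euclideanreal g" "g x = 0" "g ` (topspace X - U) \<subseteq> {1}"
      unfolding completely_regular_space_alt' by meson
    define h where "h y = max 0 (1 - g y)" for y
    have h: "continuous_map X euclideanreal h" unfolding h_def
      by (intro continuous_map_real_max continuous_map_diff g(1)) auto
    have "openin X {y \<in> topspace X. h y \<in> {0<..}}"
      by (rule openin_continuous_map_preimage[OF h]) auto
    moreover have "x \<in> {y \<in> topspace X. h y \<in> {0<..}}"
      using x O openin_subset g(2) by (auto simp: h_def)
    ultimately obtain B where B: "B \<in> \<G>" "x \<in> B" "B \<subseteq> {y \<in> topspace X. h y \<in> {0<..}}"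
      using G(3) by meson
    have "ok B h" unfolding ok_def using h B(3) g(3) by (auto simp: h_def)
    then have "B \<in> \<C>" using B by (auto simp: \<C>_def)
    then obtain i where "from_nat_into \<C> i = B" using rng by (metis rangeE)
    then show ?thesis using f[of i] B(2) by (auto simp: ok_def)
  qed
  \<comment> \<open>The factor j makes the value equal to 1, and not just positive, once j is
    large.\<close>
  define u where "u j x = min 1 (real j * (\<Sum>i\<le>j. f i x))" for j x
  show ?thesis
  proof (rule that[of u])
    show "continuous_map X euclideanreal (u j)" for j
      unfolding u_def using f
      by (intro continuous_map_real_min continuous_map_real_mult continuous_map_sum) (auto simp: ok_def)
    show "0 \<le> u j x \<and> u j x \<le> 1" for j x
      unfolding u_def using f by (auto simp: ok_def intro!: mult_nonneg_nonneg sum_nonneg)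
    show "u j x = 0" if "x \<in> topspace X - U" for j x
    proof -
      have "(\<Sum>i\<le>j. f i x) = 0" using f that by (intro sum.neutral) (auto simp: ok_def)
      then show ?thesis by (simp add: u_def)
    qed
    fix x assume "x \<in> U"
    then obtain i where i: "f i x > 0" using cover by blast
    obtain n where n: "real n * f i x > 1" using ex_less_of_nat_mult[OF i] by blast
    have "u j x = 1" if j: "j \<ge> max i n" for j
    proof -
      have "f i x \<le> (\<Sum>i\<le>j. f i x)"
        using f j by (intro member_le_sum) (auto simp: ok_def)
      then have "real n * f i x \<le> real j * (\<Sum>i\<le>j. f i x)"
        using j i by (intro mult_mono) auto
      then show ?thesis using n by (simp add: u_def)
    qed
    then have "eventually (\<lambda>j. u j x = 1) sequentially" by (rule eventually_sequentiallyI)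
    then show "(\<lambda>j. u j x) \<longlonglongrightarrow> 1" by (rule tendsto_eventually)
  qed
qed

lemma relcompact_closure:
  assumes "compactin X K" "B \<subseteq> K" shows "compactin X (X closure_of B)"
proof -
  have "closedin X K" by (rule compactin_imp_closedin[OF haus assms(1)])
  then have "X closure_of B \<subseteq> K" by (rule closure_of_minimal[OF assms(2)])
  then show ?thesis by (rule closed_compactin[OF assms(1)]) simp
qed

lemma CcI:
  assumes "continuous_map X euclidean f" "compactin X K" "\<And>x. x \<in> topspace X - K \<Longrightarrow> f x = 0"
  shows "f \<in> Cc X"
proof -
  have "{x \<in> topspace X. f x \<noteq> 0} \<subseteq> K" using assms(3) by auto
  from relcompact_closure[OF assms(2) this] show ?thesis using assms(1) by (simp add: Cc_def)
qed

end

lemma CcD: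
  assumes "f \<in> Cc X"
  obtains K where "continuous_map X euclidean f" "compactin X K" "\<And>x. x \<in> topspace X - K \<Longrightarrow> f x = 0"
proof (rule that)
  show "continuous_map X euclidean f" "compactin X (X closure_of {x \<in> topspace X. f x \<noteq> 0})"
    using assms by (auto simp: Cc_def)
  show "f x = 0" if "x \<in> topspace X - X closure_of {x \<in> topspace X. f x \<noteq> 0}" for x
    using that closure_of_subset[of "{x \<in> topspace X. f x \<noteq> 0}" X] by auto
qed

lemma continuous_on_compactin_bounded:
  fixes f :: "'a \<Rightarrow> 'b::metric_space"
  assumes "continuous_map X euclidean f" "compactin X K"
  shows "bounded (f ` K)"
proof -
  have "compactin euclidean (f ` K)" by (rule image_compactin[OF assms(2,1)])
  then show ?thesis by (simp add: compact_imp_bounded)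
qed

lemma Cc_bounded:
  assumes "f \<in> Cc X" obtains B where "\<And>x. x \<in> topspace X \<Longrightarrow> cmod (f x) \<le> B"
proof -
  obtain K where K: "continuous_map X euclidean f" "compactin X K" "\<And>x. x \<in> topspace X - K \<Longrightarrow> f x = 0"
    using CcD[OF assms] by metis
  obtain B where B: "\<And>x. x \<in> K \<Longrightarrow> cmod (f x) \<le> B"
    using continuous_on_compactin_bounded[OF K(1,2)] unfolding bounded_iff by auto
  have "cmod (f x) \<le> max B 0" if "x \<in> topspace X" for x
    using B[of x] K(3)[of x] that by (cases "x \<in> K") auto
  then show ?thesis by (rule that)
qed

context lch_space
begin

lemma cfun_subspace_Cc: "cfun.subspace (Cc X)"
  unfolding cfun.subspace_def
proof (intro conjI ballI allI)
  show "0 \<in> Cc X" by (rule CcI[of _ "{}"]) (auto simp: zero_fun_def)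
  fix f g assume "f \<in> Cc X" "g \<in> Cc X"
  then obtain K L where K: "continuous_map X euclidean f" "compactin X K" "\<And>x. x \<in> topspace X - K \<Longrightarrow> f x = 0"
    and L: "continuous_map X euclidean g" "compactin X L" "\<And>x. x \<in> topspace X - L \<Longrightarrow> g x = 0"
    by (metis CcD)
  show "f + g \<in> Cc X"
    by (rule CcI[OF _ compactin_Un[OF K(2) L(2)]])
      (use K L in \<open>auto simp: plus_fun_def intro: continuous_map_add\<close>)
next
  fix c f assume "f \<in> Cc X"
  then obtain K where K: "continuous_map X euclidean f" "compactin X K" "\<And>x. x \<in> topspace X - K \<Longrightarrow> f x = 0"
    by (metis CcD)
  show "cscale c f \<in> Cc X"
  proof (rule CcI[OF _ K(2)])
    show "continuous_map X euclidean (cscale c f)"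
      using continuous_map_compose[OF K(1), of euclidean "\<lambda>z. c * z"]
      by (simp add: o_def cscale_def[abs_def] continuous_on_mult_left)
  qed (use K(3) in \<open>simp add: cscale_def\<close>)
qed

end

text \<open>The common ground of the Haar measures on G and \<Gamma> and of the transported measure
  on the section C, which carries no group structure.\<close>

locale lch_measure = lch_space +
  fixes M :: "'a measure"
  assumes sets_M: "sets M = sets (borel_of X)"
    and finite_compact: "compactin X K \<Longrightarrow> emeasure M K < \<infinity>"
begin

lemma space_M: "space M = topspace X"
  using sets_eq_imp_space_eq[OF sets_M] by simp

lemma open_sets: "openin X U \<Longrightarrow> U \<in> sets M"
  by (simp add: sets_M borel_of_open)

lemma compact_sets: "compactin X K \<Longrightarrow> K \<in> sets M"
  by (simp add: sets_M borel_of_closed compactin_imp_closedin[OF haus])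

lemma finite_relcompact: "compactin X K \<Longrightarrow> B \<subseteq> K \<Longrightarrow> emeasure M B < \<infinity>"
  using emeasure_mono[OF _ compact_sets] finite_compact by (metis order.strict_trans1)

lemma continuous_measurable: "continuous_map X euclidean f \<Longrightarrow> f \<in> borel_measurable M"
  using continuous_map_borel_measurable[of X f] measurable_cong_sets[OF sets_M refl] by blast

lemma sigma_finite: "sigma_finite_measure M"
proof -
  obtain \<G> and A :: "nat \<Rightarrow> 'a set" where G: "range A \<subseteq> \<G>" "(\<Union>i. A i) = topspace X"
    "\<And>B. B \<in> \<G> \<Longrightarrow> openin X B" "\<And>B. B \<in> \<G> \<Longrightarrow> \<exists>K. compactin X K \<and> B \<subseteq> K"
    using generator by metis
  show ?thesis
  proof
    have "emeasure M (A i) \<noteq> \<infinity>" for i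
      using G(1) G(4)[of "A i"] finite_relcompact by (metis less_irrefl range_subsetD)
    moreover have "A i \<in> sets M" for i using G(1,3) by (intro open_sets) auto
    ultimately show "\<exists>A. countable A \<and> A \<subseteq> sets M \<and> \<Union>A = space M \<and> (\<forall>a\<in>A. emeasure M a \<noteq> \<infinity>)"
      using G by (intro exI[of _ "range A"]) (auto simp: space_M)
  qed
qed

lemma L2_separable: "L2_separable M"
proof -
  obtain \<G> and A :: "nat \<Rightarrow> 'a set" where G: "countable \<G>" "Int_stable \<G>" "\<G> \<subseteq> Pow (topspace X)"
    "sets (borel_of X) = sigma_sets (topspace X) \<G>" "range A \<subseteq> \<G>" "(\<Union>i. A i) = topspace X"
    "\<And>B. B \<in> \<G> \<Longrightarrow> \<exists>K. compactin X K \<and> B \<subseteq> K"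
    using generator by metis
  show ?thesis
  proof (rule L2_separable_if_generator[OF G(1,2)])
    show "emeasure M B < \<infinity>" if "B \<in> \<G>" for B using G(7)[OF that] finite_relcompact by blast
  qed (use G in \<open>auto simp: space_M sets_M\<close>)
qed

lemma Cc_L1_L2:
  assumes "f \<in> Cc X" shows "f \<in> L2 M" "integrable M f"
proof -
  obtain K where K: "continuous_map X euclidean f" "compactin X K" "\<And>x. x \<in> topspace X - K \<Longrightarrow> f x = 0"
    using CcD[OF assms] by metis
  obtain B where B: "\<And>x. x \<in> topspace X \<Longrightarrow> cmod (f x) \<le> B" using Cc_bounded[OF assms] by metis
  have [measurable]: "f \<in> borel_measurable M" by (rule continuous_measurable[OF K(1)])
  have [measurable]: "K \<in> sets M" by (rule compact_sets[OF K(2)])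
  have ind: "(\<lambda>x. indicator K x :: complex) \<in> L2 M" using indicator_L2[of K M] finite_compact[OF K(2)] by simp
  have "(\<lambda>x. f x * indicator K x) \<in> L2 M"
    by (rule L2_mult_bounded[OF ind]) (use B in \<open>auto simp: space_M\<close>)
  then show L2: "f \<in> L2 M"
    by (rule L2_cong_AE) (use K(3) in \<open>auto simp: space_M indicator_def intro!: AE_I2\<close>)
  have "integrable M (\<lambda>x. f x * cnj (indicator K x))" by (rule L2_inner_integrable[OF L2 ind])
  then show "integrable M f"
    by (rule integrable_cong_AE_imp) (use K(3) in \<open>auto simp: space_M indicator_def intro!: AE_I2\<close>)
qed

text \<open>Bumps under a relatively compact open set lie in \<open>Cc X\<close> and tend to its
  indicator, so a function orthogonal to \<open>Cc X\<close> integrates to 0 over a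
  generator.\<close>

lemma Cc_dense: assumes "f \<in> L2 M" "e > 0" shows "\<exists>g\<in>Cc X. L2_norm M (g - f) < e"
proof -
  have sub: "Cc X \<subseteq> L2 M" using Cc_L1_L2(1) by blast
  note span = cfun_subspace_Cc
  have "closed_span M (Cc X) = L2 M"
  proof (rule L2_total_imp_dense[OF sub])
    fix h assume h: "h \<in> L2 M" and orth: "\<And>s. s \<in> Cc X \<Longrightarrow> L2_inner M h s = 0"
    obtain \<G> and A :: "nat \<Rightarrow> 'a set" where G: "Int_stable \<G>" "\<G> \<subseteq> Pow (topspace X)"
      "sets (borel_of X) = sigma_sets (topspace X) \<G>" "range A \<subseteq> \<G>" "(\<Union>i. A i) = topspace X"
      "\<And>B. B \<in> \<G> \<Longrightarrow> openin X B" "\<And>B. B \<in> \<G> \<Longrightarrow> \<exists>K. compactin X K \<and> B \<subseteq> K"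
      using generator by metis
    have Gfin: "B \<in> sets M" "emeasure M B < \<infinity>" if "B \<in> \<G>" for B
      using G(6,7)[OF that] finite_relcompact open_sets by auto
    note [measurable] = h
    show "AE x in M. h x = 0"
    proof (rule AE_eq_0_if_generator[of \<G> M A])
      show "set_integrable M (A i) h" for i using G(4) by (intro L2_set_integrable h Gfin) auto
      fix B assume B: "B \<in> \<G>"
      obtain u :: "nat \<Rightarrow> 'a \<Rightarrow> real" where u: "\<And>j. continuous_map X euclideanreal (u j)"
        "\<And>j x. 0 \<le> u j x \<and> u j x \<le> 1" "\<And>j x. x \<in> topspace X - B \<Longrightarrow> u j x = 0"
        "\<And>x. x \<in> B \<Longrightarrow> (\<lambda>j. u j x) \<longlonglongrightarrow> 1"
        using bumps[OF G(6)[OF B]] by blast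
      obtain K where K: "compactin X K" "B \<subseteq> K" using G(7)[OF B] by blast
      have [measurable]: "u j \<in> borel_measurable M" "B \<in> sets M" for j
        using continuous_measurable[OF u(1)] Gfin B by auto
      have Cc: "(\<lambda>x. complex_of_real (u j x)) \<in> Cc X" for j
      proof (rule CcI[OF _ K(1)])
        show "continuous_map X euclidean (\<lambda>x. complex_of_real (u j x))"
          using continuous_map_compose[OF u(1), of euclidean complex_of_real]
          by (auto simp: o_def continuous_on_of_real)
      qed (use u(3) K in auto)
      have "(\<lambda>j. LINT x|M. h x * cnj (complex_of_real (u j x))) \<longlonglongrightarrow> (LINT x|M. indicator B x *\<^sub>R h x)"
      proof (rule integral_dominated_convergence)
        show "integrable M (\<lambda>x. norm (indicator B x *\<^sub>R h x))"
          using L2_set_integrable[OF h Gfin[OF B]] by (intro integrable_norm) (simp add: set_integrable_def)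
        show "AE x in M. norm (h x * cnj (complex_of_real (u j x))) \<le> norm (indicator B x *\<^sub>R h x)" for j
          using u(2,3) by (auto intro!: AE_I2 mult_left_le simp: space_M norm_mult indicator_def)
        show "AE x in M. (\<lambda>j. h x * cnj (complex_of_real (u j x))) \<longlonglongrightarrow> indicator B x *\<^sub>R h x"
        proof (rule AE_I2)
          fix x assume "x \<in> space M"
          show "(\<lambda>j. h x * cnj (complex_of_real (u j x))) \<longlonglongrightarrow> indicator B x *\<^sub>R h x"
          proof (cases "x \<in> B")
            case True
            have "(\<lambda>j. h x * cnj (complex_of_real (u j x))) \<longlonglongrightarrow> h x * cnj (complex_of_real 1)"
              by (intro tendsto_intros u(4) True)
            then show ?thesis using True by simp
          qed (use u(3) \<open>x \<in> space M\<close> in \<open>auto simp: space_M\<close>)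
        qed
      qed measurable
      moreover have "(LINT x|M. h x * cnj (complex_of_real (u j x))) = 0" for j
        using orth[OF Cc, of j] by (simp add: L2_inner_def)
      ultimately show "(LINT x:B|M. h x) = 0"
        using LIMSEQ_unique[OF _ tendsto_const] by (simp add: set_lebesgue_integral_def LIMSEQ_const_iff)
    qed (use G in \<open>auto simp: space_M sets_M\<close>)
  qed
  then have "f \<in> closed_span M (Cc X)" using assms by simp
  then obtain g where "g \<in> cfun.span (Cc X)" "L2_norm M (g - f) < e"
    using assms(2) unfolding closed_span_iff[OF sub] by blast
  moreover have "cfun.span (Cc X) = Cc X" using span by (rule cfun.span_eq_iff[THEN iffD2])
  ultimately show ?thesis by blast
qed

end


section \<open>Haar measures\<close>

lemma (in second_countable_lca_group) lch: "lch_space X"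
  using locally_compact Hausdorff second_countable by (simp add: lch_space_def)

lemma (in second_countable_lca_group) continuous_map_mult_left:
  assumes "x \<in> carrier G" shows "continuous_map X X (\<lambda>y. x \<otimes> y)"
proof -
  have "continuous_map X (prod_topology X X) (\<lambda>y. (x, y))"
    using assms by (intro continuous_map_pairedI) (auto simp: topspace_eq)
  from continuous_map_compose[OF this continuous_mult] show ?thesis by (simp add: o_def)
qed

lemma (in second_countable_lca_group) openin_translate:
  assumes U: "openin X U" and x: "x \<in> carrier G" shows "openin X (x <# U)"
proof -
  have sub: "U \<subseteq> carrier G" using openin_subset[OF U] topspace_eq by simp
  have "openin X {y \<in> topspace X. inv x \<otimes> y \<in> U}"
    by (rule openin_continuous_map_preimage[OF continuous_map_mult_left U]) (use x in simp)
  also have "{y \<in> topspace X. inv x \<otimes> y \<in> U} = x <# U"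
  proof (intro subset_antisym subsetI)
    fix y assume y: "y \<in> {y \<in> topspace X. inv x \<otimes> y \<in> U}"
    then have "y = x \<otimes> (inv x \<otimes> y)" using x by (simp add: topspace_eq m_assoc[symmetric])
    then show "y \<in> x <# U" using y unfolding l_coset_def by blast
  next
    fix y assume "y \<in> x <# U"
    then obtain u where "u \<in> U" "y = x \<otimes> u" unfolding l_coset_def by blast
    then show "y \<in> {y \<in> topspace X. inv x \<otimes> y \<in> U}"
      using x sub by (auto simp: topspace_eq m_assoc[symmetric] subset_iff)
  qed
  finally show ?thesis .
qed

lemma (in second_countable_lca_group) subgroup_lca:
  assumes H: "subgroup H G" and cl: "closedin X H"
  shows "second_countable_lca_group (G\<lparr>carrier := H\<rparr>) (subtopology X H)"
proof -
  have HG: "H \<subseteq> carrier G" by (rule subgroup.subset[OF H])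
  interpret S: group "G\<lparr>carrier := H\<rparr>" by (rule subgroup_imp_group[OF H])
  interpret S: comm_group "G\<lparr>carrier := H\<rparr>"
    by unfold_locales (use HG m_comm in auto)
  show ?thesis
  proof
    show top: "topspace (subtopology X H) = carrier (G\<lparr>carrier := H\<rparr>)"
      using HG by (auto simp: topspace_eq)
    have "continuous_map (prod_topology (subtopology X H) (subtopology X H)) X (\<lambda>(x, y). x \<otimes> y)"
      unfolding subtopology_Times[symmetric] by (rule continuous_map_from_subtopology[OF continuous_mult])
    then show "continuous_map (prod_topology (subtopology X H) (subtopology X H)) (subtopology X H)
        (\<lambda>(x, y). x \<otimes>\<^bsub>G\<lparr>carrier := H\<rparr>\<^esub> y)"
      using subgroup.m_closed[OF H] HG by (auto simp: continuous_map_in_subtopology topspace_eq)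
    have "continuous_map (subtopology X H) X (\<lambda>x. inv x)"
      by (rule continuous_map_from_subtopology[OF continuous_inv])
    then have "continuous_map (subtopology X H) X (\<lambda>x. inv\<^bsub>G\<lparr>carrier := H\<rparr>\<^esub> x)"
      by (rule continuous_map_eq) (use m_inv_consistent[OF H] in simp)
    then show "continuous_map (subtopology X H) (subtopology X H) (\<lambda>x. inv\<^bsub>G\<lparr>carrier := H\<rparr>\<^esub> x)"
      unfolding continuous_map_in_subtopology using S.inv_closed by auto
    show "Hausdorff_space (subtopology X H)" by (rule Hausdorff_space_subtopology[OF Hausdorff])
    show "locally_compact_space (subtopology X H)"
      by (rule locally_compact_space_closed_subset[OF locally_compact cl])
    show "second_countable (subtopology X H)" by (rule second_countable_subtopology[OF second_countable])
  qed
qed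

locale haar_group = second_countable_lca_group G X for G :: "'a monoid" (structure) and X +
  fixes m :: "'a measure"
  assumes haar: "haar_measure G X m"
begin

sublocale lch_measure X m
  using lch haar by (simp add: lch_measure_def lch_measure_axioms_def haar_measure_def)

lemma space_m: "space m = carrier G"
  by (simp add: space_M topspace_eq)

sublocale sigma_finite_measure m
  by (rule sigma_finite)

lemma measurable_mult [measurable]: "(\<lambda>(x, y). x \<otimes> y) \<in> measurable (m \<Otimes>\<^sub>M m) m"
  using continuous_map_prod_measurable[OF sec_count continuous_mult]
  by (subst measurable_cong_sets[OF sets_pair_measure_cong[OF sets_M sets_M] sets_M])

lemma measurable_inv: "(\<lambda>x. inv x) \<in> measurable m m"
  using continuous_map_measurable[OF continuous_inv] by (subst measurable_cong_sets[OF sets_M sets_M])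

lemma measurable_mult_left: "x \<in> carrier G \<Longrightarrow> (\<lambda>y. x \<otimes> y) \<in> measurable m m"
  using continuous_map_measurable[OF continuous_map_mult_left] by (subst measurable_cong_sets[OF sets_M sets_M])

lemma nonzero: "emeasure m (space m) \<noteq> 0"
  using haar by (simp add: haar_measure_def)

lemma emeasure_translate: "x \<in> carrier G \<Longrightarrow> E \<in> sets m \<Longrightarrow> emeasure m (x <# E) = emeasure m E"
  using haar by (simp add: haar_measure_def)

lemma distr_translate: assumes x: "x \<in> carrier G" shows "distr m m (\<lambda>y. x \<otimes> y) = m"
proof (rule measure_eqI)
  fix E assume "E \<in> sets (distr m m (\<lambda>y. x \<otimes> y))"
  then have E: "E \<in> sets m" by simp
  then have sub: "E \<subseteq> carrier G" using sets.sets_into_space space_m by blast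
  have "(\<lambda>y. x \<otimes> y) -` E \<inter> space m = inv x <# E"
  proof (intro subset_antisym subsetI)
    fix y assume y: "y \<in> (\<lambda>y. x \<otimes> y) -` E \<inter> space m"
    then have "y = inv x \<otimes> (x \<otimes> y)" using x by (simp add: space_m m_assoc[symmetric])
    then show "y \<in> inv x <# E" using y unfolding l_coset_def by blast
  next
    fix y assume "y \<in> inv x <# E"
    then obtain u where "u \<in> E" "y = inv x \<otimes> u" unfolding l_coset_def by blast
    then show "y \<in> (\<lambda>y. x \<otimes> y) -` E \<inter> space m"
      using x sub by (auto simp: space_m m_assoc[symmetric] subset_iff)
  qed
  then show "emeasure (distr m m (\<lambda>y. x \<otimes> y)) E = emeasure m E"
    using E x emeasure_translate[of "inv x" E] by (simp add: emeasure_distr[OF measurable_mult_left[OF x]])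
qed simp

lemma nn_integral_translate:
  assumes "x \<in> carrier G" "f \<in> borel_measurable m"
  shows "(\<integral>\<^sup>+y. f (x \<otimes> y) \<partial>m) = (\<integral>\<^sup>+y. f y \<partial>m)"
  using nn_integral_distr[OF measurable_mult_left[OF assms(1)], of f] assms(2) distr_translate[OF assms(1)]
  by simp

lemma integral_translate:
  fixes f :: "'a \<Rightarrow> complex"
  assumes "x \<in> carrier G" "f \<in> borel_measurable m"
  shows "(LINT y|m. f (x \<otimes> y)) = (LINT y|m. f y)"
  using integral_distr[OF measurable_mult_left[OF assms(1)] assms(2)] distr_translate[OF assms(1)]
  by simp

text \<open>Translates of a nonempty null open set would cover G, and a countable base reduces them
  to countably many null sets.\<close>

lemma open_pos:
  assumes U: "openin X U" "U \<noteq> {}" shows "emeasure m U > 0"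
proof (rule ccontr)
  assume "\<not> emeasure m U > 0"
  then have z: "emeasure m U = 0" by (simp add: zero_less_iff_neq_zero)
  obtain \<G> where G: "countable \<G>" "\<And>B. B \<in> \<G> \<Longrightarrow> openin X B"
    "\<And>U x. openin X U \<Longrightarrow> x \<in> U \<Longrightarrow> \<exists>B\<in>\<G>. x \<in> B \<and> B \<subseteq> U"
    using base by metis
  define \<D> where "\<D> = {B \<in> \<G>. \<exists>g\<in>carrier G. B \<subseteq> g <# U}"
  obtain u where u: "u \<in> U" "u \<in> carrier G" using U openin_subset topspace_eq by blast
  have "B \<in> null_sets m" if B: "B \<in> \<D>" for B
  proof -
    obtain g where g: "B \<in> \<G>" "g \<in> carrier G" "B \<subseteq> g <# U" using B unfolding \<D>_def by blast
    have "emeasure m B \<le> emeasure m (g <# U)"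
      by (intro emeasure_mono g open_sets openin_translate U)
    also have "\<dots> = 0" using emeasure_translate[OF g(2) open_sets[OF U(1)]] z by simp
    finally show ?thesis using open_sets[OF G(2)[OF g(1)]] by (auto simp: null_sets_def)
  qed
  moreover have "countable \<D>" using G(1) unfolding \<D>_def by simp
  ultimately have "(\<Union>B\<in>\<D>. B) \<in> null_sets m" by (intro null_sets_UN') auto
  moreover have "space m \<subseteq> (\<Union>B\<in>\<D>. B)"
  proof
    fix x assume "x \<in> space m"
    then have x: "x \<in> carrier G" by (simp add: space_m)
    have "x = (x \<otimes> inv u) \<otimes> u" using x u by (simp add: m_assoc)
    then have "x \<in> (x \<otimes> inv u) <# U" unfolding l_coset_def using u by blast
    from G(3)[OF openin_translate[OF U(1)] this] x u obtain B
      where "B \<in> \<G>" "x \<in> B" "B \<subseteq> (x \<otimes> inv u) <# U" by auto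
    then show "x \<in> (\<Union>B\<in>\<D>. B)" unfolding \<D>_def using x u by auto
  qed
  ultimately have "emeasure m (space m) = 0"
    by (metis emeasure_mono le_zero_eq null_setsD1 null_setsD2)
  then show False using nonzero by simp
qed

text \<open>A direct computation with Fubini: integrating 1_E(inv y) 1_A(x y) first over x gives
  m(A) m(inv E). The substitution y \<mapsto> inv x y turns the integrand into 1_E(x inv y) 1_A(y),
  which gives m(E) m(A), and m(A) cancels.\<close>

lemma distr_inv: "distr m m (\<lambda>x. inv x) = m"
proof (rule measure_eqI)
  fix E assume "E \<in> sets (distr m m (\<lambda>x. inv x))"
  then have E [measurable]: "E \<in> sets m" by simp
  interpret P: pair_sigma_finite m m ..
  note [measurable] = measurable_inv
  \<comment> \<open>A relatively compact neighbourhood of the identity: its measure is finite, and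
    positive by \<open>open_pos\<close>, so it can be cancelled.\<close>
  obtain A where A: "openin X A" "A \<noteq> {}" "emeasure m A < \<infinity>"
  proof -
    have "\<one> \<in> topspace X" by (simp add: topspace_eq)
    then obtain U K where "openin X U" "compactin X K" "\<one> \<in> U" "U \<subseteq> K"
      using loc_comp unfolding locally_compact_space_def by meson
    then show ?thesis using that[of U] finite_relcompact by blast
  qed
  have [measurable]: "A \<in> sets m" by (rule open_sets[OF A(1)])
  let ?f = "indicator A :: 'a \<Rightarrow> ennreal" and ?g = "indicator E :: 'a \<Rightarrow> ennreal"
  have inv_eq: "inv (inv x \<otimes> y) = x \<otimes> inv y" if "x \<in> carrier G" "y \<in> carrier G" for x y
    using that by (simp add: inv_mult m_comm)
  have "emeasure m A * emeasure (distr m m (\<lambda>x. inv x)) E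
      = (\<integral>\<^sup>+y. ?g (inv y) \<partial>m) * (\<integral>\<^sup>+x. ?f x \<partial>m)"
    using nn_integral_distr[OF measurable_inv, of ?g] E by (simp add: mult.commute)
  also have "\<dots> = (\<integral>\<^sup>+y. ?g (inv y) * (\<integral>\<^sup>+x. ?f x \<partial>m) \<partial>m)"
    by (rule nn_integral_multc[symmetric]) measurable
  also have "\<dots> = (\<integral>\<^sup>+y. (\<integral>\<^sup>+x. ?g (inv y) * ?f (x \<otimes> y) \<partial>m) \<partial>m)"
  proof (rule nn_integral_cong)
    fix y assume "y \<in> space m"
    then have y: "y \<in> carrier G" by (simp add: space_m)
    have "(\<integral>\<^sup>+x. ?f x \<partial>m) = (\<integral>\<^sup>+x. ?f (y \<otimes> x) \<partial>m)" by (rule nn_integral_translate[OF y, symmetric]) simp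
    also have "\<dots> = (\<integral>\<^sup>+x. ?f (x \<otimes> y) \<partial>m)" by (intro nn_integral_cong) (simp add: space_m m_comm y)
    finally have *: "(\<integral>\<^sup>+x. ?f x \<partial>m) = (\<integral>\<^sup>+x. ?f (x \<otimes> y) \<partial>m)" .
    have "(\<lambda>x. y \<otimes> x) \<in> measurable m m" by (rule measurable_mult_left[OF y])
    then have "(\<lambda>x. x \<otimes> y) \<in> measurable m m" by (subst measurable_cong[where g="\<lambda>x. y \<otimes> x"]) (auto simp: space_m m_comm y)
    then have "(\<lambda>x. ?f (x \<otimes> y)) \<in> borel_measurable m"
      by (rule measurable_compose[OF _ borel_measurable_indicator]) measurable
    then show "?g (inv y) * (\<integral>\<^sup>+x. ?f x \<partial>m) = (\<integral>\<^sup>+x. ?g (inv y) * ?f (x \<otimes> y) \<partial>m)"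
      unfolding * by (rule nn_integral_cmult[symmetric])
  qed
  also have "\<dots> = (\<integral>\<^sup>+x. (\<integral>\<^sup>+y. ?g (inv y) * ?f (x \<otimes> y) \<partial>m) \<partial>m)"
    by (rule P.Fubini') measurable
  also have "\<dots> = (\<integral>\<^sup>+x. (\<integral>\<^sup>+y. ?g (x \<otimes> inv y) * ?f y \<partial>m) \<partial>m)"
  proof (rule nn_integral_cong)
    fix x assume "x \<in> space m"
    then have x: "x \<in> carrier G" by (simp add: space_m)
    note [measurable] = measurable_mult_left[OF x]
    have "(\<integral>\<^sup>+y. ?g (inv (inv x \<otimes> y)) * ?f (x \<otimes> (inv x \<otimes> y)) \<partial>m) = (\<integral>\<^sup>+y. ?g (inv y) * ?f (x \<otimes> y) \<partial>m)"
      by (rule nn_integral_translate) (use x in auto)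
    then show "(\<integral>\<^sup>+y. ?g (inv y) * ?f (x \<otimes> y) \<partial>m) = (\<integral>\<^sup>+y. ?g (x \<otimes> inv y) * ?f y \<partial>m)"
      using x by (auto simp: inv_eq m_assoc[symmetric] space_m cong: nn_integral_cong_simp)
  qed
  also have "\<dots> = (\<integral>\<^sup>+y. (\<integral>\<^sup>+x. ?g (x \<otimes> inv y) * ?f y \<partial>m) \<partial>m)"
    by (rule P.Fubini'[symmetric]) measurable
  also have "\<dots> = (\<integral>\<^sup>+y. emeasure m E * ?f y \<partial>m)"
  proof (rule nn_integral_cong)
    fix y assume "y \<in> space m"
    then have y: "y \<in> carrier G" "inv y \<in> carrier G" by (auto simp: space_m)
    have "(\<lambda>x. x \<otimes> inv y) \<in> measurable m m"
      using measurable_mult_left[OF y(2)] by (subst measurable_cong[where g="\<lambda>x. inv y \<otimes> x"]) (auto simp: space_m m_comm y)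
    then have "(\<lambda>x. ?g (x \<otimes> inv y)) \<in> borel_measurable m"
      by (rule measurable_compose[OF _ borel_measurable_indicator]) measurable
    then have "(\<integral>\<^sup>+x. ?g (x \<otimes> inv y) * ?f y \<partial>m) = (\<integral>\<^sup>+x. ?g (x \<otimes> inv y) \<partial>m) * ?f y"
      by (rule nn_integral_multc)
    also have "(\<integral>\<^sup>+x. ?g (x \<otimes> inv y) \<partial>m) = (\<integral>\<^sup>+x. ?g (inv y \<otimes> x) \<partial>m)"
      by (intro nn_integral_cong) (simp add: space_m m_comm y)
    also have "\<dots> = emeasure m E" using nn_integral_translate[OF y(2), of ?g] by simp
    finally show "(\<integral>\<^sup>+x. ?g (x \<otimes> inv y) * ?f y \<partial>m) = emeasure m E * ?f y" .
  qed
  also have "\<dots> = emeasure m E * emeasure m A" by (subst nn_integral_cmult) auto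
  finally have "emeasure m A * emeasure (distr m m (\<lambda>x. inv x)) E = emeasure m A * emeasure m E"
    by (simp add: mult.commute)
  then show "emeasure (distr m m (\<lambda>x. inv x)) E = emeasure m E"
    using A(3) open_pos[OF A(1,2)] by (subst (asm) ennreal_mult_cancel_left) auto
qed simp

lemma nn_integral_inv:
  "f \<in> borel_measurable m \<Longrightarrow> (\<integral>\<^sup>+x. f (inv x) \<partial>m) = (\<integral>\<^sup>+x. f x \<partial>m)"
  using nn_integral_distr[OF measurable_inv, of f] distr_inv by simp

end


section \<open>Weil's formula\<close>

locale weil_pair = haar_group G X mG for G :: "'a monoid" (structure) and X mG +
  fixes \<Gamma> :: "'a set" and m\<Gamma> \<mu> :: "'a measure"
  assumes subgroup: "subgroup \<Gamma> G" and closed: "closedin X \<Gamma>"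
    and haar_sub: "haar_measure (G\<lparr>carrier := \<Gamma>\<rparr>) (subtopology X \<Gamma>) m\<Gamma>"
    and space_\<mu>: "space \<mu> \<subseteq> carrier G"
    and weil: "weil_formula G mG m\<Gamma> \<mu>"
begin

sublocale S: haar_group "G\<lparr>carrier := \<Gamma>\<rparr>" "subtopology X \<Gamma>" m\<Gamma>
  using subgroup_lca[OF subgroup closed] haar_sub by (simp add: haar_group_def haar_group_axioms_def)

lemma sub_carrier: "\<gamma> \<in> \<Gamma> \<Longrightarrow> \<gamma> \<in> carrier G"
  using subgroup.subset[OF subgroup] by blast

lemma space_m\<Gamma>: "space m\<Gamma> = \<Gamma>"
  by (simp add: S.space_m)

lemma inv_sub: "\<gamma> \<in> \<Gamma> \<Longrightarrow> inv\<^bsub>G\<lparr>carrier := \<Gamma>\<rparr>\<^esub> \<gamma> = inv \<gamma>"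
  by (rule m_inv_consistent[OF subgroup])

lemma measurable_mult_sub [measurable]: "(\<lambda>(x, y). x \<otimes> y) \<in> measurable (mG \<Otimes>\<^sub>M m\<Gamma>) mG"
proof -
  have "prod_topology X (subtopology X \<Gamma>) = subtopology (prod_topology X X) (topspace X \<times> \<Gamma>)"
    using subtopology_Times[of X X "topspace X" \<Gamma>] by simp
  then have "continuous_map (prod_topology X (subtopology X \<Gamma>)) X (\<lambda>(x, y). x \<otimes> y)"
    using continuous_map_from_subtopology[OF continuous_mult] by simp
  from continuous_map_prod_measurable[OF sec_count this] show ?thesis
    by (subst measurable_cong_sets[OF sets_pair_measure_cong[OF sets_M S.sets_M] sets_M])
qed

lemma measurable_mult_const [measurable]: "x \<in> carrier G \<Longrightarrow> (\<lambda>\<gamma>. x \<otimes> \<gamma>) \<in> measurable m\<Gamma> mG"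
  using measurable_compose[OF measurable_Pair1'[of x mG m\<Gamma>] measurable_mult_sub] by (simp add: space_m)

lemma measurable_inv_sub: "(\<lambda>\<gamma>. inv \<gamma>) \<in> measurable m\<Gamma> m\<Gamma>"
  using S.measurable_inv by (subst measurable_cong[where g="\<lambda>\<gamma>. inv\<^bsub>G\<lparr>carrier := \<Gamma>\<rparr>\<^esub> \<gamma>"])
    (auto simp: space_m\<Gamma> inv_sub)

lemma nn_integral_inv_sub:
  "f \<in> borel_measurable m\<Gamma> \<Longrightarrow> (\<integral>\<^sup>+\<gamma>. f (inv \<gamma>) \<partial>m\<Gamma>) = (\<integral>\<^sup>+\<gamma>. f \<gamma> \<partial>m\<Gamma>)"
  using S.nn_integral_inv[of f] by (simp add: space_m\<Gamma> inv_sub cong: nn_integral_cong_simp)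

lemma nn_integral_translate_sub:
  assumes "\<gamma> \<in> \<Gamma>" "f \<in> borel_measurable m\<Gamma>"
  shows "(\<integral>\<^sup>+y. f (\<gamma> \<otimes> y) \<partial>m\<Gamma>) = (\<integral>\<^sup>+y. f y \<partial>m\<Gamma>)"
  using S.nn_integral_translate[of \<gamma> f] assms by simp

lemma integral_translate_sub:
  fixes f :: "'a \<Rightarrow> complex"
  assumes "\<gamma> \<in> \<Gamma>" "f \<in> borel_measurable m\<Gamma>"
  shows "(LINT y|m\<Gamma>. f (\<gamma> \<otimes> y)) = (LINT y|m\<Gamma>. f y)"
  using S.integral_translate[of \<gamma> f] assms by simp

text \<open>The formula is given for integrable complex functions. Truncations in height and support
  are integrable and increase to \<open>f\<close>, and monotone convergence is applied to the outer
  and to the inner integral.\<close>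

lemma weil_nn_integral:
  assumes [measurable]: "f \<in> borel_measurable mG"
  shows "(\<integral>\<^sup>+x. f x \<partial>mG) = (\<integral>\<^sup>+x. (\<integral>\<^sup>+\<gamma>. f (x \<otimes> \<gamma>) \<partial>m\<Gamma>) \<partial>\<mu>)"
proof -
  obtain A :: "nat \<Rightarrow> 'a set" where A: "range A \<subseteq> sets mG" "(\<Union>i. A i) = space mG"
    "\<And>i. emeasure mG (A i) \<noteq> \<infinity>" "incseq A" using sigma_finite_incseq by blast
  have [measurable]: "A i \<in> sets mG" for i using A(1) by auto
  define r where "r k x = enn2real (min (f x) (of_nat k)) * indicator (A k) x" for k x
  have [measurable]: "r k \<in> borel_measurable mG" for k unfolding r_def by measurable
  have rpos: "0 \<le> r k x" for k x by (simp add: r_def)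
  have fin: "min (f x) (of_nat k) < \<infinity>" for k x
    using of_nat_less_top[of k] by (simp add: min_less_iff_disj)
  have er: "ennreal (r k x) = min (f x) (of_nat k) * indicator (A k) x" for k x
    using fin[of x k] by (cases "x \<in> A k") (simp_all add: r_def)
  have mono: "ennreal (r k x) \<le> ennreal (r l x)" if "k \<le> l" for k l x
  proof -
    have "A k \<subseteq> A l" using A(4) that by (rule incseqD)
    moreover have "min (f x) (of_nat k) \<le> min (f x) (of_nat l)"
      using of_nat_mono[OF that, where 'a=ennreal] by (intro min.mono order_refl)
    ultimately show ?thesis unfolding er by (cases "x \<in> A k") (auto simp: subset_iff)
  qed
  then have inc: "incseq (\<lambda>k x. ennreal (r k x))" by (auto simp: incseq_def le_fun_def)
  have sup: "(SUP k. ennreal (r k x)) = f x" if x: "x \<in> space mG" for x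
  proof (rule antisym)
    show "(SUP k. ennreal (r k x)) \<le> f x"
      unfolding er by (rule SUP_least) (auto simp: indicator_def)
    obtain i where i: "x \<in> A i" using A(2) x by blast
    have "f x = (SUP k. min (f x) (of_nat k))"
    proof -
      have "(SUP k. min (f x) (of_nat k :: ennreal)) = min (f x) (SUP k. of_nat k)"
        by (simp add: inf_min[symmetric] inf_SUP)
      also have "\<dots> = f x" by (simp add: ennreal_SUP_of_nat_eq_top)
      finally show ?thesis by simp
    qed
    also have "\<dots> \<le> (SUP k. ennreal (r k x))"
    proof (rule SUP_least)
      fix k
      have "x \<in> A (max i k)" using i incseqD[OF A(4), of i "max i k"] by auto
      then have "ennreal (r (max i k) x) = min (f x) (of_nat (max i k))" unfolding er by simp
      moreover have "min (f x) (of_nat k) \<le> min (f x) (of_nat (max i k))"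
        by (intro min.mono order_refl of_nat_mono) simp
      ultimately show "min (f x) (of_nat k) \<le> (SUP k. ennreal (r k x))"
        by (metis SUP_upper2 UNIV_I)
    qed
    finally show "f x \<le> (SUP k. ennreal (r k x))" .
  qed
  have int: "integrable mG (\<lambda>x. complex_of_real (r k x))" for k
  proof -
    have "integrable mG (\<lambda>x. real k * indicator (A k) x)"
      using A(3)[of k] by (intro integrable_mult_right integrable_real_indicator) (auto simp: less_top)
    then show ?thesis
    proof (rule Bochner_Integration.integrable_bound)
      have "r k x \<le> real k * indicator (A k) x" for x
      proof -
        have "ennreal (r k x) \<le> ennreal (real k * indicator (A k) x)"
          unfolding er by (auto simp: indicator_def ennreal_of_nat_eq_real_of_nat)
        then show ?thesis by (subst (asm) ennreal_le_iff) auto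
      qed
      then show "AE x in mG. norm (complex_of_real (r k x)) \<le> norm (real k * indicator (A k) x)"
        using rpos by (auto simp: order_trans[OF _ abs_ge_self])
    qed measurable
  qed
  \<comment> \<open>The inner integral of a truncation. Its integrability over \<open>\<mu>\<close>,
    and with it measurability, is part of \<open>weil_formula\<close>; the inner integrals of
    \<open>f\<close> are reached only through these functions.\<close>
  define q where "q k x = (LINT \<gamma>|m\<Gamma>. complex_of_real (r k (x \<otimes> \<gamma>)))" for k x
  have W: "AE x in \<mu>. integrable m\<Gamma> (\<lambda>\<gamma>. complex_of_real (r k (x \<otimes> \<gamma>)))" "integrable \<mu> (q k)"
    "(LINT x|mG. complex_of_real (r k x)) = (LINT x|\<mu>. q k x)" for k
    using weil[unfolded weil_formula_def, rule_format, OF int[of k]] by (simp_all add: q_def[abs_def])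
  have Req: "Re (q k x) = (LINT \<gamma>|m\<Gamma>. r k (x \<otimes> \<gamma>))" for k x by (simp add: q_def)
  have Wnn: "AE x in \<mu>. (\<integral>\<^sup>+\<gamma>. ennreal (r k (x \<otimes> \<gamma>)) \<partial>m\<Gamma>) = ennreal (Re (q k x))" for k
    using W(1)[of k]
  proof eventually_elim
    fix x assume "integrable m\<Gamma> (\<lambda>\<gamma>. complex_of_real (r k (x \<otimes> \<gamma>)))"
    then have "integrable m\<Gamma> (\<lambda>\<gamma>. r k (x \<otimes> \<gamma>))" by (simp add: complex_of_real_integrable_eq)
    then show "(\<integral>\<^sup>+\<gamma>. ennreal (r k (x \<otimes> \<gamma>)) \<partial>m\<Gamma>) = ennreal (Re (q k x))"
      unfolding Req by (rule nn_integral_eq_integral) (simp add: rpos)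
  qed
  have Re_nonneg: "0 \<le> Re (q k x)" for k x unfolding Req by (intro Bochner_Integration.integral_nonneg rpos)
  have eq: "(\<integral>\<^sup>+x. ennreal (r k x) \<partial>mG) = (\<integral>\<^sup>+x. ennreal (Re (q k x)) \<partial>\<mu>)" for k
  proof -
    have i: "integrable mG (r k)" using int[of k] by (simp add: complex_of_real_integrable_eq)
    have "(\<integral>\<^sup>+x. ennreal (r k x) \<partial>mG) = ennreal (LINT x|mG. r k x)"
      by (rule nn_integral_eq_integral[OF i]) (simp add: rpos)
    also have "(LINT x|mG. r k x) = Re (LINT x|mG. complex_of_real (r k x))" by simp
    also have "\<dots> = (LINT x|\<mu>. Re (q k x))" unfolding W(3) by (rule integral_Re[OF W(2), symmetric])
    also have "ennreal \<dots> = (\<integral>\<^sup>+x. ennreal (Re (q k x)) \<partial>\<mu>)"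
      by (rule nn_integral_eq_integral[symmetric]) (use W(2) Re_nonneg in auto)
    finally show ?thesis .
  qed
  have [measurable]: "q k \<in> borel_measurable \<mu>" for k using W(2) by auto
  have AEall: "AE x in \<mu>. \<forall>k. (\<integral>\<^sup>+\<gamma>. ennreal (r k (x \<otimes> \<gamma>)) \<partial>m\<Gamma>) = ennreal (Re (q k x))"
    using Wnn by (simp add: AE_all_countable)
  have "(\<integral>\<^sup>+x. f x \<partial>mG) = (\<integral>\<^sup>+x. (SUP k. ennreal (r k x)) \<partial>mG)"
    by (intro nn_integral_cong) (simp add: sup)
  also have "\<dots> = (SUP k. \<integral>\<^sup>+x. ennreal (r k x) \<partial>mG)"
    by (rule nn_integral_monotone_convergence_SUP[OF inc]) measurable
  also have "\<dots> = (SUP k. \<integral>\<^sup>+x. ennreal (Re (q k x)) \<partial>\<mu>)" by (simp add: eq)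
  also have "\<dots> = (\<integral>\<^sup>+x. (SUP k. ennreal (Re (q k x))) \<partial>\<mu>)"
  proof (rule nn_integral_monotone_convergence_SUP_AE[symmetric])
    show "AE x in \<mu>. ennreal (Re (q k x)) \<le> ennreal (Re (q (Suc k) x))" for k
      using AEall
    proof eventually_elim
      fix x assume x: "\<forall>k. (\<integral>\<^sup>+\<gamma>. ennreal (r k (x \<otimes> \<gamma>)) \<partial>m\<Gamma>) = ennreal (Re (q k x))"
      have "(\<integral>\<^sup>+\<gamma>. ennreal (r k (x \<otimes> \<gamma>)) \<partial>m\<Gamma>) \<le> (\<integral>\<^sup>+\<gamma>. ennreal (r (Suc k) (x \<otimes> \<gamma>)) \<partial>m\<Gamma>)"
        by (intro nn_integral_mono mono) simp
      then show "ennreal (Re (q k x)) \<le> ennreal (Re (q (Suc k) x))" using x by simp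
    qed
  qed measurable
  also have "\<dots> = (\<integral>\<^sup>+x. (\<integral>\<^sup>+\<gamma>. f (x \<otimes> \<gamma>) \<partial>m\<Gamma>) \<partial>\<mu>)"
  proof (rule nn_integral_cong_AE, use AEall AE_space in eventually_elim)
    fix x assume x: "\<forall>k. (\<integral>\<^sup>+\<gamma>. ennreal (r k (x \<otimes> \<gamma>)) \<partial>m\<Gamma>) = ennreal (Re (q k x))" "x \<in> space \<mu>"
    then have xG: "x \<in> carrier G" using space_\<mu> by blast
    have "(SUP k. ennreal (Re (q k x))) = (SUP k. \<integral>\<^sup>+\<gamma>. ennreal (r k (x \<otimes> \<gamma>)) \<partial>m\<Gamma>)" using x by simp
    also have "\<dots> = (\<integral>\<^sup>+\<gamma>. (SUP k. ennreal (r k (x \<otimes> \<gamma>))) \<partial>m\<Gamma>)"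
    proof (rule nn_integral_monotone_convergence_SUP[symmetric])
      show "incseq (\<lambda>k \<gamma>. ennreal (r k (x \<otimes> \<gamma>)))" using mono by (auto simp: incseq_def le_fun_def)
    qed (use xG in measurable)
    also have "\<dots> = (\<integral>\<^sup>+\<gamma>. f (x \<otimes> \<gamma>) \<partial>m\<Gamma>)"
      by (intro nn_integral_cong sup) (simp add: space_m space_m\<Gamma> xG sub_carrier)
    finally show "(SUP k. ennreal (Re (q k x))) = (\<integral>\<^sup>+\<gamma>. f (x \<otimes> \<gamma>) \<partial>m\<Gamma>)" .
  qed
  finally show ?thesis .
qed

text \<open>
  Integrals over the section of functions that live on the quotient become weighted integrals over the
  whole group. This avoids any measurability question about the embedding of the section.
\<close>

lemma weil_weight:
  obtains w :: "'a \<Rightarrow> ennreal" where "w \<in> borel_measurable mG"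
    "\<And>R. R \<in> borel_measurable mG \<Longrightarrow> (\<And>x \<gamma>. x \<in> carrier G \<Longrightarrow> \<gamma> \<in> \<Gamma> \<Longrightarrow> R (x \<otimes> \<gamma>) = R x) \<Longrightarrow>
      (\<integral>\<^sup>+x. R x \<partial>\<mu>) = (\<integral>\<^sup>+x. R x * w x \<partial>mG)"
proof -
  \<comment> \<open>A strictly positive integrable function: positivity keeps its fibre integral
    \<open>Q\<close> from vanishing, integrability keeps it finite at \<open>\<mu>\<close>-almost
    every point.\<close>
  obtain v :: "'a \<Rightarrow> ennreal" where [measurable]: "v \<in> borel_measurable mG" and v: "integral\<^sup>N mG v \<noteq> \<infinity>"
    "\<And>x. x \<in> space mG \<Longrightarrow> 0 < v x \<and> v x < \<infinity>"
    using Ex_finite_integrable_function by blast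
  define Q where "Q x = (\<integral>\<^sup>+\<gamma>. v (x \<otimes> \<gamma>) \<partial>m\<Gamma>)" for x
  have [measurable]: "Q \<in> borel_measurable mG" unfolding Q_def by measurable
  have Qinv: "Q (x \<otimes> \<gamma>) = Q x" if "x \<in> carrier G" "\<gamma> \<in> \<Gamma>" for x \<gamma>
  proof -
    have "(\<integral>\<^sup>+y. v (x \<otimes> (\<gamma> \<otimes> y)) \<partial>m\<Gamma>) = (\<integral>\<^sup>+y. v (x \<otimes> y) \<partial>m\<Gamma>)"
      by (rule nn_integral_translate_sub[OF that(2), of "\<lambda>y. v (x \<otimes> y)"]) (use that in measurable)
    moreover have "x \<otimes> \<gamma> \<otimes> y = x \<otimes> (\<gamma> \<otimes> y)" if "y \<in> \<Gamma>" for y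
      using that \<open>x \<in> carrier G\<close> \<open>\<gamma> \<in> \<Gamma>\<close> sub_carrier by (intro m_assoc) auto
    ultimately show ?thesis unfolding Q_def by (simp add: space_m\<Gamma> cong: nn_integral_cong_simp)
  qed
  have Qpos: "Q x \<noteq> 0" if x: "x \<in> carrier G" for x
  proof
    assume "Q x = 0"
    then have "AE \<gamma> in m\<Gamma>. v (x \<otimes> \<gamma>) = 0"
      unfolding Q_def by (subst (asm) nn_integral_0_iff_AE) (use x in measurable)
    then have "AE \<gamma> in m\<Gamma>. False" using AE_space
    proof eventually_elim
      fix \<gamma> assume "v (x \<otimes> \<gamma>) = 0" "\<gamma> \<in> space m\<Gamma>"
      then show False using v(2)[of "x \<otimes> \<gamma>"] x sub_carrier by (simp add: space_m space_m\<Gamma>)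
    qed
    then show False using S.nonzero by (simp add: AE_iff_measurable[OF sets.top])
  qed
  have Qfin: "AE x in \<mu>. Q x < \<infinity>"
  proof -
    have i: "integrable mG (\<lambda>x. complex_of_real (enn2real (v x)))"
    proof -
      have "(\<integral>\<^sup>+x. ennreal (norm (enn2real (v x))) \<partial>mG) = (\<integral>\<^sup>+x. v x \<partial>mG)"
        using v(2) by (intro nn_integral_cong) auto
      then have "integrable mG (\<lambda>x. enn2real (v x))" using v(1) by (intro integrableI_bounded) (auto simp: less_top)
      then show ?thesis by (simp add: complex_of_real_integrable_eq)
    qed
    have "AE x in \<mu>. integrable m\<Gamma> (\<lambda>\<gamma>. complex_of_real (enn2real (v (x \<otimes> \<gamma>))))"
      using weil[unfolded weil_formula_def, rule_format, OF i] by simp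
    then show ?thesis using AE_space
    proof eventually_elim
      fix x assume x: "integrable m\<Gamma> (\<lambda>\<gamma>. complex_of_real (enn2real (v (x \<otimes> \<gamma>))))" "x \<in> space \<mu>"
      then have "Q x = (\<integral>\<^sup>+\<gamma>. ennreal (norm (enn2real (v (x \<otimes> \<gamma>)))) \<partial>m\<Gamma>)"
        unfolding Q_def using v(2) space_\<mu> sub_carrier
        by (intro nn_integral_cong) (auto simp: space_m space_m\<Gamma> subset_iff)
      then show "Q x < \<infinity>" using x(1) by (simp add: complex_of_real_integrable_eq integrable_iff_bounded)
    qed
  qed
  \<comment> \<open>Since \<open>Q\<close> is \<Gamma>-invariant, this normalises the integral along
    almost every fibre to 1, as for a Bruhat function.\<close>
  define w where "w x = v x / Q x" for x
  have [measurable]: "w \<in> borel_measurable mG" unfolding w_def by measurable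
  have Qw: "AE x in \<mu>. (\<integral>\<^sup>+\<gamma>. w (x \<otimes> \<gamma>) \<partial>m\<Gamma>) = 1"
    using Qfin AE_space
  proof eventually_elim
    fix x assume x: "Q x < \<infinity>" "x \<in> space \<mu>"
    then have xG: "x \<in> carrier G" using space_\<mu> by blast
    have "(\<integral>\<^sup>+\<gamma>. w (x \<otimes> \<gamma>) \<partial>m\<Gamma>) = (\<integral>\<^sup>+\<gamma>. v (x \<otimes> \<gamma>) / Q x \<partial>m\<Gamma>)"
      unfolding w_def by (intro nn_integral_cong) (simp add: Qinv xG space_m\<Gamma>)
    also have "\<dots> = Q x / Q x"
      unfolding divide_ennreal_def Q_def by (rule nn_integral_multc) (use xG in measurable)
    finally show "(\<integral>\<^sup>+\<gamma>. w (x \<otimes> \<gamma>) \<partial>m\<Gamma>) = 1"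
      using x Qpos[OF xG] by (simp add: ennreal_divide_self)
  qed
  show ?thesis
  proof (rule that[of w])
    fix R :: "'a \<Rightarrow> ennreal"
    assume [measurable]: "R \<in> borel_measurable mG"
      and R: "\<And>x \<gamma>. x \<in> carrier G \<Longrightarrow> \<gamma> \<in> \<Gamma> \<Longrightarrow> R (x \<otimes> \<gamma>) = R x"
    have "(\<integral>\<^sup>+x. R x * w x \<partial>mG) = (\<integral>\<^sup>+x. (\<integral>\<^sup>+\<gamma>. R (x \<otimes> \<gamma>) * w (x \<otimes> \<gamma>) \<partial>m\<Gamma>) \<partial>\<mu>)"
      by (rule weil_nn_integral) measurable
    also have "\<dots> = (\<integral>\<^sup>+x. R x \<partial>\<mu>)"
    proof (rule nn_integral_cong_AE, use Qw AE_space in eventually_elim)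
      fix x assume x: "(\<integral>\<^sup>+\<gamma>. w (x \<otimes> \<gamma>) \<partial>m\<Gamma>) = 1" "x \<in> space \<mu>"
      then have xG: "x \<in> carrier G" using space_\<mu> by blast
      have "(\<integral>\<^sup>+\<gamma>. R (x \<otimes> \<gamma>) * w (x \<otimes> \<gamma>) \<partial>m\<Gamma>) = (\<integral>\<^sup>+\<gamma>. R x * w (x \<otimes> \<gamma>) \<partial>m\<Gamma>)"
        by (intro nn_integral_cong) (simp add: R xG space_m\<Gamma>)
      also have "\<dots> = R x * 1" unfolding x(1)[symmetric] by (rule nn_integral_cmult) (use xG in measurable)
      finally show "(\<integral>\<^sup>+\<gamma>. R (x \<otimes> \<gamma>) * w (x \<otimes> \<gamma>) \<partial>m\<Gamma>) = R x" by simp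
    qed
    finally show "(\<integral>\<^sup>+x. R x \<partial>\<mu>) = (\<integral>\<^sup>+x. R x * w x \<partial>mG)" by simp
  qed measurable
qed

end


section \<open>Sections of quotient groups\<close>

text \<open>Shared by C in G and \<Omega> in the dual group. Continuity of the group operations is
  not part of the locale, so that it can be instantiated with the dual knowing only its group laws
  and the points of its topology.\<close>

locale group_section = group H for H :: "'a monoid" (structure) +
  fixes T :: "'a topology" and N C :: "'a set" and m :: "'a set measure"
  assumes top: "topspace T = carrier H" and N: "subgroup N H"
    and sect: "measurable_section H T N C"
    and haar: "haar_measure (H Mod N) (coset_topology H T N) m"
begin

definition Q where "Q = coset_topology H T N"
definition q where "q x = N #> x"
definition S where "S = section_topology H T N C"
definition \<sigma> where "\<sigma> = section_measure H T N C m"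

lemma quotient_map_q: "quotient_map T Q q"
  unfolding Q_def coset_topology_def q_def by (rule quotient_map_quotient_topology)

lemma q_continuous: "continuous_map T Q q"
  by (rule quotient_imp_continuous_map[OF quotient_map_q])

lemma topspace_Q: "topspace Q = q ` carrier H"
  using quotient_imp_surjective_map[OF quotient_map_q] top by simp

lemma topspace_Q_rcosets: "topspace Q = rcosets N"
  by (auto simp: topspace_Q q_def RCOSETS_def)

lemma C_carrier: "C \<subseteq> carrier H"
  using sect sets.sets_into_space[of C "borel_of T"] by (simp add: measurable_section_def top)

lemma q_eq_iff: "x \<in> carrier H \<Longrightarrow> y \<in> carrier H \<Longrightarrow> q x = q y \<longleftrightarrow> x \<otimes> inv y \<in> N"
  unfolding q_def using subgroup.rcos_module[OF N group_axioms, of y x] rcos_self[OF _ N, of x]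
    repr_independence[OF _ _ N, of x y] by auto

lemma cross_section:
  assumes "c \<in> topspace Q" shows "cross_section C c \<in> c" "cross_section C c \<in> C" "q (cross_section C c) = c"
proof -
  have "\<exists>!x. x \<in> c \<inter> C" using sect assms by (simp add: measurable_section_def topspace_Q_rcosets)
  from theI'[OF this] show *: "cross_section C c \<in> c" "cross_section C c \<in> C"
    by (auto simp: cross_section_def)
  obtain x where x: "x \<in> carrier H" "c = q x" using assms topspace_Q by auto
  show "q (cross_section C c) = c"
    using repr_independence[OF _ x(1) N] *(1) unfolding x(2) q_def by auto
qed

lemma cross_section_q: assumes x: "x \<in> C" shows "cross_section C (q x) = x"
proof -
  have xH: "x \<in> carrier H" using x C_carrier by auto
  then have "q x \<in> topspace Q" by (auto simp: topspace_Q)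
  then have "\<exists>!y. y \<in> q x \<inter> C" using sect by (simp add: measurable_section_def topspace_Q_rcosets)
  moreover have "x \<in> q x" unfolding q_def by (rule rcos_self[OF xH N])
  ultimately show ?thesis unfolding cross_section_def by (intro the1_equality) (use x in auto)
qed

lemma openin_S: "openin S V \<longleftrightarrow> (\<exists>U. openin Q U \<and> V = {x \<in> C. q x \<in> U})"
  unfolding S_def section_topology_def openin_pullback_topology Q_def q_def by (auto simp: vimage_def Int_def conj_commute)

lemma topspace_S: "topspace S = C"
proof -
  have "C \<subseteq> q -` topspace Q" using C_carrier by (auto simp: topspace_Q)
  then show ?thesis
    unfolding S_def section_topology_def topspace_pullback_topology Q_def q_def by auto
qed

lemma cross_section_continuous: "continuous_map Q S (cross_section C)"
  unfolding continuous_map_def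
proof (intro conjI allI impI)
  show "cross_section C \<in> topspace Q \<rightarrow> topspace S" using cross_section(2) topspace_S by auto
  fix V assume "openin S V"
  then obtain U where U: "openin Q U" "V = {x \<in> C. q x \<in> U}" using openin_S by auto
  have "{c \<in> topspace Q. cross_section C c \<in> V} = U"
    using cross_section U openin_subset[OF U(1)] by auto
  then show "openin Q {c \<in> topspace Q. cross_section C c \<in> V}" using U by simp
qed

lemma q_continuous_S: "continuous_map S Q q"
  unfolding continuous_map_def
proof (intro conjI allI impI)
  show "q \<in> topspace S \<rightarrow> topspace Q" using C_carrier by (auto simp: topspace_S topspace_Q)
qed (auto simp: openin_S topspace_S)

text \<open>Holds by the very choice of the transported topology, and carries local compactness, the
  Hausdorff property and countability over to the section.\<close>

lemma homeomorphic: "Q homeomorphic_space S"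
  unfolding homeomorphic_space_def homeomorphic_maps_def
  by (intro exI[of _ "cross_section C"] exI[of _ q])
    (simp add: cross_section_continuous q_continuous_S cross_section(3) cross_section_q topspace_S)

lemma sets_m: "sets m = sets (borel_of Q)"
  using haar by (simp add: haar_measure_def Q_def)

lemma space_m: "space m = topspace Q"
  using sets_eq_imp_space_eq[OF sets_m] by simp

lemma sets_\<sigma>: "sets \<sigma> = sets (borel_of S)"
  by (simp add: \<sigma>_def section_measure_def S_def)

lemma space_\<sigma>: "space \<sigma> = C"
  using sets_eq_imp_space_eq[OF sets_\<sigma>] by (simp add: topspace_S)

lemma measurable_cross_section: "cross_section C \<in> measurable m (borel_of S)"
  using continuous_map_measurable[OF cross_section_continuous] measurable_cong_sets[OF sets_m refl] by blast

lemma emeasure_\<sigma>: "E \<in> sets \<sigma> \<Longrightarrow> emeasure \<sigma> E = emeasure m {c \<in> topspace Q. cross_section C c \<in> E}"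
  unfolding \<sigma>_def section_measure_def S_def[symmetric]
  by (subst emeasure_distr[OF measurable_cross_section]) (auto simp: space_m intro!: arg_cong[of _ _ "emeasure m"])

lemma sets_\<sigma>_q: assumes "E \<in> sets m" shows "{x \<in> C. q x \<in> E} \<in> sets \<sigma>"
proof -
  have "q \<in> measurable \<sigma> m"
    using continuous_map_measurable[OF q_continuous_S] measurable_cong_sets[OF sets_\<sigma> sets_m] by blast
  from measurable_sets[OF this assms] show ?thesis by (simp add: space_\<sigma> vimage_def Int_def conj_commute)
qed

lemma emeasure_\<sigma>_q: assumes "E \<in> sets m" shows "emeasure \<sigma> {x \<in> C. q x \<in> E} = emeasure m E"
proof -
  have "{c \<in> topspace Q. cross_section C c \<in> {x \<in> C. q x \<in> E}} = E"
    using cross_section sets.sets_into_space[OF assms] by (auto simp: space_m)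
  then show ?thesis by (simp add: emeasure_\<sigma> sets_\<sigma>_q[OF assms])
qed

lemma sets_m_cross_section: "E \<in> sets \<sigma> \<Longrightarrow> {c \<in> topspace Q. cross_section C c \<in> E} \<in> sets m"
  using measurable_sets[OF measurable_cross_section, of E]
  by (simp add: space_m vimage_def Int_def conj_commute sets_\<sigma>)

text \<open>For finiteness on compact sets: a compact subset of the section is the trace of its
  compact image in the quotient.\<close>

lemma lch_measure_S:
  assumes "lch_space Q" shows "lch_measure S \<sigma>"
proof -
  interpret Q: lch_space Q by fact
  interpret S: lch_space S
    using homeomorphic_locally_compact_space[OF homeomorphic] homeomorphic_Hausdorff_space[OF homeomorphic]
      homeomorphic_space_second_countability[OF homeomorphic] Q.loc_comp Q.haus Q.sec_count
    by unfold_locales simp_all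
  show ?thesis
  proof
    fix K assume K: "compactin S K"
    then have sub: "K \<subseteq> C" using compactin_subset_topspace topspace_S by auto
    have "compactin Q (q ` K)" by (rule image_compactin[OF K q_continuous_S])
    then have "emeasure m (q ` K) < \<infinity>" "q ` K \<in> sets m"
      using haar by (auto simp: haar_measure_def Q_def[symmetric] intro!: borel_of_closed compactin_imp_closedin Q.haus)
    moreover have "{x \<in> C. q x \<in> q ` K} = K"
    proof (intro subset_antisym subsetI)
      fix x assume "x \<in> {x \<in> C. q x \<in> q ` K}"
      then obtain k where "x \<in> C" "k \<in> K" "q x = q k" by auto
      then show "x \<in> K" using cross_section_q[of x] cross_section_q[of k] sub by auto
    qed (use sub in auto)
    ultimately show "emeasure \<sigma> K < \<infinity>" using emeasure_\<sigma>_q[of "q ` K"] by simp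
  qed (simp add: sets_\<sigma>)
qed

end

text \<open>The saturation of an open set is a union of translates. Openness is what lets local
  compactness and a countable base descend to the quotient.\<close>

lemma (in second_countable_lca_group) open_map_coset:
  assumes N: "subgroup N G" shows "open_map X (coset_topology G X N) (\<lambda>x. N #> x)"
  unfolding open_map_def
proof (intro allI impI)
  fix U assume U: "openin X U"
  have UG: "U \<subseteq> carrier G" using openin_subset[OF U] topspace_eq by simp
  have NG: "N \<subseteq> carrier G" by (rule subgroup.subset[OF N])
  have "{x \<in> topspace X. N #> x \<in> (\<lambda>x. N #> x) ` U} = (\<Union>h\<in>N. h <# U)"
  proof (intro subset_antisym subsetI)
    fix x assume "x \<in> {x \<in> topspace X. N #> x \<in> (\<lambda>x. N #> x) ` U}"
    then obtain u where u: "x \<in> carrier G" "u \<in> U" "N #> x = N #> u" by (auto simp: topspace_eq)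
    then have "x \<in> N #> u" using rcos_self[OF u(1) N] by simp
    then obtain h where "h \<in> N" "x = h \<otimes> u" unfolding r_coset_def by blast
    then show "x \<in> (\<Union>h\<in>N. h <# U)" using u unfolding l_coset_def by blast
  next
    fix x assume "x \<in> (\<Union>h\<in>N. h <# U)"
    then obtain h u where hu: "h \<in> N" "u \<in> U" "x = h \<otimes> u" unfolding l_coset_def by blast
    then have "x \<in> N #> u" unfolding r_coset_def by blast
    then have "N #> u = N #> x" using repr_independence[OF _ _ N, of x u] UG hu by auto
    then show "x \<in> {x \<in> topspace X. N #> x \<in> (\<lambda>x. N #> x) ` U}"
      using hu UG NG by (auto simp: topspace_eq subset_iff intro!: image_eqI[of _ _ u])
  qed
  also have "openin X (\<Union>h\<in>N. h <# U)"
    using NG by (intro openin_Union) (auto intro!: openin_translate U)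
  finally show "openin (coset_topology G X N) ((\<lambda>x. N #> x) ` U)"
    unfolding coset_topology_def openin_quotient_topology using UG by (auto simp: topspace_eq)
qed

text \<open>Closedness of \<open>N\<close> gives the Hausdorff property: x inv y avoids
  \<open>N\<close> on a whole product neighbourhood of a pair from different cosets, and the open
  images of its two factors are then disjoint.\<close>

lemma (in second_countable_lca_group) lch_coset_topology:
  assumes N: "subgroup N G" and cl: "closedin X N"
  shows "lch_space (coset_topology G X N)"
proof
  let ?q = "\<lambda>x. N #> x" and ?Q = "coset_topology G X N"
  have quot: "quotient_map X ?Q ?q" unfolding coset_topology_def by (rule quotient_map_quotient_topology)
  note cont = quotient_imp_continuous_map[OF quot] and surj = quotient_imp_surjective_map[OF quot]
    and opn = open_map_coset[OF N]
  show "locally_compact_space ?Q"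
    by (rule locally_compact_space_continuous_open_map_image[OF cont opn surj locally_compact])
  show "second_countable ?Q"
    by (rule second_countable_open_map_image[OF cont opn surj second_countable])
  show "Hausdorff_space ?Q"
    unfolding Hausdorff_space_def
  proof (intro allI impI)
    fix a b assume ab: "a \<in> topspace ?Q \<and> b \<in> topspace ?Q \<and> a \<noteq> b"
    then obtain x y where x: "x \<in> carrier G" "a = ?q x" and y: "y \<in> carrier G" "b = ?q y"
      using surj topspace_eq by (metis imageE)
    have "continuous_map (prod_topology X X) X (\<lambda>(x, y). x \<otimes> inv y)"
    proof -
      have "continuous_map (prod_topology X X) (prod_topology X X) (\<lambda>p. (fst p, inv (snd p)))"
        by (intro continuous_map_pairedI continuous_map_fst
            continuous_map_compose[OF continuous_map_snd continuous_inv, unfolded o_def])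
      from continuous_map_compose[OF this continuous_mult] show ?thesis by (simp add: o_def split_beta')
    qed
    define P where "P = {p \<in> topspace (prod_topology X X). (case p of (x, y) \<Rightarrow> x \<otimes> inv y) \<in> topspace X - N}"
    have "openin (prod_topology X X) P"
      unfolding P_def using \<open>continuous_map (prod_topology X X) X (\<lambda>(x, y). x \<otimes> inv y)\<close>
      by (rule openin_continuous_map_preimage) (use cl in \<open>auto simp: closedin_def\<close>)
    moreover have "x \<otimes> inv y \<notin> N"
    proof
      assume "x \<otimes> inv y \<in> N"
      then have "x \<in> N #> y" using subgroup.rcos_module[OF N is_group y(1) x(1)] by simp
      then have "N #> y = N #> x" by (rule repr_independence[OF _ y(1) N])
      then show False using ab x y by simp
    qed
    then have "(x, y) \<in> P" using x y by (simp add: P_def topspace_eq)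
    ultimately obtain U V where UV: "openin X U" "openin X V" "x \<in> U" "y \<in> V" "U \<times> V \<subseteq> P"
      unfolding openin_prod_topology_alt by meson
    have "disjnt (?q ` U) (?q ` V)"
      unfolding disjnt_iff
    proof (intro allI notI)
      fix c assume "c \<in> ?q ` U \<and> c \<in> ?q ` V"
      then obtain u v where uv: "u \<in> U" "v \<in> V" "N #> u = N #> v" by auto
      then have G: "u \<in> carrier G" "v \<in> carrier G" "u \<otimes> inv v \<notin> N"
        using UV by (auto simp: topspace_eq P_def)
      have "u \<in> N #> v" using uv(3) rcos_self[OF G(1) N] by simp
      then show False using subgroup.rcos_module[OF N is_group G(2,1)] G(3) by simp
    qed
    then show "\<exists>U V. openin ?Q U \<and> openin ?Q V \<and> a \<in> U \<and> b \<in> V \<and> disjnt U V"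
      using UV opn x y unfolding open_map_def by (intro exI[of _ "?q ` U"] exI[of _ "?q ` V"]) auto
  qed
qed


section \<open>Dual groups\<close>

locale group_on_space = group G for G :: "'a monoid" (structure) +
  fixes X :: "'a topology"
  assumes top: "topspace X = carrier G"

lemma continuous_map_complex_mult:
  fixes f g :: "'a \<Rightarrow> complex"
  assumes "continuous_map X euclidean f" "continuous_map X euclidean g"
  shows "continuous_map X euclidean (\<lambda>x. f x * g x)"
  using assms by (simp add: continuous_map_atin limitin_canonical_iff tendsto_mult)

lemma characterD:
  assumes "\<xi> \<in> characters G X"
  shows "continuous_map X euclidean \<xi>" "\<And>x. x \<in> carrier G \<Longrightarrow> cmod (\<xi> x) = 1"
    "\<And>x y. x \<in> carrier G \<Longrightarrow> y \<in> carrier G \<Longrightarrow> \<xi> (x \<otimes>\<^bsub>G\<^esub> y) = \<xi> x * \<xi> y" "\<xi> \<in> extensional (carrier G)"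
  using assms by (auto simp: characters_def)

lemma (in group_on_space) character_one: assumes "\<xi> \<in> characters G X" shows "\<xi> \<one> = 1"
proof -
  have "\<xi> \<one> * \<xi> \<one> = \<xi> \<one> * 1" using characterD(3)[OF assms, of \<one> \<one>] by simp
  moreover have "\<xi> \<one> \<noteq> 0" using characterD(2)[OF assms, of \<one>] by auto
  ultimately show ?thesis by simp
qed

lemma (in group_on_space) character_inv:
  assumes "\<xi> \<in> characters G X" "x \<in> carrier G" shows "\<xi> (inv x) = cnj (\<xi> x)"
proof -
  have "\<xi> x * \<xi> (inv x) = 1"
    using characterD(3)[OF assms(1), of x "inv x"] character_one[OF assms(1)] assms by simp
  moreover have "\<xi> x * cnj (\<xi> x) = 1"
    using characterD(2)[OF assms] by (simp add: complex_norm_square[symmetric])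
  ultimately show ?thesis by (metis mult_cancel_left mult_zero_left zero_neq_one)
qed

lemma character_eqI:
  "\<xi> \<in> characters G X \<Longrightarrow> \<psi> \<in> characters G X \<Longrightarrow> (\<And>x. x \<in> carrier G \<Longrightarrow> \<xi> x = \<psi> x) \<Longrightarrow> \<xi> = \<psi>"
  by (rule extensionalityI[of _ "carrier G"]) (auto dest: characterD(4))

lemma (in group_on_space) dual_group_is_group: "group (dual_group G X)"
proof (rule groupI)
  fix \<xi> \<psi> assume "\<xi> \<in> carrier (dual_group G X)" "\<psi> \<in> carrier (dual_group G X)"
  then have x: "\<xi> \<in> characters G X" and p: "\<psi> \<in> characters G X" by (auto simp: dual_group_def)
  have "continuous_map X euclidean (\<lambda>x\<in>carrier G. \<xi> x * \<psi> x)"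
    by (rule continuous_map_eq[OF continuous_map_complex_mult[OF characterD(1)[OF x] characterD(1)[OF p]]])
      (simp add: top)
  then show "\<xi> \<otimes>\<^bsub>dual_group G X\<^esub> \<psi> \<in> carrier (dual_group G X)"
    using characterD(2,3)[OF x] characterD(2,3)[OF p]
    by (simp add: dual_group_def characters_def norm_mult)
next
  have "continuous_map X euclidean (\<lambda>x\<in>carrier G. 1 :: complex)"
    by (rule continuous_map_eq[of _ _ "\<lambda>_. 1"]) (simp_all add: top)
  then show "\<one>\<^bsub>dual_group G X\<^esub> \<in> carrier (dual_group G X)"
    by (simp add: dual_group_def characters_def)
next
  fix \<xi> \<psi> \<eta>
  show "\<xi> \<otimes>\<^bsub>dual_group G X\<^esub> \<psi> \<otimes>\<^bsub>dual_group G X\<^esub> \<eta> = \<xi> \<otimes>\<^bsub>dual_group G X\<^esub> (\<psi> \<otimes>\<^bsub>dual_group G X\<^esub> \<eta>)"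
    by (auto simp: dual_group_def restrict_def fun_eq_iff)
next
  fix \<xi> assume "\<xi> \<in> carrier (dual_group G X)"
  then have x: "\<xi> \<in> characters G X" by (auto simp: dual_group_def)
  show "\<one>\<^bsub>dual_group G X\<^esub> \<otimes>\<^bsub>dual_group G X\<^esub> \<xi> = \<xi>"
    using characterD(4)[OF x] by (auto simp: dual_group_def restrict_def fun_eq_iff extensional_def)
  let ?c = "\<lambda>x\<in>carrier G. cnj (\<xi> x)"
  have "continuous_map X euclidean (\<lambda>x. cnj (\<xi> x))"
    using characterD(1)[OF x] by (simp add: continuous_map_atin limitin_canonical_iff tendsto_cnj)
  then have "continuous_map X euclidean ?c" by (rule continuous_map_eq) (simp add: top)
  then have c: "?c \<in> characters G X"
    using characterD(2,3)[OF x] by (simp add: characters_def)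
  show "\<exists>\<psi>\<in>carrier (dual_group G X). \<psi> \<otimes>\<^bsub>dual_group G X\<^esub> \<xi> = \<one>\<^bsub>dual_group G X\<^esub>"
  proof (rule bexI[of _ ?c])
    show "?c \<in> carrier (dual_group G X)" using c by (simp add: dual_group_def)
    have "cnj (\<xi> y) * \<xi> y = 1" if "y \<in> carrier G" for y
      using characterD(2)[OF x that] by (simp add: mult.commute complex_norm_square[symmetric])
    then show "?c \<otimes>\<^bsub>dual_group G X\<^esub> \<xi> = \<one>\<^bsub>dual_group G X\<^esub>"
      by (auto simp: dual_group_def restrict_def fun_eq_iff)
  qed
qed

lemma (in group_on_space) dual_group_inv:
  assumes x: "\<xi> \<in> characters G X" "y \<in> carrier G"
  shows "(inv\<^bsub>dual_group G X\<^esub> \<xi>) y = cnj (\<xi> y)" "inv\<^bsub>dual_group G X\<^esub> \<xi> \<in> characters G X"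
proof -
  interpret D: group "dual_group G X" by (rule dual_group_is_group)
  have xD: "\<xi> \<in> carrier (dual_group G X)" using x by (simp add: dual_group_def)
  then show "inv\<^bsub>dual_group G X\<^esub> \<xi> \<in> characters G X" using D.inv_closed by (simp add: dual_group_def)
  have "(\<xi> \<otimes>\<^bsub>dual_group G X\<^esub> inv\<^bsub>dual_group G X\<^esub> \<xi>) y = \<one>\<^bsub>dual_group G X\<^esub> y"
    using D.r_inv[OF xD] by simp
  then have "\<xi> y * (inv\<^bsub>dual_group G X\<^esub> \<xi>) y = 1" using x(2) by (simp add: dual_group_def)
  moreover have "\<xi> y * cnj (\<xi> y) = 1"
    using characterD(2)[OF x] by (simp add: complex_norm_square[symmetric])
  ultimately show "(inv\<^bsub>dual_group G X\<^esub> \<xi>) y = cnj (\<xi> y)"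
    by (metis mult_cancel_left mult_zero_left zero_neq_one)
qed

lemma (in group_on_space) subgroup_annihilator:
  assumes H: "H \<subseteq> carrier G"
  shows "subgroup (annihilator G X H) (dual_group G X)"
proof -
  interpret D: group "dual_group G X" by (rule dual_group_is_group)
  show ?thesis
  proof (rule D.subgroupI)
    show "annihilator G X H \<subseteq> carrier (dual_group G X)" by (auto simp: annihilator_def dual_group_def)
    have "\<one>\<^bsub>dual_group G X\<^esub> \<in> annihilator G X H"
      using D.one_closed H by (auto simp: annihilator_def dual_group_def)
    then show "annihilator G X H \<noteq> {}" by blast
    fix a assume a: "a \<in> annihilator G X H"
    then show "inv\<^bsub>dual_group G X\<^esub> a \<in> annihilator G X H"
      using dual_group_inv[of a] H by (auto simp: annihilator_def)
    fix b assume b: "b \<in> annihilator G X H"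
    then show "a \<otimes>\<^bsub>dual_group G X\<^esub> b \<in> annihilator G X H"
      using a D.m_closed[of a b] H by (auto simp: annihilator_def dual_group_def)
  qed
qed

lemma topspace_dual_topology: "topspace (dual_topology G X) = characters G X"
proof -
  have "characters G X = {\<xi> \<in> characters G X. \<xi> ` {} \<subseteq> {}}" by auto
  moreover have "compactin X {}" "open ({} :: complex set)" by auto
  ultimately show ?thesis
    unfolding dual_topology_def topology_generated_by_topspace by blast
qed

lemma openin_dual_topology:
  "compactin X K \<Longrightarrow> open U \<Longrightarrow> openin (dual_topology G X) {\<xi> \<in> characters G X. \<xi> ` K \<subseteq> U}"
  unfolding dual_topology_def by (intro topology_generated_by_Basis) auto

text \<open>Singletons are compact, so prescribing an open set for the value at one point is an open
  condition, and distinct characters differ at some point.\<close>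

lemma Hausdorff_dual_topology:
  assumes top: "topspace X = carrier G" shows "Hausdorff_space (dual_topology G X)"
  unfolding Hausdorff_space_def topspace_dual_topology
proof (intro allI impI)
  fix \<xi> \<psi> assume *: "\<xi> \<in> characters G X \<and> \<psi> \<in> characters G X \<and> \<xi> \<noteq> \<psi>"
  then obtain x where x: "x \<in> carrier G" "\<xi> x \<noteq> \<psi> x" using character_eqI by metis
  then obtain U V where UV: "open U" "open V" "\<xi> x \<in> U" "\<psi> x \<in> V" "U \<inter> V = {}"
    using hausdorff by metis
  have "compactin X {x}" using x top by simp
  then have "openin (dual_topology G X) {\<xi> \<in> characters G X. \<xi> ` {x} \<subseteq> U}"
    "openin (dual_topology G X) {\<xi> \<in> characters G X. \<xi> ` {x} \<subseteq> V}"
    by (intro openin_dual_topology UV; assumption)+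
  then show "\<exists>U V. openin (dual_topology G X) U \<and> openin (dual_topology G X) V \<and> \<xi> \<in> U \<and> \<psi> \<in> V \<and> disjnt U V"
    using * UV by (intro exI conjI) (assumption, assumption, auto simp: disjnt_def)
qed

text \<open>Local compactness supplies a compact neighbourhood K of x that \<xi> maps into U, and
  mapping K into U is a subbasic open condition on characters.\<close>

lemma (in lch_space) continuous_map_eval:
  assumes top: "topspace X = carrier G"
  shows "continuous_map (prod_topology X (dual_topology G X)) euclidean (\<lambda>(x, \<xi>). \<xi> x)"
  unfolding continuous_map_def
proof (intro conjI allI impI)
  fix U :: "complex set" assume "openin euclidean U"
  then have U: "open U" by simp
  show "openin (prod_topology X (dual_topology G X)) {p \<in> topspace (prod_topology X (dual_topology G X)). (case p of (x, \<xi>) \<Rightarrow> \<xi> x) \<in> U}"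
    unfolding openin_prod_topology_alt
  proof (intro allI impI)
    fix x \<xi> assume "(x, \<xi>) \<in> {p \<in> topspace (prod_topology X (dual_topology G X)). (case p of (x, \<xi>) \<Rightarrow> \<xi> x) \<in> U}"
    then have x: "x \<in> topspace X" "\<xi> \<in> characters G X" "\<xi> x \<in> U" by (auto simp: topspace_dual_topology)
    have "openin X {y \<in> topspace X. \<xi> y \<in> U}"
      by (rule openin_continuous_map_preimage[OF characterD(1)[OF x(2)]]) (use U in simp)
    moreover have "x \<in> {y \<in> topspace X. \<xi> y \<in> U}" using x by simp
    moreover have "neighbourhood_base_of (compactin X) X"
      using locally_compact_space_neighbourhood_base[of X] haus loc_comp by blast
    ultimately obtain V K where V: "openin X V" "compactin X K" "x \<in> V" "V \<subseteq> K" "K \<subseteq> {y \<in> topspace X. \<xi> y \<in> U}"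
      unfolding neighbourhood_base_of by meson
    let ?W = "{\<eta> \<in> characters G X. \<eta> ` K \<subseteq> U}"
    have "V \<times> ?W \<subseteq> {p \<in> topspace (prod_topology X (dual_topology G X)). (case p of (x, \<xi>) \<Rightarrow> \<xi> x) \<in> U}"
      using V by (auto simp: topspace_dual_topology)
    moreover have "openin (dual_topology G X) ?W" by (rule openin_dual_topology[OF V(2) U])
    moreover have "\<xi> \<in> ?W" using V x by auto
    ultimately show "\<exists>A B. openin X A \<and> openin (dual_topology G X) B \<and> x \<in> A \<and> \<xi> \<in> B \<and>
        A \<times> B \<subseteq> {p \<in> topspace (prod_topology X (dual_topology G X)). (case p of (x, \<xi>) \<Rightarrow> \<xi> x) \<in> U}"
      using V by blast
  qed
qed simp

lemma restrict_character:
  assumes \<xi>: "\<xi> \<in> characters G X" and H: "subgroup H G"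
  shows "restrict \<xi> H \<in> characters (G\<lparr>carrier := H\<rparr>) (subtopology X H)"
proof -
  have sub: "x \<in> carrier G" if "x \<in> H" for x using subgroup.subset[OF H] that by blast
  have "continuous_map (subtopology X H) euclidean (restrict \<xi> H)"
    by (rule continuous_map_eq[OF continuous_map_from_subtopology[OF characterD(1)[OF \<xi>]]]) simp
  then show ?thesis
    using characterD(2,3)[OF \<xi>] subgroup.m_closed[OF H] sub by (simp add: characters_def)
qed


section \<open>Harmonic analysis on the dual section\<close>

locale dual_section = weil_pair G X mG \<Gamma> m\<Gamma> \<mu>
  for G :: "'a monoid" (structure) and X mG \<Gamma> m\<Gamma> \<mu> +
  fixes C :: "'a set" and mQ :: "'a set measure" and \<Omega> :: "('a \<Rightarrow> complex) set"
    and mD :: "('a \<Rightarrow> complex) set measure" and \<nu> :: "('a \<Rightarrow> complex) measure"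
  assumes sectC: "measurable_section G X \<Gamma> C"
    and haarQ: "haar_measure (G Mod \<Gamma>) (coset_topology G X \<Gamma>) mQ"
    and \<mu>_eq: "\<mu> = section_measure G X \<Gamma> C mQ"
    and sect\<Omega>: "measurable_section (dual_group G X) (dual_topology G X) (annihilator G X \<Gamma>) \<Omega>"
    and haarD: "haar_measure (dual_group G X Mod annihilator G X \<Gamma>)
           (coset_topology (dual_group G X) (dual_topology G X) (annihilator G X \<Gamma>)) mD"
    and \<nu>_eq: "\<nu> = section_measure (dual_group G X) (dual_topology G X) (annihilator G X \<Gamma>) \<Omega> mD"
    and dual: "dual_haar_measures (G\<lparr>carrier := \<Gamma>\<rparr>) (subtopology X \<Gamma>) m\<Gamma>
           (distr \<nu> (borel_of (dual_topology (G\<lparr>carrier := \<Gamma>\<rparr>) (subtopology X \<Gamma>)))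
             (\<lambda>\<omega>. restrict \<omega> \<Gamma>))"
begin

sublocale A: group_on_space G X
  by unfold_locales (rule topspace_eq)

sublocale P: group_section G X \<Gamma> C mQ
  by (intro group_section.intro group_section_axioms.intro is_group topspace_eq subgroup sectC haarQ)

sublocale D: group_section "dual_group G X" "dual_topology G X" "annihilator G X \<Gamma>" \<Omega> mD
proof (intro group_section.intro group_section_axioms.intro)
  show "group (dual_group G X)" by (rule A.dual_group_is_group)
  show "topspace (dual_topology G X) = carrier (dual_group G X)"
    by (simp add: topspace_dual_topology dual_group_def)
  show "Group.subgroup (annihilator G X \<Gamma>) (dual_group G X)"
    by (rule A.subgroup_annihilator[OF subgroup.subset[OF subgroup]])
qed (rule sect\<Omega>, rule haarD)

sublocale M: lch_measure P.S \<mu>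
  using P.lch_measure_S lch_coset_topology[OF subgroup closed] by (simp add: P.Q_def P.\<sigma>_def \<mu>_eq)

lemma \<mu>_\<sigma>: "\<mu> = P.\<sigma>" and \<nu>_\<sigma>: "\<nu> = D.\<sigma>"
  by (simp_all add: P.\<sigma>_def \<mu>_eq D.\<sigma>_def \<nu>_eq)

lemma space_\<nu>: "space \<nu> = \<Omega>"
  by (simp add: \<nu>_\<sigma> D.space_\<sigma>)

lemma space_\<mu>_eq: "space \<mu> = C"
  by (simp add: \<mu>_\<sigma> P.space_\<sigma>)

lemma \<Omega>_characters: "\<omega> \<in> \<Omega> \<Longrightarrow> \<omega> \<in> characters G X"
  using D.C_carrier by (auto simp: dual_group_def)

lemma \<Omega>_norm: "\<omega> \<in> \<Omega> \<Longrightarrow> x \<in> carrier G \<Longrightarrow> cmod (\<omega> x) = 1"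
  by (rule characterD(2)[OF \<Omega>_characters])

lemma \<Omega>_mult: "\<omega> \<in> \<Omega> \<Longrightarrow> x \<in> carrier G \<Longrightarrow> y \<in> carrier G \<Longrightarrow> \<omega> (x \<otimes> y) = \<omega> x * \<omega> y"
  by (rule characterD(3)[OF \<Omega>_characters])

lemma \<Omega>_inv: "\<omega> \<in> \<Omega> \<Longrightarrow> x \<in> carrier G \<Longrightarrow> \<omega> (inv x) = cnj (\<omega> x)"
  by (rule A.character_inv[OF \<Omega>_characters])

section \<open>The canonical map from the dual section to the dual of \<Gamma>\<close>

definition TH where "TH = dual_topology (G\<lparr>carrier := \<Gamma>\<rparr>) (subtopology X \<Gamma>)"

text \<open>The Haar measure of the dual of \<Gamma> as it appears in the duality hypothesis, under
  the identification of \<Omega> with that dual.\<close>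

definition mH where "mH = distr \<nu> (borel_of TH) (\<lambda>\<omega>. restrict \<omega> \<Gamma>)"

lemma Hausdorff_TH: "Hausdorff_space TH"
  unfolding TH_def by (rule Hausdorff_dual_topology) (rule S.topspace_eq)

text \<open>Compact subsets of \<Gamma> are compact in G, so subbasic sets pull back to subbasic
  sets.\<close>

lemma continuous_restrict: "continuous_map (dual_topology G X) TH (\<lambda>\<omega>. restrict \<omega> \<Gamma>)"
proof -
  let ?B = "{{\<xi> \<in> characters (G\<lparr>carrier := \<Gamma>\<rparr>) (subtopology X \<Gamma>). \<xi> ` K \<subseteq> U} | K U. compactin (subtopology X \<Gamma>) K \<and> open U}"
  have rc: "restrict \<omega> \<Gamma> \<in> characters (G\<lparr>carrier := \<Gamma>\<rparr>) (subtopology X \<Gamma>)" if "\<omega> \<in> characters G X" for \<omega>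
    by (rule restrict_character[OF that subgroup])
  show ?thesis
    unfolding TH_def dual_topology_def[of "G\<lparr>carrier := \<Gamma>\<rparr>"]
  proof (rule continuous_on_generated_topo)
    fix V assume "V \<in> ?B"
    then obtain K U where KU: "compactin (subtopology X \<Gamma>) K" "open U"
      "V = {\<xi> \<in> characters (G\<lparr>carrier := \<Gamma>\<rparr>) (subtopology X \<Gamma>). \<xi> ` K \<subseteq> U}" by blast
    have K: "compactin X K" "K \<subseteq> \<Gamma>" using KU(1) by (auto simp: compactin_subtopology)
    have "restrict \<omega> \<Gamma> ` K = \<omega> ` K" for \<omega> :: "'a \<Rightarrow> complex" using K(2) by (auto intro!: image_cong)
    then have "(\<lambda>\<omega>. restrict \<omega> \<Gamma>) -` V \<inter> topspace (dual_topology G X) = {\<omega> \<in> characters G X. \<omega> ` K \<subseteq> U}"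
      using rc by (auto simp: KU(3) topspace_dual_topology)
    then show "openin (dual_topology G X) ((\<lambda>\<omega>. restrict \<omega> \<Gamma>) -` V \<inter> topspace (dual_topology G X))"
      using openin_dual_topology[OF K(1) KU(2)] by simp
  next
    have "\<Union> ?B = characters (G\<lparr>carrier := \<Gamma>\<rparr>) (subtopology X \<Gamma>)"
      using topspace_dual_topology[of "G\<lparr>carrier := \<Gamma>\<rparr>" "subtopology X \<Gamma>"]
      unfolding dual_topology_def topology_generated_by_topspace .
    then show "(\<lambda>\<omega>. restrict \<omega> \<Gamma>) ` topspace (dual_topology G X) \<subseteq> \<Union> ?B"
      using rc by (auto simp: topspace_dual_topology)
  qed
qed

text \<open>Modulo the annihilator a character retains exactly its values on \<Gamma>; this makes
  the map from the quotient to the dual of \<Gamma> well defined and injective.\<close>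

lemma dual_q_eq_iff:
  assumes \<xi>: "\<xi> \<in> characters G X" and \<psi>: "\<psi> \<in> characters G X"
  shows "D.q \<xi> = D.q \<psi> \<longleftrightarrow> restrict \<xi> \<Gamma> = restrict \<psi> \<Gamma>"
proof -
  have car: "\<xi> \<in> carrier (dual_group G X)" "\<psi> \<in> carrier (dual_group G X)"
    using assms by (simp_all add: dual_group_def)
  let ?p = "\<xi> \<otimes>\<^bsub>dual_group G X\<^esub> inv\<^bsub>dual_group G X\<^esub> \<psi>"
  have p: "?p \<in> characters G X" using D.m_closed[OF car(1) D.inv_closed[OF car(2)]] by (simp add: dual_group_def)
  have pv: "?p \<gamma> = \<xi> \<gamma> * cnj (\<psi> \<gamma>)" if "\<gamma> \<in> \<Gamma>" for \<gamma>
    using A.dual_group_inv(1)[OF \<psi> sub_carrier[OF that]] sub_carrier[OF that] by (simp add: dual_group_def)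
  have eq: "\<xi> \<gamma> * cnj (\<psi> \<gamma>) = 1 \<longleftrightarrow> \<xi> \<gamma> = \<psi> \<gamma>" if "\<gamma> \<in> \<Gamma>" for \<gamma>
  proof -
    have "cnj (\<psi> \<gamma>) * \<psi> \<gamma> = 1"
      using characterD(2)[OF \<psi> sub_carrier[OF that]] by (simp add: mult.commute complex_norm_square[symmetric])
    then show ?thesis by (metis mult.assoc mult.commute mult.left_neutral)
  qed
  have "D.q \<xi> = D.q \<psi> \<longleftrightarrow> ?p \<in> annihilator G X \<Gamma>" by (rule D.q_eq_iff[OF car])
  also have "\<dots> \<longleftrightarrow> (\<forall>\<gamma>\<in>\<Gamma>. \<xi> \<gamma> = \<psi> \<gamma>)" using p pv eq by (simp add: annihilator_def)
  also have "\<dots> \<longleftrightarrow> restrict \<xi> \<Gamma> = restrict \<psi> \<Gamma>" by (auto simp: restrict_def fun_eq_iff)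
  finally show ?thesis .
qed

text \<open>The canonical map from the quotient of the dual to the dual of \<Gamma>, written through
  the cross-section. Later arguments work with it as a continuous injection.\<close>

definition lift where "lift c = restrict (cross_section \<Omega> c) \<Gamma>"

lemma lift_q: assumes "\<xi> \<in> characters G X" shows "lift (D.q \<xi>) = restrict \<xi> \<Gamma>"
proof -
  have "\<xi> \<in> carrier (dual_group G X)" using assms by (simp add: dual_group_def)
  then have "D.q \<xi> \<in> topspace D.Q" unfolding D.topspace_Q by (rule imageI)
  from D.cross_section[OF this] have "cross_section \<Omega> (D.q \<xi>) \<in> characters G X"
    "D.q (cross_section \<Omega> (D.q \<xi>)) = D.q \<xi>" using \<Omega>_characters by auto
  then show ?thesis unfolding lift_def using dual_q_eq_iff[OF _ assms] by blast
qed

text \<open>The cross-section may fail to be continuous into the dual of G; continuity comes from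
  the quotient topology, since \<open>lift\<close> after the projection is restriction to
  \<Gamma>.\<close>

lemma continuous_lift: "continuous_map D.Q TH lift"
proof (rule continuous_compose_quotient_map[OF D.quotient_map_q])
  show "continuous_map (dual_topology G X) TH (lift \<circ> D.q)"
    by (rule continuous_map_eq[OF continuous_restrict]) (simp add: topspace_dual_topology lift_q)
qed

lemma measurable_restrict: "(\<lambda>\<omega>. restrict \<omega> \<Gamma>) \<in> measurable \<nu> (borel_of TH)"
proof -
  have "continuous_map D.S TH (\<lambda>\<omega>. restrict \<omega> \<Gamma>)"
    by (rule continuous_map_eq[OF continuous_map_compose[OF D.q_continuous_S continuous_lift]])
      (use \<Omega>_characters lift_q in \<open>auto simp: D.topspace_S\<close>)
  from continuous_map_measurable[OF this] show ?thesis
    unfolding \<nu>_\<sigma> by (subst measurable_cong_sets[OF D.sets_\<sigma> refl])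
qed

text \<open>The \<sigma>-algebra of \<open>\<nu>\<close> sees a character only through its class
  modulo the annihilator, so evaluation is confined to points of \<Gamma> and factored through
  restriction.\<close>

lemma measurable_eval: "(\<lambda>(\<gamma>, \<omega>). \<omega> \<gamma>) \<in> borel_measurable (m\<Gamma> \<Otimes>\<^sub>M \<nu>)"
proof -
  have "continuous_map (prod_topology (subtopology X \<Gamma>) TH) euclidean (\<lambda>(\<gamma>, \<xi>). \<xi> \<gamma>)"
    unfolding TH_def by (rule S.continuous_map_eval) (rule S.topspace_eq)
  from continuous_map_prod_measurable[OF S.sec_count this]
  have "(\<lambda>(\<gamma>, \<xi>). \<xi> \<gamma>) \<in> borel_measurable (m\<Gamma> \<Otimes>\<^sub>M borel_of TH)"
    unfolding borel_of_euclidean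
    using measurable_cong_sets[OF sets_pair_measure_cong[OF S.sets_M refl] refl] by blast
  moreover have "(\<lambda>(\<gamma>, \<omega>). (\<gamma>, restrict \<omega> \<Gamma>)) \<in> measurable (m\<Gamma> \<Otimes>\<^sub>M \<nu>) (m\<Gamma> \<Otimes>\<^sub>M borel_of TH)"
    using measurable_restrict by measurable
  ultimately have "(\<lambda>p. case (case p of (\<gamma>, \<omega>) \<Rightarrow> (\<gamma>, restrict \<omega> \<Gamma>)) of (\<gamma>, \<xi>) \<Rightarrow> \<xi> \<gamma>)
      \<in> borel_measurable (m\<Gamma> \<Otimes>\<^sub>M \<nu>)"
    by (rule measurable_compose[rotated])
  then show ?thesis
    by (rule measurable_cong[THEN iffD1, rotated]) (auto simp: space_pair_measure space_m\<Gamma>)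
qed

lemma measurable_eval' [measurable]: "(\<lambda>(\<omega>, \<gamma>). \<omega> \<gamma>) \<in> borel_measurable (\<nu> \<Otimes>\<^sub>M m\<Gamma>)"
proof -
  have "(\<lambda>p. case (snd p, fst p) of (\<gamma>, \<omega>) \<Rightarrow> \<omega> \<gamma>) \<in> borel_measurable (\<nu> \<Otimes>\<^sub>M m\<Gamma>)"
    by (rule measurable_compose[OF _ measurable_eval]) measurable
  then show ?thesis by (simp add: split_beta')
qed

lemma measurable_eval_const [measurable]: "\<gamma> \<in> \<Gamma> \<Longrightarrow> (\<lambda>\<omega>. \<omega> \<gamma>) \<in> borel_measurable \<nu>"
  using measurable_compose[OF measurable_Pair1'[of \<gamma> m\<Gamma> \<nu>] measurable_eval] by (simp add: space_m\<Gamma>)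

lemma measurable_character: "\<omega> \<in> \<Omega> \<Longrightarrow> (\<lambda>\<gamma>. \<omega> \<gamma>) \<in> borel_measurable m\<Gamma>"
  using measurable_compose[OF measurable_Pair1'[of \<omega> \<nu> m\<Gamma>] measurable_eval'] by (simp add: space_\<nu>)

section \<open>Fourier transforms on \<Gamma> as functions on the section\<close>

definition hat :: "('a \<Rightarrow> complex) \<Rightarrow> ('a \<Rightarrow> complex) \<Rightarrow> complex" where
  "hat g \<omega> = (LINT \<gamma>|m\<Gamma>. g \<gamma> * cnj (\<omega> \<gamma>))"

lemma fourier_restrict: "fourier m\<Gamma> g (restrict \<omega> \<Gamma>) = hat g \<omega>"
  unfolding fourier_def hat_def by (intro Bochner_Integration.integral_cong) (simp_all add: space_m\<Gamma>)

lemma hat_integrable: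
  assumes "integrable m\<Gamma> g" "\<omega> \<in> \<Omega>" shows "integrable m\<Gamma> (\<lambda>\<gamma>. g \<gamma> * cnj (\<omega> \<gamma>))"
  by (rule Bochner_Integration.integrable_bound[OF assms(1)])
    (use assms measurable_character[OF assms(2)] \<Omega>_norm[OF assms(2)] sub_carrier
      in \<open>auto simp: norm_mult space_m\<Gamma>\<close>)

lemma hat_bound: assumes "integrable m\<Gamma> g" "\<omega> \<in> \<Omega>" shows "cmod (hat g \<omega>) \<le> (LINT \<gamma>|m\<Gamma>. cmod (g \<gamma>))"
proof -
  have "cmod (hat g \<omega>) \<le> (LINT \<gamma>|m\<Gamma>. cmod (g \<gamma> * cnj (\<omega> \<gamma>)))"
    unfolding hat_def by (rule integral_norm_bound)
  also have "\<dots> = (LINT \<gamma>|m\<Gamma>. cmod (g \<gamma>))"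
    by (intro Bochner_Integration.integral_cong)
      (simp_all add: norm_mult space_m\<Gamma> \<Omega>_norm[OF assms(2)] sub_carrier)
  finally show ?thesis .
qed

text \<open>Change of variables along restriction; it moves Plancherel and the density of transforms
  from the dual of \<Gamma> to the section.\<close>

lemma L2_mH:
  assumes "f \<in> L2 mH" shows "(\<lambda>\<omega>. f (restrict \<omega> \<Gamma>)) \<in> L2 \<nu>" "L2_norm \<nu> (\<lambda>\<omega>. f (restrict \<omega> \<Gamma>)) = L2_norm mH f"
proof -
  note [measurable] = measurable_restrict
  have f [measurable]: "f \<in> borel_measurable (borel_of TH)" using assms by (simp add: L2_def mH_def)
  have "integrable \<nu> (\<lambda>\<omega>. (cmod (f (restrict \<omega> \<Gamma>)))\<^sup>2)"
    using L2_integrable[OF assms] unfolding mH_def by (subst (asm) integrable_distr_eq) measurable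
  moreover have "(\<lambda>\<omega>. f (restrict \<omega> \<Gamma>)) \<in> borel_measurable \<nu>" by measurable
  ultimately show "(\<lambda>\<omega>. f (restrict \<omega> \<Gamma>)) \<in> L2 \<nu>" by (simp add: L2_def)
  show "L2_norm \<nu> (\<lambda>\<omega>. f (restrict \<omega> \<Gamma>)) = L2_norm mH f"
    unfolding L2_norm_def mH_def by (subst integral_distr) measurable
qed

lemma dual': "dual_haar_measures (G\<lparr>carrier := \<Gamma>\<rparr>) (subtopology X \<Gamma>) m\<Gamma> mH"
  using dual by (simp add: mH_def TH_def)

lemma Plancherel:
  assumes "integrable m\<Gamma> g" "g \<in> L2 m\<Gamma>"
  shows "hat g \<in> L2 \<nu>" "L2_norm \<nu> (hat g) = L2_norm m\<Gamma> g"
proof -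
  have "fourier m\<Gamma> g \<in> L2 mH \<and> L2_norm mH (fourier m\<Gamma> g) = L2_norm m\<Gamma> g"
    using dual' assms by (simp add: dual_haar_measures_def)
  then show "hat g \<in> L2 \<nu>" "L2_norm \<nu> (hat g) = L2_norm m\<Gamma> g"
    using L2_mH[of "fourier m\<Gamma> g"] by (simp_all add: fourier_restrict)
qed

lemma Re_le_1_near: "cmod (z - 1) < 1/2 \<Longrightarrow> Re z \<ge> 1/2"
  using abs_Re_le_cmod[of "z - 1"] by auto

text \<open>The transform of the indicator of a basic set B is in L2 by Plancherel, so its modulus
  exceeds 1/(k + 1) only on a set of finite measure. These sets cover \<Omega>: a character is close
  to 1 near the identity, so the transform for a small B does not vanish at it.\<close>

lemma sigma_finite_\<nu>: "sigma_finite_measure \<nu>"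
proof
  obtain \<G> where G: "countable \<G>" "\<And>B. B \<in> \<G> \<Longrightarrow> openin (subtopology X \<Gamma>) B"
    "\<And>B. B \<in> \<G> \<Longrightarrow> \<exists>K. compactin (subtopology X \<Gamma>) K \<and> B \<subseteq> K"
    "\<And>U x. openin (subtopology X \<Gamma>) U \<Longrightarrow> x \<in> U \<Longrightarrow> \<exists>B\<in>\<G>. x \<in> B \<and> B \<subseteq> U"
    using S.base by metis
  have fin: "emeasure m\<Gamma> B < \<infinity>" "B \<in> sets m\<Gamma>" if "B \<in> \<G>" for B
    using G(2,3)[OF that] S.finite_relcompact S.open_sets by auto
  define g where "g B = (indicator B :: 'a \<Rightarrow> complex)" for B
  have g: "integrable m\<Gamma> (g B)" "g B \<in> L2 m\<Gamma>" if "B \<in> \<G>" for B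
  proof -
    have "integrable m\<Gamma> (\<lambda>x. complex_of_real (indicator B x))"
      using fin[OF that] by (intro integrable_of_real integrable_real_indicator) auto
    moreover have "(\<lambda>x. complex_of_real (indicator B x)) = g B" by (auto simp: g_def indicator_def)
    ultimately show "integrable m\<Gamma> (g B)" by simp
    show "g B \<in> L2 m\<Gamma>" unfolding g_def by (rule indicator_L2) (use fin[OF that] in auto)
  qed
  define E where "E B k = {\<omega> \<in> space \<nu>. 1 / (real k + 1) < cmod (hat (g B) \<omega>)}" for B k
  let ?\<A> = "(\<lambda>(B, k). E B k) ` (\<G> \<times> UNIV)"
  have E: "E B k \<in> sets \<nu>" "emeasure \<nu> (E B k) \<noteq> \<infinity>" if B: "B \<in> \<G>" for B k
  proof -
    note [measurable] = L2_measurable[OF Plancherel(1)[OF g[OF B]]]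
    show E: "E B k \<in> sets \<nu>" unfolding E_def by measurable
    have i: "integrable \<nu> (\<lambda>\<omega>. (cmod (hat (g B) \<omega>))\<^sup>2)"
      by (rule L2_integrable[OF Plancherel(1)[OF g[OF B]]])
    \<comment> \<open>Chebyshev's inequality for the square of the transform.\<close>
    have "emeasure \<nu> (E B k) = (\<integral>\<^sup>+\<omega>. indicator (E B k) \<omega> \<partial>\<nu>)" using E by simp
    also have "\<dots> \<le> (\<integral>\<^sup>+\<omega>. ennreal ((real k + 1)\<^sup>2 * (cmod (hat (g B) \<omega>))\<^sup>2) \<partial>\<nu>)"
    proof (intro nn_integral_mono)
      fix \<omega>
      show "indicator (E B k) \<omega> \<le> ennreal ((real k + 1)\<^sup>2 * (cmod (hat (g B) \<omega>))\<^sup>2)"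
      proof (cases "\<omega> \<in> E B k")
        case True
        then have "1 < (real k + 1) * cmod (hat (g B) \<omega>)" by (simp add: E_def field_simps)
        then have "1\<^sup>2 \<le> ((real k + 1) * cmod (hat (g B) \<omega>))\<^sup>2" by (intro power_mono) auto
        then show ?thesis using True by (simp add: power_mult_distrib)
      qed simp
    qed
    also have "\<dots> < \<infinity>"
      using i[THEN integrable_mult_right[of "(real k + 1)\<^sup>2"]]
      by (subst nn_integral_eq_integral) auto
    finally show "emeasure \<nu> (E B k) \<noteq> \<infinity>" by simp
  qed
  have "space \<nu> \<subseteq> \<Union> ?\<A>"
  proof
    fix \<omega> assume \<omega>: "\<omega> \<in> space \<nu>"
    then have \<omega>': "\<omega> \<in> \<Omega>" by (simp add: space_\<nu>)
    have cont: "continuous_map (subtopology X \<Gamma>) euclidean \<omega>"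
      by (rule continuous_map_from_subtopology[OF characterD(1)[OF \<Omega>_characters[OF \<omega>']]])
    have "openin (subtopology X \<Gamma>) {\<gamma> \<in> topspace (subtopology X \<Gamma>). \<omega> \<gamma> \<in> ball 1 (1/2)}"
      by (rule openin_continuous_map_preimage[OF cont]) simp
    moreover have "\<one> \<in> {\<gamma> \<in> topspace (subtopology X \<Gamma>). \<omega> \<gamma> \<in> ball 1 (1/2)}"
      using A.character_one[OF \<Omega>_characters[OF \<omega>']] subgroup.one_closed[OF subgroup]
      by (simp add: topspace_eq)
    ultimately obtain B where B: "B \<in> \<G>" "\<one> \<in> B"
      "B \<subseteq> {\<gamma> \<in> topspace (subtopology X \<Gamma>). \<omega> \<gamma> \<in> ball 1 (1/2)}" using G(4) by meson
    \<comment> \<open>On \<open>B\<close> the conjugate character has real part at least 1/2, so no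
      cancellation can occur in the integral.\<close>
    have Re: "1/2 \<le> Re (cnj (\<omega> \<gamma>))" if "\<gamma> \<in> B" for \<gamma>
      using Re_le_1_near[of "\<omega> \<gamma>"] B(3) that by (auto simp: dist_norm norm_minus_commute)
    have "0 < measure m\<Gamma> B / 2"
      using S.open_pos[OF G(2)[OF B(1)]] B(2) fin(1)[OF B(1)] by (auto simp: measure_def enn2real_positive_iff)
    also have "measure m\<Gamma> B / 2 = (LINT \<gamma>|m\<Gamma>. indicator B \<gamma> / 2)" using fin[OF B(1)] by simp
    also have "\<dots> \<le> (LINT \<gamma>|m\<Gamma>. Re (g B \<gamma> * cnj (\<omega> \<gamma>)))"
    proof (rule integral_mono)
      show "integrable m\<Gamma> (\<lambda>\<gamma>. indicator B \<gamma> / 2 :: real)"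
        using fin[OF B(1)] by (auto intro!: integrable_real_indicator)
      show "integrable m\<Gamma> (\<lambda>\<gamma>. Re (g B \<gamma> * cnj (\<omega> \<gamma>)))"
        by (rule integrable_Re[OF hat_integrable[OF g(1)[OF B(1)] \<omega>']])
      show "indicator B \<gamma> / 2 \<le> Re (g B \<gamma> * cnj (\<omega> \<gamma>))" for \<gamma>
        using Re[of \<gamma>] by (auto simp: g_def indicator_def)
    qed
    also have "\<dots> = Re (hat (g B) \<omega>)"
      unfolding hat_def by (rule integral_Re[OF hat_integrable[OF g(1)[OF B(1)] \<omega>']])
    also have "\<dots> \<le> cmod (hat (g B) \<omega>)" by (rule complex_Re_le_cmod)
    finally obtain k where "inverse (real (Suc k)) < cmod (hat (g B) \<omega>)" using reals_Archimedean by blast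
    then have "\<omega> \<in> E B k" using \<omega> by (simp add: E_def inverse_eq_divide add.commute)
    then show "\<omega> \<in> \<Union> ?\<A>" using B(1) by blast
  qed
  then show "\<exists>A. countable A \<and> A \<subseteq> sets \<nu> \<and> \<Union> A = space \<nu> \<and> (\<forall>a\<in>A. emeasure \<nu> a \<noteq> \<infinity>)"
    using E G(1) by (intro exI[of _ ?\<A>]) (auto simp: E_def)
qed

sublocale N: sigma_finite_measure \<nu>
  by (rule sigma_finite_\<nu>)

sublocale S\<nu>: pair_sigma_finite m\<Gamma> \<nu> ..

text \<open>The complex measure with density \<open>f\<close> has vanishing Fourier transform on
  \<Gamma>. The aim of what follows is that such an \<open>f\<close> is null.\<close>

definition annihilates :: "(('a \<Rightarrow> complex) \<Rightarrow> complex) \<Rightarrow> bool" where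
  "annihilates f \<longleftrightarrow> integrable \<nu> f \<and> (\<forall>\<gamma>\<in>\<Gamma>. (LINT \<omega>|\<nu>. f \<omega> * \<omega> \<gamma>) = 0)"

text \<open>By Fubini the new coefficient at \<gamma>0 is an average, weighted by \<open>g\<close>,
  of the old coefficients at \<open>\<kappa> \<gamma> \<otimes> \<gamma>0\<close>, which are 0. The
  parameters \<open>k\<close> and \<open>\<kappa>\<close> cover \<omega> \<gamma> and its conjugate
  in one proof.\<close>

lemma annihilates_mult_fourier:
  assumes f: "annihilates f" and g: "integrable m\<Gamma> g"
    and k: "\<And>\<omega> \<gamma>. \<omega> \<in> \<Omega> \<Longrightarrow> \<gamma> \<in> \<Gamma> \<Longrightarrow> k \<omega> \<gamma> = \<omega> (\<kappa> \<gamma>)" and \<kappa>: "\<And>\<gamma>. \<gamma> \<in> \<Gamma> \<Longrightarrow> \<kappa> \<gamma> \<in> \<Gamma>"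
    and km [measurable]: "(\<lambda>(\<gamma>, \<omega>). k \<omega> \<gamma>) \<in> borel_measurable (m\<Gamma> \<Otimes>\<^sub>M \<nu>)"
  shows "annihilates (\<lambda>\<omega>. f \<omega> * (LINT \<gamma>|m\<Gamma>. g \<gamma> * k \<omega> \<gamma>))"
proof -
  have fi: "integrable \<nu> f" and f0: "\<And>\<gamma>. \<gamma> \<in> \<Gamma> \<Longrightarrow> (LINT \<omega>|\<nu>. f \<omega> * \<omega> \<gamma>) = 0"
    using f by (auto simp: annihilates_def)
  have [measurable]: "f \<in> borel_measurable \<nu>" "g \<in> borel_measurable m\<Gamma>" using fi g by auto
  have k1: "cmod (k \<omega> \<gamma>) = 1" if "\<omega> \<in> \<Omega>" "\<gamma> \<in> \<Gamma>" for \<omega> \<gamma>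
    using k[OF that] \<Omega>_norm[OF that(1) sub_carrier[OF \<kappa>[OF that(2)]]] by simp
  have km' [measurable]: "(\<lambda>\<omega>. LINT \<gamma>|m\<Gamma>. g \<gamma> * k \<omega> \<gamma>) \<in> borel_measurable \<nu>"
  proof -
    have "(\<lambda>(\<omega>, \<gamma>). k \<omega> \<gamma>) \<in> borel_measurable (\<nu> \<Otimes>\<^sub>M m\<Gamma>)"
      using measurable_compose[OF measurable_pair_swap' km] by (simp add: split_beta')
    then show ?thesis by measurable
  qed
  have bound: "cmod (LINT \<gamma>|m\<Gamma>. g \<gamma> * k \<omega> \<gamma>) \<le> (LINT \<gamma>|m\<Gamma>. cmod (g \<gamma>))" if "\<omega> \<in> \<Omega>" for \<omega>
  proof -
    have "cmod (LINT \<gamma>|m\<Gamma>. g \<gamma> * k \<omega> \<gamma>) \<le> (LINT \<gamma>|m\<Gamma>. cmod (g \<gamma> * k \<omega> \<gamma>))" by (rule integral_norm_bound)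
    also have "\<dots> = (LINT \<gamma>|m\<Gamma>. cmod (g \<gamma>))"
      by (intro Bochner_Integration.integral_cong) (simp_all add: norm_mult space_m\<Gamma> k1[OF that])
    finally show ?thesis .
  qed
  have "integrable \<nu> (\<lambda>\<omega>. f \<omega> * (LINT \<gamma>|m\<Gamma>. g \<gamma> * k \<omega> \<gamma>))"
  proof (rule Bochner_Integration.integrable_bound)
    show "integrable \<nu> (\<lambda>\<omega>. (LINT \<gamma>|m\<Gamma>. cmod (g \<gamma>)) * f \<omega>)" using fi by simp
    show "AE \<omega> in \<nu>. norm (f \<omega> * (LINT \<gamma>|m\<Gamma>. g \<gamma> * k \<omega> \<gamma>)) \<le> norm ((LINT \<gamma>|m\<Gamma>. cmod (g \<gamma>)) * f \<omega>)"
      using bound by (auto intro!: AE_I2 simp: space_\<nu> norm_mult mult.commute intro: mult_left_mono order_trans[OF _ abs_ge_self])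
  qed measurable
  moreover have "(LINT \<omega>|\<nu>. f \<omega> * (LINT \<gamma>|m\<Gamma>. g \<gamma> * k \<omega> \<gamma>) * \<omega> \<gamma>0) = 0" if \<gamma>0: "\<gamma>0 \<in> \<Gamma>" for \<gamma>0
  proof -
    let ?F = "\<lambda>\<gamma> \<omega>. g \<gamma> * (f \<omega> * (k \<omega> \<gamma> * \<omega> \<gamma>0))"
    have [measurable]: "(\<lambda>\<omega>. \<omega> \<gamma>0) \<in> borel_measurable \<nu>" by (rule measurable_eval_const[OF \<gamma>0])
    have Fm: "case_prod ?F \<in> borel_measurable (m\<Gamma> \<Otimes>\<^sub>M \<nu>)" by measurable
    have n: "cmod (?F \<gamma> \<omega>) = cmod (g \<gamma>) * cmod (f \<omega>)" if "\<gamma> \<in> \<Gamma>" "\<omega> \<in> \<Omega>" for \<gamma> \<omega>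
      using k1[OF that(2,1)] \<Omega>_norm[OF that(2) sub_carrier[OF \<gamma>0]] by (simp add: norm_mult)
    have int: "integrable (m\<Gamma> \<Otimes>\<^sub>M \<nu>) (case_prod ?F)"
    proof (rule S\<nu>.Fubini_integrable[OF Fm])
      have "(LINT \<omega>|\<nu>. norm (case_prod ?F (\<gamma>, \<omega>))) = cmod (g \<gamma>) * (LINT \<omega>|\<nu>. cmod (f \<omega>))" if "\<gamma> \<in> \<Gamma>" for \<gamma>
      proof -
        have "(LINT \<omega>|\<nu>. norm (case_prod ?F (\<gamma>, \<omega>))) = (LINT \<omega>|\<nu>. cmod (g \<gamma>) * cmod (f \<omega>))"
          by (intro Bochner_Integration.integral_cong refl) (use n[OF that] in \<open>simp add: space_\<nu>\<close>)
        then show ?thesis by simp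
      qed
      then show "integrable m\<Gamma> (\<lambda>\<gamma>. LINT \<omega>|\<nu>. norm (case_prod ?F (\<gamma>, \<omega>)))"
        using g by (subst Bochner_Integration.integrable_cong[OF refl]) (auto simp: space_m\<Gamma>)
      show "AE \<gamma> in m\<Gamma>. integrable \<nu> (\<lambda>\<omega>. case_prod ?F (\<gamma>, \<omega>))"
      proof (rule AE_I2)
        fix \<gamma> assume "\<gamma> \<in> space m\<Gamma>"
        then have \<gamma>: "\<gamma> \<in> \<Gamma>" by (simp add: space_m\<Gamma>)
        have "integrable \<nu> (\<lambda>\<omega>. g \<gamma> * f \<omega>)" using fi by simp
        then show "integrable \<nu> (\<lambda>\<omega>. case_prod ?F (\<gamma>, \<omega>))"
        proof (rule Bochner_Integration.integrable_bound)
          show "(\<lambda>\<omega>. case_prod ?F (\<gamma>, \<omega>)) \<in> borel_measurable \<nu>"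
            using measurable_compose[OF measurable_Pair1'[OF \<open>\<gamma> \<in> space m\<Gamma>\<close>] Fm] by simp
          show "AE \<omega> in \<nu>. norm (case_prod ?F (\<gamma>, \<omega>)) \<le> norm (g \<gamma> * f \<omega>)"
          proof (rule AE_I2)
            fix \<omega> assume "\<omega> \<in> space \<nu>"
            then have "\<omega> \<in> \<Omega>" by (simp add: space_\<nu>)
            show "norm (case_prod ?F (\<gamma>, \<omega>)) \<le> norm (g \<gamma> * f \<omega>)"
              by (simp only: prod.case n[OF \<gamma> \<open>\<omega> \<in> \<Omega>\<close>]) (simp add: norm_mult)
          qed
        qed
      qed
    qed
    have inner: "(LINT \<omega>|\<nu>. ?F \<gamma> \<omega>) = 0" if \<gamma>: "\<gamma> \<in> \<Gamma>" for \<gamma>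
    proof -
      have cl: "\<kappa> \<gamma> \<otimes> \<gamma>0 \<in> \<Gamma>" by (rule subgroup.m_closed[OF subgroup \<kappa>[OF \<gamma>] \<gamma>0])
      have "(LINT \<omega>|\<nu>. f \<omega> * (k \<omega> \<gamma> * \<omega> \<gamma>0)) = (LINT \<omega>|\<nu>. f \<omega> * \<omega> (\<kappa> \<gamma> \<otimes> \<gamma>0))"
        by (intro Bochner_Integration.integral_cong refl)
          (simp add: space_\<nu> k[OF _ \<gamma>] \<Omega>_mult sub_carrier \<kappa>[OF \<gamma>] \<gamma>0)
      then show ?thesis using f0[OF cl] by simp
    qed
    have "(LINT \<omega>|\<nu>. f \<omega> * (LINT \<gamma>|m\<Gamma>. g \<gamma> * k \<omega> \<gamma>) * \<omega> \<gamma>0) = (LINT \<omega>|\<nu>. LINT \<gamma>|m\<Gamma>. ?F \<gamma> \<omega>)"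
    proof (intro Bochner_Integration.integral_cong refl)
      fix \<omega>
      have "(LINT \<gamma>|m\<Gamma>. ?F \<gamma> \<omega>) = (LINT \<gamma>|m\<Gamma>. (f \<omega> * \<omega> \<gamma>0) * (g \<gamma> * k \<omega> \<gamma>))"
        by (intro Bochner_Integration.integral_cong refl) (simp add: mult_ac)
      then show "f \<omega> * (LINT \<gamma>|m\<Gamma>. g \<gamma> * k \<omega> \<gamma>) * \<omega> \<gamma>0 = (LINT \<gamma>|m\<Gamma>. ?F \<gamma> \<omega>)" by (simp add: mult_ac)
    qed
    also have "\<dots> = (LINT \<gamma>|m\<Gamma>. LINT \<omega>|\<nu>. ?F \<gamma> \<omega>)" by (rule S\<nu>.Fubini_integral[OF int])
    also have "\<dots> = (LINT \<gamma>|m\<Gamma>. 0)"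
      by (intro Bochner_Integration.integral_cong refl) (use inner in \<open>simp add: space_m\<Gamma>\<close>)
    finally show ?thesis by simp
  qed
  ultimately show ?thesis by (simp add: annihilates_def)
qed

text \<open>The real part is the mean of the transform and its conjugate. Real multipliers are
  wanted because the exponentials formed from them have modulus 1.\<close>

lemma annihilates_Re_hat:
  assumes f: "annihilates f" and g: "integrable m\<Gamma> g"
  shows "annihilates (\<lambda>\<omega>. f \<omega> * complex_of_real (Re (hat g \<omega>)))"
proof -
  have 1: "annihilates (\<lambda>\<omega>. f \<omega> * (LINT \<gamma>|m\<Gamma>. g \<gamma> * cnj (\<omega> \<gamma>)))"
  proof (rule annihilates_mult_fourier[OF f g])
    show "cnj (\<omega> \<gamma>) = \<omega> (inv \<gamma>)" if "\<omega> \<in> \<Omega>" "\<gamma> \<in> \<Gamma>" for \<omega> \<gamma>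
      using \<Omega>_inv[OF that(1) sub_carrier[OF that(2)]] by simp
    show "inv \<gamma> \<in> \<Gamma>" if "\<gamma> \<in> \<Gamma>" for \<gamma> by (rule subgroup.m_inv_closed[OF subgroup that])
    show "(\<lambda>(\<gamma>, \<omega>). cnj (\<omega> \<gamma>)) \<in> borel_measurable (m\<Gamma> \<Otimes>\<^sub>M \<nu>)"
      using measurable_compose[OF measurable_eval borel_measurable_cnj] by (simp add: split_beta')
  qed
  have 2: "annihilates (\<lambda>\<omega>. f \<omega> * (LINT \<gamma>|m\<Gamma>. cnj (g \<gamma>) * \<omega> \<gamma>))"
    by (rule annihilates_mult_fourier[OF f, where \<kappa>="\<lambda>\<gamma>. \<gamma>"]) (use g measurable_eval in auto)
  have cnj: "(LINT \<gamma>|m\<Gamma>. cnj (g \<gamma>) * \<omega> \<gamma>) = cnj (hat g \<omega>)" for \<omega>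
  proof -
    have "(LINT \<gamma>|m\<Gamma>. cnj (g \<gamma>) * \<omega> \<gamma>) = (LINT \<gamma>|m\<Gamma>. cnj (g \<gamma> * cnj (\<omega> \<gamma>)))"
      by (intro Bochner_Integration.integral_cong refl) simp
    then show ?thesis by (simp only: Bochner_Integration.integral_cnj hat_def)
  qed
  have eq: "f \<omega> * complex_of_real (Re (hat g \<omega>)) * z
      = (f \<omega> * hat g \<omega> * z) / 2 + (f \<omega> * cnj (hat g \<omega>) * z) / 2" for \<omega> z
  proof -
    have "complex_of_real (Re (hat g \<omega>)) = (hat g \<omega> + cnj (hat g \<omega>)) / 2"
      by (simp add: complex_add_cnj)
    then show ?thesis by (simp add: algebra_simps add_divide_distrib)
  qed
  have i1: "integrable \<nu> (\<lambda>\<omega>. f \<omega> * hat g \<omega>)" and i2: "integrable \<nu> (\<lambda>\<omega>. f \<omega> * cnj (hat g \<omega>))"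
    using 1 2 by (simp_all add: annihilates_def hat_def[symmetric] cnj)
  have im: "integrable \<nu> (\<lambda>\<omega>. h \<omega> * \<omega> \<gamma>)" if "integrable \<nu> h" "\<gamma> \<in> \<Gamma>" for h \<gamma>
    by (rule Bochner_Integration.integrable_bound[OF that(1)])
      (use that \<Omega>_norm sub_carrier in \<open>auto simp: norm_mult space_\<nu>\<close>)
  show ?thesis
    unfolding annihilates_def
  proof (intro conjI ballI)
    show "integrable \<nu> (\<lambda>\<omega>. f \<omega> * complex_of_real (Re (hat g \<omega>)))"
      using eq[of _ 1] i1 i2 by simp
    fix \<gamma> assume \<gamma>: "\<gamma> \<in> \<Gamma>"
    show "(LINT \<omega>|\<nu>. f \<omega> * complex_of_real (Re (hat g \<omega>)) * \<omega> \<gamma>) = 0"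
      unfolding eq using 1 2 \<gamma> im[OF i1 \<gamma>] im[OF i2 \<gamma>]
      by (simp add: annihilates_def hat_def[symmetric] cnj)
  qed
qed

lemma annihilates_Re_hat_power:
  assumes "annihilates f" "integrable m\<Gamma> g"
  shows "annihilates (\<lambda>\<omega>. f \<omega> * complex_of_real (Re (hat g \<omega>)) ^ n)"
proof (induction n)
  case (Suc n)
  from annihilates_Re_hat[OF this assms(2)] show ?case by (simp add: mult_ac)
qed (use assms in simp)

lemma annihilates_integral_0: assumes "annihilates f" shows "(LINT \<omega>|\<nu>. f \<omega>) = 0"
proof -
  have "(LINT \<omega>|\<nu>. f \<omega>) = (LINT \<omega>|\<nu>. f \<omega> * \<omega> \<one>)"
    by (intro Bochner_Integration.integral_cong refl)
      (simp add: space_\<nu> A.character_one[OF \<Omega>_characters])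
  then show ?thesis using assms subgroup.one_closed[OF subgroup] by (simp add: annihilates_def)
qed

text \<open>
  The multipliers \<open>exp (\<i> * pi * Re (hat g))\<close> are uniformly bounded, so that
  \<open>hat g\<close> may converge in L2 to an indicator function; this gives the multiplier
  \<open>1 - 2 * indicator\<close>.
\<close>

lemma annihilates_exp:
  assumes f: "annihilates f" and g: "integrable m\<Gamma> g"
  shows "(LINT \<omega>|\<nu>. f \<omega> * exp (\<i> * complex_of_real (pi * Re (hat g \<omega>)))) = 0"
proof -
  \<comment> \<open>A bound for the exponent, uniform in the character, since a transform is bounded
    by the L1 norm of \<open>g\<close>. It dominates the exponential series by exp(c) |f|.\<close>
  define c where "c = pi * (LINT \<gamma>|m\<Gamma>. cmod (g \<gamma>))"
  have c0: "c \<ge> 0" unfolding c_def by (intro mult_nonneg_nonneg Bochner_Integration.integral_nonneg) auto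
  have fi: "integrable \<nu> f" using f by (simp add: annihilates_def)
  let ?z = "\<lambda>\<omega>. \<i> * complex_of_real (pi * Re (hat g \<omega>))"
  let ?u = "\<lambda>n \<omega>. f \<omega> * (?z \<omega> ^ n /\<^sub>R fact n)"
  have zb: "cmod (?z \<omega>) \<le> c" if "\<omega> \<in> \<Omega>" for \<omega>
    using abs_Re_le_cmod[of "hat g \<omega>"] hat_bound[OF g that] by (simp add: norm_mult c_def abs_mult)
  have u_eq: "?u n \<omega> = (\<i> * complex_of_real pi) ^ n / fact n * (f \<omega> * complex_of_real (Re (hat g \<omega>)) ^ n)" for n \<omega>
    by (simp add: power_mult_distrib scaleR_conv_of_real field_simps)
  have ui: "integrable \<nu> (?u n)" and u0: "(LINT \<omega>|\<nu>. ?u n \<omega>) = 0" for n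
    unfolding u_eq using annihilates_Re_hat_power[OF f g, of n]
      annihilates_integral_0[OF annihilates_Re_hat_power[OF f g, of n]]
    by (simp_all add: annihilates_def)
  have ub: "norm (?u n \<omega>) \<le> cmod (f \<omega>) * (c ^ n /\<^sub>R fact n)" if "\<omega> \<in> \<Omega>" for n \<omega>
  proof -
    have "norm (?u n \<omega>) = cmod (f \<omega>) * (cmod (?z \<omega>) ^ n /\<^sub>R fact n)" by (simp add: norm_mult norm_power)
    also have "\<dots> \<le> cmod (f \<omega>) * (c ^ n /\<^sub>R fact n)"
      by (intro mult_left_mono scaleR_left_mono power_mono zb[OF that]) auto
    finally show ?thesis .
  qed
  have sc: "summable (\<lambda>n. c ^ n /\<^sub>R fact n)" by (rule summable_exp_generic)
  \<comment> \<open>Termwise integration of the exponential series; each term is \<open>f\<close>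
    times a power of the multiplier and integrates to 0.\<close>
  have "(\<lambda>n. LINT \<omega>|\<nu>. ?u n \<omega>) sums (LINT \<omega>|\<nu>. (\<Sum>n. ?u n \<omega>))"
  proof (rule sums_integral[OF ui])
    show "AE \<omega> in \<nu>. summable (\<lambda>n. norm (?u n \<omega>))"
    proof (rule AE_I2)
      fix \<omega> assume "\<omega> \<in> space \<nu>"
      then have \<omega>: "\<omega> \<in> \<Omega>" by (simp add: space_\<nu>)
      show "summable (\<lambda>n. norm (?u n \<omega>))"
        by (rule summable_comparison_test'[OF summable_mult[OF sc, of "cmod (f \<omega>)"], of 0])
          (use ub[OF \<omega>] in simp)
    qed
    show "summable (\<lambda>n. LINT \<omega>|\<nu>. norm (?u n \<omega>))"
    proof (rule summable_comparison_test'[OF summable_mult[OF sc, of "LINT \<omega>|\<nu>. cmod (f \<omega>)"], of 0])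
      fix n
      have "(LINT \<omega>|\<nu>. norm (?u n \<omega>)) \<le> (LINT \<omega>|\<nu>. cmod (f \<omega>) * (c ^ n /\<^sub>R fact n))"
        by (rule integral_mono) (use ui[THEN integrable_norm] fi ub in \<open>auto simp: space_\<nu>\<close>)
      then show "norm (LINT \<omega>|\<nu>. norm (?u n \<omega>)) \<le> (LINT \<omega>|\<nu>. cmod (f \<omega>)) * (c ^ n /\<^sub>R fact n)"
        by (simp add: Bochner_Integration.integral_nonneg)
    qed
  qed
  then have "(LINT \<omega>|\<nu>. (\<Sum>n. ?u n \<omega>)) = 0" unfolding u0 using sums_unique2[OF _ sums_zero] by blast
  moreover have "(\<Sum>n. ?u n \<omega>) = f \<omega> * exp (?z \<omega>)" for \<omega>
    unfolding exp_def by (rule suminf_mult[OF summable_exp_generic])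
  ultimately show ?thesis by simp
qed

end

lemma L2_LIMSEQ_AE_subseq:
  assumes f: "\<And>n. f n \<in> L2 M" "g \<in> L2 M" and lim: "(\<lambda>n. L2_norm M (f n - g)) \<longlonglongrightarrow> 0"
  shows "\<exists>r. strict_mono (r :: nat \<Rightarrow> nat) \<and> (AE x in M. (\<lambda>n. f (r n) x) \<longlonglongrightarrow> g x)"
proof -
  have int: "integrable M (\<lambda>x. (cmod (f n x - g x))\<^sup>2)" for n
    using L2_integrable[OF L2_diff[OF f(1) f(2)], of n] by simp
  have "(LINT x|M. norm ((cmod (f n x - g x))\<^sup>2)) = (L2_norm M (f n - g))\<^sup>2" for n
    unfolding L2_norm_sq by simp
  moreover have "(\<lambda>n. (L2_norm M (f n - g))\<^sup>2) \<longlonglongrightarrow> 0\<^sup>2" by (intro tendsto_power lim)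
  ultimately have "(\<lambda>n. LINT x|M. norm ((cmod (f n x - g x))\<^sup>2)) \<longlonglongrightarrow> 0" by (simp only: zero_power2)
  from tendsto_L1_AE_subseq[OF int this] obtain r :: "nat \<Rightarrow> nat" where
    r: "strict_mono r" "AE x in M. (\<lambda>n. (cmod (f (r n) x - g x))\<^sup>2) \<longlonglongrightarrow> 0" by blast
  from r(2) have "AE x in M. (\<lambda>n. f (r n) x) \<longlonglongrightarrow> g x"
  proof eventually_elim
    fix x assume "(\<lambda>n. (cmod (f (r n) x - g x))\<^sup>2) \<longlonglongrightarrow> 0"
    from tendsto_real_sqrt[OF this] have "(\<lambda>n. cmod (f (r n) x - g x)) \<longlonglongrightarrow> 0"
      by (simp only: real_sqrt_abs real_sqrt_zero abs_of_nonneg[OF norm_ge_zero])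
    then show "(\<lambda>n. f (r n) x) \<longlonglongrightarrow> g x" by (rule LIM_zero_cancel[OF tendsto_norm_zero_cancel])
  qed
  with r(1) show ?thesis by blast
qed

context dual_section
begin

text \<open>Plancherel's dense range supplies \<open>g n\<close> whose transforms tend to the
  indicator of \<open>B\<close>, almost everywhere along a subsequence. Dominated convergence with
  bound |f| passes to the limit, and subtracting the total integral, which is 0, isolates the
  integral over the pullback of \<open>B\<close>.\<close>

lemma annihilates_pullback:
  assumes f: "annihilates f" and B: "B \<in> sets (borel_of TH)" and fin: "emeasure mH B < \<infinity>"
  shows "(LINT \<omega>:{\<omega> \<in> \<Omega>. restrict \<omega> \<Gamma> \<in> B}|\<nu>. f \<omega>) = 0"
proof -
  define K where "K = {\<omega> \<in> \<Omega>. restrict \<omega> \<Gamma> \<in> B}"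
  have fi: "integrable \<nu> f" using f by (simp add: annihilates_def)
  then have [measurable]: "f \<in> borel_measurable \<nu>" by simp
  have K [measurable]: "K \<in> sets \<nu>"
    using measurable_sets[OF measurable_restrict B] by (simp add: K_def space_\<nu> vimage_def Int_def conj_commute)
  have ind: "indicator B \<in> L2 mH" by (rule indicator_L2) (use B fin in \<open>simp_all add: mH_def\<close>)
  have indK: "(\<lambda>\<omega>. indicator B (restrict \<omega> \<Gamma>)) \<in> L2 \<nu>" by (rule L2_mH(1)[OF ind])
  have "L2_topology mH closure_of (fourier m\<Gamma> ` {f \<in> L2 m\<Gamma>. integrable m\<Gamma> f}) = L2 mH"
    using dual' by (simp add: dual_haar_measures_def)
  then have "indicator B \<in> seminorm_topology (L2 mH) (L2_norm mH) closure_of (fourier m\<Gamma> ` {f \<in> L2 m\<Gamma>. integrable m\<Gamma> f})"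
    using ind by (simp add: L2_topology_def)
  then have approx: "\<exists>a\<in>fourier m\<Gamma> ` {f \<in> L2 m\<Gamma>. integrable m\<Gamma> f} \<inter> L2 mH. L2_norm mH (a - indicator B) < e"
    if "e > 0" for e
    using that unfolding L2.in_closure_of_iff by blast
  have "\<exists>g. g \<in> L2 m\<Gamma> \<and> integrable m\<Gamma> g \<and> L2_norm \<nu> (hat g - (\<lambda>\<omega>. indicator B (restrict \<omega> \<Gamma>))) < inverse (real (Suc n))" for n
  proof -
    have "0 < inverse (real (Suc n))" by simp
    from approx[OF this] obtain g where g: "g \<in> L2 m\<Gamma>" "integrable m\<Gamma> g" "fourier m\<Gamma> g \<in> L2 mH"
      "L2_norm mH (fourier m\<Gamma> g - indicator B) < inverse (real (Suc n))" by blast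
    have "L2_norm \<nu> (\<lambda>\<omega>. (fourier m\<Gamma> g - indicator B) (restrict \<omega> \<Gamma>)) = L2_norm mH (fourier m\<Gamma> g - indicator B)"
      by (rule L2_mH(2)[OF L2_diff[OF g(3) ind]])
    moreover have "(\<lambda>\<omega>. (fourier m\<Gamma> g - indicator B) (restrict \<omega> \<Gamma>)) = hat g - (\<lambda>\<omega>. indicator B (restrict \<omega> \<Gamma>))"
      by (auto simp: fourier_restrict)
    ultimately have "L2_norm \<nu> (hat g - (\<lambda>\<omega>. indicator B (restrict \<omega> \<Gamma>))) < inverse (real (Suc n))"
      using g(4) by (simp only:)
    then show ?thesis using g(1,2) by blast
  qed
  then obtain g where g: "\<And>n. g n \<in> L2 m\<Gamma>" "\<And>n. integrable m\<Gamma> (g n)"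
    "\<And>n. L2_norm \<nu> (hat (g n) - (\<lambda>\<omega>. indicator B (restrict \<omega> \<Gamma>))) < inverse (real (Suc n))" by metis
  have hL: "hat (g n) \<in> L2 \<nu>" for n by (rule Plancherel(1)[OF g(2,1)])
  have "(\<lambda>n. L2_norm \<nu> (hat (g n) - (\<lambda>\<omega>. indicator B (restrict \<omega> \<Gamma>)))) \<longlonglongrightarrow> 0"
    by (rule Lim_null_comparison[OF _ LIMSEQ_inverse_real_of_nat])
      (use g(3) in \<open>auto intro!: always_eventually less_imp_le simp del: of_nat_Suc\<close>)
  from L2_LIMSEQ_AE_subseq[OF hL indK this] obtain r :: "nat \<Rightarrow> nat" where
    r: "AE \<omega> in \<nu>. (\<lambda>n. hat (g (r n)) \<omega>) \<longlonglongrightarrow> indicator B (restrict \<omega> \<Gamma>)" by blast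
  let ?e = "\<lambda>n \<omega>. exp (\<i> * complex_of_real (pi * Re (hat (g n) \<omega>)))"
  let ?w = "\<lambda>\<omega>. exp (\<i> * complex_of_real (pi * Re (indicator B (restrict \<omega> \<Gamma>) :: complex)))"
  \<comment> \<open>The factor pi was chosen for exp(i pi) = -1: at an indicator the exponential
    takes the two values 1 and -1.\<close>
  have w: "?w \<omega> = 1 - 2 * indicator K \<omega>" if "\<omega> \<in> space \<nu>" for \<omega>
    using that exp_pi_i by (cases "\<omega> \<in> K") (auto simp: K_def space_\<nu> mult.commute[of \<i>])
  note [measurable] = L2_measurable[OF hL] L2_measurable[OF indK]
  have "(\<lambda>n. LINT \<omega>|\<nu>. f \<omega> * ?e (r n) \<omega>) \<longlonglongrightarrow> (LINT \<omega>|\<nu>. f \<omega> * ?w \<omega>)"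
  proof (rule integral_dominated_convergence)
    show "integrable \<nu> (\<lambda>\<omega>. cmod (f \<omega>))" using fi by simp
    show "AE \<omega> in \<nu>. (\<lambda>n. f \<omega> * ?e (r n) \<omega>) \<longlonglongrightarrow> f \<omega> * ?w \<omega>"
      using r by eventually_elim (intro tendsto_intros)
    show "AE \<omega> in \<nu>. norm (f \<omega> * ?e (r n) \<omega>) \<le> cmod (f \<omega>)" for n
      by (auto simp: norm_mult simp flip: cis_conv_exp)
  qed measurable
  moreover have "(LINT \<omega>|\<nu>. f \<omega> * ?e (r n) \<omega>) = 0" for n by (rule annihilates_exp[OF f g(2)])
  ultimately have "(LINT \<omega>|\<nu>. f \<omega> * ?w \<omega>) = 0" by (simp add: LIMSEQ_const_iff)
  moreover have "(LINT \<omega>|\<nu>. f \<omega> * ?w \<omega>) = (LINT \<omega>|\<nu>. f \<omega> - 2 * (indicator K \<omega> *\<^sub>R f \<omega>))"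
    by (intro Bochner_Integration.integral_cong refl) (simp only: w, simp add: indicator_def)
  moreover have "\<dots> = (LINT \<omega>|\<nu>. f \<omega>) - 2 * (LINT \<omega>|\<nu>. indicator K \<omega> *\<^sub>R f \<omega>)"
    by (simp only: Bochner_Integration.integral_diff[OF fi integrable_mult_indicator[OF K fi, THEN integrable_mult_right[of 2]]]
        integral_mult_right_zero)
  ultimately show ?thesis
    using annihilates_integral_0[OF f] by (simp add: set_lebesgue_integral_def K_def)
qed

text \<open>Pullbacks of Borel sets of the dual of \<Gamma> are not known to include all open sets
  of the section. A compact subset of the quotient, however, has a compact and hence closed image
  under \<open>lift\<close>, and by injectivity it is the full preimage of that image. Inner
  regularity of the Haar measure exhausts an open set of finite measure by such sets up to a null
  set.\<close>

lemma annihilates_open: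
  assumes f: "annihilates f" and V: "openin D.S V" and fin: "emeasure \<nu> V < \<infinity>"
  shows "(LINT \<omega>:V|\<nu>. f \<omega>) = 0"
proof -
  have fi: "integrable \<nu> f" using f by (simp add: annihilates_def)
  obtain U where U: "openin D.Q U" "V = {\<omega> \<in> \<Omega>. D.q \<omega> \<in> U}" using V D.openin_S by auto
  have Us: "U \<in> sets mD" by (simp add: D.sets_m borel_of_open U)
  have mU: "emeasure mD U = emeasure \<nu> V" unfolding U(2) \<nu>_\<sigma> by (rule D.emeasure_\<sigma>_q[OF Us, symmetric])
  let ?\<K> = "{K. compactin D.Q K \<and> K \<subseteq> U}"
  have sup: "emeasure mD U = (SUP K\<in>?\<K>. emeasure mD K)"
    using haarD U(1) by (simp add: haar_measure_def D.Q_def)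
  have "?\<K> \<noteq> {}" by (auto intro: exI[of _ "{}"])
  from ennreal_SUP_countable_SUP[OF this, of "emeasure mD"] obtain F :: "nat \<Rightarrow> ennreal" where
    F: "range F \<subseteq> emeasure mD ` ?\<K>" "(SUP K\<in>?\<K>. emeasure mD K) = (SUP i. F i)" by blast
  then have "\<forall>i. \<exists>K. compactin D.Q K \<and> K \<subseteq> U \<and> F i = emeasure mD K" by auto
  then obtain K where K: "\<And>i. compactin D.Q (K i)" "\<And>i. K i \<subseteq> U" "\<And>i. F i = emeasure mD (K i)" by metis
  \<comment> \<open>Finite unions turn the maximising sequence of compact sets into an increasing
    one.\<close>
  define W where "W n = (\<Union>i\<le>n. K i)" for n
  have W: "compactin D.Q (W n)" "W n \<subseteq> U" for n
    unfolding W_def using K by (auto intro!: compactin_Union)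
  define E where "E n = {\<omega> \<in> \<Omega>. D.q \<omega> \<in> W n}" for n
  have lw: "{\<omega> \<in> \<Omega>. restrict \<omega> \<Gamma> \<in> lift ` W n} = E n" for n
  proof (intro subset_antisym subsetI)
    fix \<omega> assume "\<omega> \<in> {\<omega> \<in> \<Omega>. restrict \<omega> \<Gamma> \<in> lift ` W n}"
    then obtain w where w: "\<omega> \<in> \<Omega>" "w \<in> W n" "restrict \<omega> \<Gamma> = lift w" by auto
    have "w \<in> topspace D.Q" using w W(1) compactin_subset_topspace by blast
    note c = D.cross_section[OF this]
    have "D.q \<omega> = D.q (cross_section \<Omega> w)"
      using w(3) dual_q_eq_iff[OF \<Omega>_characters[OF w(1)] \<Omega>_characters[OF c(2)]] by (simp add: lift_def)
    then show "\<omega> \<in> E n" using w c(3) by (simp add: E_def)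
  next
    fix \<omega> assume "\<omega> \<in> E n"
    then show "\<omega> \<in> {\<omega> \<in> \<Omega>. restrict \<omega> \<Gamma> \<in> lift ` W n}"
      using lift_q[OF \<Omega>_characters] by (auto simp: E_def intro!: image_eqI)
  qed
  have comp: "compactin TH (lift ` W n)" for n by (rule image_compactin[OF W(1) continuous_lift])
  have lws: "lift ` W n \<in> sets (borel_of TH)" for n
    by (rule borel_of_closed[OF compactin_imp_closedin[OF Hausdorff_TH comp]])
  have EV: "E n \<subseteq> V" for n using W(2) by (auto simp: E_def U(2))
  have Vs [measurable]: "V \<in> sets \<nu>" by (simp add: \<nu>_\<sigma> D.sets_\<sigma> borel_of_open V)
  have Es [measurable]: "E n \<in> sets \<nu>" for n
    using measurable_sets[OF measurable_restrict lws[of n]] unfolding lw[symmetric]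
    by (simp add: space_\<nu> vimage_def Int_def conj_commute)
  have zero: "(LINT \<omega>:E n|\<nu>. f \<omega>) = 0" for n
  proof -
    have "(\<lambda>\<omega>. restrict \<omega> \<Gamma>) -` (lift ` W n) \<inter> space \<nu> = E n" unfolding lw[symmetric] by (auto simp: space_\<nu>)
    then have "emeasure mH (lift ` W n) = emeasure \<nu> (E n)"
      unfolding mH_def using emeasure_distr[OF measurable_restrict lws] by simp
    also have "\<dots> \<le> emeasure \<nu> V" by (rule emeasure_mono[OF EV Vs])
    finally have "emeasure mH (lift ` W n) < \<infinity>" using fin by simp
    from annihilates_pullback[OF f lws this] show ?thesis unfolding lw .
  qed
  have inc: "incseq E" by (auto simp: incseq_def E_def W_def intro: order_trans)
  have "set_integrable \<nu> (\<Union>n. E n) f"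
    unfolding set_integrable_def by (rule integrable_mult_indicator[OF _ fi]) measurable
  from set_integral_cont_up[OF Es inc this] have "(LINT \<omega>:(\<Union>n. E n)|\<nu>. f \<omega>) = 0"
    unfolding zero by (simp add: LIMSEQ_const_iff)
  moreover have "(LINT \<omega>:V|\<nu>. f \<omega>) = (LINT \<omega>:(\<Union>n. E n)|\<nu>. f \<omega>)"
    unfolding set_lebesgue_integral_def
  proof (rule integral_cong_AE)
    have "emeasure \<nu> V \<le> emeasure \<nu> (\<Union>n. E n)"
      unfolding mU[symmetric] sup F(2)
    proof (rule SUP_least)
      fix i
      \<comment> \<open>The Hausdorff property is at hand in the dual of \<Gamma>, so
        \<open>K i\<close> is seen to be closed as the preimage of its compact image under
        \<open>lift\<close>.\<close>
      have Ki: "K i \<in> sets mD"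
      proof -
        have "E i \<in> sets \<nu>" by simp
        have "{c \<in> topspace D.Q. lift c \<in> lift ` K i} = K i"
        proof (intro subset_antisym subsetI)
          fix c assume "c \<in> {c \<in> topspace D.Q. lift c \<in> lift ` K i}"
          then obtain k where k: "c \<in> topspace D.Q" "k \<in> K i" "lift c = lift k" by auto
          have k': "k \<in> topspace D.Q" using k K(1) compactin_subset_topspace by blast
          note c1 = D.cross_section[OF k(1)] and c2 = D.cross_section[OF k']
          have "D.q (cross_section \<Omega> c) = D.q (cross_section \<Omega> k)"
            using k(3) dual_q_eq_iff[OF \<Omega>_characters[OF c1(2)] \<Omega>_characters[OF c2(2)]] by (simp add: lift_def)
          then show "c \<in> K i" using c1(3) c2(3) k(2) by simp
        qed (use K(1) compactin_subset_topspace in blast)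
        moreover have "closedin D.Q {c \<in> topspace D.Q. lift c \<in> lift ` K i}"
          by (rule closedin_continuous_map_preimage[OF continuous_lift
              compactin_imp_closedin[OF Hausdorff_TH image_compactin[OF K(1) continuous_lift]]])
        ultimately show ?thesis by (simp add: D.sets_m borel_of_closed)
      qed
      have "F i = emeasure \<nu> {\<omega> \<in> \<Omega>. D.q \<omega> \<in> K i}"
        unfolding K(3) \<nu>_\<sigma> by (rule D.emeasure_\<sigma>_q[OF Ki, symmetric])
      also have "\<dots> \<le> emeasure \<nu> (\<Union>n. E n)"
      proof (rule emeasure_mono)
        show "{\<omega> \<in> \<Omega>. D.q \<omega> \<in> K i} \<subseteq> (\<Union>n. E n)" by (auto simp: E_def W_def)
        show "(\<Union>n. E n) \<in> sets \<nu>" by measurable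
      qed
      finally show "F i \<le> emeasure \<nu> (\<Union>n. E n)" .
    qed
    moreover have sub: "(\<Union>n. E n) \<subseteq> V" using EV by auto
    moreover have "emeasure \<nu> (\<Union>n. E n) \<noteq> \<infinity>" using emeasure_mono[OF sub Vs] fin by auto
    ultimately have "emeasure \<nu> (V - (\<Union>n. E n)) = 0"
      using fin by (subst emeasure_Diff) (simp_all add: diff_eq_0_ennreal less_top)
    then have "V - (\<Union>n. E n) \<in> null_sets \<nu>" by (auto simp: null_sets_def)
    from AE_not_in[OF this] show "AE \<omega> in \<nu>. indicat_real V \<omega> *\<^sub>R f \<omega> = indicat_real (\<Union>n. E n) \<omega> *\<^sub>R f \<omega>"
    proof eventually_elim
      fix \<omega> assume "\<omega> \<notin> V - (\<Union>n. E n)"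
      then have "\<omega> \<in> V \<longleftrightarrow> \<omega> \<in> (\<Union>n. E n)" using EV by blast
      then show "indicat_real V \<omega> *\<^sub>R f \<omega> = indicat_real (\<Union>n. E n) \<omega> *\<^sub>R f \<omega>" by (simp add: indicator_def)
    qed
  qed (use fi in measurable)
  ultimately show ?thesis by simp
qed

text \<open>Uniqueness for Fourier transforms on L1. Open sets of finite measure form an
  intersection-stable generator; \<sigma>-finiteness together with outer regularity yields countably
  many of them covering the section.\<close>

theorem annihilates_imp_AE_0:
  assumes f: "annihilates f" shows "AE \<omega> in \<nu>. f \<omega> = 0"
proof -
  have fi: "integrable \<nu> f" using f by (simp add: annihilates_def)
  let ?\<G> = "{V. openin D.S V \<and> emeasure \<nu> V < \<infinity>}"
  have sets: "openin D.S V \<Longrightarrow> V \<in> sets \<nu>" for V by (simp add: \<nu>_\<sigma> D.sets_\<sigma> borel_of_open)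
  obtain T :: "nat \<Rightarrow> ('a \<Rightarrow> complex) set" where T: "range T \<subseteq> sets \<nu>" "(\<Union>i. T i) = space \<nu>"
    "\<And>i. emeasure \<nu> (T i) \<noteq> \<infinity>" using N.sigma_finite by blast
  \<comment> \<open>Outer regularity is a statement on the quotient, so the piece \<open>T i\<close>
    is moved there, enlarged to an open set, and brought back.\<close>
  have "\<exists>V. V \<in> ?\<G> \<and> T i \<subseteq> V" for i
  proof -
    let ?E = "{c \<in> topspace D.Q. cross_section \<Omega> c \<in> T i}"
    have Ti: "T i \<in> sets D.\<sigma>" using T(1) \<nu>_\<sigma> by auto
    have "?E \<in> sets mD" by (rule D.sets_m_cross_section[OF Ti])
    then have "emeasure mD ?E = (INF U\<in>{U. openin D.Q U \<and> ?E \<subseteq> U}. emeasure mD U)"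
      using haarD by (simp add: haar_measure_def D.Q_def)
    moreover have "emeasure mD ?E < \<infinity>"
      using T(3)[of i] D.emeasure_\<sigma>[OF Ti] by (simp add: \<nu>_\<sigma> less_top)
    ultimately have "(INF U\<in>{U. openin D.Q U \<and> ?E \<subseteq> U}. emeasure mD U) < \<infinity>" by simp
    then obtain U where U: "openin D.Q U" "?E \<subseteq> U" "emeasure mD U < \<infinity>" unfolding INF_less_iff by blast
    let ?V = "{\<omega> \<in> \<Omega>. D.q \<omega> \<in> U}"
    have "openin D.S ?V" using U D.openin_S by auto
    moreover have "emeasure \<nu> ?V < \<infinity>"
      using U(1,3) D.emeasure_\<sigma>_q[of U] by (simp add: \<nu>_\<sigma> D.sets_m borel_of_open)
    moreover have "T i \<subseteq> ?V"
    proof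
      fix \<omega> assume \<omega>: "\<omega> \<in> T i"
      then have \<omega>': "\<omega> \<in> \<Omega>" using T(2) space_\<nu> by auto
      then have "D.q \<omega> \<in> topspace D.Q" using D.C_carrier D.topspace_Q by blast
      then have "D.q \<omega> \<in> ?E" using D.cross_section_q[OF \<omega>'] \<omega> by simp
      then show "\<omega> \<in> ?V" using U \<omega>' by blast
    qed
    ultimately show ?thesis by blast
  qed
  then obtain A where A: "\<And>i. A i \<in> ?\<G>" "\<And>i. T i \<subseteq> A i" by metis
  have cov: "(\<Union>i. A i) = space \<nu>"
  proof
    show "(\<Union>i. A i) \<subseteq> space \<nu>"
      by (rule UN_least, rule sets.sets_into_space, rule sets) (use A(1) in auto)
    show "space \<nu> \<subseteq> (\<Union>i. A i)" unfolding T(2)[symmetric] by (rule UN_mono[OF order_refl A(2)])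
  qed
  show ?thesis
  proof (rule AE_eq_0_if_generator[of ?\<G> \<nu> A])
    show "Int_stable ?\<G>"
    proof (rule Int_stableI)
      fix a b assume ab: "a \<in> ?\<G>" "b \<in> ?\<G>"
      then have "emeasure \<nu> (a \<inter> b) \<le> emeasure \<nu> a" by (intro emeasure_mono sets) auto
      then show "a \<inter> b \<in> ?\<G>" using ab by (auto intro: le_less_trans)
    qed
    show "?\<G> \<subseteq> Pow (space \<nu>)"
    proof
      fix V assume "V \<in> ?\<G>"
      then show "V \<in> Pow (space \<nu>)" using sets.sets_into_space[OF sets[of V]] by simp
    qed
    have "sets \<nu> = sigma_sets (space \<nu>) {V. openin D.S V}"
      by (simp add: \<nu>_\<sigma> D.sets_\<sigma> sets_borel_of D.space_\<sigma> D.topspace_S)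
    also have "\<dots> = sigma_sets (space \<nu>) ?\<G>"
    proof (rule sigma_sets_eqI)
      fix V assume "V \<in> {V. openin D.S V}"
      then have V: "openin D.S V" by simp
      have "V = (\<Union>i. V \<inter> A i)" using cov sets.sets_into_space[OF sets[OF V]] by auto
      moreover have "V \<inter> A i \<in> ?\<G>" for i
      proof -
        have "emeasure \<nu> (V \<inter> A i) \<le> emeasure \<nu> (A i)" using A(1)[of i] by (intro emeasure_mono sets) auto
        then show ?thesis using A(1)[of i] V by (auto intro: le_less_trans)
      qed
      then have "(\<Union>i. V \<inter> A i) \<in> sigma_sets (space \<nu>) ?\<G>"
        by (intro sigma_sets.Union sigma_sets.Basic)
      ultimately show "V \<in> sigma_sets (space \<nu>) ?\<G>" by simp
    qed auto
    finally show "sets \<nu> = sigma_sets (space \<nu>) ?\<G>" .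
    show "range A \<subseteq> ?\<G>" using A(1) by blast
    show "(\<Union>i. A i) = space \<nu>" by (rule cov)
    show "f \<in> borel_measurable \<nu>" using fi by simp
    show "set_integrable \<nu> (A i) f" for i
      unfolding set_integrable_def using A(1)[of i] sets by (intro integrable_mult_indicator fi) auto
    show "(LINT \<omega>:B|\<nu>. f \<omega>) = 0" if "B \<in> ?\<G>" for B using annihilates_open[OF f] that by simp
  qed
qed

end


section \<open>The Zak transform\<close>

lemma eq_0_if_le_eps: "0 \<le> (x::real) \<Longrightarrow> (\<And>e. e > 0 \<Longrightarrow> x \<le> e) \<Longrightarrow> x = 0"
  by (meson dense_le_bounded le_less_trans less_eq_real_def not_less field_lbound_gt_zero)

locale zak = dual_section G X mG \<Gamma> m\<Gamma> \<mu> C mQ \<Omega> mD \<nu>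
  for G :: "'a monoid" (structure) and X mG \<Gamma> m\<Gamma> \<mu> C mQ \<Omega> mD \<nu> +
  fixes Z :: "('a \<Rightarrow> complex) \<Rightarrow> ('a \<Rightarrow> complex) \<Rightarrow> 'a \<Rightarrow> complex"
  assumes zak: "zak_transform G X mG m\<Gamma> \<mu> \<nu> Z"
begin

text \<open>The integral formula as an honest function of x in all of G, whereas \<open>Z\<close> is
  tied to it only up to null sets of the section.\<close>

definition zform :: "('a \<Rightarrow> complex) \<Rightarrow> ('a \<Rightarrow> complex) \<Rightarrow> 'a \<Rightarrow> complex" where
  "zform \<psi> \<omega> x = (LINT \<gamma>|m\<Gamma>. \<psi> (x \<otimes> inv \<gamma>) * \<omega> (inv \<gamma>))"

text \<open>For fixed x the value of \<open>zform\<close> is the Fourier transform of this function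
  on \<Gamma>, which is where Plancherel applies.\<close>

definition slice :: "('a \<Rightarrow> complex) \<Rightarrow> 'a \<Rightarrow> 'a \<Rightarrow> complex" where
  "slice \<psi> x \<gamma> = \<psi> (x \<otimes> inv \<gamma>)"

lemma Z_Cc: "\<psi> \<in> Cc X \<Longrightarrow> AE \<omega> in \<nu>. AE x in \<mu>. Z \<psi> \<omega> x = zform \<psi> \<omega> x"
  using zak by (simp add: zak_transform_def zform_def)

lemma zform_eq_hat: assumes "\<omega> \<in> \<Omega>" shows "zform \<psi> \<omega> x = hat (slice \<psi> x) \<omega>"
  unfolding zform_def hat_def slice_def
  by (intro Bochner_Integration.integral_cong refl)
    (simp add: space_m\<Gamma> \<Omega>_inv[OF assms] sub_carrier)

lemma slice_Cc:
  assumes \<psi>: "\<psi> \<in> Cc X" and x: "x \<in> carrier G" shows "slice \<psi> x \<in> Cc (subtopology X \<Gamma>)"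
proof -
  obtain K where K: "continuous_map X euclidean \<psi>" "compactin X K" "\<And>x. x \<in> topspace X - K \<Longrightarrow> \<psi> x = 0"
    using CcD[OF \<psi>] by metis
  have KG: "K \<subseteq> carrier G" using compactin_subset_topspace[OF K(2)] topspace_eq by simp
  have c: "continuous_map X X (\<lambda>y. x \<otimes> inv y)"
    using continuous_map_compose[OF continuous_inv continuous_map_mult_left[OF x]] by (simp add: o_def)
  have c': "continuous_map X X (\<lambda>y. inv y \<otimes> x)"
    by (rule continuous_map_eq[OF c]) (use x in \<open>simp add: topspace_eq m_comm\<close>)
  show ?thesis
  proof (rule S.CcI)
    show "continuous_map (subtopology X \<Gamma>) euclidean (slice \<psi> x)"
      using continuous_map_from_subtopology[OF continuous_map_compose[OF c K(1)]] by (simp add: o_def slice_def[abs_def])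
    have "compactin X (((\<lambda>y. inv y \<otimes> x) ` K) \<inter> \<Gamma>)"
      by (rule compact_Int_closedin[OF image_compactin[OF K(2) c'] closed])
    then show "compactin (subtopology X \<Gamma>) (((\<lambda>y. inv y \<otimes> x) ` K) \<inter> \<Gamma>)"
      by (simp add: compactin_subtopology)
    fix \<gamma> assume "\<gamma> \<in> topspace (subtopology X \<Gamma>) - ((\<lambda>y. inv y \<otimes> x) ` K) \<inter> \<Gamma>"
    then have \<gamma>: "\<gamma> \<in> \<Gamma>" "\<gamma> \<in> carrier G" "\<gamma> \<notin> (\<lambda>y. inv y \<otimes> x) ` K" using sub_carrier by auto
    have "\<gamma> = inv (x \<otimes> inv \<gamma>) \<otimes> x"
      using x \<gamma>(2) by (simp add: inv_mult_group m_assoc)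
    then have "x \<otimes> inv \<gamma> \<notin> K" using \<gamma>(3) by blast
    then show "slice \<psi> x \<gamma> = 0" unfolding slice_def using K(3) x \<gamma>(2) by (simp add: topspace_eq)
  qed
qed

lemmas slice_L1 = S.Cc_L1_L2(2)[OF slice_Cc] and slice_L2 = S.Cc_L1_L2(1)[OF slice_Cc]

lemma zform_integrable:
  assumes "\<psi> \<in> Cc X" "x \<in> carrier G" "\<omega> \<in> \<Omega>"
  shows "integrable m\<Gamma> (\<lambda>\<gamma>. \<psi> (x \<otimes> inv \<gamma>) * \<omega> (inv \<gamma>))"
proof -
  have "integrable m\<Gamma> (\<lambda>\<gamma>. slice \<psi> x \<gamma> * cnj (\<omega> \<gamma>))"
    by (rule hat_integrable[OF slice_L1[OF assms(1,2)] assms(3)])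
  then show ?thesis
    by (rule Bochner_Integration.integrable_cong[THEN iffD1, rotated 2])
      (simp_all add: slice_def space_m\<Gamma> \<Omega>_inv[OF assms(3)] sub_carrier)
qed

text \<open>Quasi-periodicity along \<Gamma>, by translating the Haar integral. The modulus is
  therefore \<Gamma>-invariant, as required for replacing integrals over C by weighted integrals
  over G.\<close>

lemma zform_translate:
  assumes \<psi>: "\<psi> \<in> Cc X" and x: "x \<in> carrier G" and \<gamma>0: "\<gamma>0 \<in> \<Gamma>" and \<omega>: "\<omega> \<in> \<Omega>"
  shows "zform \<psi> \<omega> (x \<otimes> \<gamma>0) = cnj (\<omega> \<gamma>0) * zform \<psi> \<omega> x"
proof -
  have \<gamma>0G: "\<gamma>0 \<in> carrier G" by (rule sub_carrier[OF \<gamma>0])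
  let ?F = "\<lambda>\<gamma>. \<psi> (x \<otimes> \<gamma>0 \<otimes> inv \<gamma>) * \<omega> (inv \<gamma>)"
  have "zform \<psi> \<omega> (x \<otimes> \<gamma>0) = (LINT \<gamma>|m\<Gamma>. ?F \<gamma>)" by (simp add: zform_def)
  also have "\<dots> = (LINT \<gamma>|m\<Gamma>. ?F (\<gamma>0 \<otimes> \<gamma>))"
    by (rule integral_translate_sub[OF \<gamma>0, symmetric])
      (use zform_integrable[OF \<psi> m_closed[OF x \<gamma>0G] \<omega>] in simp)
  also have "\<dots> = (LINT \<gamma>|m\<Gamma>. cnj (\<omega> \<gamma>0) * (\<psi> (x \<otimes> inv \<gamma>) * \<omega> (inv \<gamma>)))"
  proof (intro Bochner_Integration.integral_cong refl)
    fix \<gamma> assume "\<gamma> \<in> space m\<Gamma>"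
    then have \<gamma>: "\<gamma> \<in> carrier G" by (simp add: space_m\<Gamma> sub_carrier)
    have "x \<otimes> \<gamma>0 \<otimes> inv (\<gamma>0 \<otimes> \<gamma>) = x \<otimes> inv \<gamma>"
      using x \<gamma> \<gamma>0G by (simp add: inv_mult m_assoc) (simp add: m_assoc[symmetric])
    moreover have "\<omega> (inv (\<gamma>0 \<otimes> \<gamma>)) = cnj (\<omega> \<gamma>0) * \<omega> (inv \<gamma>)"
      using \<gamma> \<gamma>0G by (simp add: inv_mult \<Omega>_mult[OF \<omega>] \<Omega>_inv[OF \<omega>])
    ultimately show "?F (\<gamma>0 \<otimes> \<gamma>) = cnj (\<omega> \<gamma>0) * (\<psi> (x \<otimes> inv \<gamma>) * \<omega> (inv \<gamma>))" by simp
  qed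
  also have "\<dots> = cnj (\<omega> \<gamma>0) * zform \<psi> \<omega> x" by (simp add: zform_def)
  finally show ?thesis .
qed

text \<open>Joint measurability is available with x ranging over G; this is why Fubini is later
  applied to \<open>\<nu>\<close> and \<open>mG\<close>.\<close>

lemma measurable_zform:
  assumes \<psi>: "\<psi> \<in> Cc X" shows "(\<lambda>(\<omega>, x). zform \<psi> \<omega> x) \<in> borel_measurable (\<nu> \<Otimes>\<^sub>M mG)"
proof -
  have [measurable]: "\<psi> \<in> borel_measurable mG" using Cc_L1_L2(1)[OF \<psi>] by measurable
  note [measurable] = measurable_inv_sub
  have 1: "(\<lambda>p. (snd (fst p), inv (snd p))) \<in> measurable ((\<nu> \<Otimes>\<^sub>M mG) \<Otimes>\<^sub>M m\<Gamma>) (mG \<Otimes>\<^sub>M m\<Gamma>)" by measurable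
  have m1: "(\<lambda>p. \<psi> (snd (fst p) \<otimes> inv (snd p))) \<in> borel_measurable ((\<nu> \<Otimes>\<^sub>M mG) \<Otimes>\<^sub>M m\<Gamma>)"
    using measurable_compose[OF measurable_compose[OF 1 measurable_mult_sub] \<open>\<psi> \<in> borel_measurable mG\<close>] by simp
  have 2: "(\<lambda>p. (fst (fst p), inv (snd p))) \<in> measurable ((\<nu> \<Otimes>\<^sub>M mG) \<Otimes>\<^sub>M m\<Gamma>) (\<nu> \<Otimes>\<^sub>M m\<Gamma>)" by measurable
  have m2: "(\<lambda>p. fst (fst p) (inv (snd p))) \<in> borel_measurable ((\<nu> \<Otimes>\<^sub>M mG) \<Otimes>\<^sub>M m\<Gamma>)"
    using measurable_compose[OF 2 measurable_eval'] by simp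
  have "(\<lambda>q. LINT \<gamma>|m\<Gamma>. \<psi> (snd q \<otimes> inv \<gamma>) * fst q (inv \<gamma>)) \<in> borel_measurable (\<nu> \<Otimes>\<^sub>M mG)"
    by (rule S.borel_measurable_lebesgue_integral)
      (use borel_measurable_times[OF m1 m2] in \<open>simp add: split_beta'\<close>)
  then show ?thesis by (simp add: zform_def split_beta')
qed

section \<open>Isometry, linearity and translation law of the transform\<close>

lemma sep_\<mu>: "L2_separable \<mu>" by (rule M.L2_separable)
lemma sep_G: "L2_separable mG" by (rule L2_separable)

lemma Z_vec: assumes "f \<in> L2 mG" shows "Z f \<in> L2_vec \<nu> \<mu>"
proof -
  have "Z \<in> topspace (L2_topology mG) \<rightarrow> topspace (L2_vec_topology \<nu> \<mu>)"
    using zak by (simp add: zak_transform_def continuous_map_def)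
  then show ?thesis using assms by (auto simp: L2_vec_topology_def)
qed

lemma Z_continuous:
  assumes "f \<in> L2 mG" "e > 0"
  shows "\<exists>d>0. \<forall>g\<in>L2 mG. L2_norm mG (g - f) < d \<longrightarrow> L2_vec_norm \<nu> \<mu> (Z g - Z f) < e"
  by (rule continuous_map_seminorm_topology[OF L2.seminormed_set_axioms seminormed_set_L2_vec[OF sep_\<mu>] _ assms])
    (use zak in \<open>simp add: zak_transform_def L2_topology_def L2_vec_topology_def\<close>)

sublocale V: seminormed_set "L2_vec \<nu> \<mu>" "L2_vec_norm \<nu> \<mu>"
  by (rule seminormed_set_L2_vec[OF sep_\<mu>])

text \<open>The integral of |zform|^2 over C becomes a weighted integral over G, the order of
  integration is exchanged, and Plancherel on \<Gamma> is applied for each x. The result is again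
  \<Gamma>-invariant, so the weight can be removed, and Weil's formula gives the norm over
  G.\<close>

lemma Z_norm_Cc:
  assumes \<psi>: "\<psi> \<in> Cc X" shows "L2_vec_norm \<nu> \<mu> (Z \<psi>) = L2_norm mG \<psi>"
proof -
  have L2: "\<psi> \<in> L2 mG" and [measurable]: "\<psi> \<in> borel_measurable mG" using Cc_L1_L2(1)[OF \<psi>] by (auto dest: L2_measurable)
  note ZV = L2_vecD[OF Z_vec[OF L2]]
  interpret P: pair_sigma_finite \<nu> mG ..
  note [measurable] = measurable_zform[OF \<psi>]
  obtain w :: "'a \<Rightarrow> ennreal" where [measurable]: "w \<in> borel_measurable mG" and w: "\<And>R. R \<in> borel_measurable mG \<Longrightarrow>
      (\<And>x \<gamma>. x \<in> carrier G \<Longrightarrow> \<gamma> \<in> \<Gamma> \<Longrightarrow> R (x \<otimes> \<gamma>) = R x) \<Longrightarrow> (\<integral>\<^sup>+x. R x \<partial>\<mu>) = (\<integral>\<^sup>+x. R x * w x \<partial>mG)"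
    using weil_weight by blast
  let ?R = "\<lambda>\<omega> x. ennreal ((cmod (zform \<psi> \<omega> x))\<^sup>2)"
  let ?R2 = "\<lambda>x. \<integral>\<^sup>+\<gamma>. ennreal ((cmod (\<psi> (x \<otimes> \<gamma>)))\<^sup>2) \<partial>m\<Gamma>"
  have Rm: "(\<lambda>(\<omega>, x). ?R \<omega> x) \<in> borel_measurable (\<nu> \<Otimes>\<^sub>M mG)" by measurable
  have R1: "(\<integral>\<^sup>+x. ?R \<omega> x \<partial>\<mu>) = (\<integral>\<^sup>+x. ?R \<omega> x * w x \<partial>mG)" if \<omega>: "\<omega> \<in> \<Omega>" for \<omega>
  proof (rule w)
    show "?R \<omega> \<in> borel_measurable mG"
      using measurable_compose[OF measurable_Pair1'[of \<omega> \<nu> mG] Rm] \<omega> by (simp add: space_\<nu>)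
    show "?R \<omega> (x \<otimes> \<gamma>) = ?R \<omega> x" if "x \<in> carrier G" "\<gamma> \<in> \<Gamma>" for x \<gamma>
      using \<Omega>_norm[OF \<omega> sub_carrier[OF that(2)]] by (simp add: zform_translate[OF \<psi> that \<omega>] norm_mult)
  qed
  have R2: "(\<integral>\<^sup>+\<omega>. ?R \<omega> x \<partial>\<nu>) = ?R2 x" if x: "x \<in> carrier G" for x
  proof -
    note [measurable] = L2_measurable[OF slice_L2[OF \<psi> x]]
    have "(\<integral>\<^sup>+\<omega>. ?R \<omega> x \<partial>\<nu>) = (\<integral>\<^sup>+\<omega>. ennreal ((cmod (hat (slice \<psi> x) \<omega>))\<^sup>2) \<partial>\<nu>)"
      by (intro nn_integral_cong) (simp add: space_\<nu> zform_eq_hat)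
    also have "\<dots> = ennreal ((L2_norm m\<Gamma> (slice \<psi> x))\<^sup>2)"
      using nn_integral_L2[OF Plancherel(1)] Plancherel(2) slice_L1[OF \<psi> x] slice_L2[OF \<psi> x] by simp
    also have "\<dots> = (\<integral>\<^sup>+\<gamma>. ennreal ((cmod (slice \<psi> x \<gamma>))\<^sup>2) \<partial>m\<Gamma>)"
      by (rule nn_integral_L2[OF slice_L2[OF \<psi> x], symmetric])
    \<comment> \<open>Inversion invariance of the Haar measure on \<Gamma> trades inv \<gamma> for
      \<gamma>.\<close>
    also have "\<dots> = ?R2 x"
      unfolding slice_def by (rule nn_integral_inv_sub[of "\<lambda>\<gamma>. ennreal ((cmod (\<psi> (x \<otimes> \<gamma>)))\<^sup>2)"]) (use x in measurable)
    finally show ?thesis .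
  qed
  have R2m: "?R2 \<in> borel_measurable mG" by measurable
  have R2inv: "?R2 (x \<otimes> \<gamma>) = ?R2 x" if x: "x \<in> carrier G" and \<gamma>: "\<gamma> \<in> \<Gamma>" for x \<gamma>
  proof -
    have "?R2 (x \<otimes> \<gamma>) = (\<integral>\<^sup>+\<gamma>'. ennreal ((cmod (\<psi> (x \<otimes> (\<gamma> \<otimes> \<gamma>'))))\<^sup>2) \<partial>m\<Gamma>)"
      by (intro nn_integral_cong) (simp add: space_m\<Gamma> m_assoc x sub_carrier \<gamma>)
    also have "\<dots> = ?R2 x"
      by (rule nn_integral_translate_sub[OF \<gamma>, of "\<lambda>\<gamma>. ennreal ((cmod (\<psi> (x \<otimes> \<gamma>)))\<^sup>2)"]) (use x in measurable)
    finally show ?thesis .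
  qed
  have "ennreal ((L2_vec_norm \<nu> \<mu> (Z \<psi>))\<^sup>2) = (\<integral>\<^sup>+\<omega>. ennreal ((L2_norm \<mu> (Z \<psi> \<omega>))\<^sup>2) \<partial>\<nu>)"
    unfolding L2_vec_norm_sq by (rule nn_integral_eq_integral[symmetric, OF ZV(2)]) simp
  also have "\<dots> = (\<integral>\<^sup>+\<omega>. (\<integral>\<^sup>+x. ?R \<omega> x * w x \<partial>mG) \<partial>\<nu>)"
  proof (rule nn_integral_cong_AE, use Z_Cc[OF \<psi>] AE_space in eventually_elim)
    fix \<omega> assume ae: "AE x in \<mu>. Z \<psi> \<omega> x = zform \<psi> \<omega> x" and \<omega>: "\<omega> \<in> space \<nu>"
    have "ennreal ((L2_norm \<mu> (Z \<psi> \<omega>))\<^sup>2) = (\<integral>\<^sup>+x. ennreal ((cmod (Z \<psi> \<omega> x))\<^sup>2) \<partial>\<mu>)"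
      by (rule nn_integral_L2[OF ZV(3)[OF \<omega>], symmetric])
    also have "\<dots> = (\<integral>\<^sup>+x. ?R \<omega> x \<partial>\<mu>)"
      by (rule nn_integral_cong_AE) (use ae in eventually_elim, simp)
    also have "\<dots> = (\<integral>\<^sup>+x. ?R \<omega> x * w x \<partial>mG)" by (rule R1) (use \<omega> in \<open>simp add: space_\<nu>\<close>)
    finally show "ennreal ((L2_norm \<mu> (Z \<psi> \<omega>))\<^sup>2) = (\<integral>\<^sup>+x. ?R \<omega> x * w x \<partial>mG)" .
  qed
  also have "\<dots> = (\<integral>\<^sup>+x. (\<integral>\<^sup>+\<omega>. ?R \<omega> x * w x \<partial>\<nu>) \<partial>mG)"
    by (rule P.Fubini'[symmetric]) measurable
  also have "\<dots> = (\<integral>\<^sup>+x. ?R2 x * w x \<partial>mG)"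
  proof (intro nn_integral_cong)
    fix x assume "x \<in> space mG"
    then have x: "x \<in> carrier G" by (simp add: space_m)
    have "(\<lambda>\<omega>. ?R \<omega> x) \<in> borel_measurable \<nu>"
      using measurable_compose[OF measurable_Pair2'[OF \<open>x \<in> space mG\<close>] Rm] by simp
    then show "(\<integral>\<^sup>+\<omega>. ?R \<omega> x * w x \<partial>\<nu>) = ?R2 x * w x"
      by (subst nn_integral_multc) (simp_all only: R2[OF x])
  qed
  also have "\<dots> = (\<integral>\<^sup>+x. ?R2 x \<partial>\<mu>)" by (rule w[OF R2m R2inv, symmetric])
  also have "\<dots> = (\<integral>\<^sup>+x. ennreal ((cmod (\<psi> x))\<^sup>2) \<partial>mG)"
    by (rule weil_nn_integral[symmetric]) measurable
  also have "\<dots> = ennreal ((L2_norm mG \<psi>)\<^sup>2)" by (rule nn_integral_L2[OF L2])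
  finally have "(L2_vec_norm \<nu> \<mu> (Z \<psi>))\<^sup>2 = (L2_norm mG \<psi>)\<^sup>2" by (subst (asm) ennreal_inj) auto
  then show ?thesis by (simp add: power2_eq_iff_nonneg)
qed

text \<open>One function of \<open>Cc X\<close> approximates \<open>f\<close> and \<open>Z f\<close>
  at once when it is chosen within the radius of continuity.\<close>

lemma Cc_approx:
  assumes f: "f \<in> L2 mG" and e: "e > 0"
  shows "\<exists>\<psi>\<in>Cc X. L2_norm mG (\<psi> - f) < e \<and> L2_vec_norm \<nu> \<mu> (Z \<psi> - Z f) < e"
proof -
  from Z_continuous[OF f e] obtain d where d: "d > 0"
    "\<And>g. g \<in> L2 mG \<Longrightarrow> L2_norm mG (g - f) < d \<Longrightarrow> L2_vec_norm \<nu> \<mu> (Z g - Z f) < e" by blast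
  obtain \<psi> where "\<psi> \<in> Cc X" "L2_norm mG (\<psi> - f) < min d e" using Cc_dense[OF f, of "min d e"] d e by auto
  then show ?thesis using d(2)[OF Cc_L1_L2(1)] by (intro bexI[of _ \<psi>]) auto
qed

lemma vec_diff_triangle:
  assumes "F \<in> L2_vec \<nu> \<mu>" "H \<in> L2_vec \<nu> \<mu>"
  shows "L2_vec_norm \<nu> \<mu> F \<le> L2_vec_norm \<nu> \<mu> (H - F) + L2_vec_norm \<nu> \<mu> H"
    "L2_vec_norm \<nu> \<mu> H \<le> L2_vec_norm \<nu> \<mu> (H - F) + L2_vec_norm \<nu> \<mu> F"
proof -
  have d: "F - H \<in> L2_vec \<nu> \<mu>" "H - F \<in> L2_vec \<nu> \<mu>" by (intro L2_vec_diff sep_\<mu> assms)+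
  have "(F - H) + H = F" "(H - F) + F = H" by simp_all
  then show "L2_vec_norm \<nu> \<mu> F \<le> L2_vec_norm \<nu> \<mu> (H - F) + L2_vec_norm \<nu> \<mu> H"
    "L2_vec_norm \<nu> \<mu> H \<le> L2_vec_norm \<nu> \<mu> (H - F) + L2_vec_norm \<nu> \<mu> F"
    using L2_vec_add(2)[OF sep_\<mu> d(1) assms(2)] L2_vec_add(2)[OF sep_\<mu> d(2) assms(1)]
      L2_vec_norm_minus_commute[of \<nu> \<mu> F H] by simp_all
qed

lemma L2_diff_triangle:
  assumes "f \<in> L2 M" "h \<in> L2 M" shows "\<bar>L2_norm M f - L2_norm M h\<bar> \<le> L2_norm M (h - f)"
proof -
  have "(f - h) + h = f" "(h - f) + f = h" by simp_all
  then show ?thesis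
    using L2_norm_triangle[OF L2_diff[OF assms] assms(2)] L2_norm_triangle[OF L2_diff[OF assms(2,1)] assms(1)]
      L2_norm_minus_commute[of M f h] by simp
qed

text \<open>Both sides are continuous in \<open>f\<close>, so the identity extends from the dense
  \<open>Cc X\<close>.\<close>

lemma Z_norm: assumes f: "f \<in> L2 mG" shows "L2_vec_norm \<nu> \<mu> (Z f) = L2_norm mG f"
proof -
  have "\<bar>L2_vec_norm \<nu> \<mu> (Z f) - L2_norm mG f\<bar> \<le> e" if e: "e > 0" for e
  proof -
    have "e / 2 > 0" using e by simp
    from Cc_approx[OF f this] obtain \<psi> where
      \<psi>: "\<psi> \<in> Cc X" "L2_norm mG (\<psi> - f) < e / 2" "L2_vec_norm \<nu> \<mu> (Z \<psi> - Z f) < e / 2" by blast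
    have L: "\<psi> \<in> L2 mG" by (rule Cc_L1_L2(1)[OF \<psi>(1)])
    show ?thesis
      using vec_diff_triangle[OF Z_vec[OF f] Z_vec[OF L]] L2_diff_triangle[OF f L] \<psi>(2,3) Z_norm_Cc[OF \<psi>(1)] by linarith
  qed
  then have "\<bar>L2_vec_norm \<nu> \<mu> (Z f) - L2_norm mG f\<bar> = 0" by (intro eq_0_if_le_eps) auto
  then show ?thesis by simp
qed

lemma vec_norm_0_AE:
  assumes F: "F \<in> L2_vec \<nu> \<mu>" and ae: "AE \<omega> in \<nu>. AE x in \<mu>. F \<omega> x = 0"
  shows "L2_vec_norm \<nu> \<mu> F = 0"
  unfolding L2_vec_norm_eq_0[OF F]
  using ae AE_space
proof eventually_elim
  fix \<omega> assume "AE x in \<mu>. F \<omega> x = 0" "\<omega> \<in> space \<nu>"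
  then show "L2_norm \<mu> (F \<omega>) = 0" using L2_norm_eq_0_iff[OF L2_vecD(3)[OF F]] by blast
qed

lemma Z_add_Cc:
  assumes "\<psi> \<in> Cc X" "\<phi> \<in> Cc X" shows "L2_vec_norm \<nu> \<mu> (Z (\<psi> + \<phi>) - (Z \<psi> + Z \<phi>)) = 0"
proof (rule vec_norm_0_AE)
  have Cc: "\<psi> + \<phi> \<in> Cc X" using cfun_subspace_Cc assms unfolding cfun.subspace_def by blast
  show "Z (\<psi> + \<phi>) - (Z \<psi> + Z \<phi>) \<in> L2_vec \<nu> \<mu>"
    by (intro L2_vec_diff L2_vec_add(1) sep_\<mu> Z_vec Cc_L1_L2(1) assms Cc)
  show "AE \<omega> in \<nu>. AE x in \<mu>. (Z (\<psi> + \<phi>) - (Z \<psi> + Z \<phi>)) \<omega> x = 0"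
    using Z_Cc[OF assms(1)] Z_Cc[OF assms(2)] Z_Cc[OF Cc] AE_space
  proof eventually_elim
    fix \<omega> assume ae: "AE x in \<mu>. Z \<psi> \<omega> x = zform \<psi> \<omega> x" "AE x in \<mu>. Z \<phi> \<omega> x = zform \<phi> \<omega> x"
      "AE x in \<mu>. Z (\<psi> + \<phi>) \<omega> x = zform (\<psi> + \<phi>) \<omega> x" and "\<omega> \<in> space \<nu>"
    then have \<omega>: "\<omega> \<in> \<Omega>" by (simp add: space_\<nu>)
    show "AE x in \<mu>. (Z (\<psi> + \<phi>) - (Z \<psi> + Z \<phi>)) \<omega> x = 0"
      using ae AE_space
    proof eventually_elim
      fix x assume x: "Z \<psi> \<omega> x = zform \<psi> \<omega> x" "Z \<phi> \<omega> x = zform \<phi> \<omega> x"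
        "Z (\<psi> + \<phi>) \<omega> x = zform (\<psi> + \<phi>) \<omega> x" "x \<in> space \<mu>"
      then have xG: "x \<in> carrier G" using space_\<mu> by blast
      have "zform (\<psi> + \<phi>) \<omega> x = zform \<psi> \<omega> x + zform \<phi> \<omega> x"
        unfolding zform_def
        by (subst Bochner_Integration.integral_add[symmetric])
          (simp_all add: zform_integrable assms xG \<omega> distrib_right)
      then show "(Z (\<psi> + \<phi>) - (Z \<psi> + Z \<phi>)) \<omega> x = 0" using x by simp
    qed
  qed
qed

text \<open>Additivity holds on \<open>Cc X\<close> by the integral formula and extends by
  continuity. It takes the form that the defect has seminorm 0, because the values of
  \<open>Z\<close> are functions and not classes.\<close>

lemma Z_add:
  assumes f: "f \<in> L2 mG" and g: "g \<in> L2 mG"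
  shows "L2_vec_norm \<nu> \<mu> (Z (f + g) - (Z f + Z g)) = 0"
proof (rule eq_0_if_le_eps)
  fix e :: real assume e: "e > 0"
  have fg: "f + g \<in> L2 mG" by (intro L2_add f g)
  have e3: "e / 3 > 0" using e by simp
  from Z_continuous[OF fg this] obtain d where d: "d > 0"
    "\<And>h. h \<in> L2 mG \<Longrightarrow> L2_norm mG (h - (f + g)) < d \<Longrightarrow> L2_vec_norm \<nu> \<mu> (Z h - Z (f + g)) < e / 3" by blast
  let ?d = "min (d / 2) (e / 3)"
  have d': "?d > 0" using d e by simp
  obtain \<psi> where \<psi>: "\<psi> \<in> Cc X" "L2_norm mG (\<psi> - f) < ?d" "L2_vec_norm \<nu> \<mu> (Z \<psi> - Z f) < ?d"
    using Cc_approx[OF f d'] by blast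
  obtain \<phi> where \<phi>: "\<phi> \<in> Cc X" "L2_norm mG (\<phi> - g) < ?d" "L2_vec_norm \<nu> \<mu> (Z \<phi> - Z g) < ?d"
    using Cc_approx[OF g d'] by blast
  have L: "\<psi> \<in> L2 mG" "\<phi> \<in> L2 mG" using \<psi> \<phi> Cc_L1_L2(1) by auto
  have "L2_norm mG ((\<psi> - f) + (\<phi> - g)) \<le> L2_norm mG (\<psi> - f) + L2_norm mG (\<phi> - g)"
    by (intro L2_norm_triangle L2_diff L f g)
  moreover have "(\<psi> - f) + (\<phi> - g) = (\<psi> + \<phi>) - (f + g)" by simp
  ultimately have "L2_norm mG ((\<psi> + \<phi>) - (f + g)) < d" using \<psi>(2) \<phi>(2) by auto
  from d(2)[OF L2_add[OF L] this]
  have 1: "L2_vec_norm \<nu> \<mu> (Z (f + g) - Z (\<psi> + \<phi>)) < e / 3" by (simp only: L2_vec_norm_minus_commute)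
  have V: "Z (f + g) \<in> L2_vec \<nu> \<mu>" "Z (\<psi> + \<phi>) \<in> L2_vec \<nu> \<mu>" "Z \<psi> + Z \<phi> \<in> L2_vec \<nu> \<mu>" "Z f + Z g \<in> L2_vec \<nu> \<mu>"
    by (intro L2_vec_add(1) sep_\<mu> Z_vec L2_add f g L)+
  have "L2_vec_norm \<nu> \<mu> ((Z \<psi> - Z f) + (Z \<phi> - Z g)) \<le> L2_vec_norm \<nu> \<mu> (Z \<psi> - Z f) + L2_vec_norm \<nu> \<mu> (Z \<phi> - Z g)"
    by (intro L2_vec_add(2) L2_vec_diff sep_\<mu> Z_vec L f g)
  moreover have "(Z \<psi> - Z f) + (Z \<phi> - Z g) = (Z \<psi> + Z \<phi>) - (Z f + Z g)" by simp
  ultimately have 2: "L2_vec_norm \<nu> \<mu> ((Z \<psi> + Z \<phi>) - (Z f + Z g)) < 2 * (e / 3)" using \<psi>(3) \<phi>(3) by auto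
  show "L2_vec_norm \<nu> \<mu> (Z (f + g) - (Z f + Z g)) \<le> e"
    using V.norm_tri[OF V(1,2,4)] V.norm_tri[OF V(2,3,4)] Z_add_Cc[OF \<psi>(1) \<phi>(1)] 1 2 by linarith
qed simp

lemma vec_norm_0_D:
  assumes "F \<in> L2_vec \<nu> \<mu>" "H \<in> L2_vec \<nu> \<mu>" "L2_vec_norm \<nu> \<mu> (F - H) = 0"
  shows "AE \<omega> in \<nu>. L2_norm \<mu> (F \<omega> - H \<omega>) = 0"
  using L2_vec_norm_eq_0[OF L2_vec_diff[OF sep_\<mu> assms(1,2)], THEN iffD1, OF assms(3)]
  by (simp only: fun_diff_def[of F])

lemma vec_norm_cong:
  assumes "F \<in> L2_vec \<nu> \<mu>" "H \<in> L2_vec \<nu> \<mu>" "L2_vec_norm \<nu> \<mu> (F - H) = 0"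
  shows "L2_vec_norm \<nu> \<mu> F = L2_vec_norm \<nu> \<mu> H"
  using vec_diff_triangle[OF assms(1,2)] assms(3) L2_vec_norm_minus_commute[of \<nu> \<mu> F H] by simp

text \<open>Additivity for the sum (f - g) + g identifies Z f - Z g with Z (f - g) up to seminorm
  0.\<close>

lemma Z_diff_norm:
  assumes f: "f \<in> L2 mG" and g: "g \<in> L2 mG"
  shows "L2_vec_norm \<nu> \<mu> (Z f - Z g) = L2_norm mG (f - g)"
proof -
  have fg: "f - g \<in> L2 mG" by (intro L2_diff f g)
  have "L2_vec_norm \<nu> \<mu> (Z ((f - g) + g) - (Z (f - g) + Z g)) = 0" by (rule Z_add[OF fg g])
  then have "L2_vec_norm \<nu> \<mu> ((Z f - Z g) - Z (f - g)) = 0"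
    by (simp add: diff_diff_eq add.commute)
  from vec_norm_cong[OF L2_vec_diff[OF sep_\<mu> Z_vec[OF f] Z_vec[OF g]] Z_vec[OF fg] this] Z_norm[OF fg]
  show ?thesis by simp
qed

lemma AE_Z_add:
  assumes "f \<in> L2 mG" "g \<in> L2 mG" shows "AE \<omega> in \<nu>. L2_norm \<mu> (Z (f + g) \<omega> - (Z f \<omega> + Z g \<omega>)) = 0"
  using vec_norm_0_D[OF Z_vec[OF L2_add[OF assms]] L2_vec_add(1)[OF sep_\<mu> Z_vec[OF assms(1)] Z_vec[OF assms(2)]] Z_add[OF assms]]
  by simp

text \<open>
  Both sides are continuous in \<open>f\<close> and agree on \<open>Cc X\<close>; \<open>S\<close> is going to be a scaling or a
  translation.
\<close>

lemma Z_intertwine: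
  assumes S: "\<And>f. f \<in> L2 mG \<Longrightarrow> S f \<in> L2 mG" "\<And>f g. S (f - g) = S f - S g"
      "\<And>f. f \<in> L2 mG \<Longrightarrow> L2_norm mG (S f) = c * L2_norm mG f" "c \<ge> 0"
    and k: "k \<in> borel_measurable \<nu>" "\<And>\<omega>. \<omega> \<in> \<Omega> \<Longrightarrow> cmod (k \<omega>) = c"
    and Cc: "\<And>\<psi>. \<psi> \<in> Cc X \<Longrightarrow> S \<psi> \<in> Cc X"
      "\<And>\<psi> \<omega> x. \<psi> \<in> Cc X \<Longrightarrow> \<omega> \<in> \<Omega> \<Longrightarrow> x \<in> carrier G \<Longrightarrow> zform (S \<psi>) \<omega> x = k \<omega> * zform \<psi> \<omega> x"
    and f: "f \<in> L2 mG"
  shows "AE \<omega> in \<nu>. L2_norm \<mu> (Z (S f) \<omega> - cscale (k \<omega>) (Z f \<omega>)) = 0"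
proof -
  define K where "K F = (\<lambda>\<omega>. cscale (k \<omega>) (F \<omega> :: 'a \<Rightarrow> complex))" for F :: "('a \<Rightarrow> complex) \<Rightarrow> 'a \<Rightarrow> complex"
  have KV: "K F \<in> L2_vec \<nu> \<mu>" if "F \<in> L2_vec \<nu> \<mu>" for F
    unfolding K_def by (rule L2_vec_mult_bounded[OF sep_\<mu> that k(1), of c]) (simp add: space_\<nu> k(2))
  have Kn: "L2_vec_norm \<nu> \<mu> (K F) = c * L2_vec_norm \<nu> \<mu> F" if "F \<in> L2_vec \<nu> \<mu>" for F
    unfolding K_def by (rule L2_vec_norm_cscale[OF that]) (simp_all add: space_\<nu> k(2) S(4))
  have Kd: "K F - K H = K (F - H)" for F H by (auto simp: K_def cscale_def fun_eq_iff algebra_simps)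
  have "L2_vec_norm \<nu> \<mu> (Z (S f) - K (Z f)) = 0"
  proof (rule eq_0_if_le_eps)
    fix e :: real assume e: "e > 0"
    \<comment> \<open>Two errors of size c d each have to fit into \<open>e\<close>; the 1 covers c
      = 0.\<close>
    define d where "d = e / (2 * c + 1)"
    have d: "d > 0" "2 * c * d \<le> e" using e S(4) by (simp_all add: d_def field_simps)
    obtain \<psi> where \<psi>: "\<psi> \<in> Cc X" "L2_norm mG (\<psi> - f) < d" "L2_vec_norm \<nu> \<mu> (Z \<psi> - Z f) < d"
      using Cc_approx[OF f d(1)] by blast
    have L: "\<psi> \<in> L2 mG" "S \<psi> \<in> L2 mG" "S f \<in> L2 mG" using Cc_L1_L2(1) \<psi>(1) S(1) f by auto
    have "L2_vec_norm \<nu> \<mu> (Z (S f) - Z (S \<psi>)) = c * L2_norm mG (f - \<psi>)"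
      unfolding Z_diff_norm[OF L(3,2)] S(2)[symmetric] by (rule S(3)) (intro L2_diff f L)
    then have 1: "L2_vec_norm \<nu> \<mu> (Z (S f) - Z (S \<psi>)) \<le> c * d"
      using \<psi>(2) S(4) by (simp add: L2_norm_minus_commute[of mG f] mult_left_mono)
    have V: "Z (S f) \<in> L2_vec \<nu> \<mu>" "Z (S \<psi>) \<in> L2_vec \<nu> \<mu>" "K (Z \<psi>) \<in> L2_vec \<nu> \<mu>" "K (Z f) \<in> L2_vec \<nu> \<mu>"
      by (intro Z_vec L KV f)+
    have 2: "L2_vec_norm \<nu> \<mu> (Z (S \<psi>) - K (Z \<psi>)) = 0"
    proof (rule vec_norm_0_AE[OF L2_vec_diff[OF sep_\<mu> V(2,3)]])
      show "AE \<omega> in \<nu>. AE x in \<mu>. (Z (S \<psi>) - K (Z \<psi>)) \<omega> x = 0"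
        using Z_Cc[OF \<psi>(1)] Z_Cc[OF Cc(1)[OF \<psi>(1)]] AE_space
      proof eventually_elim
        fix \<omega> assume ae: "AE x in \<mu>. Z \<psi> \<omega> x = zform \<psi> \<omega> x" "AE x in \<mu>. Z (S \<psi>) \<omega> x = zform (S \<psi>) \<omega> x"
          and "\<omega> \<in> space \<nu>"
        then have \<omega>: "\<omega> \<in> \<Omega>" by (simp add: space_\<nu>)
        show "AE x in \<mu>. (Z (S \<psi>) - K (Z \<psi>)) \<omega> x = 0"
          using ae AE_space
        proof eventually_elim
          fix x assume x: "Z \<psi> \<omega> x = zform \<psi> \<omega> x" "Z (S \<psi>) \<omega> x = zform (S \<psi>) \<omega> x" "x \<in> space \<mu>"
          then have "x \<in> carrier G" using space_\<mu> by blast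
          then show "(Z (S \<psi>) - K (Z \<psi>)) \<omega> x = 0"
            using x Cc(2)[OF \<psi>(1) \<omega>] by (simp add: K_def cscale_def)
        qed
      qed
    qed
    have "L2_vec_norm \<nu> \<mu> (K (Z \<psi>) - K (Z f)) \<le> c * d"
      unfolding Kd Kn[OF L2_vec_diff[OF sep_\<mu> Z_vec[OF L(1)] Z_vec[OF f]]]
      using \<psi>(3) S(4) by (simp add: mult_left_mono)
    then show "L2_vec_norm \<nu> \<mu> (Z (S f) - K (Z f)) \<le> e"
      using V.norm_tri[OF V(1,2,4)] V.norm_tri[OF V(2,3,4)] 1 2 d(2) by linarith
  qed simp
  from vec_norm_0_D[OF Z_vec[OF S(1)[OF f]] KV[OF Z_vec[OF f]] this] show ?thesis by (simp add: K_def)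
qed

lemma Z_cscale:
  assumes f: "f \<in> L2 mG" shows "AE \<omega> in \<nu>. L2_norm \<mu> (Z (cscale c f) \<omega> - cscale c (Z f \<omega>)) = 0"
proof (rule Z_intertwine[where c="cmod c" and S="cscale c"])
  show "cscale c \<psi> \<in> Cc X" if "\<psi> \<in> Cc X" for \<psi>
    using cfun_subspace_Cc that unfolding cfun.subspace_def by blast
  show "zform (cscale c \<psi>) \<omega> x = c * zform \<psi> \<omega> x" for \<psi> \<omega> x
    by (simp add: zform_def cscale_def mult.assoc)
qed (use f in \<open>auto simp: L2_norm_cscale cfun.scale_right_diff_distrib\<close>)

lemma translate_L2:
  assumes f: "f \<in> L2 mG" and \<gamma>: "\<gamma> \<in> carrier G"
  shows "translate G \<gamma> f \<in> L2 mG" "L2_norm mG (translate G \<gamma> f) = L2_norm mG f"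
proof -
  have i: "inv \<gamma> \<in> carrier G" using \<gamma> by simp
  have m: "(\<lambda>x. x \<otimes> inv \<gamma>) \<in> measurable mG mG"
    using measurable_mult_left[OF i] by (subst measurable_cong[where g="\<lambda>x. inv \<gamma> \<otimes> x"]) (auto simp: space_m m_comm \<gamma>)
  note [measurable] = L2_measurable[OF f]
  have tm: "translate G \<gamma> f \<in> borel_measurable mG"
    unfolding translate_def using measurable_compose[OF m L2_measurable[OF f]] .
  have "(\<integral>\<^sup>+x. ennreal ((cmod (translate G \<gamma> f x))\<^sup>2) \<partial>mG) = (\<integral>\<^sup>+x. ennreal ((cmod (f (inv \<gamma> \<otimes> x)))\<^sup>2) \<partial>mG)"
    unfolding translate_def by (intro nn_integral_cong) (simp add: space_m m_comm \<gamma>)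
  also have "\<dots> = (\<integral>\<^sup>+x. ennreal ((cmod (f x))\<^sup>2) \<partial>mG)"
    by (rule nn_integral_translate[OF i, of "\<lambda>x. ennreal ((cmod (f x))\<^sup>2)"]) measurable
  finally have eq: "(\<integral>\<^sup>+x. ennreal ((cmod (translate G \<gamma> f x))\<^sup>2) \<partial>mG) = ennreal ((L2_norm mG f)\<^sup>2)"
    by (simp only: nn_integral_L2[OF f])
  show L: "translate G \<gamma> f \<in> L2 mG" by (rule L2_I_nn_integral[OF tm]) (simp add: eq)
  have "(L2_norm mG (translate G \<gamma> f))\<^sup>2 = (L2_norm mG f)\<^sup>2"
    using eq nn_integral_L2[OF L] by (simp add: ennreal_inj)
  then show "L2_norm mG (translate G \<gamma> f) = L2_norm mG f" by (simp add: power2_eq_iff_nonneg)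
qed

text \<open>Translating the function translates x in \<open>zform\<close>, and quasi-periodicity
  with inv \<gamma> then produces the factor \<omega> \<gamma>.\<close>

lemma Z_translate:
  assumes f: "f \<in> L2 mG" and \<gamma>: "\<gamma> \<in> \<Gamma>"
  shows "AE \<omega> in \<nu>. L2_norm \<mu> (Z (translate G \<gamma> f) \<omega> - cscale (\<omega> \<gamma>) (Z f \<omega>)) = 0"
proof (rule Z_intertwine[where c=1 and S="translate G \<gamma>"])
  have \<gamma>G: "\<gamma> \<in> carrier G" "inv \<gamma> \<in> \<Gamma>" "inv \<gamma> \<in> carrier G"
    using sub_carrier[OF \<gamma>] subgroup.m_inv_closed[OF subgroup \<gamma>] by auto
  show "translate G \<gamma> \<psi> \<in> Cc X" if \<psi>: "\<psi> \<in> Cc X" for \<psi>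
  proof -
    obtain K where K: "continuous_map X euclidean \<psi>" "compactin X K" "\<And>x. x \<in> topspace X - K \<Longrightarrow> \<psi> x = 0"
      using CcD[OF \<psi>] by metis
    have c: "continuous_map X X (\<lambda>x. x \<otimes> inv \<gamma>)"
      by (rule continuous_map_eq[OF continuous_map_mult_left[OF \<gamma>G(3)]]) (use \<gamma>G in \<open>simp add: topspace_eq m_comm\<close>)
    show ?thesis
    proof (rule CcI)
      show "continuous_map X euclidean (translate G \<gamma> \<psi>)"
        using continuous_map_compose[OF c K(1)] by (simp add: o_def translate_def)
      show "compactin X ((\<lambda>x. \<gamma> \<otimes> x) ` K)"
        by (rule image_compactin[OF K(2) continuous_map_mult_left[OF \<gamma>G(1)]])
      fix x assume x: "x \<in> topspace X - (\<lambda>x. \<gamma> \<otimes> x) ` K"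
      then have xG: "x \<in> carrier G" by (simp add: topspace_eq)
      have "\<gamma> \<otimes> (x \<otimes> inv \<gamma>) = x \<otimes> (\<gamma> \<otimes> inv \<gamma>)" by (rule m_lcomm[OF \<gamma>G(1) xG \<gamma>G(3)])
      then have "x = \<gamma> \<otimes> (x \<otimes> inv \<gamma>)" using xG \<gamma>G(1) by simp
      then have "x \<otimes> inv \<gamma> \<notin> K" using x by blast
      then show "translate G \<gamma> \<psi> x = 0" unfolding translate_def using K(3) xG \<gamma>G by (simp add: topspace_eq)
    qed
  qed
  show "zform (translate G \<gamma> \<psi>) \<omega> x = \<omega> \<gamma> * zform \<psi> \<omega> x" if "\<psi> \<in> Cc X" "\<omega> \<in> \<Omega>" "x \<in> carrier G" for \<psi> \<omega> x
  proof -
    have "zform (translate G \<gamma> \<psi>) \<omega> x = zform \<psi> \<omega> (x \<otimes> inv \<gamma>)"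
      unfolding zform_def translate_def
    proof (intro Bochner_Integration.integral_cong refl)
      fix \<eta> assume "\<eta> \<in> space m\<Gamma>"
      then have \<eta>: "inv \<eta> \<in> carrier G" using sub_carrier by (simp add: space_m\<Gamma>)
      have "x \<otimes> inv \<eta> \<otimes> inv \<gamma> = x \<otimes> inv \<gamma> \<otimes> inv \<eta>"
        using m_assoc[OF that(3) \<eta> \<gamma>G(3)] m_assoc[OF that(3) \<gamma>G(3) \<eta>] m_comm[OF \<eta> \<gamma>G(3)] by simp
      then show "\<psi> (x \<otimes> inv \<eta> \<otimes> inv \<gamma>) * \<omega> (inv \<eta>) = \<psi> (x \<otimes> inv \<gamma> \<otimes> inv \<eta>) * \<omega> (inv \<eta>)" by simp
    qed
    also have "\<dots> = \<omega> \<gamma> * zform \<psi> \<omega> x"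
      using zform_translate[OF that(1,3) \<gamma>G(2) that(2)] \<Omega>_inv[OF that(2) \<gamma>G(1)] by simp
    finally show ?thesis .
  qed
  show "(\<lambda>\<omega>. \<omega> \<gamma>) \<in> borel_measurable \<nu>" by (rule measurable_eval_const[OF \<gamma>])
  show "cmod (\<omega> \<gamma>) = 1" if "\<omega> \<in> \<Omega>" for \<omega> by (rule \<Omega>_norm[OF that \<gamma>G(1)])
  show "translate G \<gamma> (g - h) = translate G \<gamma> g - translate G \<gamma> h" for g h
    by (rule ext) (simp only: translate_def minus_apply)
  show "L2_norm mG (translate G \<gamma> g) = 1 * L2_norm mG g" if "g \<in> L2 mG" for g
    unfolding mult_1 by (rule translate_L2(2)[OF that sub_carrier[OF \<gamma>]])
qed (simp_all only: f translate_L2(1)[OF _ sub_carrier[OF \<gamma>]] zero_le_one)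

lemma L2_inner_null_left:
  assumes "f \<in> L2 M" "g \<in> L2 M" "h \<in> L2 M" "L2_norm M (f - g) = 0"
  shows "L2_inner M f h = L2_inner M g h"
  using L2_Cauchy_Schwarz[OF L2_diff[OF assms(1,2)] assms(3)] assms by (simp add: L2_inner_diff_left)

lemma L2_inner_null_right:
  assumes "f \<in> L2 M" "g \<in> L2 M" "h \<in> L2 M" "L2_norm M (f - g) = 0"
  shows "L2_inner M h f = L2_inner M h g"
  using L2_inner_null_left[OF assms] L2_inner_commute[of M f h] L2_inner_commute[of M g h]
  by (metis complex_cnj_cancel_iff)

text \<open>Polarisation of the isometry: expanding the norm of f + g gives real parts, and
  replacing g by i g gives the imaginary ones.\<close>

lemma Z_inner:
  assumes f: "f \<in> L2 mG" and g: "g \<in> L2 mG"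
  shows "(LINT \<omega>|\<nu>. L2_inner \<mu> (Z f \<omega>) (Z g \<omega>)) = L2_inner mG f g"
proof -
  have Re: "Re (LINT \<omega>|\<nu>. L2_inner \<mu> (Z f \<omega>) (Z g \<omega>)) = Re (L2_inner mG f g)" if g: "g \<in> L2 mG" for g
  proof -
    note F = Z_vec[OF f] and H = Z_vec[OF g]
    note i = L2_vec_inner_integrable(1)[OF sep_\<mu> F H]
    have "(L2_vec_norm \<nu> \<mu> (Z f + Z g))\<^sup>2 = (LINT \<omega>|\<nu>. (L2_norm \<mu> (Z f \<omega>))\<^sup>2 + (L2_norm \<mu> (Z g \<omega>))\<^sup>2
        + 2 * Re (L2_inner \<mu> (Z f \<omega>) (Z g \<omega>)))"
      unfolding L2_vec_norm_sq
      by (intro Bochner_Integration.integral_cong refl)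
        (simp only: plus_fun_apply L2_norm_add_sq[OF L2_vecD(3)[OF F] L2_vecD(3)[OF H]])
    also have "\<dots> = (L2_vec_norm \<nu> \<mu> (Z f))\<^sup>2 + (L2_vec_norm \<nu> \<mu> (Z g))\<^sup>2
        + 2 * Re (LINT \<omega>|\<nu>. L2_inner \<mu> (Z f \<omega>) (Z g \<omega>))"
      unfolding L2_vec_norm_sq using L2_vecD(2)[OF F] L2_vecD(2)[OF H] i by (simp add: integral_Re)
    also have "L2_vec_norm \<nu> \<mu> (Z f + Z g) = L2_norm mG (f + g)"
      using vec_norm_cong[OF Z_vec[OF L2_add[OF f g]] L2_vec_add(1)[OF sep_\<mu> F H] Z_add[OF f g]] Z_norm[OF L2_add[OF f g]]
      by simp
    finally show ?thesis using Z_norm[OF f] Z_norm[OF g] L2_norm_add_sq[OF f g] by simp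
  qed
  have ig: "cscale \<i> g \<in> L2 mG" by (rule L2_cscale[OF g])
  have "(LINT \<omega>|\<nu>. L2_inner \<mu> (Z f \<omega>) (Z (cscale \<i> g) \<omega>)) = (LINT \<omega>|\<nu>. - \<i> * L2_inner \<mu> (Z f \<omega>) (Z g \<omega>))"
  proof (rule integral_cong_AE)
    note i = L2_vec_inner_integrable(1)[OF sep_\<mu> Z_vec[OF f]]
    show "(\<lambda>\<omega>. L2_inner \<mu> (Z f \<omega>) (Z (cscale \<i> g) \<omega>)) \<in> borel_measurable \<nu>"
      "(\<lambda>\<omega>. - \<i> * L2_inner \<mu> (Z f \<omega>) (Z g \<omega>)) \<in> borel_measurable \<nu>"
      using i[OF Z_vec[OF ig]] i[OF Z_vec[OF g]] by auto
    show "AE \<omega> in \<nu>. L2_inner \<mu> (Z f \<omega>) (Z (cscale \<i> g) \<omega>) = - \<i> * L2_inner \<mu> (Z f \<omega>) (Z g \<omega>)"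
      using Z_cscale[OF g, of \<i>] AE_space
    proof eventually_elim
      fix \<omega> assume n: "L2_norm \<mu> (Z (cscale \<i> g) \<omega> - cscale \<i> (Z g \<omega>)) = 0" and \<omega>: "\<omega> \<in> space \<nu>"
      have "L2_inner \<mu> (Z f \<omega>) (Z (cscale \<i> g) \<omega>) = L2_inner \<mu> (Z f \<omega>) (cscale \<i> (Z g \<omega>))"
        by (rule L2_inner_null_right[OF _ _ _ n]) (intro L2_cscale L2_vecD(3)[OF Z_vec] f g ig \<omega>)+
      then show "L2_inner \<mu> (Z f \<omega>) (Z (cscale \<i> g) \<omega>) = - \<i> * L2_inner \<mu> (Z f \<omega>) (Z g \<omega>)"
        by (simp add: L2_inner_cscale_right)
    qed
  qed
  with Re[OF ig] have "Im (LINT \<omega>|\<nu>. L2_inner \<mu> (Z f \<omega>) (Z g \<omega>)) = Im (L2_inner mG f g)"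
    by (simp add: L2_inner_cscale_right)
  then show ?thesis using Re[OF g] by (simp add: complex_eq_iff)
qed

text \<open>Stated for an arbitrary \<open>F\<close> rather than for a transform, since it is also
  applied before \<open>Z\<close> is known to be onto.\<close>

lemma inner_translates_0:
  assumes F: "F \<in> L2_vec \<nu> \<mu>" and \<phi>: "\<phi> \<in> L2 mG"
    and orth: "\<And>\<gamma>. \<gamma> \<in> \<Gamma> \<Longrightarrow> (LINT \<omega>|\<nu>. L2_inner \<mu> (F \<omega>) (Z (translate G \<gamma> \<phi>) \<omega>)) = 0"
  shows "AE \<omega> in \<nu>. L2_inner \<mu> (F \<omega>) (Z \<phi> \<omega>) = 0"
proof (rule annihilates_imp_AE_0)
  let ?h = "\<lambda>\<omega>. L2_inner \<mu> (F \<omega>) (Z \<phi> \<omega>)"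
  have hi: "integrable \<nu> ?h" by (rule L2_vec_inner_integrable(1)[OF sep_\<mu> F Z_vec[OF \<phi>]])
  then have [measurable]: "?h \<in> borel_measurable \<nu>" by simp
  have "(LINT \<omega>|\<nu>. ?h \<omega> * \<omega> \<gamma>) = 0" if \<gamma>: "\<gamma> \<in> \<Gamma>" for \<gamma>
  proof -
    have \<gamma>i: "inv \<gamma> \<in> \<Gamma>" "\<gamma> \<in> carrier G" using subgroup.m_inv_closed[OF subgroup \<gamma>] sub_carrier[OF \<gamma>] by auto
    \<comment> \<open>The inverse translate, because the inner product is conjugate linear in its
      second argument: the conjugate of \<omega> (inv \<gamma>) is \<omega> \<gamma>.\<close>
    let ?t = "translate G (inv \<gamma>) \<phi>"
    have t: "?t \<in> L2 mG" by (rule translate_L2(1)[OF \<phi>]) (use \<gamma>i in simp)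
    have [measurable]: "(\<lambda>\<omega>. \<omega> \<gamma>) \<in> borel_measurable \<nu>" by (rule measurable_eval_const[OF \<gamma>])
    have "(LINT \<omega>|\<nu>. ?h \<omega> * \<omega> \<gamma>) = (LINT \<omega>|\<nu>. L2_inner \<mu> (F \<omega>) (Z ?t \<omega>))"
    proof (rule integral_cong_AE)
      show "(\<lambda>\<omega>. L2_inner \<mu> (F \<omega>) (Z ?t \<omega>)) \<in> borel_measurable \<nu>"
        using L2_vec_inner_integrable(1)[OF sep_\<mu> F Z_vec[OF t]] by auto
      show "AE \<omega> in \<nu>. ?h \<omega> * \<omega> \<gamma> = L2_inner \<mu> (F \<omega>) (Z ?t \<omega>)"
        using Z_translate[OF \<phi> \<gamma>i(1)] AE_space
      proof eventually_elim
        fix \<omega> assume n: "L2_norm \<mu> (Z ?t \<omega> - cscale (\<omega> (inv \<gamma>)) (Z \<phi> \<omega>)) = 0" and \<omega>: "\<omega> \<in> space \<nu>"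
        have "L2_inner \<mu> (F \<omega>) (Z ?t \<omega>) = L2_inner \<mu> (F \<omega>) (cscale (\<omega> (inv \<gamma>)) (Z \<phi> \<omega>))"
          by (rule L2_inner_null_right[OF _ _ _ n])
            (intro L2_cscale L2_vecD(3)[OF Z_vec] L2_vecD(3)[OF F] t \<phi> \<omega>)+
        then show "?h \<omega> * \<omega> \<gamma> = L2_inner \<mu> (F \<omega>) (Z ?t \<omega>)"
          using \<Omega>_inv[OF _ \<gamma>i(2), of \<omega>] \<omega> by (simp add: L2_inner_cscale_right space_\<nu> mult.commute)
      qed
    qed measurable
    then show ?thesis using orth[OF \<gamma>i(1)] by simp
  qed
  then show "annihilates ?h" using hi by (simp add: annihilates_def)
qed

end

lemma closed_subspace_null:
  assumes "closed_subspace M W" "f \<in> W" "g \<in> L2 M" "L2_norm M (g - f) = 0"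
  shows "g \<in> W"
proof -
  have "f \<in> L2 M" using closed_subspaceD(1)[OF assms(1)] assms(2) by blast
  then have "AE x in M. g x = f x" using assms(3,4) L2_norm_diff_eq_0 by blast
  then have "AE x in M. f x = g x" by eventually_elim simp
  then show ?thesis by (rule closed_subspace_cong_AE[OF assms(1-3)])
qed

section \<open>Surjectivity of the transform\<close>

context zak
begin

text \<open>Where the bump does not vanish, \<omega> (inv \<gamma>) is within 1/2 of 1, so the real
  part of the integrand is at least half the bump. A vanishing integral would make the bump vanish
  almost everywhere on the fibre through x, although it is positive on an open set of fibre points
  around the identity of \<Gamma>.\<close>

lemma zform_nonzero:
  assumes \<omega>: "\<omega> \<in> \<Omega>" and x: "x \<in> carrier G" and B: "openin X B" "x \<in> B"
    and near: "\<And>y. y \<in> B \<Longrightarrow> cmod (\<omega> (inv x \<otimes> y) - 1) < 1/2"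
    and u: "continuous_map X euclideanreal u" "\<And>y. 0 \<le> u y" "\<And>y. y \<in> topspace X - B \<Longrightarrow> u y = 0" "u x > 0"
    and Cc: "(\<lambda>y. complex_of_real (u y)) \<in> Cc X"
  shows "zform (\<lambda>y. complex_of_real (u y)) \<omega> x \<noteq> 0"
proof
  assume z: "zform (\<lambda>y. complex_of_real (u y)) \<omega> x = 0"
  let ?F = "\<lambda>\<gamma>. complex_of_real (u (x \<otimes> inv \<gamma>)) * \<omega> (inv \<gamma>)"
  have i: "integrable m\<Gamma> ?F" by (rule zform_integrable[OF Cc x \<omega>])
  have iu: "integrable m\<Gamma> (\<lambda>\<gamma>. u (x \<otimes> inv \<gamma>))"
    using slice_L1[OF Cc x] by (simp add: slice_def[abs_def] complex_of_real_integrable_eq)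
  have ge: "u (x \<otimes> inv \<gamma>) / 2 \<le> Re (?F \<gamma>)" if "\<gamma> \<in> \<Gamma>" for \<gamma>
  proof (cases "x \<otimes> inv \<gamma> \<in> B")
    case True
    have \<gamma>: "\<gamma> \<in> carrier G" by (rule sub_carrier[OF that])
    have "inv x \<otimes> (x \<otimes> inv \<gamma>) = inv \<gamma>" using x \<gamma> by (simp add: m_assoc[symmetric])
    then have "1/2 \<le> Re (\<omega> (inv \<gamma>))" using Re_le_1_near[OF near[OF True]] by simp
    from mult_left_mono[OF this u(2)[of "x \<otimes> inv \<gamma>"]] show ?thesis by simp
  next
    case False
    then show ?thesis using u(3) x sub_carrier[OF that] by (simp add: topspace_eq)
  qed
  have "(LINT \<gamma>|m\<Gamma>. u (x \<otimes> inv \<gamma>) / 2) \<le> (LINT \<gamma>|m\<Gamma>. Re (?F \<gamma>))"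
    by (rule integral_mono) (use iu integrable_Re[OF i] ge in \<open>simp_all add: space_m\<Gamma>\<close>)
  also have "\<dots> = 0" using integral_Re[OF i] z by (simp add: zform_def)
  finally have "(LINT \<gamma>|m\<Gamma>. u (x \<otimes> inv \<gamma>)) \<le> 0" by simp
  moreover have "(LINT \<gamma>|m\<Gamma>. u (x \<otimes> inv \<gamma>)) \<ge> 0" by (intro Bochner_Integration.integral_nonneg u(2))
  ultimately have ae: "AE \<gamma> in m\<Gamma>. u (x \<otimes> inv \<gamma>) = 0"
    using integral_nonneg_eq_0_iff_AE[OF iu] u(2) by simp
  let ?U = "{\<gamma> \<in> topspace (subtopology X \<Gamma>). u (x \<otimes> inv \<gamma>) \<in> {0<..}}"
  have U: "openin (subtopology X \<Gamma>) ?U"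
  proof (rule openin_continuous_map_preimage)
    have "continuous_map X X (\<lambda>y. x \<otimes> inv y)"
      using continuous_map_compose[OF continuous_inv continuous_map_mult_left[OF x]] by (simp add: o_def)
    from continuous_map_from_subtopology[OF continuous_map_compose[OF this u(1)]]
    show "continuous_map (subtopology X \<Gamma>) euclideanreal (\<lambda>\<gamma>. u (x \<otimes> inv \<gamma>))" by (simp add: o_def)
  qed simp
  from ae have "AE \<gamma> in m\<Gamma>. \<gamma> \<notin> ?U" by eventually_elim simp
  then have null: "emeasure m\<Gamma> ?U = 0"
    using AE_iff_measurable[OF S.open_sets[OF U], of "\<lambda>\<gamma>. \<gamma> \<notin> ?U"] S.space_M by auto
  have "\<one> \<in> ?U" using subgroup.one_closed[OF subgroup] u(4) x by (simp add: topspace_eq)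
  then have "?U \<noteq> {}" by (metis empty_iff)
  from S.open_pos[OF U this] show False unfolding null by (rule less_irrefl[THEN notE])
qed

text \<open>Orthogonality to a single Z \<phi> is only one scalar equation at each \<omega>.
  Multiplying \<phi> by \<Gamma>-invariant bumps multiplies the transform by a bump in x, so E
  \<omega> times the conjugate of Z \<phi> \<omega> integrates to 0 over a generator of the section
  and vanishes almost everywhere; at every x some \<phi> has a nonzero transform.\<close>

lemma orthogonal_to_range:
  assumes E: "E \<in> L2_vec \<nu> \<mu>"
    and orth: "\<And>w. w \<in> L2 mG \<Longrightarrow> (LINT \<omega>|\<nu>. L2_inner \<mu> (E \<omega>) (Z w \<omega>)) = 0"
  shows "AE \<omega> in \<nu>. L2_norm \<mu> (E \<omega>) = 0"
proof -
  have ae0: "AE \<omega> in \<nu>. L2_inner \<mu> (E \<omega>) (Z \<phi> \<omega>) = 0" if "\<phi> \<in> L2 mG" for \<phi>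
    by (rule inner_translates_0[OF E that orth]) (rule translate_L2(1)[OF that sub_carrier])
  obtain \<G> where G: "countable \<G>" "\<And>B. B \<in> \<G> \<Longrightarrow> openin X B" "\<And>B. B \<in> \<G> \<Longrightarrow> \<exists>K. compactin X K \<and> B \<subseteq> K"
    "\<And>U x. openin X U \<Longrightarrow> x \<in> U \<Longrightarrow> \<exists>B\<in>\<G>. x \<in> B \<and> B \<subseteq> U"
    using base by metis
  define bump where "bump B u \<longleftrightarrow> (\<forall>j. continuous_map X euclideanreal (u j)) \<and> (\<forall>j x. 0 \<le> u j x \<and> u j x \<le> (1::real))
      \<and> (\<forall>j. \<forall>x\<in>topspace X - B. u j x = 0) \<and> (\<forall>x\<in>B. (\<lambda>j. u j x) \<longlonglongrightarrow> 1)" for B and u :: "nat \<Rightarrow> 'a \<Rightarrow> real"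
  have "\<forall>B\<in>\<G>. \<exists>u. bump B u"
  proof
    fix B assume "B \<in> \<G>"
    from bumps[OF G(2)[OF this]] show "\<exists>u. bump B u" unfolding bump_def by metis
  qed
  then obtain u where "\<And>B. B \<in> \<G> \<Longrightarrow> bump B (u B)" by metis
  then have u: "\<And>B j. B \<in> \<G> \<Longrightarrow> continuous_map X euclideanreal (u B j)"
    "\<And>B j x. B \<in> \<G> \<Longrightarrow> 0 \<le> u B j x"
    "\<And>B j x. B \<in> \<G> \<Longrightarrow> x \<in> topspace X - B \<Longrightarrow> u B j x = 0" "\<And>B x. B \<in> \<G> \<Longrightarrow> x \<in> B \<Longrightarrow> (\<lambda>j. u B j x) \<longlonglongrightarrow> 1"
    unfolding bump_def by blast+
  let ?\<phi> = "\<lambda>B j y. complex_of_real (u B j y)"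
  have \<phi>c: "continuous_map X euclidean (?\<phi> B j)" if "B \<in> \<G>" for B j
    using continuous_map_compose[OF u(1)[OF that], of euclidean complex_of_real]
    by (auto simp: o_def continuous_on_of_real)
  have \<phi>: "?\<phi> B j \<in> Cc X" if B: "B \<in> \<G>" for B j
  proof -
    obtain K where K: "compactin X K" "B \<subseteq> K" using G(3)[OF B] by blast
    show ?thesis by (rule CcI[OF \<phi>c[OF B] K(1)]) (use u(3)[OF B] K(2) in auto)
  qed
  obtain \<H> and A :: "nat \<Rightarrow> 'a set" where H: "countable \<H>" "Int_stable \<H>" "\<H> \<subseteq> Pow (topspace P.S)"
    "sets (borel_of P.S) = sigma_sets (topspace P.S) \<H>" "range A \<subseteq> \<H>" "(\<Union>i. A i) = topspace P.S"
    "\<And>B. B \<in> \<H> \<Longrightarrow> openin P.S B"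
    using M.generator by metis
  define vbump where "vbump B v \<longleftrightarrow> (\<forall>j. continuous_map P.S euclideanreal (v j)) \<and> (\<forall>j x. 0 \<le> v j x \<and> v j x \<le> (1::real))
      \<and> (\<forall>j. \<forall>x\<in>topspace P.S - B. v j x = 0) \<and> (\<forall>x\<in>B. (\<lambda>j. v j x) \<longlonglongrightarrow> 1)" for B and v :: "nat \<Rightarrow> 'a \<Rightarrow> real"
  have "\<forall>B\<in>\<H>. \<exists>v. vbump B v"
  proof
    fix B assume "B \<in> \<H>"
    from M.bumps[OF H(7)[OF this]] show "\<exists>v. vbump B v" unfolding vbump_def by metis
  qed
  then obtain v where "\<And>B. B \<in> \<H> \<Longrightarrow> vbump B (v B)" by metis
  then have v: "\<And>B j. B \<in> \<H> \<Longrightarrow> continuous_map P.S euclideanreal (v B j)"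
    "\<And>B j x. B \<in> \<H> \<Longrightarrow> \<bar>v B j x\<bar> \<le> 1"
    "\<And>B j x. B \<in> \<H> \<Longrightarrow> x \<in> topspace P.S - B \<Longrightarrow> v B j x = 0" "\<And>B x. B \<in> \<H> \<Longrightarrow> x \<in> B \<Longrightarrow> (\<lambda>j. v B j x) \<longlonglongrightarrow> 1"
    unfolding vbump_def by auto
  \<comment> \<open>The bump on the section, made into a continuous \<Gamma>-invariant multiplier on
    G that preserves \<open>Cc X\<close>.\<close>
  define ext where "ext B j y = complex_of_real (v B j (cross_section C (P.q y)))" for B j y
  have extc: "continuous_map X euclidean (ext B j)" if "B \<in> \<H>" for B j
    using continuous_map_compose[OF continuous_map_compose[OF continuous_map_compose[OF P.q_continuous
          P.cross_section_continuous] v(1)[OF that, of j]], of euclidean complex_of_real]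
    by (auto simp: o_def continuous_on_of_real ext_def[abs_def])
  have extinv: "ext B j (x \<otimes> \<gamma>) = ext B j x" if "x \<in> carrier G" "\<gamma> \<in> \<Gamma>" for B j x \<gamma>
  proof -
    have \<gamma>: "\<gamma> \<in> carrier G" by (rule sub_carrier[OF that(2)])
    have "x \<otimes> \<gamma> \<otimes> inv x = \<gamma>" using that(1) \<gamma> by (simp add: m_comm[of x \<gamma>] m_assoc)
    then have "P.q (x \<otimes> \<gamma>) = P.q x" using P.q_eq_iff[of "x \<otimes> \<gamma>" x] that \<gamma> by simp
    then show ?thesis by (simp add: ext_def)
  qed
  have extC: "ext B j x = complex_of_real (v B j x)" if "x \<in> C" for B j x
    using P.cross_section_q[OF that] by (simp add: ext_def)
  let ?\<psi> = "\<lambda>B i D j y. ext D j y * ?\<phi> B i y"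
  have \<psi>: "?\<psi> B i D j \<in> Cc X" if B: "B \<in> \<G>" and D: "D \<in> \<H>" for B i D j
  proof -
    obtain K where K: "compactin X K" "B \<subseteq> K" using G(3)[OF B] by blast
    show ?thesis
      by (rule CcI[OF continuous_map_complex_mult[OF extc[OF D] \<phi>c[OF B]] K(1)]) (use u(3)[OF B] K(2) in auto)
  qed
  have \<psi>z: "zform (?\<psi> B i D j) \<omega> x = complex_of_real (v D j x) * zform (?\<phi> B i) \<omega> x" if x: "x \<in> C" for B i D j \<omega> x
  proof -
    have xG: "x \<in> carrier G" using x P.C_carrier by blast
    have "zform (?\<psi> B i D j) \<omega> x = (LINT \<gamma>|m\<Gamma>. complex_of_real (v D j x) * (?\<phi> B i (x \<otimes> inv \<gamma>) * \<omega> (inv \<gamma>)))"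
      unfolding zform_def
      by (intro Bochner_Integration.integral_cong refl)
        (simp add: space_m\<Gamma> extinv[OF xG subgroup.m_inv_closed[OF subgroup]] extC[OF x])
    then show ?thesis by (simp add: zform_def)
  qed
  \<comment> \<open>The families of bumps are countable, so that one null set of \<omega> serves all
    of them.\<close>
  have ae1: "AE \<omega> in \<nu>. \<forall>B\<in>\<G>. \<forall>i. AE x in \<mu>. Z (?\<phi> B i) \<omega> x = zform (?\<phi> B i) \<omega> x"
    using \<phi> by (simp add: AE_ball_countable[OF G(1)] AE_all_countable Z_Cc)
  have ae2: "AE \<omega> in \<nu>. \<forall>B\<in>\<G>. \<forall>i. \<forall>D\<in>\<H>. \<forall>j. (AE x in \<mu>. Z (?\<psi> B i D j) \<omega> x = zform (?\<psi> B i D j) \<omega> x)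
      \<and> L2_inner \<mu> (E \<omega>) (Z (?\<psi> B i D j) \<omega>) = 0"
    using \<psi> by (simp add: AE_ball_countable[OF G(1)] AE_ball_countable[OF H(1)] AE_all_countable Z_Cc ae0 Cc_L1_L2(1))
  show ?thesis
    using ae1 ae2 AE_space
  proof eventually_elim
    fix \<omega> assume a1: "\<forall>B\<in>\<G>. \<forall>i. AE x in \<mu>. Z (?\<phi> B i) \<omega> x = zform (?\<phi> B i) \<omega> x"
      and a2: "\<forall>B\<in>\<G>. \<forall>i. \<forall>D\<in>\<H>. \<forall>j. (AE x in \<mu>. Z (?\<psi> B i D j) \<omega> x = zform (?\<psi> B i D j) \<omega> x)
      \<and> L2_inner \<mu> (E \<omega>) (Z (?\<psi> B i D j) \<omega>) = 0" and \<omega>s: "\<omega> \<in> space \<nu>"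
    have \<omega>: "\<omega> \<in> \<Omega>" using \<omega>s by (simp add: space_\<nu>)
    have EL: "E \<omega> \<in> L2 \<mu>" by (rule L2_vecD(3)[OF E \<omega>s])
    have [measurable]: "E \<omega> \<in> borel_measurable \<mu>" by (rule L2_measurable[OF EL])
    have ae3: "AE x in \<mu>. E \<omega> x * cnj (Z (?\<phi> B i) \<omega> x) = 0" if B: "B \<in> \<G>" for B i
    proof (rule AE_eq_0_if_generator[of \<H> \<mu> A])
      let ?b = "\<lambda>x. E \<omega> x * cnj (Z (?\<phi> B i) \<omega> x)"
      have ZL: "Z (?\<phi> B i) \<omega> \<in> L2 \<mu>" by (rule L2_vecD(3)[OF Z_vec[OF Cc_L1_L2(1)[OF \<phi>[OF B]]] \<omega>s])
      have bi: "integrable \<mu> ?b" by (rule L2_inner_integrable[OF EL ZL])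
      then show [measurable]: "?b \<in> borel_measurable \<mu>" by simp
      have Hs: "D \<in> sets \<mu>" if "D \<in> \<H>" for D by (rule M.open_sets[OF H(7)[OF that]])
      show "set_integrable \<mu> (A j) ?b" for j
        unfolding set_integrable_def using H(5) Hs by (intro integrable_mult_indicator bi) auto
      fix D assume D: "D \<in> \<H>"
      have [measurable]: "v D j \<in> borel_measurable \<mu>" "D \<in> sets \<mu>" for j
        using M.continuous_measurable[OF v(1)[OF D]] Hs[OF D] by auto
      have zero: "(LINT x|\<mu>. complex_of_real (v D j x) * ?b x) = 0" for j
      proof -
        have "(LINT x|\<mu>. complex_of_real (v D j x) * ?b x) = L2_inner \<mu> (E \<omega>) (Z (?\<psi> B i D j) \<omega>)"
          unfolding L2_inner_def
        proof (rule integral_cong_AE)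
          have "Z (?\<psi> B i D j) \<omega> \<in> L2 \<mu>" by (rule L2_vecD(3)[OF Z_vec[OF Cc_L1_L2(1)[OF \<psi>[OF B D]]] \<omega>s])
          then show "(\<lambda>x. E \<omega> x * cnj (Z (?\<psi> B i D j) \<omega> x)) \<in> borel_measurable \<mu>"
            using L2_inner_integrable[OF EL] by (metis borel_measurable_integrable)
          have "AE x in \<mu>. Z (?\<psi> B i D j) \<omega> x = zform (?\<psi> B i D j) \<omega> x"
            "AE x in \<mu>. Z (?\<phi> B i) \<omega> x = zform (?\<phi> B i) \<omega> x" using a1 a2 B D by blast+
          then show "AE x in \<mu>. complex_of_real (v D j x) * ?b x = E \<omega> x * cnj (Z (?\<psi> B i D j) \<omega> x)"
            using AE_space
          proof eventually_elim
            fix x assume x: "Z (?\<psi> B i D j) \<omega> x = zform (?\<psi> B i D j) \<omega> x" "Z (?\<phi> B i) \<omega> x = zform (?\<phi> B i) \<omega> x"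
              "x \<in> space \<mu>"
            then have "x \<in> C" by (simp add: space_\<mu>_eq)
            then show "complex_of_real (v D j x) * ?b x = E \<omega> x * cnj (Z (?\<psi> B i D j) \<omega> x)"
              unfolding x(1,2) \<psi>z[OF \<open>x \<in> C\<close>] by simp
          qed
        qed measurable
        then show ?thesis using a2 B D by simp
      qed
      have "(\<lambda>j. LINT x|\<mu>. complex_of_real (v D j x) * ?b x) \<longlonglongrightarrow> (LINT x|\<mu>. indicator D x *\<^sub>R ?b x)"
      proof (rule integral_dominated_convergence)
        show "integrable \<mu> (\<lambda>x. norm (?b x))" by (rule integrable_norm[OF bi])
        show "AE x in \<mu>. norm (complex_of_real (v D j x) * ?b x) \<le> norm (?b x)" for j
          using v(2)[OF D, of j] by (auto intro!: AE_I2 mult_left_le_one_le simp: norm_mult)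
        show "AE x in \<mu>. (\<lambda>j. complex_of_real (v D j x) * ?b x) \<longlonglongrightarrow> indicator D x *\<^sub>R ?b x"
        proof (rule AE_I2)
          fix x assume x: "x \<in> space \<mu>"
          show "(\<lambda>j. complex_of_real (v D j x) * ?b x) \<longlonglongrightarrow> indicator D x *\<^sub>R ?b x"
          proof (cases "x \<in> D")
            case True
            have "(\<lambda>j. complex_of_real (v D j x) * ?b x) \<longlonglongrightarrow> complex_of_real 1 * ?b x"
              by (intro tendsto_mult tendsto_of_real v(4)[OF D True] tendsto_const)
            then show ?thesis using True by simp
          next
            case False
            then have "v D j x = 0" for j using v(3)[OF D] x M.space_M by simp
            then show ?thesis using False by simp
          qed
        qed
      qed measurable
      then show "(LINT x:D|\<mu>. ?b x) = 0"
        unfolding zero by (simp add: set_lebesgue_integral_def LIMSEQ_const_iff)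
    qed (use H in \<open>auto simp: M.space_M M.sets_M\<close>)
    have "AE x in \<mu>. \<forall>B\<in>\<G>. \<forall>i. E \<omega> x * cnj (Z (?\<phi> B i) \<omega> x) = 0"
      unfolding AE_ball_countable[OF G(1)] AE_all_countable by (intro ballI allI ae3)
    moreover have "AE x in \<mu>. \<forall>B\<in>\<G>. \<forall>i. Z (?\<phi> B i) \<omega> x = zform (?\<phi> B i) \<omega> x"
      using a1 by (simp add: AE_ball_countable[OF G(1)] AE_all_countable)
    ultimately have "AE x in \<mu>. E \<omega> x = 0"
      using AE_space
    proof eventually_elim
      fix x assume x: "\<forall>B\<in>\<G>. \<forall>i. E \<omega> x * cnj (Z (?\<phi> B i) \<omega> x) = 0"
        "\<forall>B\<in>\<G>. \<forall>i. Z (?\<phi> B i) \<omega> x = zform (?\<phi> B i) \<omega> x" "x \<in> space \<mu>"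
      then have xG: "x \<in> carrier G" using space_\<mu> by blast
      \<comment> \<open>The bump must live where \<omega> (inv x y) is close to 1. It depends on
        \<omega> and x, but is taken from the countable family fixed before.\<close>
      have "continuous_map X euclidean (\<lambda>y. \<omega> (inv x \<otimes> y))"
        using continuous_map_compose[OF continuous_map_mult_left characterD(1)[OF \<Omega>_characters[OF \<omega>]], of "inv x"] xG
        by (simp add: o_def)
      then have "openin X {y \<in> topspace X. \<omega> (inv x \<otimes> y) \<in> ball 1 (1/2)}"
        by (rule openin_continuous_map_preimage) simp
      moreover have "x \<in> {y \<in> topspace X. \<omega> (inv x \<otimes> y) \<in> ball 1 (1/2)}"
        using xG A.character_one[OF \<Omega>_characters[OF \<omega>]] by (simp add: topspace_eq)
      ultimately obtain B where B: "B \<in> \<G>" "x \<in> B" "B \<subseteq> {y \<in> topspace X. \<omega> (inv x \<otimes> y) \<in> ball 1 (1/2)}"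
        using G(4) by meson
      have "eventually (\<lambda>i. u B i x > 0) sequentially" by (rule order_tendstoD(1)[OF u(4)[OF B(1,2)]]) simp
      then obtain i where i: "u B i x > 0" by (auto simp: eventually_sequentially)
      have nz: "zform (?\<phi> B i) \<omega> x \<noteq> 0"
      proof (rule zform_nonzero[OF \<omega> xG G(2)[OF B(1)] B(2) _ u(1)[OF B(1)] u(2)[OF B(1)] u(3)[OF B(1)] i \<phi>[OF B(1)]])
        show "cmod (\<omega> (inv x \<otimes> y) - 1) < 1/2" if "y \<in> B" for y
          using B(3) that by (auto simp: dist_norm norm_minus_commute)
      qed
      from x(1) B(1) have "E \<omega> x * cnj (Z (?\<phi> B i) \<omega> x) = 0" by metis
      moreover from x(2) B(1) have "Z (?\<phi> B i) \<omega> x = zform (?\<phi> B i) \<omega> x" by metis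
      ultimately show "E \<omega> x = 0" using nz by simp
    qed
    then show "L2_norm \<mu> (E \<omega>) = 0" using L2_norm_eq_0_iff[OF EL] by blast
  qed
qed

text \<open>The functional sending w to the integral of <Z w, F> is bounded because \<open>Z\<close>
  is isometric. Its Riesz representative p is the preimage, since Z p - F is orthogonal to the
  range.\<close>

theorem Z_surj:
  assumes F: "F \<in> L2_vec \<nu> \<mu>"
  shows "\<exists>f\<in>L2 mG. AE \<omega> in \<nu>. L2_norm \<mu> (Z f \<omega> - F \<omega>) = 0"
proof -
  let ?l = "\<lambda>f. LINT \<omega>|\<nu>. L2_inner \<mu> (Z f \<omega>) (F \<omega>)"
  note int = L2_vec_inner_integrable[OF sep_\<mu> Z_vec F]
  have "\<exists>p\<in>L2 mG. \<forall>w\<in>L2 mG. ?l w = L2_inner mG w p"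
  proof (rule L2_Riesz[OF closed_subspace_L2])
    fix f g assume f: "f \<in> L2 mG" and g: "g \<in> L2 mG"
    have "?l (f + g) = (LINT \<omega>|\<nu>. L2_inner \<mu> (Z f \<omega>) (F \<omega>) + L2_inner \<mu> (Z g \<omega>) (F \<omega>))"
    proof (rule integral_cong_AE)
      show "AE \<omega> in \<nu>. L2_inner \<mu> (Z (f + g) \<omega>) (F \<omega>) = L2_inner \<mu> (Z f \<omega>) (F \<omega>) + L2_inner \<mu> (Z g \<omega>) (F \<omega>)"
        using AE_Z_add[OF f g] AE_space
      proof eventually_elim
        fix \<omega> assume n: "L2_norm \<mu> (Z (f + g) \<omega> - (Z f \<omega> + Z g \<omega>)) = 0" and \<omega>: "\<omega> \<in> space \<nu>"
        note L = L2_vecD(3)[OF Z_vec[OF f] \<omega>] L2_vecD(3)[OF Z_vec[OF g] \<omega>] L2_vecD(3)[OF F \<omega>]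
          L2_vecD(3)[OF Z_vec[OF L2_add[OF f g]] \<omega>]
        have "L2_inner \<mu> (Z (f + g) \<omega>) (F \<omega>) = L2_inner \<mu> (Z f \<omega> + Z g \<omega>) (F \<omega>)"
          by (rule L2_inner_null_left[OF L(4) L2_add[OF L(1,2)] L(3) n])
        also have "\<dots> = L2_inner \<mu> (Z f \<omega>) (F \<omega>) + L2_inner \<mu> (Z g \<omega>) (F \<omega>)" by (rule L2_inner_add_left[OF L(1-3)])
        finally show "L2_inner \<mu> (Z (f + g) \<omega>) (F \<omega>) = L2_inner \<mu> (Z f \<omega>) (F \<omega>) + L2_inner \<mu> (Z g \<omega>) (F \<omega>)" .
      qed
    qed (use int(1)[OF f] int(1)[OF g] int(1)[OF L2_add[OF f g]] in auto)
    then show "?l (f + g) = ?l f + ?l g" using int(1)[OF f] int(1)[OF g] by simp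
  next
    fix c f assume f: "f \<in> L2 mG"
    have "?l (cscale c f) = (LINT \<omega>|\<nu>. c * L2_inner \<mu> (Z f \<omega>) (F \<omega>))"
    proof (rule integral_cong_AE)
      show "AE \<omega> in \<nu>. L2_inner \<mu> (Z (cscale c f) \<omega>) (F \<omega>) = c * L2_inner \<mu> (Z f \<omega>) (F \<omega>)"
        using Z_cscale[OF f, of c] AE_space
      proof eventually_elim
        fix \<omega> assume n: "L2_norm \<mu> (Z (cscale c f) \<omega> - cscale c (Z f \<omega>)) = 0" and \<omega>: "\<omega> \<in> space \<nu>"
        have "L2_inner \<mu> (Z (cscale c f) \<omega>) (F \<omega>) = L2_inner \<mu> (cscale c (Z f \<omega>)) (F \<omega>)"
          by (rule L2_inner_null_left[OF _ _ _ n]) (intro L2_cscale L2_vecD(3)[OF Z_vec] L2_vecD(3)[OF F] f \<omega>)+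
        then show "L2_inner \<mu> (Z (cscale c f) \<omega>) (F \<omega>) = c * L2_inner \<mu> (Z f \<omega>) (F \<omega>)"
          by (simp add: L2_inner_cscale_left)
      qed
    qed (use int(1)[OF f] int(1)[OF L2_cscale[OF f]] in auto)
    then show "?l (cscale c f) = c * ?l f" by simp
  next
    fix f assume f: "f \<in> L2 mG"
    show "cmod (?l f) \<le> L2_vec_norm \<nu> \<mu> F * L2_norm mG f"
      using int(2)[OF f] Z_norm[OF f] by (simp add: mult.commute)
  qed
  then obtain p where p: "p \<in> L2 mG" "\<And>w. w \<in> L2 mG \<Longrightarrow> ?l w = L2_inner mG w p" by blast
  have E: "Z p - F \<in> L2_vec \<nu> \<mu>" by (rule L2_vec_diff[OF sep_\<mu> Z_vec[OF p(1)] F])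
  have "AE \<omega> in \<nu>. L2_norm \<mu> ((Z p - F) \<omega>) = 0"
  proof (rule orthogonal_to_range[OF E])
    fix w assume w: "w \<in> L2 mG"
    note i1 = L2_vec_inner_integrable(1)[OF sep_\<mu> Z_vec[OF w] Z_vec[OF p(1)]]
    note i2 = int(1)[OF w]
    have "(LINT \<omega>|\<nu>. L2_inner \<mu> ((Z p - F) \<omega>) (Z w \<omega>))
        = (LINT \<omega>|\<nu>. cnj (L2_inner \<mu> (Z w \<omega>) (Z p \<omega>) - L2_inner \<mu> (Z w \<omega>) (F \<omega>)))"
    proof (intro Bochner_Integration.integral_cong refl)
      fix \<omega> assume \<omega>: "\<omega> \<in> space \<nu>"
      note L = L2_vecD(3)[OF Z_vec[OF p(1)] \<omega>] L2_vecD(3)[OF F \<omega>] L2_vecD(3)[OF Z_vec[OF w] \<omega>]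
      have "L2_inner \<mu> ((Z p - F) \<omega>) (Z w \<omega>) = cnj (L2_inner \<mu> (Z w \<omega>) (Z p \<omega> - F \<omega>))"
        unfolding fun_diff_def[of "Z p"] by (rule L2_inner_commute)
      then show "L2_inner \<mu> ((Z p - F) \<omega>) (Z w \<omega>) = cnj (L2_inner \<mu> (Z w \<omega>) (Z p \<omega>) - L2_inner \<mu> (Z w \<omega>) (F \<omega>))"
        by (simp only: L2_inner_diff_right[OF L])
    qed
    also have "\<dots> = cnj (L2_inner mG w p - ?l w)"
      unfolding Bochner_Integration.integral_cnj Bochner_Integration.integral_diff[OF i1 i2] Z_inner[OF w p(1)] ..
    also have "\<dots> = 0" using p(2)[OF w] by simp
    finally show "(LINT \<omega>|\<nu>. L2_inner \<mu> ((Z p - F) \<omega>) (Z w \<omega>)) = 0" .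
  qed
  then show ?thesis using p(1) by (intro bexI[of _ p]) (simp_all only: fun_diff_def[of "Z p"])
qed

end


section \<open>Range functions and invariant spaces\<close>

lemma orth_proj_L2: "closed_subspace M W \<Longrightarrow> a \<in> L2 M \<Longrightarrow> orth_proj M W a \<in> L2 M"
  using orth_proj(1) closed_subspaceD(1) by blast

lemma orth_proj_contract:
  assumes "closed_subspace M W" "a \<in> L2 M" "w \<in> W"
  shows "L2_norm M (orth_proj M W a - w) \<le> L2_norm M (a - w)"
  by (rule power2_le_imp_le) (simp_all add: norm_orth_proj[OF assms])

lemma norm_orth_proj_le:
  assumes "closed_subspace M W" "a \<in> L2 M" shows "L2_norm M (orth_proj M W a) \<le> L2_norm M a"
  using orth_proj_contract[OF assms closed_subspaceD(2)[OF assms(1)]] by simp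

text \<open>The distance to \<open>W\<close> is an infimum over the dense subset \<open>L\<close>;
  with countable \<open>L\<close> this makes it measurable in a parameter.\<close>

lemma dist_orth_proj_less_iff:
  assumes W: "closed_subspace M W" and a: "a \<in> L2 M" and L: "L \<subseteq> W"
    and dense: "\<And>w e. w \<in> W \<Longrightarrow> e > 0 \<Longrightarrow> \<exists>l\<in>L. L2_norm M (l - w) < e"
  shows "L2_norm M (a - orth_proj M W a) < r \<longleftrightarrow> (\<exists>l\<in>L. L2_norm M (l - a) < r)"
proof
  note p = orth_proj(1)[OF W a] orth_proj_L2[OF W a]
  have LL: "l \<in> L2 M" if "l \<in> L" for l using that L closed_subspaceD(1)[OF W] by blast
  show "\<exists>l\<in>L. L2_norm M (l - a) < r" if "L2_norm M (a - orth_proj M W a) < r"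
  proof -
    from dense[OF p(1), of "r - L2_norm M (a - orth_proj M W a)"] that
    obtain l where l: "l \<in> L" "L2_norm M (l - orth_proj M W a) < r - L2_norm M (a - orth_proj M W a)" by auto
    have "L2_norm M (l - a) \<le> L2_norm M (l - orth_proj M W a) + L2_norm M (a - orth_proj M W a)"
      using L2_norm_triangle_diff[OF LL[OF l(1)] p(2) a] L2_norm_minus_commute[of M a] by simp
    then show ?thesis using l by (intro bexI[of _ l]) linarith+
  qed
  assume "\<exists>l\<in>L. L2_norm M (l - a) < r"
  then obtain l where l: "l \<in> L" "L2_norm M (l - a) < r" by blast
  have "(L2_norm M (a - orth_proj M W a))\<^sup>2 \<le> (L2_norm M (a - l))\<^sup>2"
    unfolding norm_orth_proj[OF W a subsetD[OF L l(1)]] by simp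
  then have "L2_norm M (a - orth_proj M W a) \<le> L2_norm M (a - l)" by (rule power2_le_imp_le) simp
  then show "L2_norm M (a - orth_proj M W a) < r" using l(2) L2_norm_minus_commute[of M a l] by linarith
qed

text \<open>By Pythagoras the condition on l and a says exactly that l is within 1/(n + 1) of the
  projection. On the right the projection enters only through its distance to a, which the choice of
  representative does not affect.\<close>

lemma orth_proj_dist_less_iff:
  assumes W: "closed_subspace M W" and a: "a \<in> L2 M" and b: "b \<in> L2 M" and L: "L \<subseteq> W"
    and dense: "\<And>w e. w \<in> W \<Longrightarrow> e > 0 \<Longrightarrow> \<exists>l\<in>L. L2_norm M (l - w) < e"
  shows "L2_norm M (orth_proj M W a - b) < r \<longleftrightarrow>
    (\<exists>n. \<exists>l\<in>L. (L2_norm M (l - a))\<^sup>2 < (L2_norm M (a - orth_proj M W a))\<^sup>2 + (1 / real (Suc n))\<^sup>2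
      \<and> L2_norm M (l - b) < r - 1 / real (Suc n))"
proof
  let ?p = "orth_proj M W a"
  note p = orth_proj(1)[OF W a] orth_proj_L2[OF W a]
  have LL: "l \<in> L2 M" if "l \<in> L" for l using that L closed_subspaceD(1)[OF W] by blast
  have pyth: "(L2_norm M (l - a))\<^sup>2 = (L2_norm M (a - ?p))\<^sup>2 + (L2_norm M (?p - l))\<^sup>2" if "l \<in> L" for l
    using norm_orth_proj[OF W a, of l] that L L2_norm_minus_commute[of M a l] by auto
  {
    assume less: "L2_norm M (?p - b) < r"
    \<comment> \<open>Twice 1/(n + 1) must fit below the slack: once for the distance of l to the
      projection, once for the margin demanded of l.\<close>
    then obtain n where n: "inverse (real (Suc n)) < (r - L2_norm M (?p - b)) / 2"
      using reals_Archimedean[of "(r - L2_norm M (?p - b)) / 2"] by auto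
    have "1 / real (Suc n) > 0" by simp
    from dense[OF p(1) this] obtain l where l: "l \<in> L" "L2_norm M (l - ?p) < 1 / real (Suc n)" by blast
    have "L2_norm M (l - b) \<le> L2_norm M (l - ?p) + L2_norm M (?p - b)"
      by (rule L2_norm_triangle_diff[OF LL[OF l(1)] p(2) b])
    then have "L2_norm M (l - b) < r - 1 / real (Suc n)" using l(2) n by (simp add: inverse_eq_divide)
    moreover have "(L2_norm M (?p - l))\<^sup>2 < (1 / real (Suc n))\<^sup>2"
      using l(2) L2_norm_minus_commute[of M l ?p] by (intro power_strict_mono) simp_all
    ultimately show "\<exists>n. \<exists>l\<in>L. (L2_norm M (l - a))\<^sup>2 < (L2_norm M (a - ?p))\<^sup>2 + (1 / real (Suc n))\<^sup>2
      \<and> L2_norm M (l - b) < r - 1 / real (Suc n)"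
      using pyth[OF l(1)] l(1) by (intro exI[of _ n] bexI[of _ l]) auto
  }
  assume "\<exists>n. \<exists>l\<in>L. (L2_norm M (l - a))\<^sup>2 < (L2_norm M (a - ?p))\<^sup>2 + (1 / real (Suc n))\<^sup>2
      \<and> L2_norm M (l - b) < r - 1 / real (Suc n)"
  then obtain n l where l: "l \<in> L" "(L2_norm M (l - a))\<^sup>2 < (L2_norm M (a - ?p))\<^sup>2 + (1 / real (Suc n))\<^sup>2"
    "L2_norm M (l - b) < r - 1 / real (Suc n)" by blast
  have "(L2_norm M (?p - l))\<^sup>2 < (1 / real (Suc n))\<^sup>2" using pyth[OF l(1)] l(2) by linarith
  then have "L2_norm M (?p - l) < 1 / real (Suc n)" by (rule power2_less_imp_less) simp
  moreover have "L2_norm M (?p - b) \<le> L2_norm M (?p - l) + L2_norm M (l - b)"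
    by (rule L2_norm_triangle_diff[OF p(2) LL[OF l(1)] b])
  ultimately show "L2_norm M (?p - b) < r" using l(3) by linarith
qed

text \<open>Combinations of the \<open>F i\<close> with coefficients in \<open>crat\<close> are
  measurable, and the same countable family is dense in the span at every point. The two preceding
  characterisations express the distances of the projection through this family.\<close>

lemma measurable_range_function_closed_span:
  assumes sep: "L2_separable M" and I: "countable I"
    and F: "\<And>i. i \<in> I \<Longrightarrow> F i \<in> measurable N (L2_borel M)"
  shows "measurable_range_function N M (\<lambda>w. closed_span M ((\<lambda>i. F i w) ` I))"
proof -
  let ?J = "\<lambda>w. closed_span M ((\<lambda>i. F i w) ` I)" and ?l = "\<lambda>xs w. lincomb (\<lambda>i. F i w) xs"
  let ?L = "lists (crat \<times> I)"
  have FL: "(\<lambda>i. F i w) ` I \<subseteq> L2 M" if "w \<in> space N" for w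
    using L2_borel_space[OF F that] by auto
  note J = closed_subspace_closed_span[OF FL]
  have count: "countable ?L" using countable_crat I by (intro countable_lists countable_SIGMA)
  have l [measurable]: "?l xs \<in> measurable N (L2_borel M)" if "xs \<in> ?L" for xs
    by (rule L2_borel_lincomb[OF sep F that])
  have sub: "(\<lambda>xs. ?l xs w) ` ?L \<subseteq> ?J w" if w: "w \<in> space N" for w
  proof -
    have "cfun.span ((\<lambda>i. F i w) ` I) \<subseteq> ?J w"
      by (rule cfun.span_minimal[OF closed_span_superset[OF FL[OF w]]]) (use J[OF w] in \<open>simp add: closed_subspace_def\<close>)
    then show ?thesis using lincomb_in_span[of _ crat I "\<lambda>i. F i w"] by blast
  qed
  have dense: "\<exists>l\<in>(\<lambda>xs. ?l xs w) ` ?L. L2_norm M (l - v) < e" if "w \<in> space N" "v \<in> ?J w" "e > 0" for w v e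
    using lincomb_dense[OF FL[OF that(1)] that(2,3)] by blast
  show ?thesis
    unfolding measurable_range_function_def
  proof (intro conjI ballI)
    fix a assume a: "a \<in> L2 M"
    let ?P = "\<lambda>w. orth_proj M (?J w) a"
    have dm: "(\<lambda>w. L2_norm M (a - ?P w)) \<in> borel_measurable N"
      unfolding borel_measurable_iff_less
    proof
      fix r
      have "{w \<in> space N. L2_norm M (a - ?P w) < r} = (\<Union>xs\<in>?L. {w \<in> space N. L2_norm M (?l xs w - a) < r})"
        using dist_orth_proj_less_iff[OF J a sub dense, of _ r] by auto
      also have "\<dots> \<in> sets N"
        using L2_borel_norm_diff[OF l a, unfolded borel_measurable_iff_less]
        by (intro sets.countable_UN' count image_subsetI) blast
      finally show "{w \<in> space N. L2_norm M (a - ?P w) < r} \<in> sets N" .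
    qed
    show "?P \<in> measurable N (L2_borel M)"
    proof (rule L2_borelI[OF sep orth_proj_L2[OF J a]])
      fix b assume b: "b \<in> L2 M"
      show "(\<lambda>w. L2_norm M (?P w - b)) \<in> borel_measurable N"
        unfolding borel_measurable_iff_less
      proof
        fix r
        let ?E = "\<lambda>n xs. {w \<in> space N. (L2_norm M (?l xs w - a))\<^sup>2 < (L2_norm M (a - ?P w))\<^sup>2 + (1 / real (Suc n))\<^sup>2
            \<and> L2_norm M (?l xs w - b) < r - 1 / real (Suc n)}"
        have "{w \<in> space N. L2_norm M (?P w - b) < r} = (\<Union>n. \<Union>xs\<in>?L. ?E n xs)"
          using orth_proj_dist_less_iff[OF J a b sub dense, of _ r] by auto
        also have "\<dots> \<in> sets N"
        proof (intro sets.countable_UN sets.countable_UN' count image_subsetI)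
          fix n xs assume xs: "xs \<in> ?L"
          note [measurable] = dm L2_borel_norm_diff[OF l[OF xs] a] L2_borel_norm_diff[OF l[OF xs] b]
          show "?E n xs \<in> sets N" by measurable
        qed
        finally show "{w \<in> space N. L2_norm M (?P w - b) < r} \<in> sets N" .
      qed
    qed
  qed (rule J)
qed

section \<open>The correspondence between range functions and invariant spaces\<close>

context zak
begin

lemma closed_subspace_range:
  assumes J: "\<And>\<omega>. \<omega> \<in> space \<nu> \<Longrightarrow> closed_subspace \<mu> (J \<omega>)"
  shows "closed_subspace mG (range_space mG \<nu> Z J)" "\<And>\<gamma>. \<gamma> \<in> \<Gamma> \<Longrightarrow> translate G \<gamma> ` range_space mG \<nu> Z J \<subseteq> range_space mG \<nu> Z J"
proof -
  let ?V = "range_space mG \<nu> Z J"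
  \<comment> \<open>The laws of \<open>Z\<close> hold only up to seminorm 0 at almost every
    \<omega>; closed subspaces absorb that error.\<close>
  have mem: "g \<in> ?V" if g: "g \<in> L2 mG" and h: "AE \<omega> in \<nu>. h \<omega> \<in> J \<omega>"
    "AE \<omega> in \<nu>. L2_norm \<mu> (Z g \<omega> - h \<omega>) = 0" for g h
  proof -
    have "AE \<omega> in \<nu>. Z g \<omega> \<in> J \<omega>"
      using h AE_space
    proof eventually_elim
      fix \<omega> assume h: "h \<omega> \<in> J \<omega>" "L2_norm \<mu> (Z g \<omega> - h \<omega>) = 0" and \<omega>: "\<omega> \<in> space \<nu>"
      show "Z g \<omega> \<in> J \<omega>" by (rule closed_subspace_null[OF J[OF \<omega>] h(1) L2_vecD(3)[OF Z_vec[OF g] \<omega>] h(2)])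
    qed
    then show ?thesis using g by (simp add: range_space_def)
  qed
  have VD: "f \<in> L2 mG" "AE \<omega> in \<nu>. Z f \<omega> \<in> J \<omega>" if "f \<in> ?V" for f
    using that by (auto simp: range_space_def)
  show "translate G \<gamma> ` ?V \<subseteq> ?V" if \<gamma>: "\<gamma> \<in> \<Gamma>" for \<gamma>
  proof (intro image_subsetI)
    fix f assume f: "f \<in> ?V"
    have "AE \<omega> in \<nu>. cscale (\<omega> \<gamma>) (Z f \<omega>) \<in> J \<omega>"
      using VD(2)[OF f] AE_space by eventually_elim (rule closed_subspaceD(4)[OF J])
    then show "translate G \<gamma> f \<in> ?V"
      by (rule mem[OF translate_L2(1)[OF VD(1)[OF f] sub_carrier[OF \<gamma>]] _ Z_translate[OF VD(1)[OF f] \<gamma>]])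
  qed
  show "closed_subspace mG ?V"
  proof (rule closed_subspaceI)
    show "?V \<subseteq> L2 mG" using VD(1) by blast
    show "cfun.subspace ?V"
      unfolding cfun.subspace_def
    proof (intro conjI ballI allI)
      have z: "L2_vec_norm \<nu> \<mu> (Z 0) = 0" using Z_norm[OF L2_zero] by simp
      show "0 \<in> ?V"
      proof (rule mem[OF L2_zero, of "\<lambda>_. 0"])
        show "AE \<omega> in \<nu>. 0 \<in> J \<omega>" using AE_space by eventually_elim (rule closed_subspaceD(2)[OF J])
        show "AE \<omega> in \<nu>. L2_norm \<mu> (Z 0 \<omega> - 0) = 0"
          using z unfolding L2_vec_norm_eq_0[OF Z_vec[OF L2_zero]] diff_zero .
      qed
    next
      fix f g assume f: "f \<in> ?V" and g: "g \<in> ?V"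
      have "AE \<omega> in \<nu>. Z f \<omega> + Z g \<omega> \<in> J \<omega>"
        using VD(2)[OF f] VD(2)[OF g] AE_space by eventually_elim (rule closed_subspaceD(3)[OF J])
      then show "f + g \<in> ?V"
        by (rule mem[OF L2_add[OF VD(1)[OF f] VD(1)[OF g]] _ AE_Z_add[OF VD(1)[OF f] VD(1)[OF g]]])
    next
      fix c f assume f: "f \<in> ?V"
      have "AE \<omega> in \<nu>. cscale c (Z f \<omega>) \<in> J \<omega>"
        using VD(2)[OF f] AE_space by eventually_elim (rule closed_subspaceD(4)[OF J])
      then show "cscale c f \<in> ?V"
        by (rule mem[OF L2_cscale[OF VD(1)[OF f]] _ Z_cscale[OF VD(1)[OF f]]])
    qed
    fix f assume f: "f \<in> L2 mG" and lim: "\<And>e. e > 0 \<Longrightarrow> \<exists>a\<in>?V. L2_norm mG (a - f) < e"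
    have "\<exists>a\<in>?V. L2_norm mG (a - f) < 1 / real (Suc n)" for n by (rule lim) simp
    then obtain a where a: "\<And>n. a n \<in> ?V" "\<And>n. L2_norm mG (a n - f) < 1 / real (Suc n)" by metis
    have "(\<lambda>n. L2_norm mG (a n - f)) \<longlonglongrightarrow> 0"
      by (rule Lim_null_comparison[OF _ LIMSEQ_inverse_real_of_nat])
        (use a(2) in \<open>auto intro!: always_eventually less_imp_le simp: inverse_eq_divide\<close>)
    then have "(\<lambda>n. L2_vec_norm \<nu> \<mu> (Z (a n) - Z f)) \<longlonglongrightarrow> 0" by (simp only: Z_diff_norm[OF VD(1)[OF a(1)] f])
    \<comment> \<open>Norm convergence gives pointwise convergence only along a subsequence, which
      is enough to stay in the closed J(\<omega>).\<close>
    from L2_vec_LIMSEQ_AE_subseq[OF sep_\<mu> Z_vec[OF VD(1)[OF a(1)]] Z_vec[OF f] this]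
    obtain r where r: "AE \<omega> in \<nu>. (\<lambda>n. L2_norm \<mu> (Z (a (r n)) \<omega> - Z f \<omega>)) \<longlonglongrightarrow> 0" by blast
    have "AE \<omega> in \<nu>. \<forall>n. Z (a n) \<omega> \<in> J \<omega>" unfolding AE_all_countable using VD(2)[OF a(1)] by blast
    then have "AE \<omega> in \<nu>. Z f \<omega> \<in> J \<omega>"
      using r AE_space
    proof eventually_elim
      fix \<omega> assume m: "\<forall>n. Z (a n) \<omega> \<in> J \<omega>" and c: "(\<lambda>n. L2_norm \<mu> (Z (a (r n)) \<omega> - Z f \<omega>)) \<longlonglongrightarrow> 0"
        and \<omega>: "\<omega> \<in> space \<nu>"
      show "Z f \<omega> \<in> J \<omega>"
        by (rule closed_subspace_LIMSEQ[OF J[OF \<omega>] L2_vecD(3)[OF Z_vec[OF f] \<omega>] _ c]) (use m in blast)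
    qed
    then show "f \<in> ?V" using f by (simp add: range_space_def)
  qed
qed

lemma invariant_range_space:
  "(\<And>\<omega>. \<omega> \<in> space \<nu> \<Longrightarrow> closed_subspace \<mu> (J \<omega>)) \<Longrightarrow> invariant_space G mG \<Gamma> (range_space mG \<nu> Z J)"
  unfolding invariant_space_def using closed_subspace_range by blast

definition span_range :: "('a \<Rightarrow> complex) set \<Rightarrow> ('a \<Rightarrow> complex) \<Rightarrow> ('a \<Rightarrow> complex) set" where
  "span_range A \<omega> = closed_span \<mu> ((\<lambda>\<phi>. Z \<phi> \<omega>) ` A)"

lemma span_range_L2: "A \<subseteq> L2 mG \<Longrightarrow> \<omega> \<in> space \<nu> \<Longrightarrow> (\<lambda>\<phi>. Z \<phi> \<omega>) ` A \<subseteq> L2 \<mu>"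
  using L2_vecD(3)[OF Z_vec] by blast

lemma measurable_span_range:
  assumes "A \<subseteq> L2 mG" "countable A" shows "measurable_range_function \<nu> \<mu> (span_range A)"
  unfolding span_range_def
  by (rule measurable_range_function_closed_span[OF sep_\<mu> assms(2)]) (use assms(1) L2_vecD(1)[OF Z_vec] in blast)

lemma translates_L2:
  assumes "A \<subseteq> L2 mG" shows "{translate G \<gamma> \<phi> | \<gamma> \<phi>. \<gamma> \<in> \<Gamma> \<and> \<phi> \<in> A} \<subseteq> L2 mG"
  using assms translate_L2(1) sub_carrier by blast

lemma closed_subspace_generated: "A \<subseteq> L2 mG \<Longrightarrow> closed_subspace mG (generated_space G mG \<Gamma> A)"
  unfolding generated_space_def by (rule closed_subspace_closed_span[OF translates_L2])

lemma translate_in_generated: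
  assumes "A \<subseteq> L2 mG" "\<gamma> \<in> \<Gamma>" "\<phi> \<in> A" shows "translate G \<gamma> \<phi> \<in> generated_space G mG \<Gamma> A"
  unfolding generated_space_def using closed_span_superset[OF translates_L2[OF assms(1)]] assms(2,3) by blast

lemma generated_space_minimal:
  assumes "invariant_space G mG \<Gamma> V" "A \<subseteq> V" shows "generated_space G mG \<Gamma> A \<subseteq> V"
  unfolding generated_space_def
  by (rule closed_span_minimal) (use assms in \<open>auto simp: invariant_space_def\<close>)

text \<open>For the harder inclusion, the residual after projection to the generated space still
  lies in the range space, because the projection does. At almost every \<omega> it is then both in
  the closed span of the Z \<phi> \<omega> and orthogonal to them, hence null.\<close>

lemma range_space_span_range:
  assumes A: "A \<subseteq> L2 mG" and count: "countable A"
  shows "range_space mG \<nu> Z (span_range A) = generated_space G mG \<Gamma> A"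
proof
  let ?S = "generated_space G mG \<Gamma> A" and ?R = "range_space mG \<nu> Z (span_range A)"
  have J: "closed_subspace \<mu> (span_range A \<omega>)" if "\<omega> \<in> space \<nu>" for \<omega>
    unfolding span_range_def by (rule closed_subspace_closed_span[OF span_range_L2[OF A that]])
  have sup: "Z \<phi> \<omega> \<in> span_range A \<omega>" if "\<phi> \<in> A" "\<omega> \<in> space \<nu>" for \<phi> \<omega>
    unfolding span_range_def using closed_span_superset[OF span_range_L2[OF A that(2)]] that(1) by blast
  have V: "closed_subspace mG ?R" by (rule closed_subspace_range(1)[OF J])
  have "A \<subseteq> ?R" unfolding range_space_def using A sup by (auto intro!: AE_I2)
  from generated_space_minimal[OF invariant_range_space[of "span_range A", OF J] this] show le: "?S \<subseteq> ?R" .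
  show "?R \<subseteq> ?S"
  proof
    fix f assume f: "f \<in> ?R"
    then have fL: "f \<in> L2 mG" by (simp add: range_space_def)
    note SC = closed_subspace_generated[OF A]
    let ?p = "orth_proj mG ?S f"
    let ?r = "f - ?p"
    have p: "?p \<in> ?S" by (rule orth_proj(1)[OF SC fL])
    have r: "?r \<in> ?R" by (rule closed_subspaceD(5)[OF V f]) (rule subsetD[OF le p])
    then have rL: "?r \<in> L2 mG" "AE \<omega> in \<nu>. Z ?r \<omega> \<in> span_range A \<omega>" by (auto simp: range_space_def)
    have "AE \<omega> in \<nu>. L2_inner \<mu> (Z ?r \<omega>) (Z \<phi> \<omega>) = 0" if \<phi>: "\<phi> \<in> A" for \<phi>
    proof (rule inner_translates_0[OF Z_vec[OF rL(1)]])
      show \<phi>L: "\<phi> \<in> L2 mG" using A \<phi> by blast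
      fix \<gamma> assume \<gamma>: "\<gamma> \<in> \<Gamma>"
      have "(LINT \<omega>|\<nu>. L2_inner \<mu> (Z ?r \<omega>) (Z (translate G \<gamma> \<phi>) \<omega>)) = L2_inner mG ?r (translate G \<gamma> \<phi>)"
        by (rule Z_inner[OF rL(1) translate_L2(1)[OF \<phi>L sub_carrier[OF \<gamma>]]])
      also have "\<dots> = 0" by (rule orth_proj(2)[OF SC fL translate_in_generated[OF A \<gamma> \<phi>]])
      finally show "(LINT \<omega>|\<nu>. L2_inner \<mu> (Z ?r \<omega>) (Z (translate G \<gamma> \<phi>) \<omega>)) = 0" .
    qed
    then have "AE \<omega> in \<nu>. \<forall>\<phi>\<in>A. L2_inner \<mu> (Z ?r \<omega>) (Z \<phi> \<omega>) = 0"
      unfolding AE_ball_countable[OF count] by blast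
    then have "AE \<omega> in \<nu>. L2_norm \<mu> (Z ?r \<omega>) = 0"
      using rL(2) AE_space
    proof eventually_elim
      fix \<omega> assume o: "\<forall>\<phi>\<in>A. L2_inner \<mu> (Z ?r \<omega>) (Z \<phi> \<omega>) = 0" and m: "Z ?r \<omega> \<in> span_range A \<omega>"
        and \<omega>: "\<omega> \<in> space \<nu>"
      have ZL: "Z ?r \<omega> \<in> L2 \<mu>" by (rule L2_vecD(3)[OF Z_vec[OF rL(1)] \<omega>])
      have "span_range A \<omega> \<subseteq> {h \<in> L2 \<mu>. L2_inner \<mu> h (Z ?r \<omega>) = 0}"
        unfolding span_range_def
      proof (rule closed_span_minimal[OF closed_subspace_orthogonal[OF ZL]], intro image_subsetI CollectI conjI)
        fix \<phi> assume \<phi>: "\<phi> \<in> A"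
        show "Z \<phi> \<omega> \<in> L2 \<mu>" using span_range_L2[OF A \<omega>] \<phi> by blast
        show "L2_inner \<mu> (Z \<phi> \<omega>) (Z ?r \<omega>) = 0"
          unfolding L2_inner_commute[of \<mu> "Z \<phi> \<omega>"] using o \<phi> by simp
      qed
      then have "L2_inner \<mu> (Z ?r \<omega>) (Z ?r \<omega>) = 0" using m by blast
      then show "L2_norm \<mu> (Z ?r \<omega>) = 0" by (simp add: L2_inner_self)
    qed
    then have "L2_norm mG ?r = 0"
      unfolding Z_norm[OF rL(1), symmetric] L2_vec_norm_eq_0[OF Z_vec[OF rL(1)]] .
    then show "f \<in> ?S" by (rule closed_subspace_null[OF SC p fL])
  qed
qed

text \<open>Stated as an inclusion, so that uniqueness follows by applying it in both directions.
  The inclusion of range spaces is tested on preimages of the cut-off projections, and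
  \<sigma>-finiteness lets the cut-offs exhaust \<Omega>.\<close>

lemma range_space_subset_imp:
  assumes J: "measurable_range_function \<nu> \<mu> J"
    and J': "\<And>\<omega>. \<omega> \<in> space \<nu> \<Longrightarrow> closed_subspace \<mu> (J' \<omega>)"
    and sub: "range_space mG \<nu> Z J \<subseteq> range_space mG \<nu> Z J'"
  shows "AE \<omega> in \<nu>. J \<omega> \<subseteq> J' \<omega>"
proof -
  obtain D where D: "countable D" "D \<subseteq> L2 \<mu>" "\<And>f e. f \<in> L2 \<mu> \<Longrightarrow> e > 0 \<Longrightarrow> \<exists>d\<in>D. L2_norm \<mu> (d - f) < e"
    using L2_separableE[OF sep_\<mu>] by metis
  obtain S :: "nat \<Rightarrow> ('a \<Rightarrow> complex) set" where S: "range S \<subseteq> sets \<nu>" "(\<Union>k. S k) = space \<nu>" "\<And>k. emeasure \<nu> (S k) \<noteq> \<infinity>"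
    using N.sigma_finite by metis
  have Jc: "closed_subspace \<mu> (J \<omega>)" if "\<omega> \<in> space \<nu>" for \<omega>
    using J that by (simp add: measurable_range_function_def)
  have "AE \<omega> in \<nu>. cscale (indicator (S k) \<omega>) (orth_proj \<mu> (J \<omega>) d) \<in> J' \<omega>" if d: "d \<in> D" for d k
  proof -
    let ?F = "\<lambda>\<omega>. cscale (indicator (S k) \<omega>) (orth_proj \<mu> (J \<omega>) d)"
    have dL: "d \<in> L2 \<mu>" using d D(2) by blast
    have Sk: "S k \<in> sets \<nu>" "emeasure \<nu> (S k) < \<infinity>" using S(1) S(3)[of k] by (auto simp: less_top)
    have "?F \<in> L2_vec \<nu> \<mu>"
    proof (rule L2_vecI(1))
      show "?F \<in> measurable \<nu> (L2_borel \<mu>)"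
        by (rule L2_borel_cscale[OF sep_\<mu>]) (use J dL Sk in \<open>auto simp: measurable_range_function_def\<close>)
      show "cscale (complex_of_real (L2_norm \<mu> d)) (indicator (S k)) \<in> L2 \<nu>"
        by (rule L2_cscale[OF indicator_L2[OF Sk]])
      fix \<omega> assume "\<omega> \<in> space \<nu>"
      from mult_left_mono[OF norm_orth_proj_le[OF Jc[OF this] dL], of "cmod (indicator (S k) \<omega>)"]
      show "L2_norm \<mu> (?F \<omega>) \<le> cmod (cscale (complex_of_real (L2_norm \<mu> d)) (indicator (S k)) \<omega>)"
        unfolding L2_norm_cscale by (simp add: cscale_def norm_mult mult.commute)
    qed
    note FV = this
    from Z_surj[OF FV] obtain f where f: "f \<in> L2 mG" "AE \<omega> in \<nu>. L2_norm \<mu> (Z f \<omega> - ?F \<omega>) = 0" by blast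
    have "AE \<omega> in \<nu>. Z f \<omega> \<in> J \<omega>"
      using f(2) AE_space
    proof eventually_elim
      fix \<omega> assume n: "L2_norm \<mu> (Z f \<omega> - ?F \<omega>) = 0" and \<omega>: "\<omega> \<in> space \<nu>"
      show "Z f \<omega> \<in> J \<omega>"
        by (rule closed_subspace_null[OF Jc[OF \<omega>] _ L2_vecD(3)[OF Z_vec[OF f(1)] \<omega>] n])
          (intro closed_subspaceD(4)[OF Jc[OF \<omega>]] orth_proj(1)[OF Jc[OF \<omega>] dL])
    qed
    then have "f \<in> range_space mG \<nu> Z J" using f(1) by (simp add: range_space_def)
    from subsetD[OF sub this] have "AE \<omega> in \<nu>. Z f \<omega> \<in> J' \<omega>" by (simp add: range_space_def)
    then show ?thesis
      using f(2) AE_space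
    proof eventually_elim
      fix \<omega> assume m: "Z f \<omega> \<in> J' \<omega>" and n: "L2_norm \<mu> (Z f \<omega> - ?F \<omega>) = 0" and \<omega>: "\<omega> \<in> space \<nu>"
      show "?F \<omega> \<in> J' \<omega>"
        by (rule closed_subspace_null[OF J'[OF \<omega>] m L2_vecD(3)[OF FV \<omega>] trans[OF L2_norm_minus_commute n]])
    qed
  qed
  then have "AE \<omega> in \<nu>. \<forall>d\<in>D. \<forall>k. cscale (indicator (S k) \<omega>) (orth_proj \<mu> (J \<omega>) d) \<in> J' \<omega>"
    unfolding AE_ball_countable[OF D(1)] AE_all_countable by blast
  then show ?thesis
    using AE_space
  proof eventually_elim
    fix \<omega> assume m: "\<forall>d\<in>D. \<forall>k. cscale (indicator (S k) \<omega>) (orth_proj \<mu> (J \<omega>) d) \<in> J' \<omega>" and \<omega>: "\<omega> \<in> space \<nu>"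
    obtain k where k: "\<omega> \<in> S k" using S(2) \<omega> by blast
    have P: "orth_proj \<mu> (J \<omega>) d \<in> J' \<omega>" if "d \<in> D" for d
    proof -
      have "cscale (indicator (S k) \<omega>) (orth_proj \<mu> (J \<omega>) d) \<in> J' \<omega>" using m that by blast
      then show ?thesis using k by (simp add: cscale_def)
    qed
    show "J \<omega> \<subseteq> J' \<omega>"
    proof
      fix w assume w: "w \<in> J \<omega>"
      then have wL: "w \<in> L2 \<mu>" using closed_subspaceD(1)[OF Jc[OF \<omega>]] by blast
      show "w \<in> J' \<omega>"
      proof (rule closed_subspace_closed[OF J'[OF \<omega>] wL])
        fix e :: real assume "e > 0"
        from D(3)[OF wL this] obtain d where d: "d \<in> D" "L2_norm \<mu> (d - w) < e" by blast
        have "d \<in> L2 \<mu>" using d(1) D(2) by blast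
        \<comment> \<open>Projecting a point near w keeps it near w, so the projections of the
          countable dense set are dense in J(\<omega>).\<close>
        from orth_proj_contract[OF Jc[OF \<omega>] this w] d P
        show "\<exists>a\<in>J' \<omega>. L2_norm \<mu> (a - w) < e" by (intro bexI[of _ "orth_proj \<mu> (J \<omega>) d"]) auto
      qed
    qed
  qed
qed

text \<open>The projections to \<open>V\<close> of a countable dense set are dense in
  \<open>V\<close>, because projecting does not increase the distance to an element of
  \<open>V\<close>.\<close>

lemma invariant_imp_generated:
  assumes V: "invariant_space G mG \<Gamma> V"
  obtains A where "countable A" "A \<subseteq> L2 mG" "V = generated_space G mG \<Gamma> A"
proof -
  have Vc: "closed_subspace mG V" using V by (simp add: invariant_space_def)
  obtain D where D: "countable D" "D \<subseteq> L2 mG" "\<And>f e. f \<in> L2 mG \<Longrightarrow> e > 0 \<Longrightarrow> \<exists>d\<in>D. L2_norm mG (d - f) < e"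
    using L2_separableE[OF sep_G] by metis
  let ?A = "orth_proj mG V ` D"
  have AV: "?A \<subseteq> V" using orth_proj(1)[OF Vc] D(2) by blast
  then have A: "?A \<subseteq> L2 mG" using closed_subspaceD(1)[OF Vc] by blast
  note S = closed_subspace_generated[OF A]
  have "V \<subseteq> generated_space G mG \<Gamma> ?A"
  proof
    fix f assume f: "f \<in> V"
    then have fL: "f \<in> L2 mG" using closed_subspaceD(1)[OF Vc] by blast
    show "f \<in> generated_space G mG \<Gamma> ?A"
    proof (rule closed_subspace_closed[OF S fL])
      fix e :: real assume "e > 0"
      from D(3)[OF fL this] obtain d where d: "d \<in> D" "L2_norm mG (d - f) < e" by blast
      then have dL: "d \<in> L2 mG" using D(2) by blast
      let ?p = "orth_proj mG V d"
      have pA: "?p \<in> ?A" using d(1) by blast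
      \<comment> \<open>Translation by the identity changes a function at most off the carrier, so
        \<open>?p\<close> agrees with a generator almost everywhere.\<close>
      have "?p \<in> generated_space G mG \<Gamma> ?A"
      proof (rule closed_subspace_cong_AE[OF S translate_in_generated[OF A subgroup.one_closed[OF subgroup] pA]])
        show "?p \<in> L2 mG" using pA A by blast
        show "AE x in mG. translate G \<one> ?p x = ?p x" by (rule AE_I2) (simp add: translate_def space_m)
      qed
      then show "\<exists>a\<in>generated_space G mG \<Gamma> ?A. L2_norm mG (a - f) < e"
        using orth_proj_contract[OF Vc dL f] d(2) by (intro bexI[of _ ?p]) auto
    qed
  qed
  with generated_space_minimal[OF V AV] have "V = generated_space G mG \<Gamma> ?A" by blast
  then show thesis using D(1) A by (intro that[of ?A]) auto
qed

lemma range_space_eq_iff: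
  assumes J: "measurable_range_function \<nu> \<mu> J" and J': "measurable_range_function \<nu> \<mu> J'"
  shows "range_space mG \<nu> Z J = range_space mG \<nu> Z J' \<longleftrightarrow> (AE \<omega> in \<nu>. J \<omega> = J' \<omega>)"
proof
  assume eq: "range_space mG \<nu> Z J = range_space mG \<nu> Z J'"
  have "AE \<omega> in \<nu>. J \<omega> \<subseteq> J' \<omega>"
    by (rule range_space_subset_imp[OF J]) (use J' eq in \<open>auto simp: measurable_range_function_def\<close>)
  moreover have "AE \<omega> in \<nu>. J' \<omega> \<subseteq> J \<omega>"
    by (rule range_space_subset_imp[OF J']) (use J eq in \<open>auto simp: measurable_range_function_def\<close>)
  ultimately show "AE \<omega> in \<nu>. J \<omega> = J' \<omega>" by eventually_elim blast
next
  assume ae: "AE \<omega> in \<nu>. J \<omega> = J' \<omega>"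
  have "(AE \<omega> in \<nu>. Z f \<omega> \<in> J \<omega>) \<longleftrightarrow> (AE \<omega> in \<nu>. Z f \<omega> \<in> J' \<omega>)" for f
  proof
    assume "AE \<omega> in \<nu>. Z f \<omega> \<in> J \<omega>"
    then show "AE \<omega> in \<nu>. Z f \<omega> \<in> J' \<omega>" using ae by eventually_elim simp
  next
    assume "AE \<omega> in \<nu>. Z f \<omega> \<in> J' \<omega>"
    then show "AE \<omega> in \<nu>. Z f \<omega> \<in> J \<omega>" using ae by eventually_elim simp
  qed
  then show "range_space mG \<nu> Z J = range_space mG \<nu> Z J'" by (simp add: range_space_def)
qed

lemma invariant_space_iff:
  "invariant_space G mG \<Gamma> V \<longleftrightarrow> (\<exists>J. measurable_range_function \<nu> \<mu> J \<and> V = range_space mG \<nu> Z J)"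
proof
  assume "invariant_space G mG \<Gamma> V"
  then obtain A where A: "countable A" "A \<subseteq> L2 mG" "V = generated_space G mG \<Gamma> A"
    by (rule invariant_imp_generated)
  then show "\<exists>J. measurable_range_function \<nu> \<mu> J \<and> V = range_space mG \<nu> Z J"
    using measurable_span_range[OF A(2,1)] range_space_span_range[OF A(2,1)] by metis
next
  assume "\<exists>J. measurable_range_function \<nu> \<mu> J \<and> V = range_space mG \<nu> Z J"
  then obtain J where "measurable_range_function \<nu> \<mu> J" "V = range_space mG \<nu> Z J" by blast
  then show "invariant_space G mG \<Gamma> V"
    using invariant_range_space[of J] by (simp add: measurable_range_function_def)
qed

text \<open>\<open>J\<close> and the pointwise closed span have the same range space, so uniqueness
  applies.\<close>

lemma range_function_generated_space:
  assumes A: "A \<subseteq> L2 mG" "countable A" and J: "measurable_range_function \<nu> \<mu> J"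
    and eq: "generated_space G mG \<Gamma> A = range_space mG \<nu> Z J"
  shows "AE \<omega> in \<nu>. J \<omega> = closed_span \<mu> {Z \<phi> \<omega> | \<phi>. \<phi> \<in> A}"
proof -
  have "AE \<omega> in \<nu>. J \<omega> = span_range A \<omega>"
    using range_space_eq_iff[OF J measurable_span_range[OF A]] range_space_span_range[OF A] eq by simp
  then show ?thesis by (simp add: span_range_def Setcompr_eq_image)
qed

end

theorem theorem6p7:
  fixes G :: "'g monoid" and X :: "'g topology" and \<Gamma> C :: "'g set"
    and \<Omega> :: "('g \<Rightarrow> complex) set"
    and mG m\<Gamma> \<mu> :: "'g measure" and mQ :: "'g set measure"
    and mD :: "('g \<Rightarrow> complex) set measure" and \<nu> :: "('g \<Rightarrow> complex) measure"
    and Z :: "('g \<Rightarrow> complex) \<Rightarrow> ('g \<Rightarrow> complex) \<Rightarrow> 'g \<Rightarrow> complex"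
    and V :: "('g \<Rightarrow> complex) set"
  assumes "second_countable_lca_group G X"
    and "subgroup \<Gamma> G" and "closedin X \<Gamma>"
    and "measurable_section G X \<Gamma> C"
    and "haar_measure (G Mod \<Gamma>) (coset_topology G X \<Gamma>) mQ"
    and "\<mu> = section_measure G X \<Gamma> C mQ"
    and "measurable_section (dual_group G X) (dual_topology G X) (annihilator G X \<Gamma>) \<Omega>"
    and "haar_measure (dual_group G X Mod annihilator G X \<Gamma>)
           (coset_topology (dual_group G X) (dual_topology G X) (annihilator G X \<Gamma>)) mD"
    and "\<nu> = section_measure (dual_group G X) (dual_topology G X) (annihilator G X \<Gamma>) \<Omega> mD"
    and "dual_haar_measures (G\<lparr>carrier := \<Gamma>\<rparr>) (subtopology X \<Gamma>) m\<Gamma>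
           (distr \<nu> (borel_of (dual_topology (G\<lparr>carrier := \<Gamma>\<rparr>) (subtopology X \<Gamma>)))
             (\<lambda>\<omega>. restrict \<omega> \<Gamma>))"
    and "haar_measure G X mG" and "weil_formula G mG m\<Gamma> \<mu>"
    and "zak_transform G X mG m\<Gamma> \<mu> \<nu> Z"
    and "closed_subspace mG V"
  shows "(invariant_space G mG \<Gamma> V \<longleftrightarrow>
            (\<exists>J. measurable_range_function \<nu> \<mu> J \<and> V = range_space mG \<nu> Z J)) \<and>
         range_space mG \<nu> Z ` {J. measurable_range_function \<nu> \<mu> J} = {W. invariant_space G mG \<Gamma> W} \<and>
         (\<forall>J J'. measurable_range_function \<nu> \<mu> J \<longrightarrow> measurable_range_function \<nu> \<mu> J' \<longrightarrow>
            (range_space mG \<nu> Z J = range_space mG \<nu> Z J' \<longleftrightarrow> (AE \<omega> in \<nu>. J \<omega> = J' \<omega>))) \<and>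
         (\<forall>A J. A \<subseteq> L2 mG \<longrightarrow> countable A \<longrightarrow> V = generated_space G mG \<Gamma> A \<longrightarrow>
            measurable_range_function \<nu> \<mu> J \<longrightarrow> V = range_space mG \<nu> Z J \<longrightarrow>
            (AE \<omega> in \<nu>. J \<omega> = closed_span \<mu> {Z \<phi> \<omega> | \<phi>. \<phi> \<in> A}))"
proof -
  interpret zak G X mG \<Gamma> m\<Gamma> \<mu> C mQ \<Omega> mD \<nu> Z
  proof -
    interpret H: haar_group G X mG
      by (rule haar_group.intro[OF assms(1) haar_group_axioms.intro[OF assms(11)]])
    interpret P: group_section G X \<Gamma> C mQ
      by (intro group_section.intro group_section_axioms.intro H.is_group H.topspace_eq assms(2,4,5))
    have space: "space \<mu> \<subseteq> carrier G"
      using P.C_carrier P.space_\<sigma> unfolding P.\<sigma>_def assms(6) by simp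
    have "haar_measure (G\<lparr>carrier := \<Gamma>\<rparr>) (subtopology X \<Gamma>) m\<Gamma>"
      using assms(10) unfolding dual_haar_measures_def by (rule conjunct1)
    note weil = weil_pair.intro[OF H.haar_group_axioms weil_pair_axioms.intro[OF assms(2,3) this space assms(12)]]
    show "zak G X mG \<Gamma> m\<Gamma> \<mu> C mQ \<Omega> mD \<nu> Z"
      by (rule zak.intro[OF dual_section.intro[OF weil dual_section_axioms.intro[OF assms(4-10)]]
            zak_axioms.intro[OF assms(13)]])
  qed
  have "range_space mG \<nu> Z ` {J. measurable_range_function \<nu> \<mu> J} = {W. invariant_space G mG \<Gamma> W}"
    unfolding image_def by (rule Collect_cong) (use invariant_space_iff in blast)
  then show ?thesis
    by (intro conjI allI impI invariant_space_iff range_space_eq_iff range_function_generated_space)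
      (assumption | simp only:)+
qed

end
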